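(* There is a constant $c>0$, depending only on the structural constants $N_0$, $c_0$, $\beta$, such that for every $n\ge n_0$ and all $S_1,S_2\in\mathcal{S}(n,1)$, $$|S_1|_{BV}\le |S_2|_{BV}+c\,n^{1/2}\|S_1-S_2\|_{L^2(\Omega)},$$ where $|\cdot|_{BV}$ denotes the total variation seminorm on $\Omega$.
   Context: Fix constants $N_0\in\mathbb{N}$, $c_0\ge 1$ and $0<\beta\le\pi/3$. A compact convex set $Q\subset\mathbb{R}^2$ is regular if there are balls $B(x_2,r_2)\subset Q\subset B(x_1,r_1)$ with $r_1\le c_0r_2$. A set $R\subset\mathbb{R}^2$ is a ring if $R=Q_1\setminus Q_2$ where: (a) $Q_2\subset Q_1$ or $Q_2=\emptyset$; (b) each of $Q_1,Q_2$ (when nonempty) is a compact regular convex set whose boundary is a polygon consisting of at most $N_0$ line segments; (c) each edge $E$ of $\partial R$ can be written as $E=E_1\cup E_2$, a union of at most two segments with disjoint one-dimensional interiors, such that for each $i$ there is a triangle $\triangle_i\subset R$ having $E_i$ as a side with both angles adjacent to $E_i$ equal to $\beta$. The domain $\Omega$ is either $\mathbb{R}^2$ or a compact polygonal domain, i.e. a union of finitely many triangles with disjoint interiors obeying the minimum angle condition; in the compact case it is assumed that $\Omega$ is the union of $n_0$ rings with disjoint interiors for some fixed $n_0\ge1$, and if $\Omega=\mathbb{R}^2$ then $n_0:=1$. $\mathcal{S}(n,1)$: if $\Omega$ is compact, the set of all functions $S=\sum_{j=1}^n c_j\mathbb{1}_{R_j}$, $c_j\in\mathbb{R}$, where $R_1,\dots,R_n$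 are rings with disjoint interiors and $\Omega=\bigcup_j R_j$; if $\Omega=\mathbb{R}^2$, the same but with the requirement that $\bigcup_j R_j$ is a ring. *)

theory Defs
  imports "HOL-Analysis.Analysis"
begin

type_synonym pt = "real^2"

definition regular_set :: "real \<Rightarrow> pt set \<Rightarrow> bool" where
  "regular_set c0 Q \<longleftrightarrow> compact Q \<and> convex Q \<and>
     (\<exists>x1 r1 x2 r2. r2 > 0 \<and> cball x2 r2 \<subseteq> Q \<and> Q \<subseteq> cball x1 r1 \<and> r1 \<le> c0 * r2)"

definition polygonal_boundary :: "nat \<Rightarrow> pt set \<Rightarrow> bool" where
  "polygonal_boundary N0 Q \<longleftrightarrow>
     (\<exists>P. finite P \<and> card P \<le> N0 \<and> frontier Q = (\<Union>(a,b)\<in>P. closed_segment a b))"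

definition is_edge :: "pt set \<Rightarrow> pt set \<Rightarrow> bool" where
  "is_edge B E \<longleftrightarrow> (\<exists>a b. a \<noteq> b \<and> E = closed_segment a b) \<and> E \<subseteq> B \<and>
     (\<forall>a b. E \<subseteq> closed_segment a b \<and> closed_segment a b \<subseteq> B \<longrightarrow> closed_segment a b = E)"

definition vec_angle :: "pt \<Rightarrow> pt \<Rightarrow> real" where
  "vec_angle u v = arccos ((u \<bullet> v) / (norm u * norm v))"

definition beta_triangle :: "real \<Rightarrow> pt set \<Rightarrow> pt \<Rightarrow> pt \<Rightarrow> bool" where
  "beta_triangle \<beta> R a b \<longleftrightarrow> a \<noteq> b \<and>
     (\<exists>p. vec_angle (b - a) (p - a) = \<beta> \<and> vec_angle (a - b) (p - b) = \<beta> \<and>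
          convex hull {a, b, p} \<subseteq> closure R)"

definition is_ring :: "nat \<Rightarrow> real \<Rightarrow> real \<Rightarrow> pt set \<Rightarrow> bool" where
  "is_ring N0 c0 \<beta> R \<longleftrightarrow>
     (\<exists>Q1 Q2. R = Q1 - Q2 \<and> (Q2 \<subseteq> Q1 \<or> Q2 = {}) \<and>
        Q1 \<noteq> {} \<and> regular_set c0 Q1 \<and> polygonal_boundary N0 Q1 \<and>
        (Q2 \<noteq> {} \<longrightarrow> regular_set c0 Q2 \<and> polygonal_boundary N0 Q2)) \<and>
     (\<forall>E. is_edge (frontier R) E \<longrightarrow>
        (\<exists>a b. E = closed_segment a b \<and> beta_triangle \<beta> R a b) \<or>
        (\<exists>a1 b1 a2 b2. E = closed_segment a1 b1 \<union> closed_segment a2 b2 \<and>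
           open_segment a1 b1 \<inter> open_segment a2 b2 = {} \<and>
           beta_triangle \<beta> R a1 b1 \<and> beta_triangle \<beta> R a2 b2))"

definition polygonal_domain :: "pt set \<Rightarrow> bool" where
  "polygonal_domain \<Omega> \<longleftrightarrow>
     (\<exists>T. finite T \<and> (\<forall>t\<in>T. \<exists>a b c. \<not> collinear {a, b, c} \<and> t = convex hull {a, b, c}) \<and>
          pairwise (\<lambda>s t. interior s \<inter> interior t = {}) T \<and> \<Omega> = \<Union>T)"

definition admissible_domain :: "nat \<Rightarrow> real \<Rightarrow> real \<Rightarrow> pt set \<Rightarrow> nat \<Rightarrow> bool" where
  "admissible_domain N0 c0 \<beta> \<Omega> n0 \<longleftrightarrow>
     (\<Omega> = UNIV \<and> n0 = 1) \<or>
     (polygonal_domain \<Omega> \<and> n0 \<ge> 1 \<and>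
      (\<exists>R. (\<forall>j<n0. is_ring N0 c0 \<beta> (R j)) \<and>
           (\<forall>i<n0. \<forall>j<n0. i \<noteq> j \<longrightarrow> interior (R i) \<inter> interior (R j) = {}) \<and>
           \<Omega> = (\<Union>j<n0. R j)))"

definition S_n1 :: "nat \<Rightarrow> real \<Rightarrow> real \<Rightarrow> pt set \<Rightarrow> nat \<Rightarrow> (pt \<Rightarrow> real) set" where
  "S_n1 N0 c0 \<beta> \<Omega> n = {S. \<exists>c R.
      (\<forall>x. S x = (\<Sum>j<n. c j * indicator (R j) x)) \<and>
      (\<forall>j<n. is_ring N0 c0 \<beta> (R j)) \<and>
      (\<forall>i<n. \<forall>j<n. i \<noteq> j \<longrightarrow> interior (R i) \<inter> interior (R j) = {}) \<and>
      (if \<Omega> = UNIV then is_ring N0 c0 \<beta> (\<Union>j<n. R j) else \<Omega> = (\<Union>j<n. R j))}"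

definition test_fields :: "pt set \<Rightarrow> ((pt \<Rightarrow> pt) \<times> (pt \<Rightarrow> pt \<Rightarrow> pt)) set" where
  "test_fields \<Omega> = {(\<phi>, \<phi>'). (\<forall>x. (\<phi> has_derivative \<phi>' x) (at x)) \<and>
      (\<forall>b\<in>Basis. continuous_on UNIV (\<lambda>x. \<phi>' x b)) \<and>
      (\<exists>K. compact K \<and> K \<subseteq> interior \<Omega> \<and> (\<forall>x. x \<notin> K \<longrightarrow> \<phi> x = 0)) \<and>
      (\<forall>x. norm (\<phi> x) \<le> 1)}"

definition TV :: "pt set \<Rightarrow> (pt \<Rightarrow> real) \<Rightarrow> ereal" where
  "TV \<Omega> f = (SUP p \<in> test_fields \<Omega>.
      ereal (integral \<Omega> (\<lambda>x. f x * (\<Sum>b\<in>Basis. snd p x b \<bullet> b))))"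

definition L2_norm_on :: "pt set \<Rightarrow> (pt \<Rightarrow> real) \<Rightarrow> real" where
  "L2_norm_on \<Omega> f = sqrt (integral \<Omega> (\<lambda>x. (f x)\<^sup>2))"

end

(*
  Both functions are locally constant off finitely many lines, so the total variation of S1 is the
  integral of its jump over these lines. Over each edge i of a ring of S1 stands, by condition (c), an
  isosceles triangle of fixed slope kappa inside the ring, and these triangles are disjoint. On the
  fibre of this triangle over a point t of the edge let m_i(t) be the least value of |S1 - S2|.
  Between the two fibres that start at a jump point of S1 on either side, S2 varies by at least the jump of
  S1 minus the two values of m. Hence TV(S1) <= TV(S2) + sum_i (integral of m_i).

  If S2 takes K_i values on triangle i, then m_i takes at most K_i values, and a level set of m_i of length b
  lies under an area of order kappa b^2, so (integral of m_i)^2 <= (8 / kappa) K_i * (integral of |S1 - S2|^2 over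
  triangle i). By Cauchy-Schwarz it remains to see that the K_i add up to O(n). A ring of S2 that meets
  triangle i either contains it up to finitely many points or has an edge meeting it, and an edge meets
  only boundedly many triangles over longer edges because these are disjoint; the incidences with shorter
  triangles are counted in the same way from the other side.

  If the domain is the plane, the outermost edges carry infinite strips on their outer side, on which
  both functions vanish far away, and these contribute no error.
*)
theory Submission
  imports Defs
begin

section \<open>Frames and step functions on line arrangements\<close>

text \<open>The trace of S1 - S2 on an edge is not controlled by its L2 norm, but its least absolute
  value on a fibre is, because the length of a fibre is proportional to the distance of its foot
  from the nearer end of the edge. A test field that runs through two opposite fibres then sees S2
  only near the two points where the minima are attained. Such a field lives on thin rectangles
  covered by the tubes and the edge, and the rectangles of different edges must not meet. So the
  triangles have to be disjoint even within one ring, which condition (c) does not say; lowering the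
  slope from \<open>\<kappa>0\<close> to \<open>\<kappa>0 / (2 + \<kappa>0)\<close> achieves it.
  Rings are disjoint only up to their boundaries, so values on edges are arbitrary. Jumps are
  therefore differences of one-sided values along the normal, taken off the crossing points of the
  lines. For the plane, the union of the rings of S1 may have a hole. Adding it as one more ring of
  value 0 makes the outer boundary convex, and the outer strips become disjoint. The triangles over
  the edges of the hole come from regularity; this is where \<open>c0\<close> enters the
  constant.\<close>

definition rot :: "pt \<Rightarrow> pt" where
  "rot v = vector [- (v $ 2), v $ 1]"

lemma rot_nth [simp]: "rot v $ 1 = - (v $ 2)" "rot v $ 2 = v $ 1"
  by (simp_all add: rot_def)

lemma inner_pt: "(x::pt) \<bullet> y = x $ 1 * y $ 1 + x $ 2 * y $ 2"
  by (simp add: inner_vec_def sum_2)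

lemma pt_eqI: "x $ 1 = y $ 1 \<Longrightarrow> x $ 2 = y $ 2 \<Longrightarrow> x = (y::pt)"
  by (simp add: vec_eq_iff forall_2)

lemma rot_minus [simp]: "rot (- v) = - rot v"
  by (rule pt_eqI) auto

lemma rot_rot [simp]: "rot (rot v) = - v"
  by (rule pt_eqI) auto

lemma rot_scale [simp]: "rot (c *\<^sub>R v) = c *\<^sub>R rot v"
  by (rule pt_eqI) auto

lemma inner_rot [simp]: "v \<bullet> rot v = 0" "rot v \<bullet> v = 0" "rot v \<bullet> rot w = v \<bullet> w"
  by (simp_all add: inner_pt)

lemma norm_rot [simp]: "norm (rot v) = norm v"
  by (simp add: norm_eq_sqrt_inner)

text \<open>Coordinates along a direction and its left normal. Edges are written with s = 0 and the
  triangle or tube over them with s > 0, so the orientation of e records on which side of the edge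
  the ring lies.\<close>

definition fr :: "pt \<Rightarrow> pt \<Rightarrow> real \<Rightarrow> real \<Rightarrow> pt" where
  "fr p e t s = p + t *\<^sub>R e + s *\<^sub>R rot e"

lemma norm1_sq: "norm (e::pt) = 1 \<Longrightarrow> e $ 1 * e $ 1 + e $ 2 * e $ 2 = 1"
  by (metis inner_pt norm_eq_1)

lemma norm1_inner: "norm (e::pt) = 1 \<Longrightarrow> e \<bullet> e = 1"
  by (simp add: norm_eq_1)

lemma frame_decomp:
  assumes "norm e = 1"
  shows "v = (v \<bullet> e) *\<^sub>R e + (v \<bullet> rot e) *\<^sub>R rot e"
proof -
  have 1: "e $ 1 * e $ 1 + e $ 2 * e $ 2 = 1" using norm1_sq[OF assms] .
  have "v $ 1 = v $ 1 * (e $ 1 * e $ 1 + e $ 2 * e $ 2)"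
       "v $ 2 = v $ 2 * (e $ 1 * e $ 1 + e $ 2 * e $ 2)" by (simp_all add: 1)
  then show ?thesis
    by (intro pt_eqI) (simp_all add: inner_pt algebra_simps)
qed

lemma fr_coords:
  assumes "norm e = 1"
  shows "fr p e ((x - p) \<bullet> e) ((x - p) \<bullet> rot e) = x"
  using frame_decomp[OF assms, of "x - p"] by (simp add: fr_def algebra_simps)

lemma fr_inner [simp]:
  assumes "norm e = 1"
  shows "(fr p e t s - p) \<bullet> e = t" "(fr p e t s - p) \<bullet> rot e = s"
  using norm1_inner[OF assms] by (simp_all add: fr_def inner_add_left)

lemma fr_eq_iff:
  assumes "norm e = 1"
  shows "fr p e t s = fr p e t' s' \<longleftrightarrow> t = t' \<and> s = s'"
  using fr_inner[OF assms] by metis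

lemma fr_ex:
  assumes "norm e = 1"
  obtains t s where "x = fr p e t s"
  using fr_coords[OF assms] by metis

lemma norm_frame:
  assumes "norm e = 1"
  shows "norm (a *\<^sub>R e + b *\<^sub>R rot e) = sqrt (a\<^sup>2 + b\<^sup>2)"
  using norm1_inner[OF assms]
  by (simp add: norm_eq_sqrt_inner inner_add_left inner_add_right power2_eq_square)

lemma fr_diff: "fr p e t s - fr p e t' s' = (t - t') *\<^sub>R e + (s - s') *\<^sub>R rot e"
  by (simp add: fr_def algebra_simps)

lemma dist_fr:
  assumes "norm e = 1"
  shows "dist (fr p e t s) (fr p e t' s') = sqrt ((t - t')\<^sup>2 + (s - s')\<^sup>2)"
  by (simp add: dist_norm fr_diff norm_frame[OF assms])

lemma continuous_on_fr [continuous_intros]: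
  "continuous_on A f \<Longrightarrow> continuous_on A g \<Longrightarrow> continuous_on A (\<lambda>x. fr p e (f x) (g x))"
  unfolding fr_def by (intro continuous_intros)

lemma fr_borel: "(\<lambda>(t,s). fr p e t s) \<in> borel_measurable borel"
  by (intro borel_measurable_continuous_onI) (simp add: case_prod_beta fr_def, intro continuous_intros)

lemma fr_measurable [measurable]:
  "(\<lambda>(t,s). fr p e t s) \<in> lborel \<Otimes>\<^sub>M lborel \<rightarrow>\<^sub>M borel"
  using fr_borel by (simp add: lborel_prod)

section \<open>Lebesgue measure in a rotated frame\<close>

text \<open>Only the axis-parallel frame is computed on boxes; every other frame follows from it by
  an orthogonal map and a translation.\<close>

lemma distr_axis:
  "distr (lborel \<Otimes>\<^sub>M lborel) borel (\<lambda>(x,y). vector [x, y] :: pt) = lborel"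
proof (rule lborel_eqI[symmetric])
  have m: "(\<lambda>(x,y). vector [x, y] :: pt) = (\<lambda>(x,y). fr 0 (axis 1 1) x y)"
    by (auto simp: fun_eq_iff fr_def intro!: pt_eqI simp: axis_def)
  show "sets (distr (lborel \<Otimes>\<^sub>M lborel) borel (\<lambda>(x,y). vector [x, y] :: pt)) = sets borel" by simp
  fix l u :: pt assume lu: "\<And>b. b \<in> Basis \<Longrightarrow> l \<bullet> b \<le> u \<bullet> b"
  have b: "axis 1 1 \<in> (Basis::pt set)" "axis 2 1 \<in> (Basis::pt set)" by auto
  have B: "(Basis::pt set) = {axis 1 1, axis 2 1}"
    by (auto simp: Basis_vec_def UNIV_2)
  have ne: "axis 1 1 \<noteq> (axis 2 1 :: pt)" by (simp add: axis_eq_axis)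
  have le: "l $ 1 \<le> u $ 1" "l $ 2 \<le> u $ 2" using lu[OF b(1)] lu[OF b(2)] by (simp_all add: inner_axis)
  have pre: "(\<lambda>(x,y). vector [x, y] :: pt) -` box l u \<inter> space (lborel \<Otimes>\<^sub>M lborel)
      = box (l $ 1) (u $ 1) \<times> box (l $ 2) (u $ 2)"
    by (auto simp: mem_box_cart forall_2 space_pair_measure)
  have "emeasure (distr (lborel \<Otimes>\<^sub>M lborel) borel (\<lambda>(x,y). vector [x, y] :: pt)) (box l u)
    = emeasure (lborel \<Otimes>\<^sub>M lborel) (box (l $ 1) (u $ 1) \<times> box (l $ 2) (u $ 2))"
    by (subst emeasure_distr) (use pre fr_measurable[of 0 "axis 1 1"] in \<open>simp_all add: m\<close>)
  also have "\<dots> = emeasure lborel (box (l $ 1) (u $ 1)) * emeasure lborel (box (l $ 2) (u $ 2))"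
    by (rule lborel.emeasure_pair_measure_Times) auto
  also have "\<dots> = ennreal ((u $ 1 - l $ 1) * (u $ 2 - l $ 2))"
    using le by (simp add: ennreal_mult)
  also have "(u $ 1 - l $ 1) * (u $ 2 - l $ 2) = (\<Prod>b\<in>Basis. (u - l) \<bullet> b)"
    using ne by (simp add: B inner_axis)
  finally show "emeasure (distr (lborel \<Otimes>\<^sub>M lborel) borel (\<lambda>(x,y). vector [x, y] :: pt)) (box l u) = 
    ennreal (\<Prod>b\<in>Basis. (u - l) \<bullet> b)" by simp
qed

text \<open>The preimage of a box is its image under the inverse map, and orthogonal images keep the
  measure; agreement on boxes determines Lebesgue measure.\<close>

lemma distr_orthogonal:
  fixes r :: "pt \<Rightarrow> pt"
  assumes r: "orthogonal_transformation r"
  shows "distr lborel borel r = lborel"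
proof (rule lborel_eqI[symmetric])
  have "linear r" using r by (simp add: orthogonal_transformation_def)
  then have meas: "r \<in> borel_measurable borel"
    by (intro borel_measurable_continuous_onI linear_continuous_on) (simp add: linear_conv_bounded_linear)
  show "sets (distr lborel borel r) = sets borel" by simp
  fix l u :: pt assume lu: "\<And>b. b \<in> Basis \<Longrightarrow> l \<bullet> b \<le> u \<bullet> b"
  have bij: "bij r" using r orthogonal_transformation_bij by blast
  have inv: "orthogonal_transformation (inv r)" using r orthogonal_transformation_inv by blast
  have "emeasure (distr lborel borel r) (box l u) = emeasure lborel (r -` box l u)"
    by (subst emeasure_distr) (use meas in auto)
  also have "r -` box l u = inv r ` box l u" using bij by (simp add: bij_vimage_eq_inv_image)
  also have "emeasure lborel (inv r ` box l u) = emeasure lebesgue (inv r ` box l u)"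
  proof -
    have "inv r ` box l u = r -` box l u" using bij by (simp add: bij_vimage_eq_inv_image)
    also have "\<dots> \<in> sets borel" using measurable_sets[OF meas, of "box l u"] by simp
    finally show ?thesis by simp
  qed
  also have "\<dots> = ennreal (measure lebesgue (inv r ` box l u))"
    using measurable_orthogonal_image[OF inv, of "box l u"] 
    by (intro emeasure_eq_ennreal_measure) (metis fmeasurableD2 lmeasurable_box)
  also have "measure lebesgue (inv r ` box l u) = measure lebesgue (box l u)"
    by (rule measure_orthogonal_image[OF inv]) auto
  also have "\<dots> = (\<Prod>b\<in>Basis. (u - l) \<bullet> b)" using lu by (simp add: measure_lborel_box_eq)
  finally show "emeasure (distr lborel borel r) (box l u) = ennreal (\<Prod>b\<in>Basis. (u - l) \<bullet> b)" .
qed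

lemma distr_fr:
  assumes e: "norm e = 1"
  shows "distr (lborel \<Otimes>\<^sub>M lborel) borel (\<lambda>(t,s). fr p e t s) = lborel"
proof -
  define r where "r = (\<lambda>x::pt. (x $ 1) *\<^sub>R e + (x $ 2) *\<^sub>R rot e)"
  have lin: "linear r" unfolding r_def by (rule linearI) (auto simp: algebra_simps)
  have "norm (r x) = norm x" for x
    unfolding r_def norm_frame[OF e] by (simp add: norm_eq_sqrt_inner inner_pt power2_eq_square)
  then have o: "orthogonal_transformation r" using lin by (simp add: orthogonal_transformation)
  have rm[measurable]: "r \<in> borel_measurable borel"
    using lin by (intro borel_measurable_continuous_onI linear_continuous_on) (simp add: linear_conv_bounded_linear)
  have m: "(\<lambda>(x,y). vector [x, y] :: pt) = (\<lambda>(x,y). fr 0 (axis 1 1) x y)"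
    by (auto simp: fun_eq_iff fr_def intro!: pt_eqI simp: axis_def)
  have am: "(\<lambda>(x,y). vector [x, y] :: pt) \<in> lborel \<Otimes>\<^sub>M lborel \<rightarrow>\<^sub>M borel"
    unfolding m by (rule fr_measurable)
  have "(\<lambda>(t,s). fr p e t s) = ((+) p \<circ> r) \<circ> (\<lambda>(x,y). vector [x, y] :: pt)"
    by (auto simp: fun_eq_iff fr_def r_def)
  then have "distr (lborel \<Otimes>\<^sub>M lborel) borel (\<lambda>(t,s). fr p e t s)
     = distr (distr (lborel \<Otimes>\<^sub>M lborel) borel (\<lambda>(x,y). vector [x, y] :: pt)) borel ((+) p \<circ> r)"
    by (subst distr_distr[OF _ am]) auto
  also have "\<dots> = distr (distr lborel borel r) borel ((+) p)"
    by (subst distr_distr) (auto simp: distr_axis)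
  also have "\<dots> = lborel" by (simp add: distr_orthogonal[OF o] lborel_distr_plus)
  finally show ?thesis .
qed

lemma nn_integral_fr:
  assumes e: "norm e = 1" and f: "f \<in> borel_measurable borel"
  shows "(\<integral>\<^sup>+x. f x \<partial>lborel) = (\<integral>\<^sup>+t. \<integral>\<^sup>+s. f (fr p e t s) \<partial>lborel \<partial>lborel)"
proof -
  have m: "(\<lambda>x. f (case x of (t, s) \<Rightarrow> fr p e t s)) \<in> borel_measurable (lborel \<Otimes>\<^sub>M lborel)"
    using f by measurable
  have "(\<integral>\<^sup>+x. f x \<partial>lborel) = (\<integral>\<^sup>+x. f x \<partial>distr (lborel \<Otimes>\<^sub>M lborel) borel (\<lambda>(t,s). fr p e t s))"
    by (simp add: distr_fr[OF e])
  also have "\<dots> = (\<integral>\<^sup>+z. f (case z of (t,s) \<Rightarrow> fr p e t s) \<partial>(lborel \<Otimes>\<^sub>M lborel))"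
    using f by (subst nn_integral_distr) auto
  also have "\<dots> = (\<integral>\<^sup>+t. \<integral>\<^sup>+s. f (fr p e t s) \<partial>lborel \<partial>lborel)"
    using lborel.nn_integral_fst[OF m] by simp
  finally show ?thesis .
qed

lemma
  fixes f :: "pt \<Rightarrow> real"
  assumes e: "norm e = 1" and f: "integrable lborel f"
  shows integral_fr: "(\<integral>x. f x \<partial>lborel) = (\<integral>t. (\<integral>s. f (fr p e t s) \<partial>lborel) \<partial>lborel)"
    and integrable_fr: "integrable (lborel \<Otimes>\<^sub>M lborel) (\<lambda>(t,s). f (fr p e t s))"
proof -
  have fm[measurable]: "f \<in> borel_measurable borel" using f by auto
  have "integrable (distr (lborel \<Otimes>\<^sub>M lborel) borel (\<lambda>(t,s). fr p e t s)) f"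
    using f by (simp add: distr_fr[OF e])
  then have i: "integrable (lborel \<Otimes>\<^sub>M lborel) (\<lambda>z. f (case z of (t,s) \<Rightarrow> fr p e t s))"
    by (subst (asm) integrable_distr_eq) auto
  then show i': "integrable (lborel \<Otimes>\<^sub>M lborel) (\<lambda>(t,s). f (fr p e t s))"
    by (simp add: case_prod_unfold)
  have "(\<integral>x. f x \<partial>lborel) = (\<integral>x. f x \<partial>distr (lborel \<Otimes>\<^sub>M lborel) borel (\<lambda>(t,s). fr p e t s))"
    by (simp add: distr_fr[OF e])
  also have "\<dots> = (\<integral>z. f (case z of (t,s) \<Rightarrow> fr p e t s) \<partial>(lborel \<Otimes>\<^sub>M lborel))"
    by (subst integral_distr) auto
  also have "\<dots> = (\<integral>t. (\<integral>s. f (fr p e t s) \<partial>lborel) \<partial>lborel)"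
    using lborel_pair.integral_fst'[OF i] by simp
  finally show "(\<integral>x. f x \<partial>lborel) = (\<integral>t. (\<integral>s. f (fr p e t s) \<partial>lborel) \<partial>lborel)" .
qed

section \<open>Integration by parts for a step function on the line\<close>

text \<open>Induction on the jump set: subtracting J times a Heaviside function at one jump point x
  removes this jump and leaves all others unchanged, and the Heaviside part integrates to
  \<open>- J * \<zeta> x\<close> by the fundamental theorem. The values of g at the jump points
  themselves are arbitrary.\<close>

lemma step_ibp:
  fixes g \<zeta> \<zeta>' :: "real \<Rightarrow> real"
  assumes fin: "finite X"
    and g: "\<And>x y. x \<le> y \<Longrightarrow> {x..y} \<inter> X = {} \<Longrightarrow> g x = g y"
    and gp: "\<And>x. x \<in> X \<Longrightarrow> \<forall>\<^sub>F s in at_right 0. g (x + s) = gp x"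
    and gm: "\<And>x. x \<in> X \<Longrightarrow> \<forall>\<^sub>F s in at_right 0. g (x - s) = gm x"
    and d: "\<And>t. (\<zeta> has_real_derivative \<zeta>' t) (at t)"
    and z: "\<And>t. \<bar>t\<bar> \<ge> M \<Longrightarrow> \<zeta> t = 0" "\<And>t. \<bar>t\<bar> \<ge> M \<Longrightarrow> \<zeta>' t = 0"
  shows "((\<lambda>t. g t * \<zeta>' t) has_integral - (\<Sum>x\<in>X. (gp x - gm x) * \<zeta> x)) UNIV"
  using fin g gp gm
proof (induction X arbitrary: g gp gm rule: finite_induct)
  case empty
  then have c: "g t = g 0" for t
    using empty.prems(1)[of "min t 0" "max t 0"] by (smt (verit) Int_empty_right min_def max_def)
  have "(\<zeta>' has_integral \<zeta> (max M 0) - \<zeta> (- (max M 0))) {- (max M 0)..max M 0}"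
    by (rule fundamental_theorem_of_calculus)
      (auto intro: has_field_derivative_at_within[OF d] simp: has_real_derivative_iff_has_vector_derivative[symmetric])
  then have "(\<zeta>' has_integral 0) {- (max M 0)..max M 0}" by (simp add: z)
  then have "(\<zeta>' has_integral 0) UNIV"
    by (rule has_integral_on_superset) (auto simp: z)
  then have "((\<lambda>t. g 0 * \<zeta>' t) has_integral g 0 * 0) UNIV"
    by (rule has_integral_mult_right)
  then show ?case using c by (metis (no_types, lifting) has_integral_cong mult_zero_right neg_0_equal_iff_equal sum.empty)
next
  case (insert x X)
  define J where "J = gp x - gm x"
  \<comment> \<open>The value at x is overwritten with the left limit, so that \<open>g1\<close> is
    constant across x and meets the induction hypothesis for the smaller set.\<close>
  define g1 where "g1 = (\<lambda>t. if t = x then gm x else if x < t then g t - J else g t)"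
  have near: "g1 w = gm x" if "\<And>v. v \<in> X \<Longrightarrow> \<not> (min w x \<le> v \<and> v \<le> max w x)" for w
  proof (cases w x rule: linorder_cases)
    case less
    have evs: "\<forall>\<^sub>F s in at_right 0. s < x - w \<and> s > 0"
      using less by (auto simp: eventually_at_right_less eventually_at intro!: exI[of _ "x - w"])
    then obtain s where s: "g (x - s) = gm x" "0 < s" "s < x - w"
      using eventually_happens'[OF trivial_limit_at_right_real eventually_conj[OF insert.prems(3)[OF insertI1] evs]] by blast
    have "g w = g (x - s)" using s that less by (intro insert.prems(1)) force+
    then show ?thesis using s less by (simp add: g1_def)
  next
    case equal then show ?thesis by (simp add: g1_def)
  next
    case greater
    have evs: "\<forall>\<^sub>F s in at_right 0. s < w - x \<and> s > 0"
      using greater by (auto simp: eventually_at_right_less eventually_at intro!: exI[of _ "w - x"])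
    then obtain s where s: "g (x + s) = gp x" "0 < s" "s < w - x"
      using eventually_happens'[OF trivial_limit_at_right_real eventually_conj[OF insert.prems(2)[OF insertI1] evs]] by blast
    have "g (x + s) = g w" using s that greater by (intro insert.prems(1)) force+
    then show ?thesis using s greater by (simp add: g1_def J_def)
  qed
  have step1: "g1 u = g1 v" if "u \<le> v" "{u..v} \<inter> X = {}" for u v
  proof (cases "x \<in> {u..v}")
    case True
    have "\<And>w. w \<in> X \<Longrightarrow> \<not> (u \<le> w \<and> w \<le> v)" using that(2) by auto
    then have "g1 u = gm x" "g1 v = gm x" using True by (auto intro!: near) (meson order_trans)+
    then show ?thesis by simp
  next
    case False
    then have "g u = g v" using that by (intro insert.prems(1)) auto
    then show ?thesis using False that by (auto simp: g1_def)
  qed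
  have ev: "\<forall>\<^sub>F s in at_right 0. s < \<bar>y - x\<bar> \<and> s > 0" if "y \<noteq> x" for y
    using that by (auto simp: eventually_at intro!: exI[of _ "\<bar>y - x\<bar>"])
  have "((\<lambda>t. g1 t * \<zeta>' t) has_integral - (\<Sum>y\<in>X. ((if x < y then gp y - J else gp y) - (if x < y then gm y - J else gm y)) * \<zeta> y)) UNIV"
  proof (rule insert.IH)
    show "g1 u = g1 v" if "u \<le> v" "{u..v} \<inter> X = {}" for u v using that by (rule step1)
  next
    fix y assume y: "y \<in> X"
    then have ne: "y \<noteq> x" using insert.hyps by auto
    show "\<forall>\<^sub>F s in at_right 0. g1 (y + s) = (if x < y then gp y - J else gp y)"
      using insert.prems(2)[OF insertI2[OF y]] ev[OF ne]
      by eventually_elim (use ne in \<open>auto simp: g1_def\<close>)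
    show "\<forall>\<^sub>F s in at_right 0. g1 (y - s) = (if x < y then gm y - J else gm y)"
      using insert.prems(3)[OF insertI2[OF y]] ev[OF ne]
      by eventually_elim (use ne in \<open>auto simp: g1_def\<close>)
  qed
  moreover have "(\<Sum>y\<in>X. ((if x < y then gp y - J else gp y) - (if x < y then gm y - J else gm y)) * \<zeta> y)
    = (\<Sum>y\<in>X. (gp y - gm y) * \<zeta> y)" by (rule sum.cong) auto
  ultimately have I1: "((\<lambda>t. g1 t * \<zeta>' t) has_integral - (\<Sum>y\<in>X. (gp y - gm y) * \<zeta> y)) UNIV" by simp
  define M' where "M' = max (\<bar>x\<bar>) M"
  have "(\<zeta>' has_integral \<zeta> M' - \<zeta> x) {x..M'}"
    by (rule fundamental_theorem_of_calculus)
      (auto intro: has_field_derivative_at_within[OF d] simp: M'_def has_real_derivative_iff_has_vector_derivative[symmetric])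
  then have "(\<zeta>' has_integral - \<zeta> x) {x..M'}" by (simp add: z M'_def)
  then have "((\<lambda>t. if t \<in> {x..M'} then \<zeta>' t else 0) has_integral - \<zeta> x) UNIV"
    by (simp only: has_integral_restrict_UNIV)
  moreover have "(\<lambda>t. if t \<in> {x..M'} then \<zeta>' t else 0) = (\<lambda>t. if t \<in> {x..} then \<zeta>' t else 0)"
    by (auto simp: fun_eq_iff z M'_def)
  ultimately have "((\<lambda>t. if t \<in> {x..} then \<zeta>' t else 0) has_integral - \<zeta> x) UNIV" by simp
  then have I2: "((\<lambda>t. J * (if t \<in> {x..} then \<zeta>' t else 0)) has_integral J * (- \<zeta> x)) UNIV"
    by (rule has_integral_mult_right)
  have "((\<lambda>t. g1 t * \<zeta>' t + J * (if t \<in> {x..} then \<zeta>' t else 0)) has_integral 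
      - (\<Sum>y\<in>X. (gp y - gm y) * \<zeta> y) + J * (- \<zeta> x)) UNIV"
    by (rule has_integral_add[OF I1 I2])
  \<comment> \<open>The two integrands can differ only at x, through the overwritten value.\<close>
  then have "((\<lambda>t. g t * \<zeta>' t) has_integral - (\<Sum>y\<in>X. (gp y - gm y) * \<zeta> y) + J * (- \<zeta> x)) UNIV"
    by (rule has_integral_spike[of "{x}", rotated 2]) (auto simp: g1_def algebra_simps)
  then show ?case using insert.hyps by (simp add: J_def algebra_simps)
qed

section \<open>Line arrangements, one-sided values and jumps\<close>

definition ln_of :: "pt \<times> pt \<Rightarrow> pt set" where
  "ln_of l = range (\<lambda>t. fr (fst l) (snd l) t 0)"

lemma ln_of_iff:
  assumes "norm (snd l) = 1"
  shows "x \<in> ln_of l \<longleftrightarrow> (x - fst l) \<bullet> rot (snd l) = 0"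
proof
  assume "x \<in> ln_of l" then show "(x - fst l) \<bullet> rot (snd l) = 0"
    using assms by (auto simp: ln_of_def)
next
  assume "(x - fst l) \<bullet> rot (snd l) = 0"
  then have "x = fr (fst l) (snd l) ((x - fst l) \<bullet> snd l) 0" using fr_coords[OF assms, of "fst l" x] by simp
  then show "x \<in> ln_of l" unfolding ln_of_def by blast
qed

lemma closed_ln_of:
  assumes "norm (snd l) = 1"
  shows "closed (ln_of l)"
proof -
  have "ln_of l = {x. (x - fst l) \<bullet> rot (snd l) = 0}" using ln_of_iff[OF assms] by auto
  then show ?thesis by (simp add: closed_Collect_eq continuous_on_diff continuous_on_inner)
qed

text \<open>The value of f on a short ray from x. Since rings may overlap along their boundaries,
  the value at x itself says nothing about the jump there. If f is not eventually constant on the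
  ray, the value is unspecified.\<close>

definition side :: "(pt \<Rightarrow> real) \<Rightarrow> pt \<Rightarrow> pt \<Rightarrow> real" where
  "side f x v = (THE c. \<forall>\<^sub>F s in at_right (0::real). f (x + s *\<^sub>R v) = c)"

lemma side_eq:
  assumes "\<forall>\<^sub>F s in at_right (0::real). f (x + s *\<^sub>R v) = c"
  shows "side f x v = c"
  unfolding side_def
proof (rule the_equality)
  show "\<forall>\<^sub>F s in at_right (0::real). f (x + s *\<^sub>R v) = c" by fact
  fix c' assume "\<forall>\<^sub>F s in at_right (0::real). f (x + s *\<^sub>R v) = c'"
  with assms have "\<forall>\<^sub>F s in at_right (0::real). c = c'" by eventually_elim simp
  then show "c' = c" by (simp add: eventually_happens)
qed

text \<open>A line is stored as a base point with a unit direction, so it has many names; the third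
  assumption admits only one name for each line, and no jump is counted twice.\<close>

locale lines =
  fixes \<Lambda> :: "(pt \<times> pt) set"
  assumes fin: "finite \<Lambda>"
    and unit: "\<And>l. l \<in> \<Lambda> \<Longrightarrow> norm (snd l) = 1"
    and distinct: "\<And>l l'. l \<in> \<Lambda> \<Longrightarrow> l' \<in> \<Lambda> \<Longrightarrow> l \<noteq> l' \<Longrightarrow> finite (ln_of l \<inter> ln_of l')"
begin

definition N :: "pt set" where "N = (\<Union>l\<in>\<Lambda>. ln_of l)"

definition X :: "pt set" where "X = (\<Union>l\<in>\<Lambda>. \<Union>l'\<in>\<Lambda>-{l}. ln_of l \<inter> ln_of l')"

lemma finX: "finite X"
  unfolding X_def using fin distinct by (intro finite_UN_I) auto

lemma closed_N: "closed N"
  unfolding N_def using fin unit by (intro closed_UN) (auto intro: closed_ln_of)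

text \<open>Constancy is asked along segments that avoid the lines, instead of on the cells of the
  arrangement: the cells need no description, and the property passes to differences at
  once.\<close>

definition steplike :: "(pt \<Rightarrow> real) \<Rightarrow> bool" where
  "steplike f \<longleftrightarrow> (\<forall>x y. closed_segment x y \<inter> N = {} \<longrightarrow> f x = f y)"

lemma steplike_ball:
  assumes "steplike f" "z \<notin> N"
  obtains r where "r > 0" "ball z r \<inter> N = {}" "\<And>y. y \<in> ball z r \<Longrightarrow> f y = f z"
proof -
  have "open (- N)" using closed_N by auto
  then obtain r where r: "r > 0" "ball z r \<subseteq> - N" using assms(2) by (meson ComplI open_contains_ball)
  have "f y = f z" if "y \<in> ball z r" for y
  proof -
    have "closed_segment y z \<subseteq> ball z r" using that r by (intro closed_segment_subset) auto
    then show ?thesis using assms(1) r unfolding steplike_def by blast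
  qed
  then show ?thesis using that r by blast
qed

lemma steplike_diff:
  assumes "steplike f" "steplike g" shows "steplike (\<lambda>x. f x - g x)"
  using assms unfolding steplike_def by metis

lemma generic_ball:
  assumes l: "l \<in> \<Lambda>" and x: "x \<in> ln_of l" "x \<notin> X"
  obtains r where "r > 0" "\<And>l'. l' \<in> \<Lambda> \<Longrightarrow> l' \<noteq> l \<Longrightarrow> ball x r \<inter> ln_of l' = {}"
proof -
  define W where "W = (\<Union>l'\<in>\<Lambda>-{l}. ln_of l')"
  have "closed W" unfolding W_def using fin unit by (intro closed_UN) (auto intro: closed_ln_of)
  moreover have "x \<notin> W" using x l unfolding W_def X_def by blast
  ultimately obtain r where "r > 0" "ball x r \<subseteq> - W" by (metis ComplI open_Compl open_contains_ball)
  then show ?thesis using that[of r] unfolding W_def by blast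
qed

text \<open>Away from the crossing points a small disc about x meets only one line. Its two open
  half-discs are convex and free of lines, so f is constant on each, and the constant is the
  one-sided value along the normal.\<close>

lemma local_sides:
  assumes f: "steplike f" and l: "(p, e) \<in> \<Lambda>" and x: "x \<in> ln_of (p, e)" "x \<notin> X"
  obtains r where "r > 0" 
    "\<And>z. z \<in> ball x r \<Longrightarrow> (z - x) \<bullet> rot e > 0 \<Longrightarrow> f z = side f x (rot e)"
    "\<And>z. z \<in> ball x r \<Longrightarrow> (z - x) \<bullet> rot e < 0 \<Longrightarrow> f z = side f x (- rot e)"
    "\<And>z. z \<in> ball x r \<Longrightarrow> (z - x) \<bullet> rot e \<noteq> 0 \<Longrightarrow> z \<notin> N"
proof -
  obtain r where r: "r > 0" "\<And>l'. l' \<in> \<Lambda> \<Longrightarrow> l' \<noteq> (p,e) \<Longrightarrow> ball x r \<inter> ln_of l' = {}"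
    using generic_ball[OF l x] by blast
  have e: "norm e = 1" using unit[OF l] by simp
  have x0: "(x - p) \<bullet> rot e = 0" using x ln_of_iff[of "(p,e)" x] e by simp
  have nN: "z \<notin> N" if "z \<in> ball x r" "(z - x) \<bullet> rot e \<noteq> 0" for z
  proof
    assume "z \<in> N"
    then obtain l' where "l' \<in> \<Lambda>" "z \<in> ln_of l'" unfolding N_def by blast
    then have "z \<in> ln_of (p,e)" using r(2)[of l'] that by blast
    then have "(z - p) \<bullet> rot e = 0" using ln_of_iff[of "(p,e)" z] e by simp
    then show False using that x0 by (simp add: inner_diff_left)
  qed
  have gen: "f z = side f x v" if v: "v = rot e \<or> v = - rot e" and z: "z \<in> ball x r" "(z - x) \<bullet> v > 0" for z v
  proof -
    define H where "H = ball x r \<inter> {z. (z - x) \<bullet> v > 0}"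
    have "{z. (z - x) \<bullet> v > 0} = {z. v \<bullet> z > v \<bullet> x}" by (auto simp: inner_diff_left inner_diff_right inner_commute)
    then have cH: "convex H" unfolding H_def by (auto intro!: convex_Int convex_halfspace_gt)
    have HN: "H \<inter> N = {}" using nN v unfolding H_def by fastforce
    have eq: "f y = f z" if "y \<in> H" for y
    proof -
      have "closed_segment y z \<subseteq> H" using cH that z by (intro closed_segment_subset) (auto simp: H_def)
      then show ?thesis using HN f unfolding steplike_def by blast
    qed
    have nv: "norm v = 1" using v e by auto
    have "\<forall>\<^sub>F s in at_right (0::real). s < r \<and> s > 0"
      using r by (auto simp: eventually_at intro!: exI[of _ r])
    then have "\<forall>\<^sub>F s in at_right (0::real). f (x + s *\<^sub>R v) = f z"
    proof eventually_elim
      case (elim s)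
      then have "x + s *\<^sub>R v \<in> H" using nv by (auto simp: H_def dist_norm norm1_inner)
      then show ?case by (rule eq)
    qed
    from side_eq[OF this] show ?thesis by simp
  qed
  show ?thesis
    by (rule that[OF r(1)]) (use gen nN in \<open>auto\<close>)
qed

text \<open>The value 0 at crossing points is a default on finitely many parameters: it does not
  affect integrals, and it makes the function measurable whatever f does there.\<close>

definition jmp :: "(pt \<Rightarrow> real) \<Rightarrow> pt \<times> pt \<Rightarrow> real \<Rightarrow> real" where
  "jmp f l t = (let x = fr (fst l) (snd l) t 0 in
     if x \<in> X then 0 else side f x (rot (snd l)) - side f x (- rot (snd l)))"

lemma finite_fr_X:
  assumes "norm e = 1" "finite Y"
  shows "finite {t. fr p e t 0 \<in> Y}"
  using finite_vimageI[OF assms(2), of "\<lambda>t. fr p e t 0"] fr_eq_iff[OF assms(1)]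
  by (auto simp: inj_on_def vimage_def)

lemma side_bounds:
  assumes f: "steplike f" and l: "l \<in> \<Lambda>" and x: "x \<in> ln_of l" "x \<notin> X" and B: "\<And>z. \<bar>f z\<bar> \<le> B"
    and v: "v = rot (snd l) \<or> v = - rot (snd l)"
  shows "\<bar>side f x v\<bar> \<le> B"
proof -
  obtain p e where pe: "l = (p,e)" by force
  have e: "norm e = 1" using unit[OF l] pe by simp
  obtain r where r: "r > 0" 
    "\<And>z. z \<in> ball x r \<Longrightarrow> (z - x) \<bullet> rot e > 0 \<Longrightarrow> f z = side f x (rot e)"
    "\<And>z. z \<in> ball x r \<Longrightarrow> (z - x) \<bullet> rot e < 0 \<Longrightarrow> f z = side f x (- rot e)"
    using local_sides[OF f l[unfolded pe] x[unfolded pe]] by metis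
  have "f (x + (r/2) *\<^sub>R v) = side f x v"
    using v r(1) e r(2)[of "x + (r/2) *\<^sub>R v"] r(3)[of "x + (r/2) *\<^sub>R v"] 
    by (auto simp: pe dist_norm norm1_inner)
  then show ?thesis using B by metis
qed

lemma jmp_bound:
  assumes f: "steplike f" and l: "l \<in> \<Lambda>" and B: "\<And>z. \<bar>f z\<bar> \<le> B"
  shows "\<bar>jmp f l t\<bar> \<le> 2 * B"
proof -
  have x: "fr (fst l) (snd l) t 0 \<in> ln_of l" by (auto simp: ln_of_def)
  have "0 \<le> B" using B[of 0] by simp
  then show ?thesis
    using side_bounds[OF f l x _ B, of "rot (snd l)"] side_bounds[OF f l x _ B, of "- rot (snd l)"]
    by (auto simp: jmp_def Let_def)
qed

lemma jmp_locally_const: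
  assumes f: "steplike f" and l: "(p, e) \<in> \<Lambda>" and x: "fr p e t 0 \<notin> X"
  obtains r where "r > 0" "\<And>t'. \<bar>t' - t\<bar> < r \<Longrightarrow> fr p e t' 0 \<notin> X \<and> jmp f (p,e) t' = jmp f (p,e) t
     \<and> side f (fr p e t' 0) (rot e) = side f (fr p e t 0) (rot e)
     \<and> side f (fr p e t' 0) (- rot e) = side f (fr p e t 0) (- rot e)"
proof -
  have e: "norm e = 1" using unit[OF l] by simp
  have xl: "fr p e t' 0 \<in> ln_of (p,e)" for t' by (auto simp: ln_of_def)
  obtain r where r: "r > 0" 
    "\<And>z. z \<in> ball (fr p e t 0) r \<Longrightarrow> (z - fr p e t 0) \<bullet> rot e > 0 \<Longrightarrow> f z = side f (fr p e t 0) (rot e)"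
    "\<And>z. z \<in> ball (fr p e t 0) r \<Longrightarrow> (z - fr p e t 0) \<bullet> rot e < 0 \<Longrightarrow> f z = side f (fr p e t 0) (- rot e)"
    using local_sides[OF f l xl x] by metis
  obtain r' where r': "r' > 0" "\<And>l'. l' \<in> \<Lambda> \<Longrightarrow> l' \<noteq> (p,e) \<Longrightarrow> ball (fr p e t 0) r' \<inter> ln_of l' = {}"
    using generic_ball[OF l xl x] by blast
  define q where "q = min r r'"
  have q: "q > 0" using r r' by (simp add: q_def)
  show ?thesis
  proof (rule that[OF q])
    fix t' assume t': "\<bar>t' - t\<bar> < q"
    have in_ball: "fr p e t' s \<in> ball (fr p e t 0) q" if "\<bar>s\<bar> < q - \<bar>t' - t\<bar>" for s
    proof -
      have "sqrt ((t - t')\<^sup>2 + (0 - s)\<^sup>2) \<le> \<bar>t - t'\<bar> + \<bar>0 - s\<bar>" by (rule sqrt_sum_squares_le_sum_abs)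
      then show ?thesis using that by (simp add: dist_fr[OF e])
    qed
    have inb: "fr p e t' 0 \<in> ball (fr p e t 0) q" using in_ball[of 0] t' by simp
    have nX: "fr p e t' 0 \<notin> X"
    proof
      assume "fr p e t' 0 \<in> X"
      then obtain l1 l2 where "l1 \<in> \<Lambda>" "l2 \<in> \<Lambda>" "l1 \<noteq> l2" "fr p e t' 0 \<in> ln_of l1" "fr p e t' 0 \<in> ln_of l2"
        unfolding X_def by blast
      then obtain l' where "l' \<in> \<Lambda>" "l' \<noteq> (p,e)" "fr p e t' 0 \<in> ln_of l'" by metis
      then show False using r'(2) inb q_def by fastforce
    qed
    have ev: "\<forall>\<^sub>F s in at_right (0::real). s < q - \<bar>t' - t\<bar> \<and> s > 0"
      using t' by (auto simp: eventually_at intro!: exI[of _ "q - \<bar>t' - t\<bar>"])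
    have s1: "side f (fr p e t' 0) (rot e) = side f (fr p e t 0) (rot e)"
    proof (rule side_eq, use ev in eventually_elim)
      case (elim s)
      have "fr p e t' 0 + s *\<^sub>R rot e = fr p e t' s" by (simp add: fr_def)
      moreover have "fr p e t' s \<in> ball (fr p e t 0) r" using in_ball[of s] elim by (simp add: q_def)
      moreover have "(fr p e t' s - fr p e t 0) \<bullet> rot e > 0"
        using elim e by (simp add: fr_def inner_add_left inner_diff_left norm1_inner)
      ultimately show ?case using r(2) by simp
    qed
    have s2: "side f (fr p e t' 0) (- rot e) = side f (fr p e t 0) (- rot e)"
    proof (rule side_eq, use ev in eventually_elim)
      case (elim s)
      have "fr p e t' 0 + s *\<^sub>R - rot e = fr p e t' (-s)" by (simp add: fr_def)
      moreover have "fr p e t' (-s) \<in> ball (fr p e t 0) r" using in_ball[of "-s"] elim by (simp add: q_def)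
      moreover have "(fr p e t' (-s) - fr p e t 0) \<bullet> rot e < 0"
        using elim e by (simp add: fr_def inner_add_left inner_diff_left norm1_inner)
      ultimately show ?case using r(3) by simp
    qed
    show "fr p e t' 0 \<notin> X \<and> jmp f (p,e) t' = jmp f (p,e) t
     \<and> side f (fr p e t' 0) (rot e) = side f (fr p e t 0) (rot e)
     \<and> side f (fr p e t' 0) (- rot e) = side f (fr p e t 0) (- rot e)"
      using s1 s2 nX x by (simp add: jmp_def Let_def)
  qed
qed

text \<open>On the open complement of finitely many parameters the jump is locally constant, hence
  continuous; at these parameters it is 0.\<close>

lemma jmp_measurable:
  assumes f: "steplike f" and l: "l \<in> \<Lambda>"
  shows "jmp f l \<in> borel_measurable borel"
proof -
  obtain p e where pe: "l = (p,e)" by force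
  have e: "norm e = 1" using unit[OF l] pe by simp
  define G where "G = {t. fr p e t 0 \<notin> X}"
  have "closed {t. fr p e t 0 \<in> X}" using finite_fr_X[OF e finX] by (rule finite_imp_closed)
  moreover have "G = - {t. fr p e t 0 \<in> X}" by (auto simp: G_def)
  ultimately have oG: "open G" by auto
  have "continuous_on G (jmp f l)"
    unfolding continuous_on_eq_continuous_at[OF oG]
  proof
    fix t assume "t \<in> G"
    then have "fr p e t 0 \<notin> X" by (simp add: G_def)
    from jmp_locally_const[OF f l[unfolded pe] this]
    obtain r where r: "r > 0" "\<And>t'. \<bar>t' - t\<bar> < r \<Longrightarrow> jmp f (p,e) t' = jmp f (p,e) t"
      by metis
    have "\<forall>\<^sub>F t' in at t. jmp f l t' = jmp f l t"
      unfolding eventually_at pe using r by (metis dist_real_def)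
    then show "isCont (jmp f l) t"
      unfolding isCont_def by (rule tendsto_eventually)
  qed
  then have m: "(\<lambda>t. indicator G t *\<^sub>R jmp f l t) \<in> borel_measurable borel"
    using borel_open[OF oG] by (rule borel_measurable_continuous_on_indicator[rotated])
  moreover have "indicator G t *\<^sub>R jmp f l t = jmp f l t" for t
    by (cases "t \<in> G") (simp_all add: G_def jmp_def pe)
  ultimately show ?thesis by (simp only: )
qed

end

section \<open>The divergence formula for step functions\<close>

lemma has_derivative_along:
  fixes \<zeta> :: "pt \<Rightarrow> real"
  assumes "(\<zeta> has_derivative D) (at (p + t *\<^sub>R b))"
  shows "((\<lambda>t. \<zeta> (p + t *\<^sub>R b)) has_real_derivative D b) (at t)"
proof -
  have "((\<lambda>t. p + t *\<^sub>R b) has_derivative (\<lambda>h. h *\<^sub>R b)) (at t)"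
    by (auto intro!: derivative_eq_intros)
  from has_derivative_compose[OF this assms]
  have "((\<lambda>t. \<zeta> (p + t *\<^sub>R b)) has_derivative (\<lambda>h. D (h *\<^sub>R b))) (at t)" .
  moreover have "D (h *\<^sub>R b) = D b * h" for h
    using linear_scale[OF has_derivative_linear[OF assms]] by simp
  ultimately show ?thesis by (simp add: has_field_derivative_def)
qed

context lines begin

text \<open>On the slice in direction b at height y, f is a one-dimensional step function that can
  jump only where the slice crosses a line not parallel to b. The finitely many excluded y are those
  whose slice passes through a crossing point or runs inside a line. Since
  \<open>b \<bullet> rot e = e \<bullet> c\<close>, the sign of \<open>e \<bullet> c\<close> tells
  in which order the slice meets the two sides of the line.\<close>

lemma slice_formula:
  fixes \<zeta> :: "pt \<Rightarrow> real"
  assumes f: "steplike f"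
    and b: "norm c = 1" "b = rot c"
    and y: "y \<notin> (\<lambda>x. x \<bullet> c) ` X" "y \<notin> {p \<bullet> c | p e. (p, e) \<in> \<Lambda> \<and> e \<bullet> c = 0}"
    and d: "\<And>x. (\<zeta> has_derivative D x) (at x)"
    and z: "\<And>x. norm x \<ge> M \<Longrightarrow> \<zeta> x = 0" "\<And>x. norm x \<ge> M \<Longrightarrow> D x b = 0"
  shows "((\<lambda>s. f (fr 0 c y s) * D (fr 0 c y s) b) has_integral
    - (\<Sum>l\<in>{l\<in>\<Lambda>. snd l \<bullet> c \<noteq> 0}. sgn (snd l \<bullet> c) *
        jmp f l ((y - fst l \<bullet> c) / (snd l \<bullet> c)) * \<zeta> (fr (fst l) (snd l) ((y - fst l \<bullet> c) / (snd l \<bullet> c)) 0))) UNIV"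
proof -
  define L where "L = {l\<in>\<Lambda>. snd l \<bullet> c \<noteq> 0}"
  define tt where "tt = (\<lambda>l. (y - fst l \<bullet> c) / (snd l \<bullet> c))"
  define xx where "xx = (\<lambda>l. fr (fst l) (snd l) (tt l) 0)"
  define \<sigma> where "\<sigma> = (\<lambda>l. xx l \<bullet> b)"
  have finL: "finite L" using fin by (simp add: L_def)
  have xc: "xx l \<bullet> c = y" if "l \<in> L" for l
    using that by (simp add: xx_def tt_def fr_def L_def inner_add_left)
  have xl: "xx l \<in> ln_of l" for l by (auto simp: xx_def ln_of_def)
  have xX: "xx l \<notin> X" if "l \<in> L" for l using xc[OF that] y(1) by force
  have frx: "fr 0 c y (\<sigma> l) = xx l" if "l \<in> L" for l
    using fr_coords[OF b(1), of 0 "xx l"] xc[OF that] by (simp add: \<sigma>_def b(2))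
  have inj: "inj_on \<sigma> L"
  proof (rule inj_onI)
    fix l l' assume l: "l \<in> L" "l' \<in> L" "\<sigma> l = \<sigma> l'"
    then have "xx l = xx l'" using frx by metis
    then have "l \<noteq> l' \<Longrightarrow> xx l \<in> X" using xl[of l] xl[of l'] l unfolding X_def L_def by auto
    then show "l = l'" using xX l by blast
  qed
  have inN: "fr 0 c y s \<in> N \<longleftrightarrow> s \<in> \<sigma> ` L" for s
  proof
    assume "s \<in> \<sigma> ` L" then obtain l where "l \<in> L" "s = \<sigma> l" by blast
    then have "fr 0 c y s = xx l" "l \<in> \<Lambda>" using frx by (auto simp: L_def)
    then show "fr 0 c y s \<in> N" using xl[of l] unfolding N_def by auto
  next
    assume "fr 0 c y s \<in> N"
    then obtain l where l: "l \<in> \<Lambda>" "fr 0 c y s \<in> ln_of l" unfolding N_def by blast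
    then obtain t where t: "fr 0 c y s = fr (fst l) (snd l) t 0" unfolding ln_of_def by blast
    have "fr 0 c y s \<bullet> c = y" using fr_inner(1)[OF b(1), of 0 y s] by simp
    then have y': "y = fst l \<bullet> c + t * (snd l \<bullet> c)" unfolding t by (simp add: fr_def inner_add_left)
    have nz: "snd l \<bullet> c \<noteq> 0"
    proof
      assume 0: "snd l \<bullet> c = 0"
      then have "y = fst l \<bullet> c" using y' by simp
      then show False using y(2) l(1) 0 by (metis (mono_tags, lifting) mem_Collect_eq prod.collapse)
    qed
    then have "l \<in> L" "tt l = t" using l y' by (simp_all add: L_def tt_def)
    then have "xx l = fr 0 c y s" using t by (simp add: xx_def)
    moreover have "fr 0 c y s \<bullet> b = s" using fr_inner(2)[OF b(1), of 0 y s] by (simp add: b(2))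
    ultimately show "s \<in> \<sigma> ` L" using \<open>l \<in> L\<close> unfolding \<sigma>_def by force
  qed
  have seg: "closed_segment (fr 0 c y s) (fr 0 c y s') = fr 0 c y ` {s..s'}" if "s \<le> s'" for s s'
  proof -
    have "fr 0 c y ` {s..s'} = (\<lambda>x. y *\<^sub>R c + x) ` ((\<lambda>s. s *\<^sub>R b) ` closed_segment s s')"
      using that by (simp add: fr_def b(2) image_image closed_segment_eq_real_ivl)
    also have "(\<lambda>s. s *\<^sub>R b) ` closed_segment s s' = closed_segment (s *\<^sub>R b) (s' *\<^sub>R b)"
      by (rule closed_segment_linear_image[symmetric]) (auto intro: linearI simp: algebra_simps)
    also have "(\<lambda>x. y *\<^sub>R c + x) ` closed_segment (s *\<^sub>R b) (s' *\<^sub>R b) = closed_segment (fr 0 c y s) (fr 0 c y s')"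
      by (simp add: fr_def b(2) closed_segment_translation)
    finally show ?thesis by simp
  qed
  define inv where "inv = the_inv_into L \<sigma>"
  have inv: "inv (\<sigma> l) = l" if "l \<in> L" for l using the_inv_into_f_f[OF inj that] by (simp add: inv_def)
  define gp where "gp = (\<lambda>s. side f (xx (inv s)) (sgn (snd (inv s) \<bullet> c) *\<^sub>R rot (snd (inv s))))"
  define gm where "gm = (\<lambda>s. side f (xx (inv s)) (- sgn (snd (inv s) \<bullet> c) *\<^sub>R rot (snd (inv s))))"
  have ev: "(\<forall>\<^sub>F s in at_right 0. f (fr 0 c y (\<sigma> l + s)) = gp (\<sigma> l))
      \<and> (\<forall>\<^sub>F s in at_right 0. f (fr 0 c y (\<sigma> l - s)) = gm (\<sigma> l))" if l: "l \<in> L" for l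
  proof -
    obtain p e where pe: "l = (p,e)" by force
    have l': "(p,e) \<in> \<Lambda>" using l pe by (simp add: L_def)
    have e: "norm e = 1" using unit[OF l'] by simp
    obtain r where r: "r > 0" 
      "\<And>z. z \<in> ball (xx l) r \<Longrightarrow> (z - xx l) \<bullet> rot e > 0 \<Longrightarrow> f z = side f (xx l) (rot e)"
      "\<And>z. z \<in> ball (xx l) r \<Longrightarrow> (z - xx l) \<bullet> rot e < 0 \<Longrightarrow> f z = side f (xx l) (- rot e)"
      using local_sides[OF f l' xl[of l, unfolded pe] xX[OF l, unfolded pe]] pe by metis
    have bre: "b \<bullet> rot e = e \<bullet> c" by (simp add: b(2) inner_commute)
    have nb: "norm b = 1" using b by simp
    have nz: "e \<bullet> c \<noteq> 0" using l pe by (simp add: L_def)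
    have sh: "fr 0 c y (\<sigma> l + s) = xx l + s *\<^sub>R b" for s
      using frx[OF l] by (simp add: fr_def b(2) algebra_simps)
    have evr: "\<forall>\<^sub>F s in at_right (0::real). s < r \<and> s > 0"
      using r by (auto simp: eventually_at intro!: exI[of _ r])
    have A: "f (xx l + s *\<^sub>R b) = (if s * (e \<bullet> c) > 0 then side f (xx l) (rot e) else side f (xx l) (- rot e))"
      if "\<bar>s\<bar> < r" "s \<noteq> 0" for s
    proof -
      have inb: "xx l + s *\<^sub>R b \<in> ball (xx l) r" using that nb by (simp add: dist_norm)
      have ip: "(xx l + s *\<^sub>R b - xx l) \<bullet> rot e = s * (e \<bullet> c)" by (simp add: bre)
      have "s * (e \<bullet> c) \<noteq> 0" using that nz by simp
      then show ?thesis using r(2)[OF inb] r(3)[OF inb] unfolding ip by (smt (verit))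
    qed
    have "\<forall>\<^sub>F s in at_right 0. f (fr 0 c y (\<sigma> l + s)) = gp (\<sigma> l)"
      using evr
    proof eventually_elim
      case (elim s)
      then show ?case using A[of s] nz inv[OF l] unfolding sh gp_def
        by (cases "e \<bullet> c > 0") (simp_all add: pe zero_less_mult_iff)
    qed
    moreover have "\<forall>\<^sub>F s in at_right 0. f (fr 0 c y (\<sigma> l - s)) = gm (\<sigma> l)"
      using evr
    proof eventually_elim
      case (elim s)
      then show ?case using A[of "-s"] nz inv[OF l] sh[of "-s"] unfolding gm_def
        by (cases "e \<bullet> c > 0") (simp_all add: pe mult_less_0_iff)
    qed
    ultimately show ?thesis by blast
  qed
  have fs: "fr 0 c y s = y *\<^sub>R c + s *\<^sub>R b" for s by (simp add: fr_def b(2))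
  have nfr: "norm (fr 0 c y s) \<ge> M" if "\<bar>s\<bar> \<ge> M" for s
  proof -
    have "norm (fr 0 c y s) = sqrt (y\<^sup>2 + s\<^sup>2)" using norm_frame[OF b(1), of y s] by (simp add: fr_def)
    then show ?thesis using that real_sqrt_sum_squares_ge2[of s y] 
      by (smt (verit) real_sqrt_sum_squares_ge2 real_sqrt_abs2 real_sqrt_le_iff power2_eq_square sum_power2_ge_zero zero_le_power2)
  qed
  have "((\<lambda>s. f (fr 0 c y s) * D (fr 0 c y s) b) has_integral
    - (\<Sum>s\<in>\<sigma> ` L. (gp s - gm s) * \<zeta> (fr 0 c y s))) UNIV"
  proof (rule step_ibp)
    show "finite (\<sigma> ` L)" using finL by simp
    fix s s' assume s: "s \<le> s'" "{s..s'} \<inter> \<sigma> ` L = {}"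
    have "closed_segment (fr 0 c y s) (fr 0 c y s') \<inter> N = {}"
      unfolding seg[OF s(1)] using s(2) inN by auto
    then show "f (fr 0 c y s) = f (fr 0 c y s')" using f unfolding steplike_def by blast
  next
    fix s assume "s \<in> \<sigma> ` L" then show "\<forall>\<^sub>F t in at_right 0. f (fr 0 c y (s + t)) = gp s" using ev by blast
  next
    fix s assume "s \<in> \<sigma> ` L" then show "\<forall>\<^sub>F t in at_right 0. f (fr 0 c y (s - t)) = gm s" using ev by blast
  next
    fix t show "((\<lambda>s. \<zeta> (fr 0 c y s)) has_real_derivative D (fr 0 c y t) b) (at t)"
      unfolding fs by (rule has_derivative_along[OF d])
  next
    fix t assume "\<bar>t\<bar> \<ge> M" then show "\<zeta> (fr 0 c y t) = 0" "D (fr 0 c y t) b = 0" using z nfr by auto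
  qed
  moreover have "(\<Sum>s\<in>\<sigma> ` L. (gp s - gm s) * \<zeta> (fr 0 c y s))
     = (\<Sum>l\<in>L. sgn (snd l \<bullet> c) * jmp f l (tt l) * \<zeta> (fr (fst l) (snd l) (tt l) 0))"
    unfolding sum.reindex[OF inj] o_def
  proof (rule sum.cong)
    fix l assume l: "l \<in> L"
    have nz: "snd l \<bullet> c \<noteq> 0" using l by (simp add: L_def)
    have "jmp f l (tt l) = side f (xx l) (rot (snd l)) - side f (xx l) (- rot (snd l))"
      using xX[OF l] by (simp add: jmp_def xx_def Let_def)
    then have "gp (\<sigma> l) - gm (\<sigma> l) = sgn (snd l \<bullet> c) * jmp f l (tt l)"
      unfolding gp_def gm_def inv[OF l] using nz by (cases "snd l \<bullet> c > 0") simp_all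
    then show "(gp (\<sigma> l) - gm (\<sigma> l)) * \<zeta> (fr 0 c y (\<sigma> l)) = sgn (snd l \<bullet> c) * jmp f l (tt l) * \<zeta> (fr (fst l) (snd l) (tt l) 0)"
      using frx[OF l] by (simp add: xx_def)
  qed simp
  ultimately show ?thesis by (simp add: L_def tt_def)
qed

end

lemma integrable_bounded_support:
  fixes f :: "'a::euclidean_space \<Rightarrow> real"
  assumes "f \<in> borel_measurable borel" "\<And>x. \<bar>f x\<bar> \<le> B" "\<And>x. norm x > M \<Longrightarrow> f x = 0"
  shows "integrable lborel f"
proof -
  have "integrable lborel (\<lambda>x::'a. B * indicator (cball 0 M) x :: real)"
    using emeasure_bounded_finite[of "cball 0 M :: 'a set"]
    by (intro integrable_mult_right integrable_real_indicator) auto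
  then show ?thesis
  proof (rule Bochner_Integration.integrable_bound)
    show "f \<in> borel_measurable lborel" using assms by simp
    show "AE x in lborel. norm (f x) \<le> norm (B * indicator (cball 0 M) x :: real)"
      using assms(2,3) by (intro AE_I2) (smt (verit) indicator_simps mem_cball_0 mult_cancel_left1 mult_cancel_left2 norm_zero real_norm_def)
  qed
qed

context lines begin

text \<open>Fubini reduces the integral to the slices. On each line the substitution from y back to
  the line parameter t has Jacobian \<open>\<bar>e \<bullet> c\<bar>\<close>, which together with
  the sign from the slice formula gives the factor \<open>e \<bullet> c\<close>.\<close>

lemma divergence_dir:
  fixes \<zeta> :: "pt \<Rightarrow> real"
  assumes f: "steplike f" "f \<in> borel_measurable borel" "\<And>x. \<bar>f x\<bar> \<le> B"
    and b: "norm c = 1" "b = rot c"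
    and d: "\<And>x. (\<zeta> has_derivative D x) (at x)" and cont: "continuous_on UNIV (\<lambda>x. D x b)"
    and z: "\<And>x. norm x \<ge> M \<Longrightarrow> \<zeta> x = 0" "\<And>x. norm x \<ge> M \<Longrightarrow> D x b = 0"
  shows "(\<integral>x. f x * D x b \<partial>lborel) = 
    - (\<Sum>l\<in>\<Lambda>. \<integral>t. jmp f l t * \<zeta> (fr (fst l) (snd l) t 0) * (snd l \<bullet> c) \<partial>lborel)"
    and "integrable lborel (\<lambda>x. f x * D x b)"
    and "\<And>l k. l \<in> \<Lambda> \<Longrightarrow> integrable lborel (\<lambda>t. jmp f l t * \<zeta> (fr (fst l) (snd l) t 0) * k)"
proof -
  have B: "0 \<le> B" using f(3)[of 0] by simp
  have bd: "\<exists>K. \<forall>x. \<bar>h x\<bar> \<le> K" if "continuous_on UNIV h" "\<And>x. norm x \<ge> M \<Longrightarrow> h x = 0" for h :: "pt \<Rightarrow> real"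
  proof -
    have "bounded (h ` cball 0 M)"
      by (intro compact_imp_bounded compact_continuous_image continuous_on_subset[OF that(1)]) auto
    then obtain K where K: "\<And>x. x \<in> cball 0 M \<Longrightarrow> norm (h x) \<le> K" unfolding bounded_iff by blast
    have "\<bar>h x\<bar> \<le> max K 0" for x using K[of x] that(2)[of x] by (cases "norm x \<le> M") auto
    then show ?thesis by blast
  qed
  have c\<zeta>: "continuous_on UNIV \<zeta>"
    using d has_derivative_continuous by (force simp: continuous_on_eq_continuous_at)
  obtain K1 where K1: "\<And>x. \<bar>D x b\<bar> \<le> K1" using bd[OF cont z(2)] by blast
  obtain K2 where K2: "\<And>x. \<bar>\<zeta> x\<bar> \<le> K2" using bd[OF c\<zeta> z(1)] by blast
  have K: "0 \<le> K1" "0 \<le> K2" using K1[of 0] K2[of 0] by auto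
  show I: "integrable lborel (\<lambda>x. f x * D x b)"
  proof (rule integrable_bounded_support)
    show "(\<lambda>x. f x * D x b) \<in> borel_measurable borel"
      using f(2) borel_measurable_continuous_onI[OF cont] by measurable
    show "\<bar>f x * D x b\<bar> \<le> B * K1" for x
      unfolding abs_mult using f(3) K1 B by (intro mult_mono) auto
    show "f x * D x b = 0" if "norm x > M" for x using z(2)[of x] that by simp
  qed
  have e: "norm (snd l) = 1" if "l \<in> \<Lambda>" for l using unit[OF that] .
  have Jm: "(\<lambda>t. jmp f l t * \<zeta> (fr (fst l) (snd l) t 0) * k) \<in> borel_measurable borel" if "l \<in> \<Lambda>" for l k
  proof -
    have "continuous_on UNIV (\<lambda>t. \<zeta> (fr (fst l) (snd l) t 0))"
      by (intro continuous_on_compose2[OF c\<zeta>] continuous_intros) auto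
    then have "(\<lambda>t. \<zeta> (fr (fst l) (snd l) t 0)) \<in> borel_measurable borel"
      by (rule borel_measurable_continuous_onI)
    then show ?thesis using jmp_measurable[OF f(1) that] by measurable
  qed
  show J: "integrable lborel (\<lambda>t. jmp f l t * \<zeta> (fr (fst l) (snd l) t 0) * k)" if l: "l \<in> \<Lambda>" for l k
  proof (rule integrable_bounded_support[OF Jm[OF l]])
    show "\<bar>jmp f l t * \<zeta> (fr (fst l) (snd l) t 0) * k\<bar> \<le> 2 * B * K2 * \<bar>k\<bar>" for t
      unfolding abs_mult using jmp_bound[OF f(1) l f(3)] K2 B K
      by (intro mult_mono) auto
    fix t :: real assume t: "norm t > \<bar>M\<bar> + norm (fst l)"
    have "fr (fst l) (snd l) t 0 = fst l + t *\<^sub>R snd l" by (simp add: fr_def)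
    then have "norm (fr (fst l) (snd l) t 0) \<ge> norm (t *\<^sub>R snd l) - norm (fst l)"
      by (metis add.commute norm_diff_ineq)
    then have "norm (fr (fst l) (snd l) t 0) \<ge> M" using t e[OF l] by simp
    then show "jmp f l t * \<zeta> (fr (fst l) (snd l) t 0) * k = 0" using z by simp
  qed
  define L where "L = {l\<in>\<Lambda>. snd l \<bullet> c \<noteq> 0}"
  define F where "F = (\<lambda>l y. sgn (snd l \<bullet> c) *
        jmp f l ((y - fst l \<bullet> c) / (snd l \<bullet> c)) * \<zeta> (fr (fst l) (snd l) ((y - fst l \<bullet> c) / (snd l \<bullet> c)) 0))"
  have F: "(\<integral>y. F l y \<partial>lborel) = (\<integral>t. jmp f l t * \<zeta> (fr (fst l) (snd l) t 0) * (snd l \<bullet> c) \<partial>lborel)"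
    "integrable lborel (F l)" if l: "l \<in> L" for l
  proof -
    have nz: "snd l \<bullet> c \<noteq> 0" and l': "l \<in> \<Lambda>" using l by (auto simp: L_def)
    have F': "F l (fst l \<bullet> c + (snd l \<bullet> c) * t) = jmp f l t * \<zeta> (fr (fst l) (snd l) t 0) * sgn (snd l \<bullet> c)" for t
      using nz by (simp add: F_def)
    show "integrable lborel (F l)"
      using J[OF l', of "sgn (snd l \<bullet> c)"] unfolding F'[symmetric]
      by (simp only: lborel_integrable_real_affine_iff[OF nz])
    have "(\<integral>y. F l y \<partial>lborel) = \<bar>snd l \<bullet> c\<bar> *\<^sub>R (\<integral>t. F l (fst l \<bullet> c + (snd l \<bullet> c) * t) \<partial>lborel)"
      by (rule lborel_integral_real_affine[OF nz])
    also have "\<dots> = (\<integral>t. \<bar>snd l \<bullet> c\<bar> * (jmp f l t * \<zeta> (fr (fst l) (snd l) t 0) * sgn (snd l \<bullet> c)) \<partial>lborel)"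
      unfolding F' by simp
    also have "(\<lambda>t. \<bar>snd l \<bullet> c\<bar> * (jmp f l t * \<zeta> (fr (fst l) (snd l) t 0) * sgn (snd l \<bullet> c)))
      = (\<lambda>t. jmp f l t * \<zeta> (fr (fst l) (snd l) t 0) * (snd l \<bullet> c))"
    proof
      fix t
      have "\<bar>k\<bar> * (a * sgn k) = a * k" for k a :: real by (cases "k > 0") (auto simp: sgn_if)
      then show "\<bar>snd l \<bullet> c\<bar> * (jmp f l t * \<zeta> (fr (fst l) (snd l) t 0) * sgn (snd l \<bullet> c))
        = jmp f l t * \<zeta> (fr (fst l) (snd l) t 0) * (snd l \<bullet> c)" .
    qed
    finally show "(\<integral>y. F l y \<partial>lborel) = (\<integral>t. jmp f l t * \<zeta> (fr (fst l) (snd l) t 0) * (snd l \<bullet> c) \<partial>lborel)" .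
  qed
  define Y where "Y = (\<lambda>x. x \<bullet> c) ` X \<union> {p \<bullet> c | p e. (p, e) \<in> \<Lambda> \<and> e \<bullet> c = 0}"
  have "{p \<bullet> c | p e. (p, e) \<in> \<Lambda> \<and> e \<bullet> c = 0} \<subseteq> (\<lambda>l. fst l \<bullet> c) ` \<Lambda>" by force
  then have "finite {p \<bullet> c | p e. (p, e) \<in> \<Lambda> \<and> e \<bullet> c = 0}"
    using fin by (rule finite_subset[OF _ finite_imageI])
  then have finY: "finite Y" unfolding Y_def using finX by blast
  have "AE y in lborel. y \<notin> Y" using finite_imp_null_set_lborel[OF finY] by (rule AE_not_in)
  moreover have "AE y in lborel. integrable lborel (\<lambda>s. f (fr 0 c y s) * D (fr 0 c y s) b)"
    using lborel_pair.AE_integrable_fst'[OF integrable_fr[OF b(1) I, of 0]] by simp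
  ultimately have ae: "AE y in lborel. (\<integral>s. f (fr 0 c y s) * D (fr 0 c y s) b \<partial>lborel) = - (\<Sum>l\<in>L. F l y)"
  proof eventually_elim
    case (elim y)
    have h1: "((\<lambda>s. f (fr 0 c y s) * D (fr 0 c y s) b) has_integral - (\<Sum>l\<in>L. F l y)) UNIV"
      unfolding L_def F_def using elim(1) by (intro slice_formula[OF f(1) b _ _ d z]) (auto simp: Y_def)
    show ?case using has_integral_integral_lborel[OF elim(2)] h1 has_integral_unique by blast
  qed
  have "(\<integral>x. f x * D x b \<partial>lborel) = (\<integral>y. (\<integral>s. f (fr 0 c y s) * D (fr 0 c y s) b \<partial>lborel) \<partial>lborel)"
    by (rule integral_fr[OF b(1) I])
  also have "\<dots> = (\<integral>y. - (\<Sum>l\<in>L. F l y) \<partial>lborel)"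
  proof (rule integral_cong_AE)
    show "(\<lambda>y. \<integral>s. f (fr 0 c y s) * D (fr 0 c y s) b \<partial>lborel) \<in> borel_measurable lborel"
      using lborel_pair.integrable_fst'[OF integrable_fr[OF b(1) I, of 0]] by auto
    show "(\<lambda>y. - (\<Sum>l\<in>L. F l y)) \<in> borel_measurable lborel"
      using F(2) by (intro borel_measurable_uminus borel_measurable_sum) auto
  qed (rule ae)
  also have "\<dots> = - (\<Sum>l\<in>L. \<integral>y. F l y \<partial>lborel)"
    using F(2) by (simp add: Bochner_Integration.integral_sum)
  also have "(\<Sum>l\<in>L. \<integral>y. F l y \<partial>lborel) = (\<Sum>l\<in>L. \<integral>t. jmp f l t * \<zeta> (fr (fst l) (snd l) t 0) * (snd l \<bullet> c) \<partial>lborel)"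
    by (rule sum.cong) (auto simp: F)
  \<comment> \<open>Lines parallel to the slices are restored to the sum; their factor
    \<open>snd l \<bullet> c\<close> is 0.\<close>
  also have "\<dots> = (\<Sum>l\<in>\<Lambda>. \<integral>t. jmp f l t * \<zeta> (fr (fst l) (snd l) t 0) * (snd l \<bullet> c) \<partial>lborel)"
    using fin by (intro sum.mono_neutral_left) (auto simp: L_def)
  finally show "(\<integral>x. f x * D x b \<partial>lborel) = 
    - (\<Sum>l\<in>\<Lambda>. \<integral>t. jmp f l t * \<zeta> (fr (fst l) (snd l) t 0) * (snd l \<bullet> c) \<partial>lborel)" .
qed

end

section \<open>Cutoff functions and bumps on rectangles\<close>

lemma has_derivative_max_sq: "((\<lambda>x::real. (max 0 x)\<^sup>2) has_real_derivative 2 * max 0 x) (at x)"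
proof -
  consider "x < 0" | "x = 0" | "x > 0" by linarith
  then show ?thesis
  proof cases
    case 1
    have "((\<lambda>x::real. 0) has_real_derivative 2 * max 0 x) (at x)" using 1 by simp
    then show ?thesis
      by (rule has_field_derivative_transform_within_open[of _ _ _ "{..<0}"]) (use 1 in auto)
  next
    case 3
    have "((\<lambda>x::real. x\<^sup>2) has_real_derivative 2 * max 0 x) (at x)"
      using 3 by (auto intro!: derivative_eq_intros)
    then show ?thesis
      by (rule has_field_derivative_transform_within_open[of _ _ _ "{0<..}"]) (use 3 in auto)
  next
    case 2
    have "((\<lambda>h::real. (max 0 h)\<^sup>2 / h) \<longlongrightarrow> 0) (at 0)"
    proof (rule Lim_null_comparison)
      show "\<forall>\<^sub>F h::real in at 0. norm ((max 0 h)\<^sup>2 / h) \<le> \<bar>h\<bar>"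
        by (intro always_eventually) (auto simp: max_def power2_eq_square)
      show "((\<lambda>h::real. \<bar>h\<bar>) \<longlongrightarrow> 0) (at 0)" by (rule tendsto_eq_intros | simp)+
    qed
    then show ?thesis using 2 by (simp add: DERIV_def)
  qed
qed

text \<open>A transition from 0 to 1 on the unit interval. Test fields only have to be continuously
  differentiable, so squares of positive parts are smooth enough.\<close>

definition sm :: "real \<Rightarrow> real" where
  "sm x = (max 0 x)\<^sup>2 / ((max 0 x)\<^sup>2 + (max 0 (1 - x))\<^sup>2)"

definition sm' :: "real \<Rightarrow> real" where
  "sm' x = (2 * max 0 x * ((max 0 x)\<^sup>2 + (max 0 (1 - x))\<^sup>2) - (max 0 x)\<^sup>2 * (2 * max 0 x - 2 * max 0 (1 - x)))
     / ((max 0 x)\<^sup>2 + (max 0 (1 - x))\<^sup>2)\<^sup>2"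

lemma sm_denom: "(max 0 x)\<^sup>2 + (max 0 (1 - x))\<^sup>2 > (0::real)"
  by (cases "x > 0") (auto simp: add_pos_nonneg max_def)

lemma sm_deriv: "(sm has_real_derivative sm' x) (at x)"
proof -
  have 1: "((\<lambda>x::real. (max 0 (1 - x))\<^sup>2) has_real_derivative (2 * max 0 (1 - x)) * (-1)) (at x)"
    by (rule DERIV_chain'[OF _ has_derivative_max_sq]) (auto intro!: derivative_eq_intros)
  show ?thesis
    unfolding sm_def[abs_def] sm'_def power2_eq_square[of "(max 0 x)\<^sup>2 + (max 0 (1 - x))\<^sup>2"]
    using DERIV_divide[OF has_derivative_max_sq DERIV_add[OF has_derivative_max_sq 1] less_imp_neq[OF sm_denom, symmetric]]
    by simp
qed

lemma sm'_cont: "continuous_on A sm'"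
  unfolding sm'_def[abs_def] using sm_denom
  by (intro continuous_intros) (metis less_numeral_extra(3) power_not_zero)

lemma sm_0 [simp]: "x \<le> 0 \<Longrightarrow> sm x = 0" "x \<le> 0 \<Longrightarrow> sm' x = 0"
  by (simp_all add: sm_def sm'_def)

lemma sm_1 [simp]: "x \<ge> 1 \<Longrightarrow> sm x = 1" "x \<ge> 1 \<Longrightarrow> sm' x = 0"
  by (simp_all add: sm_def sm'_def max_def)

lemma sm_range: "0 \<le> sm x" "sm x \<le> 1"
  using sm_denom[of x] by (simp_all add: sm_def)

text \<open>A plateau: 0 outside the interval from a to b and 1 on that interval shortened by
  \<open>\<eta>\<close> at both ends.\<close>

definition pl :: "real \<Rightarrow> real \<Rightarrow> real \<Rightarrow> real \<Rightarrow> real" where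
  "pl a b \<eta> x = sm ((x - a) / \<eta>) * sm ((b - x) / \<eta>)"

definition pl' :: "real \<Rightarrow> real \<Rightarrow> real \<Rightarrow> real \<Rightarrow> real" where
  "pl' a b \<eta> x = sm' ((x - a) / \<eta>) / \<eta> * sm ((b - x) / \<eta>) - sm ((x - a) / \<eta>) * (sm' ((b - x) / \<eta>) / \<eta>)"

lemma sm_affine_deriv: "((\<lambda>x. sm ((x - a) / \<eta>)) has_real_derivative sm' ((x - a) / \<eta>) / \<eta>) (at x)"
proof -
  have "((\<lambda>x. (x - a) / \<eta>) has_real_derivative 1 / \<eta>) (at x)"
    using DERIV_cdivide[OF DERIV_diff[OF DERIV_ident DERIV_const]] by simp
  from DERIV_chain'[OF this sm_deriv] show ?thesis by simp
qed

lemma sm_affine_deriv': "((\<lambda>x. sm ((b - x) / \<eta>)) has_real_derivative - (sm' ((b - x) / \<eta>) / \<eta>)) (at x)"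
proof -
  have "((\<lambda>x. (b - x) / \<eta>) has_real_derivative (- 1) / \<eta>) (at x)"
    using DERIV_cdivide[OF DERIV_diff[OF DERIV_const DERIV_ident]] by simp
  from DERIV_chain'[OF this sm_deriv] show ?thesis by simp
qed

lemma pl_deriv: "(pl a b \<eta> has_real_derivative pl' a b \<eta> x) (at x)"
  unfolding pl_def[abs_def] pl'_def
  using DERIV_mult[OF sm_affine_deriv[of a \<eta> x] sm_affine_deriv'[of b \<eta> x]] by (simp add: algebra_simps)

lemma pl_cont: "continuous_on A (pl a b \<eta>)"
  by (rule DERIV_continuous_on) (rule has_field_derivative_at_within[OF pl_deriv])

lemma pl'_cont: 
  assumes "\<eta> > 0"
  shows "continuous_on A (pl' a b \<eta>)"
proof -
  have "continuous_on UNIV sm" by (rule DERIV_continuous_on) (rule sm_deriv)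
  note c = continuous_on_compose2[OF this _ subset_UNIV] continuous_on_compose2[OF sm'_cont[of UNIV] _ subset_UNIV]
  have l: "continuous_on A (\<lambda>x. (x - a) / \<eta>)" "continuous_on A (\<lambda>x. (b - x) / \<eta>)"
    using assms by (auto intro!: continuous_intros)
  have n: "\<forall>x\<in>A. \<eta> \<noteq> 0" using assms by simp
  show ?thesis unfolding pl'_def[abs_def]
    by (rule continuous_on_diff continuous_on_mult continuous_on_divide c l n continuous_on_const)+
qed

lemma pl_range: "0 \<le> pl a b \<eta> x" "pl a b \<eta> x \<le> 1"
  using sm_range by (auto simp: pl_def intro: mult_le_one)

lemma pl_0: "\<eta> > 0 \<Longrightarrow> x \<le> a \<or> x \<ge> b \<Longrightarrow> pl a b \<eta> x = 0"
  by (auto simp: pl_def divide_nonpos_pos)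

lemma pl_1: "\<eta> > 0 \<Longrightarrow> a + \<eta> \<le> x \<Longrightarrow> x \<le> b - \<eta> \<Longrightarrow> pl a b \<eta> x = 1"
  by (simp add: pl_def)

text \<open>The two transitions do not overlap, so where one factor varies the other is 1.\<close>

lemma pl'_split:
  assumes "\<eta> > 0" "2 * \<eta> < b - a"
  shows "pl' a b \<eta> x = sm' ((x - a) / \<eta>) / \<eta> - sm' ((b - x) / \<eta>) / \<eta>"
proof -
  have "x \<le> b - \<eta> \<or> x \<ge> a + \<eta>" using assms by linarith
  then show ?thesis
  proof
    assume "x \<le> b - \<eta>" then have "(b - x) / \<eta> \<ge> 1" using assms by simp
    then show ?thesis by (simp add: pl'_def)
  next
    assume "x \<ge> a + \<eta>" then have "(x - a) / \<eta> \<ge> 1" using assms by simp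
    then show ?thesis by (simp add: pl'_def)
  qed
qed

lemma sm'_pos_support:
  assumes "\<eta> > 0" "sm' ((x - a) / \<eta>) \<noteq> 0"
  shows "a < x \<and> x < a + \<eta>"
proof (rule ccontr)
  assume "\<not> ?thesis"
  then have "(x - a) / \<eta> \<le> 0 \<or> (x - a) / \<eta> \<ge> 1" using assms by (auto simp: divide_nonpos_pos)
  then show False using assms(2) by auto
qed

lemma sm'_pos_support':
  assumes "\<eta> > 0" "sm' ((b - x) / \<eta>) \<noteq> 0"
  shows "b - \<eta> < x \<and> x < b"
proof (rule ccontr)
  assume "\<not> ?thesis"
  then have "(b - x) / \<eta> \<le> 0 \<or> (b - x) / \<eta> \<ge> 1" using assms by (auto simp: divide_nonpos_pos)
  then show False using assms(2) by auto
qed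

lemma has_bochner_integral_of_deriv:
  fixes g g' :: "real \<Rightarrow> real"
  assumes ab: "a \<le> b" and d: "\<And>x. (g has_real_derivative g' x) (at x)" and c: "continuous_on UNIV g'"
    and z: "\<And>x. x \<notin> {a..b} \<Longrightarrow> g' x = 0"
  shows "has_bochner_integral lborel g' (g b - g a)"
proof -
  have "(g' has_integral (g b - g a)) {a..b}"
    by (rule fundamental_theorem_of_calculus[OF ab])
      (auto intro: has_field_derivative_at_within[OF d] simp: has_real_derivative_iff_has_vector_derivative[symmetric])
  then have "((\<lambda>x. if x \<in> {a..b} then g' x else 0) has_integral (g b - g a)) UNIV"
    by (simp only: has_integral_restrict_UNIV)
  also have "(\<lambda>x. if x \<in> {a..b} then g' x else 0) = g'" using z by auto
  finally have h: "(g' has_integral (g b - g a)) UNIV" .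
  have i: "integrable lborel g'"
  proof -
    have "integrable lborel (\<lambda>x. indicator {a..b} x *\<^sub>R g' x)"
      by (rule borel_integrable_compact) (auto intro: continuous_on_subset[OF c])
    also have "(\<lambda>x. indicator {a..b} x *\<^sub>R g' x) = g'" using z by (auto simp: fun_eq_iff indicator_def)
    finally show ?thesis .
  qed
  have "integral\<^sup>L lborel g' = g b - g a"
    using has_integral_integral_lborel[OF i] h has_integral_unique by blast
  then show ?thesis using i by (simp add: has_bochner_integral_iff)
qed

lemma sm'_integral:
  assumes "\<eta> > 0"
  shows "has_bochner_integral lborel (\<lambda>x. sm' ((x - a) / \<eta>) / \<eta>) 1"
    and "has_bochner_integral lborel (\<lambda>x. sm' ((b - x) / \<eta>) / \<eta>) 1"
proof -
  have c: "continuous_on UNIV (\<lambda>x. sm' ((x - a) / \<eta>) / \<eta>)" "continuous_on UNIV (\<lambda>x. - (sm' ((b - x) / \<eta>) / \<eta>))"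
    using assms by (auto intro!: continuous_intros continuous_on_compose2[OF sm'_cont[of UNIV]])
  have z: "x \<notin> {a..a+\<eta>} \<Longrightarrow> sm' ((x - a) / \<eta>) / \<eta> = 0" for x
    using sm'_pos_support[OF assms, of x a] by fastforce
  have z': "x \<notin> {b-\<eta>..b} \<Longrightarrow> - (sm' ((b - x) / \<eta>) / \<eta>) = 0" for x
    using sm'_pos_support'[OF assms, of b x] by fastforce
  have "has_bochner_integral lborel (\<lambda>x. sm' ((x - a) / \<eta>) / \<eta>) (sm ((a + \<eta> - a)/\<eta>) - sm ((a - a)/\<eta>))"
    using assms by (intro has_bochner_integral_of_deriv[OF _ sm_affine_deriv c(1) z]) auto
  then show "has_bochner_integral lborel (\<lambda>x. sm' ((x - a) / \<eta>) / \<eta>) 1" using assms by simp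
  have "has_bochner_integral lborel (\<lambda>x. - (sm' ((b - x) / \<eta>) / \<eta>)) (sm ((b - b)/\<eta>) - sm ((b - (b - \<eta>))/\<eta>))"
    using assms by (intro has_bochner_integral_of_deriv[OF _ sm_affine_deriv' c(2) z']) auto
  then have "has_bochner_integral lborel (\<lambda>x. - (sm' ((b - x) / \<eta>) / \<eta>)) (- 1)" using assms by simp
  from has_bochner_integral_minus[OF this]
  show "has_bochner_integral lborel (\<lambda>x. sm' ((b - x) / \<eta>) / \<eta>) 1" by simp
qed

lemma pl_integral_ge:
  assumes "\<eta> > 0" "2 * \<eta> < b - a"
  shows "integrable lborel (pl a b \<eta>)" "(\<integral>x. pl a b \<eta> x \<partial>lborel) \<ge> b - a - 2 * \<eta>"
proof -
  show i: "integrable lborel (pl a b \<eta>)"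
  proof -
    have "integrable lborel (\<lambda>x. indicator {a..b} x *\<^sub>R pl a b \<eta> x)"
      by (rule borel_integrable_compact) (auto intro: pl_cont)
    also have "(\<lambda>x. indicator {a..b} x *\<^sub>R pl a b \<eta> x) = pl a b \<eta>"
    proof
      fix x show "indicator {a..b} x *\<^sub>R pl a b \<eta> x = pl a b \<eta> x"
        using pl_0[OF assms(1), of x a b] by (cases "x \<in> {a..b}") auto
    qed
    finally show ?thesis .
  qed
  have "b - a - 2 * \<eta> = (\<integral>x. indicator {a + \<eta>..b - \<eta>} x \<partial>lborel)"
    using assms by simp
  also have "\<dots> \<le> (\<integral>x. pl a b \<eta> x \<partial>lborel)"
  proof (rule integral_mono[OF _ i])
    show "integrable lborel (indicator {a + \<eta>..b - \<eta>} :: real \<Rightarrow> real)" 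
      using assms by (intro integrable_real_indicator) (auto simp: emeasure_lborel_Icc)
    show "indicator {a + \<eta>..b - \<eta>} x \<le> pl a b \<eta> x" for x
      using pl_1[OF assms(1), of a x b] pl_range[of a b \<eta> x] by (simp add: indicator_def)
  qed
  finally show "(\<integral>x. pl a b \<eta> x \<partial>lborel) \<ge> b - a - 2 * \<eta>" .
qed

text \<open>The plateau along e has transition width \<open>\<theta>\<close>, the one along the
  normal has \<open>\<eta>\<close>. Only \<open>\<theta>\<close> will cost something in the lower
  bound; the transitions across lie where the function is constant.\<close>

definition cell_field :: "pt \<Rightarrow> pt \<Rightarrow> real \<Rightarrow> real \<Rightarrow> real \<Rightarrow> real \<Rightarrow> real \<Rightarrow> real \<Rightarrow> pt \<Rightarrow> real" where
  "cell_field p e \<alpha> \<beta> \<theta> s1 s2 \<eta> x = pl \<alpha> \<beta> \<theta> ((x - p) \<bullet> e) * pl s1 s2 \<eta> ((x - p) \<bullet> rot e)"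

definition cell_deriv :: "pt \<Rightarrow> pt \<Rightarrow> real \<Rightarrow> real \<Rightarrow> real \<Rightarrow> real \<Rightarrow> real \<Rightarrow> real \<Rightarrow> pt \<Rightarrow> pt \<Rightarrow> real" where
  "cell_deriv p e \<alpha> \<beta> \<theta> s1 s2 \<eta> x v = 
     pl' \<alpha> \<beta> \<theta> ((x - p) \<bullet> e) * (v \<bullet> e) * pl s1 s2 \<eta> ((x - p) \<bullet> rot e)
     + pl \<alpha> \<beta> \<theta> ((x - p) \<bullet> e) * (pl' s1 s2 \<eta> ((x - p) \<bullet> rot e) * (v \<bullet> rot e))"

lemma cell_field_deriv:
  "(cell_field p e \<alpha> \<beta> \<theta> s1 s2 \<eta> has_derivative cell_deriv p e \<alpha> \<beta> \<theta> s1 s2 \<eta> x) (at x)"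
proof -
  have 1: "((\<lambda>x. (x - p) \<bullet> w) has_derivative (\<lambda>v. v \<bullet> w)) (at x)" for w
    by (auto intro!: derivative_eq_intros)
  have 2: "((\<lambda>x. pl a b c ((x - p) \<bullet> w)) has_derivative (\<lambda>v. pl' a b c ((x - p) \<bullet> w) * (v \<bullet> w))) (at x)" for a b c w
    using has_derivative_compose[OF 1 pl_deriv[unfolded has_field_derivative_def]] by simp
  have "((\<lambda>x. pl \<alpha> \<beta> \<theta> ((x - p) \<bullet> e) * pl s1 s2 \<eta> ((x - p) \<bullet> rot e)) has_derivative cell_deriv p e \<alpha> \<beta> \<theta> s1 s2 \<eta> x) (at x)"
    by (rule has_derivative_eq_rhs[OF has_derivative_mult[OF 2 2]])
       (auto simp: fun_eq_iff cell_deriv_def algebra_simps)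
  then show ?thesis by (simp add: cell_field_def[abs_def])
qed

lemma cell_deriv_cont:
  assumes "\<theta> > 0" "\<eta> > 0"
  shows "continuous_on UNIV (\<lambda>x. cell_deriv p e \<alpha> \<beta> \<theta> s1 s2 \<eta> x v)"
proof -
  have c: "continuous_on UNIV (\<lambda>x::pt. (x - p) \<bullet> w)" for w by (intro continuous_intros)
  show ?thesis
    unfolding cell_deriv_def
    by (intro continuous_intros continuous_on_compose2[OF pl_cont[of UNIV] c] 
       continuous_on_compose2[OF pl'_cont[OF assms(1), of UNIV] c] continuous_on_compose2[OF pl'_cont[OF assms(2), of UNIV] c]) auto
qed

lemma cell_field_0:
  assumes e: "norm e = 1" and "\<theta> > 0" "\<eta> > 0" "\<not> (\<exists>t\<in>{\<alpha><..<\<beta>}. \<exists>s\<in>{s1<..<s2}. x = fr p e t s)"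
  shows "cell_field p e \<alpha> \<beta> \<theta> s1 s2 \<eta> x = 0"
proof -
  define t s where "t = (x - p) \<bullet> e" and "s = (x - p) \<bullet> rot e"
  have "x = fr p e t s" unfolding t_def s_def using fr_coords[OF e] by simp
  then have "t \<notin> {\<alpha><..<\<beta>} \<or> s \<notin> {s1<..<s2}" using assms(4) by blast
  then show ?thesis using pl_0[OF assms(2), of t \<alpha> \<beta>] pl_0[OF assms(3), of s s1 s2]
    by (auto simp: cell_field_def t_def[symmetric] s_def[symmetric])
qed

lemma cell_field_range: "0 \<le> cell_field p e \<alpha> \<beta> \<theta> s1 s2 \<eta> x" "cell_field p e \<alpha> \<beta> \<theta> s1 s2 \<eta> x \<le> 1"
  using pl_range by (auto simp: cell_field_def intro: mult_le_one)

text \<open>The normal derivative of the bump lives in two strips of width \<open>\<eta>\<close> at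
  the ends of the rectangle, and across them it integrates to 1 and -1. So only the values of f in
  these strips enter; whatever f does between them is invisible.\<close>

lemma cell_integral:
  fixes f :: "pt \<Rightarrow> real"
  assumes e: "norm e = 1" and th: "\<theta> > 0" "2 * \<theta> < \<beta> - \<alpha>" and eta: "\<eta> > 0" "2 * \<eta> < s2 - s1"
    and f: "f \<in> borel_measurable borel" "\<And>x. \<bar>f x\<bar> \<le> B"
    and v1: "\<And>t s. t \<in> {\<alpha>..\<beta>} \<Longrightarrow> s \<in> {s1..s1+\<eta>} \<Longrightarrow> f (fr p e t s) = v1"
    and v2: "\<And>t s. t \<in> {\<alpha>..\<beta>} \<Longrightarrow> s \<in> {s2-\<eta>..s2} \<Longrightarrow> f (fr p e t s) = v2"
  shows "integrable lborel (\<lambda>x. f x * cell_deriv p e \<alpha> \<beta> \<theta> s1 s2 \<eta> x (rot e))"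
    and "(\<integral>x. f x * cell_deriv p e \<alpha> \<beta> \<theta> s1 s2 \<eta> x (rot e) \<partial>lborel) = (v1 - v2) * (\<integral>t. pl \<alpha> \<beta> \<theta> t \<partial>lborel)"
proof -
  define g where "g = (\<lambda>s. v1 * (sm' ((s - s1) / \<eta>) / \<eta>) - v2 * (sm' ((s2 - s) / \<eta>) / \<eta>))"
  have cd: "cell_deriv p e \<alpha> \<beta> \<theta> s1 s2 \<eta> (fr p e t s) (rot e) = pl \<alpha> \<beta> \<theta> t * pl' s1 s2 \<eta> s" for t s
    using norm1_inner[OF e] by (simp add: cell_deriv_def fr_inner[OF e])
  have pt: "f (fr p e t s) * cell_deriv p e \<alpha> \<beta> \<theta> s1 s2 \<eta> (fr p e t s) (rot e) = pl \<alpha> \<beta> \<theta> t * g s" for t s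
  proof (cases "t \<in> {\<alpha>..\<beta>}")
    case False then show ?thesis using pl_0[OF th(1), of t \<alpha> \<beta>] by (auto simp: cd)
  next
    case True
    have 1: "f (fr p e t s) * (sm' ((s - s1) / \<eta>) / \<eta>) = v1 * (sm' ((s - s1) / \<eta>) / \<eta>)"
      using sm'_pos_support[OF eta(1), of s s1] v1[OF True, of s] by (cases "sm' ((s - s1) / \<eta>) = 0") auto
    have 2: "f (fr p e t s) * (sm' ((s2 - s) / \<eta>) / \<eta>) = v2 * (sm' ((s2 - s) / \<eta>) / \<eta>)"
      using sm'_pos_support'[OF eta(1), of s2 s] v2[OF True, of s] by (cases "sm' ((s2 - s) / \<eta>) = 0") auto
    have "f (fr p e t s) * pl' s1 s2 \<eta> s = g s"
      unfolding pl'_split[OF eta] g_def right_diff_distrib 1 2 ..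
    then show ?thesis unfolding cd by (simp add: algebra_simps)
  qed
  have hg: "has_bochner_integral lborel g (v1 * 1 - v2 * 1)"
    unfolding g_def by (intro has_bochner_integral_diff has_bochner_integral_mult_right sm'_integral eta(1))
  define R where "R = (norm p + \<bar>\<alpha>\<bar> + \<bar>\<beta>\<bar> + \<bar>s1\<bar> + \<bar>s2\<bar>)"
  have cc: "continuous_on UNIV (\<lambda>x. cell_deriv p e \<alpha> \<beta> \<theta> s1 s2 \<eta> x (rot e))"
    by (rule cell_deriv_cont[OF th(1) eta(1)])
  have z: "cell_deriv p e \<alpha> \<beta> \<theta> s1 s2 \<eta> x (rot e) = 0" if x: "norm x > R" for x
  proof -
    obtain t s where ts: "x = fr p e t s" using fr_ex[OF e] by blast
    have "norm x \<le> norm p + norm (t *\<^sub>R e) + norm (s *\<^sub>R rot e)"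
      unfolding ts fr_def by (meson add_right_mono norm_triangle_ineq order_trans)
    then have "norm p + \<bar>t\<bar> + \<bar>s\<bar> > R" using x e by simp
    then have "t \<notin> {\<alpha>..\<beta>} \<or> s \<notin> {s1..s2}" unfolding R_def by auto
    moreover have "s \<notin> {s1..s2} \<Longrightarrow> pl' s1 s2 \<eta> s = 0"
      unfolding pl'_split[OF eta]
      using sm'_pos_support[OF eta(1), of s s1] sm'_pos_support'[OF eta(1), of s2 s] eta by force
    ultimately show ?thesis using pl_0[OF th(1), of t \<alpha> \<beta>] unfolding ts cd by auto
  qed
  have "bounded ((\<lambda>x. cell_deriv p e \<alpha> \<beta> \<theta> s1 s2 \<eta> x (rot e)) ` cball 0 R)"
    by (intro compact_imp_bounded compact_continuous_image continuous_on_subset[OF cc]) auto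
  then obtain K where K: "\<And>x. x \<in> cball 0 R \<Longrightarrow> norm (cell_deriv p e \<alpha> \<beta> \<theta> s1 s2 \<eta> x (rot e)) \<le> K" unfolding bounded_iff by blast
  have K': "\<bar>cell_deriv p e \<alpha> \<beta> \<theta> s1 s2 \<eta> x (rot e)\<bar> \<le> \<bar>K\<bar>" for x
    using K[of x] z[of x] by (cases "norm x \<le> R") auto
  show I: "integrable lborel (\<lambda>x. f x * cell_deriv p e \<alpha> \<beta> \<theta> s1 s2 \<eta> x (rot e))"
  proof (rule integrable_bounded_support)
    show "(\<lambda>x. f x * cell_deriv p e \<alpha> \<beta> \<theta> s1 s2 \<eta> x (rot e)) \<in> borel_measurable borel"
      using f(1) borel_measurable_continuous_onI[OF cc] by measurable
    show "\<bar>f x * cell_deriv p e \<alpha> \<beta> \<theta> s1 s2 \<eta> x (rot e)\<bar> \<le> \<bar>B\<bar> * \<bar>K\<bar>" for x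
      unfolding abs_mult using f(2)[of x] K' by (intro mult_mono) auto
    show "f x * cell_deriv p e \<alpha> \<beta> \<theta> s1 s2 \<eta> x (rot e) = 0" if "norm x > R" for x using z that by simp
  qed
  have "(\<integral>x. f x * cell_deriv p e \<alpha> \<beta> \<theta> s1 s2 \<eta> x (rot e) \<partial>lborel) = (\<integral>t. (\<integral>s. pl \<alpha> \<beta> \<theta> t * g s \<partial>lborel) \<partial>lborel)"
    unfolding integral_fr[OF e I, of p] pt ..
  also have "\<dots> = (\<integral>t. pl \<alpha> \<beta> \<theta> t * (v1 - v2) \<partial>lborel)"
    using hg by (simp add: has_bochner_integral_iff)
  finally show "(\<integral>x. f x * cell_deriv p e \<alpha> \<beta> \<theta> s1 s2 \<eta> x (rot e) \<partial>lborel) = (v1 - v2) * (\<integral>t. pl \<alpha> \<beta> \<theta> t \<partial>lborel)"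
    by (simp add: mult.commute)
qed

section \<open>The total variation of a step function\<close>

lemma Basis_pt: "(Basis::pt set) = {axis 1 1, axis 2 1}"
  by (auto simp: Basis_vec_def UNIV_2)

lemma div_pt: "(\<Sum>b\<in>Basis. v b \<bullet> b) = v (axis 1 1) $ 1 + v (axis 2 1) $ (2::2)"
proof -
  have "axis 1 1 \<noteq> (axis 2 1 :: pt)" by (simp add: axis_eq_axis)
  then show ?thesis by (simp add: Basis_pt inner_axis)
qed

lemma test_field_support:
  assumes "(\<phi>, \<phi>') \<in> test_fields \<Omega>"
  obtains M where "\<And>x. norm x \<ge> M \<Longrightarrow> \<phi> x = 0" "\<And>x v. norm x \<ge> M \<Longrightarrow> \<phi>' x v = 0"
    "\<And>x. \<phi> x \<noteq> 0 \<Longrightarrow> x \<in> interior \<Omega>"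
proof -
  obtain K where K: "compact K" "K \<subseteq> interior \<Omega>" "\<And>x. x \<notin> K \<Longrightarrow> \<phi> x = 0"
    and d: "\<And>x. (\<phi> has_derivative \<phi>' x) (at x)"
    using assms unfolding test_fields_def by auto
  obtain B where B: "B > 0" "\<And>x. x \<in> K \<Longrightarrow> norm x \<le> B" using compact_imp_bounded[OF K(1)] bounded_pos by metis
  have z: "\<phi> x = 0" if "norm x > B" for x using that K(3) B(2) by force
  have "\<phi>' x v = 0" if x: "norm x > B" for x v
  proof -
    have "open {x::pt. norm x > B}" by (intro open_Collect_less continuous_intros)
    then have "((\<lambda>_. 0) has_derivative \<phi>' x) (at x)"
      by (rule has_derivative_transform_within_open[OF d]) (use x z in auto)
    then have "\<phi>' x = (\<lambda>_. 0)" using has_derivative_unique has_derivative_const by blast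
    then show ?thesis by simp
  qed
  then show ?thesis using that[of "B + 1"] z K(2,3) by force
qed

text \<open>The bridge from the gauge integral over \<open>\<Omega>\<close> in \<open>TV\<close> to
  the Lebesgue integral over the plane, possible because f vanishes off
  \<open>\<Omega>\<close>.\<close>

lemma test_field_integral:
  fixes f :: "pt \<Rightarrow> real"
  assumes t: "(\<phi>, \<phi>') \<in> test_fields \<Omega>" and f: "f \<in> borel_measurable borel" "\<And>x. \<bar>f x\<bar> \<le> B" "\<And>x. x \<notin> \<Omega> \<Longrightarrow> f x = 0"
  shows "integral \<Omega> (\<lambda>x. f x * (\<Sum>b\<in>Basis. \<phi>' x b \<bullet> b)) = (\<integral>x. f x * (\<Sum>b\<in>Basis. \<phi>' x b \<bullet> b) \<partial>lborel)"
proof -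
  obtain M where M: "\<And>x v. norm x \<ge> M \<Longrightarrow> \<phi>' x v = 0" using test_field_support[OF t] by metis
  have "\<forall>b\<in>Basis. continuous_on UNIV (\<lambda>x. \<phi>' x b)" using t by (auto simp: test_fields_def)
  then have c: "continuous_on UNIV (\<lambda>x. \<Sum>b\<in>Basis. \<phi>' x b \<bullet> b)" by (intro continuous_intros) auto
  have "bounded ((\<lambda>x. \<Sum>b\<in>Basis. \<phi>' x b \<bullet> b) ` cball 0 M)"
    by (intro compact_imp_bounded compact_continuous_image continuous_on_subset[OF c]) auto
  then obtain K where K: "\<And>x. x \<in> cball 0 M \<Longrightarrow> norm (\<Sum>b\<in>Basis. \<phi>' x b \<bullet> b) \<le> K" unfolding bounded_iff by blast
  have K': "\<bar>\<Sum>b\<in>Basis. \<phi>' x b \<bullet> b\<bar> \<le> \<bar>K\<bar>" for x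
    using K[of x] M[of x] by (cases "norm x \<le> M") auto
  have I: "integrable lborel (\<lambda>x. f x * (\<Sum>b\<in>Basis. \<phi>' x b \<bullet> b))"
  proof (rule integrable_bounded_support)
    show "(\<lambda>x. f x * (\<Sum>b\<in>Basis. \<phi>' x b \<bullet> b)) \<in> borel_measurable borel"
      using f(1) borel_measurable_continuous_onI[OF c] by measurable
    show "\<bar>f x * (\<Sum>b\<in>Basis. \<phi>' x b \<bullet> b)\<bar> \<le> \<bar>B\<bar> * \<bar>K\<bar>" for x
      unfolding abs_mult using f(2)[of x] K' by (intro mult_mono) auto
    show "f x * (\<Sum>b\<in>Basis. \<phi>' x b \<bullet> b) = 0" if "norm x > M" for x using M[of x] that by simp
  qed
  have "integral \<Omega> (\<lambda>x. f x * (\<Sum>b\<in>Basis. \<phi>' x b \<bullet> b))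
     = integral UNIV (\<lambda>x. if x \<in> \<Omega> then f x * (\<Sum>b\<in>Basis. \<phi>' x b \<bullet> b) else 0)"
    by (simp add: integral_restrict_UNIV)
  also have "(\<lambda>x. if x \<in> \<Omega> then f x * (\<Sum>b\<in>Basis. \<phi>' x b \<bullet> b) else 0) = (\<lambda>x. f x * (\<Sum>b\<in>Basis. \<phi>' x b \<bullet> b))"
    using f(3) by auto
  also have "integral UNIV \<dots> = (\<integral>x. f x * (\<Sum>b\<in>Basis. \<phi>' x b \<bullet> b) \<partial>lborel)"
    using has_integral_integral_lborel[OF I] by (rule integral_unique)
  finally show ?thesis .
qed

context lines begin

lemma jmp_zero:
  assumes f: "steplike f" "\<And>x. norm x > M \<Longrightarrow> f x = 0" and l: "l \<in> \<Lambda>" and t: "norm (fr (fst l) (snd l) t 0) > M"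
  shows "jmp f l t = 0"
proof -
  define x where "x = fr (fst l) (snd l) t 0"
  have "side f x v = 0" for v
  proof (rule side_eq)
    have "continuous_on UNIV (\<lambda>s::real. norm (x + s *\<^sub>R v))" by (intro continuous_intros)
    then have "((\<lambda>s::real. norm (x + s *\<^sub>R v)) \<longlongrightarrow> norm (x + 0 *\<^sub>R v)) (at 0)"
      by (metis UNIV_I continuous_on_def)
    then have "((\<lambda>s::real. norm (x + s *\<^sub>R v)) \<longlongrightarrow> norm (x + 0 *\<^sub>R v)) (at_right 0)"
      by (rule filterlim_at_split[THEN iffD1, THEN conjunct2])
    then have "\<forall>\<^sub>F s in at_right (0::real). norm (x + s *\<^sub>R v) > M"
      using t by (intro order_tendstoD(1)[where y = "norm (x + 0 *\<^sub>R v)"]) (auto simp: x_def)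
    then show "\<forall>\<^sub>F s in at_right (0::real). f (x + s *\<^sub>R v) = 0"
      by eventually_elim (rule f(2))
  qed
  then show ?thesis by (simp add: jmp_def x_def Let_def)
qed

lemma jmp_support:
  assumes f: "steplike f" "\<And>x. norm x > M \<Longrightarrow> f x = 0" and l: "l \<in> \<Lambda>" and t: "\<bar>t\<bar> > M + norm (fst l)"
  shows "jmp f l t = 0"
proof (rule jmp_zero[OF f l])
  have "fr (fst l) (snd l) t 0 = t *\<^sub>R snd l + fst l" by (simp add: fr_def)
  then have "norm (fr (fst l) (snd l) t 0) \<ge> norm (t *\<^sub>R snd l) - norm (fst l)"
    by (metis norm_diff_ineq)
  then show "norm (fr (fst l) (snd l) t 0) > M" using t unit[OF l] by simp
qed

lemma jmp_abs_integrable: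
  assumes f: "steplike f" "\<And>x. \<bar>f x\<bar> \<le> B" "\<And>x. norm x > M \<Longrightarrow> f x = 0" and l: "l \<in> \<Lambda>"
    and U: "U \<in> sets borel"
  shows "integrable lborel (\<lambda>t. \<bar>jmp f l t\<bar> * indicator U (fr (fst l) (snd l) t 0))"
proof (rule integrable_bounded_support)
  have "(\<lambda>t. fr (fst l) (snd l) t 0) \<in> borel_measurable borel"
    by (intro borel_measurable_continuous_onI continuous_intros)
  then show "(\<lambda>t. \<bar>jmp f l t\<bar> * indicator U (fr (fst l) (snd l) t 0)) \<in> borel_measurable borel"
    using U jmp_measurable[OF f(1) l] by measurable
  show "\<bar>\<bar>jmp f l t\<bar> * indicator U (fr (fst l) (snd l) t 0)\<bar> \<le> 2 * B" for t
    using jmp_bound[OF f(1) l f(2), of t] by (auto simp: indicator_def)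
  show "\<bar>jmp f l t\<bar> * indicator U (fr (fst l) (snd l) t 0) = 0" if "norm t > M + norm (fst l)" for t
    using jmp_support[OF f(1,3) l] that by simp
qed

text \<open>The divergence formulas for the two coordinates add up to the flux of the field through
  the lines, weighted by the jump. The normal component of the field is at most 1 and vanishes
  outside the interior of \<open>\<Omega>\<close>.\<close>

lemma tv_upper:
  assumes t: "(\<phi>, \<phi>') \<in> test_fields \<Omega>"
    and f: "steplike f" "f \<in> borel_measurable borel" "\<And>x. \<bar>f x\<bar> \<le> B" "\<And>x. norm x > M \<Longrightarrow> f x = 0" "\<And>x. x \<notin> \<Omega> \<Longrightarrow> f x = 0"
  shows "integral \<Omega> (\<lambda>x. f x * (\<Sum>b\<in>Basis. \<phi>' x b \<bullet> b))
     \<le> (\<Sum>l\<in>\<Lambda>. \<integral>t. \<bar>jmp f l t\<bar> * indicator (interior \<Omega>) (fr (fst l) (snd l) t 0) \<partial>lborel)"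
proof -
  obtain M1 where M1: "\<And>x. norm x \<ge> M1 \<Longrightarrow> \<phi> x = 0" "\<And>x v. norm x \<ge> M1 \<Longrightarrow> \<phi>' x v = 0"
    "\<And>x. \<phi> x \<noteq> 0 \<Longrightarrow> x \<in> interior \<Omega>" using test_field_support[OF t] by metis
  have d: "\<And>x. (\<phi> has_derivative \<phi>' x) (at x)" and c: "\<And>b. b \<in> Basis \<Longrightarrow> continuous_on UNIV (\<lambda>x. \<phi>' x b)"
    and n1: "\<And>x. norm (\<phi> x) \<le> 1"
    using t by (auto simp: test_fields_def)
  have dd: "((\<lambda>x. \<phi> x \<bullet> w) has_derivative (\<lambda>v. \<phi>' x v \<bullet> w)) (at x)" for x w
    using d[of x] by (auto intro!: derivative_eq_intros)
  define b1 b2 :: pt where "b1 = axis 1 1" and "b2 = axis 2 1"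
  have B12: "b1 \<in> Basis" "b2 \<in> Basis" by (auto simp: b1_def b2_def)
  have cc: "continuous_on UNIV (\<lambda>x. \<phi>' x b \<bullet> w)" if "b \<in> Basis" for b w
    using c[OF that] by (intro continuous_intros)
  \<comment> \<open>Each coordinate direction is written as the quarter turn of the slicing normal,
    hence the minus sign in the first pair.\<close>
  have r1: "norm (- b2) = 1" "b1 = rot (- b2)" "norm b1 = 1" "b2 = rot b1"
    unfolding b1_def b2_def by (simp_all add: norm_axis_1) (auto simp: axis_def intro!: pt_eqI)
  have z1: "\<And>x. norm x \<ge> M1 \<Longrightarrow> \<phi> x \<bullet> w = 0" "\<And>x. norm x \<ge> M1 \<Longrightarrow> \<phi>' x v \<bullet> w = 0" for w v
    using M1 by auto
  have D1: "(\<integral>x. f x * (\<phi>' x b1 \<bullet> b1) \<partial>lborel) = 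
      - (\<Sum>l\<in>\<Lambda>. \<integral>t. jmp f l t * (\<phi> (fr (fst l) (snd l) t 0) \<bullet> b1) * (snd l \<bullet> - b2) \<partial>lborel)"
    "integrable lborel (\<lambda>x. f x * (\<phi>' x b1 \<bullet> b1))"
    "\<And>l k. l \<in> \<Lambda> \<Longrightarrow> integrable lborel (\<lambda>t. jmp f l t * (\<phi> (fr (fst l) (snd l) t 0) \<bullet> b1) * k)"
    subgoal by (rule divergence_dir(1)[OF f(1-3) r1(1,2) dd[of b1] cc[OF B12(1)], of M1]) (use z1 in blast)+
    subgoal by (rule divergence_dir(2)[OF f(1-3) r1(1,2) dd[of b1] cc[OF B12(1)], of M1]) (use z1 in blast)+
    subgoal by (rule divergence_dir(3)[OF f(1-3) r1(1,2) dd[of b1] cc[OF B12(1)], of M1]) (use z1 in blast)+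
    done
  have D2: "(\<integral>x. f x * (\<phi>' x b2 \<bullet> b2) \<partial>lborel) = 
      - (\<Sum>l\<in>\<Lambda>. \<integral>t. jmp f l t * (\<phi> (fr (fst l) (snd l) t 0) \<bullet> b2) * (snd l \<bullet> b1) \<partial>lborel)"
    "integrable lborel (\<lambda>x. f x * (\<phi>' x b2 \<bullet> b2))"
    "\<And>l k. l \<in> \<Lambda> \<Longrightarrow> integrable lborel (\<lambda>t. jmp f l t * (\<phi> (fr (fst l) (snd l) t 0) \<bullet> b2) * k)"
    subgoal by (rule divergence_dir(1)[OF f(1-3) r1(3,4) dd[of b2] cc[OF B12(2)], of M1]) (use z1 in blast)+
    subgoal by (rule divergence_dir(2)[OF f(1-3) r1(3,4) dd[of b2] cc[OF B12(2)], of M1]) (use z1 in blast)+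
    subgoal by (rule divergence_dir(3)[OF f(1-3) r1(3,4) dd[of b2] cc[OF B12(2)], of M1]) (use z1 in blast)+
    done
  have div: "(\<Sum>b\<in>Basis. \<phi>' x b \<bullet> b) = \<phi>' x b1 \<bullet> b1 + \<phi>' x b2 \<bullet> b2" for x
    using div_pt[of "\<phi>' x"] by (simp add: b1_def b2_def inner_axis)
  have "integral \<Omega> (\<lambda>x. f x * (\<Sum>b\<in>Basis. \<phi>' x b \<bullet> b)) = (\<integral>x. f x * (\<phi>' x b1 \<bullet> b1) + f x * (\<phi>' x b2 \<bullet> b2) \<partial>lborel)"
    using test_field_integral[OF t f(2,3,5)] by (simp add: div algebra_simps)
  also have "\<dots> = (\<integral>x. f x * (\<phi>' x b1 \<bullet> b1) \<partial>lborel) + (\<integral>x. f x * (\<phi>' x b2 \<bullet> b2) \<partial>lborel)"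
    by (rule Bochner_Integration.integral_add[OF D1(2) D2(2)])
  also have "\<dots> = - (\<Sum>l\<in>\<Lambda>. (\<integral>t. jmp f l t * (\<phi> (fr (fst l) (snd l) t 0) \<bullet> b1) * (snd l \<bullet> - b2) \<partial>lborel)
       + (\<integral>t. jmp f l t * (\<phi> (fr (fst l) (snd l) t 0) \<bullet> b2) * (snd l \<bullet> b1) \<partial>lborel))"
    unfolding D1(1) D2(1) by (simp add: sum.distrib sum_subtractf sum_negf)
  also have "\<dots> = (\<Sum>l\<in>\<Lambda>. - (\<integral>t. jmp f l t * (\<phi> (fr (fst l) (snd l) t 0) \<bullet> b1) * (snd l \<bullet> - b2)
       + jmp f l t * (\<phi> (fr (fst l) (snd l) t 0) \<bullet> b2) * (snd l \<bullet> b1) \<partial>lborel))"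
    unfolding sum_negf[symmetric]
    by (intro sum.cong refl arg_cong[where f = uminus] Bochner_Integration.integral_add[symmetric] D1(3) D2(3))
  also have "\<dots> \<le> (\<Sum>l\<in>\<Lambda>. \<integral>t. \<bar>jmp f l t\<bar> * indicator (interior \<Omega>) (fr (fst l) (snd l) t 0) \<partial>lborel)"
  proof (rule sum_mono)
    fix l assume l: "l \<in> \<Lambda>"
    define h where "h = (\<lambda>t. jmp f l t * (\<phi> (fr (fst l) (snd l) t 0) \<bullet> b1) * (snd l \<bullet> - b2)
       + jmp f l t * (\<phi> (fr (fst l) (snd l) t 0) \<bullet> b2) * (snd l \<bullet> b1))"
    have hi: "integrable lborel h" unfolding h_def by (intro Bochner_Integration.integrable_add D1(3) D2(3) l)
    \<comment> \<open>The factors \<open>snd l \<bullet> - b2\<close> and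
      \<open>snd l \<bullet> b1\<close> are the two components of
      \<open>rot (snd l)\<close>.\<close>
    have h: "h t = jmp f l t * (\<phi> (fr (fst l) (snd l) t 0) \<bullet> rot (snd l))" for t
      by (simp add: h_def b1_def b2_def inner_pt axis_def algebra_simps)
    have hb: "- h t \<le> \<bar>jmp f l t\<bar> * indicator (interior \<Omega>) (fr (fst l) (snd l) t 0)" for t
    proof (cases "\<phi> (fr (fst l) (snd l) t 0) = 0")
      case True then show ?thesis by (simp add: h)
    next
      case False
      have "\<bar>\<phi> (fr (fst l) (snd l) t 0) \<bullet> rot (snd l)\<bar> \<le> norm (\<phi> (fr (fst l) (snd l) t 0)) * norm (rot (snd l))"
        by (rule Cauchy_Schwarz_ineq2)
      also have "\<dots> \<le> 1" using n1 unit[OF l] by simp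
      finally have "\<bar>h t\<bar> \<le> \<bar>jmp f l t\<bar> * 1" unfolding h abs_mult by (intro mult_left_mono) auto
      then show ?thesis using M1(3)[OF False] by simp
    qed
    have "- (\<integral>t. h t \<partial>lborel) = (\<integral>t. - h t \<partial>lborel)" by simp
    also have "\<dots> \<le> (\<integral>t. \<bar>jmp f l t\<bar> * indicator (interior \<Omega>) (fr (fst l) (snd l) t 0) \<partial>lborel)"
      by (rule integral_mono) (use hi hb jmp_abs_integrable[OF f(1,3,4) l] in auto)
    finally show "- (\<integral>t. jmp f l t * (\<phi> (fr (fst l) (snd l) t 0) \<bullet> b1) * (snd l \<bullet> - b2)
       + jmp f l t * (\<phi> (fr (fst l) (snd l) t 0) \<bullet> b2) * (snd l \<bullet> b1) \<partial>lborel)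
       \<le> (\<integral>t. \<bar>jmp f l t\<bar> * indicator (interior \<Omega>) (fr (fst l) (snd l) t 0) \<partial>lborel)" by (simp add: h_def)
  qed
  finally show ?thesis .
qed

end

text \<open>The test field is a sum of normal bumps over pairwise disjoint rectangles, each with the
  sign of \<open>v1 k - v2 k\<close>; disjointness keeps its norm at most 1. Between the two end
  strips f may be any bounded measurable function, so the jump set of f is never computed.\<close>

lemma tv_lower:
  fixes f :: "pt \<Rightarrow> real" and p e :: "'k \<Rightarrow> pt"
  assumes C: "finite C"
    and e: "\<And>k. k \<in> C \<Longrightarrow> norm (e k) = 1"
    and th: "\<And>k. k \<in> C \<Longrightarrow> \<theta> k > 0 \<and> 2 * \<theta> k < \<beta> k - \<alpha> k"
    and eta: "\<And>k. k \<in> C \<Longrightarrow> \<eta> k > 0 \<and> 2 * \<eta> k < s2 k - s1 k"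
    and f: "f \<in> borel_measurable borel" "\<And>x. \<bar>f x\<bar> \<le> B" "\<And>x. x \<notin> \<Omega> \<Longrightarrow> f x = 0"
    and v1: "\<And>k t s. k \<in> C \<Longrightarrow> t \<in> {\<alpha> k..\<beta> k} \<Longrightarrow> s \<in> {s1 k..s1 k+\<eta> k} \<Longrightarrow> f (fr (p k) (e k) t s) = v1 k"
    and v2: "\<And>k t s. k \<in> C \<Longrightarrow> t \<in> {\<alpha> k..\<beta> k} \<Longrightarrow> s \<in> {s2 k-\<eta> k..s2 k} \<Longrightarrow> f (fr (p k) (e k) t s) = v2 k"
    and int: "\<And>k t s. k \<in> C \<Longrightarrow> t \<in> {\<alpha> k..\<beta> k} \<Longrightarrow> s \<in> {s1 k..s2 k} \<Longrightarrow> fr (p k) (e k) t s \<in> interior \<Omega>"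
    and disj: "\<And>k k' t s t' s'. k \<in> C \<Longrightarrow> k' \<in> C \<Longrightarrow> t \<in> {\<alpha> k<..<\<beta> k} \<Longrightarrow> s \<in> {s1 k<..<s2 k} \<Longrightarrow>
       t' \<in> {\<alpha> k'<..<\<beta> k'} \<Longrightarrow> s' \<in> {s1 k'<..<s2 k'} \<Longrightarrow> fr (p k) (e k) t s = fr (p k') (e k') t' s' \<Longrightarrow> k = k'"
  shows "ereal (\<Sum>k\<in>C. \<bar>v1 k - v2 k\<bar> * (\<beta> k - \<alpha> k - 2 * \<theta> k)) \<le> TV \<Omega> f"
proof -
  define \<sigma> where "\<sigma> = (\<lambda>k. sgn (v1 k - v2 k))"
  define cf where "cf = (\<lambda>k. cell_field (p k) (e k) (\<alpha> k) (\<beta> k) (\<theta> k) (s1 k) (s2 k) (\<eta> k))"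
  define cd where "cd = (\<lambda>k. cell_deriv (p k) (e k) (\<alpha> k) (\<beta> k) (\<theta> k) (s1 k) (s2 k) (\<eta> k))"
  define \<phi> where "\<phi> = (\<lambda>x. \<Sum>k\<in>C. (\<sigma> k * cf k x) *\<^sub>R rot (e k))"
  define \<phi>' where "\<phi>' = (\<lambda>x v. \<Sum>k\<in>C. (\<sigma> k * cd k x v) *\<^sub>R rot (e k))"
  have dcf: "(cf k has_derivative cd k x) (at x)" for k x unfolding cf_def cd_def by (rule cell_field_deriv)
  have lin: "linear (cd k x)" for k x using has_derivative_linear[OF dcf] .
  define Kb where "Kb = (\<lambda>k. (\<lambda>(t,s). fr (p k) (e k) t s) ` ({\<alpha> k..\<beta> k} \<times> {s1 k..s2 k}))"
  have in_box: "\<exists>t\<in>{\<alpha> k<..<\<beta> k}. \<exists>s\<in>{s1 k<..<s2 k}. x = fr (p k) (e k) t s" if "k \<in> C" "cf k x \<noteq> 0" for k x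
    using cell_field_0[OF e[OF that(1)], of "\<theta> k" "\<eta> k"] th[OF that(1)] eta[OF that(1)] that(2) unfolding cf_def by blast
  have tf: "(\<phi>, \<phi>') \<in> test_fields \<Omega>"
    unfolding test_fields_def
  proof (intro CollectI case_prodI conjI allI ballI)
    show "(\<phi> has_derivative \<phi>' x) (at x)" for x
      unfolding \<phi>_def \<phi>'_def using dcf by (auto intro!: derivative_eq_intros)
    show "continuous_on UNIV (\<lambda>x. \<phi>' x b)" for b
      unfolding \<phi>'_def cd_def using th eta by (intro continuous_intros cell_deriv_cont) auto
    show "\<exists>K. compact K \<and> K \<subseteq> interior \<Omega> \<and> (\<forall>x. x \<notin> K \<longrightarrow> \<phi> x = 0)"
    proof (intro exI[of _ "\<Union>k\<in>C. Kb k"] conjI allI impI)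
      have "compact (Kb k)" for k unfolding Kb_def case_prod_beta
        by (intro compact_continuous_image compact_Times continuous_intros) auto
      then show "compact (\<Union>k\<in>C. Kb k)" using C by (intro compact_UN) auto
      show "(\<Union>k\<in>C. Kb k) \<subseteq> interior \<Omega>" using int unfolding Kb_def by fastforce
      fix x assume x: "x \<notin> (\<Union>k\<in>C. Kb k)"
      have "cf k x = 0" if kC: "k \<in> C" for k
      proof (rule ccontr)
        assume "cf k x \<noteq> 0"
        then obtain t s where "t \<in> {\<alpha> k<..<\<beta> k}" "s \<in> {s1 k<..<s2 k}" "x = fr (p k) (e k) t s" using in_box[OF kC] by blast
        then have "x \<in> Kb k" unfolding Kb_def by force
        then show False using x kC by blast
      qed
      then show "\<phi> x = 0" by (simp add: \<phi>_def)
    qed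
    show "norm (\<phi> x) \<le> 1" for x
    proof (cases "\<exists>k\<in>C. cf k x \<noteq> 0")
      case False then show ?thesis by (simp add: \<phi>_def)
    next
      case True
      then obtain k where k: "k \<in> C" "cf k x \<noteq> 0" by blast
      have "cf k' x = 0" if "k' \<in> C" "k' \<noteq> k" for k'
      proof (rule ccontr)
        assume "cf k' x \<noteq> 0"
        from in_box[OF k] in_box[OF that(1) this] show False using disj[OF k(1) that(1)] that(2) by metis
      qed
      then have "\<phi> x = (\<Sum>k'\<in>C. if k' = k then (\<sigma> k * cf k x) *\<^sub>R rot (e k) else 0)"
        unfolding \<phi>_def by (intro sum.cong) auto
      also have "\<dots> = (\<sigma> k * cf k x) *\<^sub>R rot (e k)" using k C by simp
      finally have "norm (\<phi> x) = \<bar>\<sigma> k\<bar> * \<bar>cf k x\<bar>" using e[OF k(1)] by (simp add: abs_mult)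
      also have "\<dots> \<le> 1 * 1" unfolding cf_def using cell_field_range
        by (intro mult_mono) (auto simp: \<sigma>_def abs_sgn_eq)
      finally show ?thesis by simp
    qed
  qed
  have div: "(\<Sum>b\<in>Basis. \<phi>' x b \<bullet> b) = (\<Sum>k\<in>C. \<sigma> k * cd k x (rot (e k)))" for x
  proof -
    have "(\<Sum>b\<in>Basis. cd k x b * (rot (e k) \<bullet> b)) = cd k x (rot (e k))" for k
    proof -
      have "cd k x (rot (e k)) = cd k x (\<Sum>b\<in>Basis. (rot (e k) \<bullet> b) *\<^sub>R b)" by (simp add: euclidean_representation)
      also have "\<dots> = (\<Sum>b\<in>Basis. (rot (e k) \<bullet> b) * cd k x b)"
        unfolding linear_sum[OF lin] by (simp add: linear_scale[OF lin])
      finally show ?thesis by (simp add: mult.commute)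
    qed
    then have "(\<Sum>k\<in>C. \<sigma> k * cd k x (rot (e k))) = (\<Sum>k\<in>C. \<Sum>b\<in>Basis. \<sigma> k * (cd k x b * (rot (e k) \<bullet> b)))"
      by (simp add: sum_distrib_left[symmetric])
    also have "\<dots> = (\<Sum>b\<in>Basis. \<phi>' x b \<bullet> b)"
      unfolding \<phi>'_def inner_sum_left by (subst sum.swap) (simp add: mult.assoc)
    finally show ?thesis by simp
  qed
  have ci: "integrable lborel (\<lambda>x. f x * cd k x (rot (e k)))"
    "(\<integral>x. f x * cd k x (rot (e k)) \<partial>lborel) = (v1 k - v2 k) * (\<integral>t. pl (\<alpha> k) (\<beta> k) (\<theta> k) t \<partial>lborel)" if k: "k \<in> C" for k
    unfolding cd_def using cell_integral[OF e[OF k] _ _ _ _ f(1,2) v1[OF k] v2[OF k]] th[OF k] eta[OF k] by auto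
  have "integral \<Omega> (\<lambda>x. f x * (\<Sum>b\<in>Basis. \<phi>' x b \<bullet> b)) = (\<integral>x. (\<Sum>k\<in>C. \<sigma> k * (f x * cd k x (rot (e k)))) \<partial>lborel)"
  proof -
    have "f x * (\<Sum>k\<in>C. \<sigma> k * cd k x (rot (e k))) = (\<Sum>k\<in>C. \<sigma> k * (f x * cd k x (rot (e k))))" for x
      unfolding sum_distrib_left by (rule sum.cong) simp_all
    then show ?thesis using test_field_integral[OF tf f] unfolding div by simp
  qed
  also have "\<dots> = (\<Sum>k\<in>C. \<sigma> k * ((v1 k - v2 k) * (\<integral>t. pl (\<alpha> k) (\<beta> k) (\<theta> k) t \<partial>lborel)))"
    using ci by (subst Bochner_Integration.integral_sum) auto
  also have "\<dots> = (\<Sum>k\<in>C. \<bar>v1 k - v2 k\<bar> * (\<integral>t. pl (\<alpha> k) (\<beta> k) (\<theta> k) t \<partial>lborel))"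
  proof (rule sum.cong[OF refl])
    fix k
    have "sgn x * (x * y) = \<bar>x\<bar> * y" for x y :: real by (simp add: sgn_if)
    then show "\<sigma> k * ((v1 k - v2 k) * (\<integral>t. pl (\<alpha> k) (\<beta> k) (\<theta> k) t \<partial>lborel)) = \<bar>v1 k - v2 k\<bar> * (\<integral>t. pl (\<alpha> k) (\<beta> k) (\<theta> k) t \<partial>lborel)"
      unfolding \<sigma>_def .
  qed
  finally have eq: "integral \<Omega> (\<lambda>x. f x * (\<Sum>b\<in>Basis. \<phi>' x b \<bullet> b)) = (\<Sum>k\<in>C. \<bar>v1 k - v2 k\<bar> * (\<integral>t. pl (\<alpha> k) (\<beta> k) (\<theta> k) t \<partial>lborel))" .
  have "(\<Sum>k\<in>C. \<bar>v1 k - v2 k\<bar> * (\<beta> k - \<alpha> k - 2 * \<theta> k)) \<le> integral \<Omega> (\<lambda>x. f x * (\<Sum>b\<in>Basis. \<phi>' x b \<bullet> b))"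
    unfolding eq using th pl_integral_ge(2) by (intro sum_mono mult_left_mono) auto
  then have "ereal (\<Sum>k\<in>C. \<bar>v1 k - v2 k\<bar> * (\<beta> k - \<alpha> k - 2 * \<theta> k)) \<le> ereal (integral \<Omega> (\<lambda>x. f x * (\<Sum>b\<in>Basis. snd (\<phi>, \<phi>') x b \<bullet> b)))"
    by simp
  also have "\<dots> \<le> TV \<Omega> f" unfolding TV_def by (rule SUP_upper[OF tf])
  finally show ?thesis .
qed

section \<open>Tubes over the edges\<close>

text \<open>
  Over the edge from \<open>a i\<close> in direction \<open>e i\<close> stands a tube of height \<open>h i t\<close>, on which \<open>S1\<close> is the constant \<open>c i\<close>;
  \<open>m i t\<close> is at least the smallest value of \<open>\<bar>S1 - S2\<bar>\<close> on the fibre over \<open>t\<close>. Almost every jump point of \<open>S1\<close>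
  is the foot of one fibre on each side, so \<open>S2\<close> oscillates along these two fibres by at least the jump
  minus the two values of \<open>m\<close>.
\<close>
locale tube_system = lines +
  fixes \<Omega> Z :: "pt set" and S1 S2 :: "pt \<Rightarrow> real" and B M :: real
    and I :: "'i set" and a e :: "'i \<Rightarrow> pt" and len c :: "'i \<Rightarrow> real" and h m :: "'i \<Rightarrow> real \<Rightarrow> real" and Bm :: real
  assumes S1: "steplike S1" "S1 \<in> borel_measurable borel" "\<And>x. \<bar>S1 x\<bar> \<le> B" "\<And>x. norm x > M \<Longrightarrow> S1 x = 0" "\<And>x. x \<notin> \<Omega> \<Longrightarrow> S1 x = 0"
    and S2: "steplike S2" "S2 \<in> borel_measurable borel" "\<And>x. \<bar>S2 x\<bar> \<le> B" "\<And>x. norm x > M \<Longrightarrow> S2 x = 0" "\<And>x. x \<notin> \<Omega> \<Longrightarrow> S2 x = 0"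
    and Z: "finite Z" "X \<subseteq> Z"
    and I: "finite I" and ne: "\<And>i. i \<in> I \<Longrightarrow> norm (e i) = 1"
    and hc: "\<And>i. i \<in> I \<Longrightarrow> continuous_on {0<..<len i} (h i)"
    and mm: "\<And>i. i \<in> I \<Longrightarrow> m i \<in> borel_measurable borel" "\<And>i t. i \<in> I \<Longrightarrow> 0 \<le> m i t" "\<And>i t. i \<in> I \<Longrightarrow> m i t \<le> Bm"
    and T_int: "\<And>i t s. i \<in> I \<Longrightarrow> 0 < t \<Longrightarrow> t < len i \<Longrightarrow> 0 < s \<Longrightarrow> s < h i t \<Longrightarrow> fr (a i) (e i) t s \<in> interior \<Omega>"
    and T_S1: "\<And>i t s. i \<in> I \<Longrightarrow> 0 < t \<Longrightarrow> t < len i \<Longrightarrow> 0 < s \<Longrightarrow> s < h i t \<Longrightarrow> fr (a i) (e i) t s \<notin> N \<Longrightarrow>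
       S1 (fr (a i) (e i) t s) = c i"
    and T_disj: "\<And>i t s i' t' s'. i \<in> I \<Longrightarrow> 0 < t \<Longrightarrow> t < len i \<Longrightarrow> 0 < s \<Longrightarrow> s < h i t \<Longrightarrow>
       i' \<in> I \<Longrightarrow> 0 < t' \<Longrightarrow> t' < len i' \<Longrightarrow> 0 < s' \<Longrightarrow> s' < h i' t' \<Longrightarrow>
       fr (a i) (e i) t s = fr (a i') (e i') t' s' \<Longrightarrow> i = i'"
    and T_m: "\<And>i t. i \<in> I \<Longrightarrow> 0 < t \<Longrightarrow> t < len i \<Longrightarrow> fr (a i) (e i) t 0 \<notin> Z \<Longrightarrow>
       \<exists>s. 0 < s \<and> s < h i t \<and> fr (a i) (e i) t s \<notin> N \<and> \<bar>S1 (fr (a i) (e i) t s) - S2 (fr (a i) (e i) t s)\<bar> \<le> m i t"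
    and T_ex: "\<And>l t v. l \<in> \<Lambda> \<Longrightarrow> fr (fst l) (snd l) t 0 \<notin> Z \<Longrightarrow> fr (fst l) (snd l) t 0 \<in> interior \<Omega> \<Longrightarrow> jmp S1 l t \<noteq> 0 \<Longrightarrow>
       v = snd l \<or> v = - snd l \<Longrightarrow>
       \<exists>i\<in>I. e i = v \<and> (\<exists>\<tau>. 0 < \<tau> \<and> \<tau> < len i \<and> fr (fst l) (snd l) t 0 = fr (a i) (e i) \<tau> 0)"
begin

definition inT :: "'i \<Rightarrow> pt \<Rightarrow> bool" where
  "inT i z \<longleftrightarrow> (\<exists>t s. 0 < t \<and> t < len i \<and> 0 < s \<and> s < h i t \<and> z = fr (a i) (e i) t s)"

definition mt :: "'i \<Rightarrow> real \<Rightarrow> real" where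
  "mt i t = indicator {0<..<len i} t * m i t"

text \<open>The tubes that stand on the line l and point to its left (\<open>\<sigma>\<close> = 1)
  or to its right (\<open>\<sigma>\<close> = -1): reversing the direction reverses the left
  normal.\<close>

definition IL :: "pt \<times> pt \<Rightarrow> real \<Rightarrow> 'i set" where
  "IL l \<sigma> = {i\<in>I. a i \<in> ln_of l \<and> e i = \<sigma> *\<^sub>R snd l}"

definition AL :: "pt \<times> pt \<Rightarrow> real set" where
  "AL l = {t. fr (fst l) (snd l) t 0 \<in> interior \<Omega> \<and> fr (fst l) (snd l) t 0 \<notin> Z \<and> jmp S1 l t \<noteq> 0}"

text \<open>The argument of \<open>mt\<close> is the coordinate of the point t of l in the frame of
  the tube. Summing over all tubes on this side avoids selecting one; the sum bounds the term of
  whichever tube stands over t.\<close>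

definition mp :: "pt \<times> pt \<Rightarrow> real \<Rightarrow> real \<Rightarrow> real" where
  "mp l \<sigma> t = (\<Sum>i\<in>IL l \<sigma>. mt i (\<sigma> * t - \<sigma> * ((a i - fst l) \<bullet> snd l)))"

text \<open>The guaranteed oscillation of \<open>S2\<close> across the jump point t; it may be
  negative, and then it says nothing.\<close>

definition wl :: "pt \<times> pt \<Rightarrow> real \<Rightarrow> real" where
  "wl l t = indicator (AL l) t * (\<bar>jmp S1 l t\<bar> - mp l 1 t - mp l (-1) t)"

lemma mt_nonneg: "i \<in> I \<Longrightarrow> 0 \<le> mt i t"
  using mm(2) by (simp add: mt_def)

lemma mt_le: "i \<in> I \<Longrightarrow> mt i t \<le> Bm"
  using mm(2)[of i t] mm(3)[of i t] by (cases "t \<in> {0<..<len i}") (auto simp: mt_def)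

lemma mt_meas: "i \<in> I \<Longrightarrow> mt i \<in> borel_measurable borel"
  unfolding mt_def[abs_def] using mm(1) by measurable

lemma mt_int: "i \<in> I \<Longrightarrow> integrable lborel (mt i)"
  using mt_nonneg[of i] mt_le[of i]
  by (intro integrable_bounded_support[of _ Bm "\<bar>len i\<bar>"] mt_meas) (auto simp: mt_def indicator_def)

lemma IL_sub: "IL l \<sigma> \<subseteq> I" by (auto simp: IL_def)

lemma finIL: "finite (IL l \<sigma>)" using IL_sub I finite_subset by blast

text \<open>Parallel lines with a common point coincide and would meet in infinitely many
  points.\<close>

lemma line_eq:
  assumes l: "l \<in> \<Lambda>" "l' \<in> \<Lambda>" and x: "x \<in> ln_of l" "x \<in> ln_of l'" and d: "snd l' = snd l \<or> snd l' = - snd l"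
  shows "l = l'"
proof (rule ccontr)
  assume "l \<noteq> l'"
  then have f: "finite (ln_of l \<inter> ln_of l')" using distinct l by blast
  obtain t where t1: "x = fr (fst l) (snd l) t 0" using x(1) unfolding ln_of_def by blast
  obtain t' where t2: "x = fr (fst l') (snd l') t' 0" using x(2) unfolding ln_of_def by blast
  note t = t1 t2
  have "fr (fst l) (snd l) u 0 \<in> ln_of l'" for u
  proof -
    have "fst l + t *\<^sub>R snd l = fst l' + t' *\<^sub>R snd l'" using t by (simp add: fr_def)
    then have "fr (fst l) (snd l) u 0 = fst l' + t' *\<^sub>R snd l' + (u - t) *\<^sub>R snd l" 
      by (simp add: fr_def algebra_simps)
    also have "\<dots> = fr (fst l') (snd l') (if snd l' = snd l then t' + (u - t) else t' - (u - t)) 0"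
      using d by (auto simp: fr_def algebra_simps)
    finally show ?thesis by (auto simp: ln_of_def)
  qed
  then have "range (\<lambda>u. fr (fst l) (snd l) u 0) \<subseteq> ln_of l \<inter> ln_of l'" by (auto simp: ln_of_def)
  then have "finite (range (\<lambda>u. fr (fst l) (snd l) u 0))" using f finite_subset by blast
  moreover have "inj (\<lambda>u. fr (fst l) (snd l) u 0)" using unit[OF l(1)] by (auto simp: inj_def fr_eq_iff)
  ultimately show False using finite_imageD infinite_UNIV_char_0 by blast
qed

lemma AL_bound: "l \<in> \<Lambda> \<Longrightarrow> t \<in> AL l \<Longrightarrow> \<bar>t\<bar> \<le> M + norm (fst l)"
  using jmp_support[OF S1(1), of M l t] S1(4) by (force simp: AL_def)

lemma tube_coords:
  assumes l: "l \<in> \<Lambda>" and i: "i \<in> I" "e i = \<sigma> *\<^sub>R snd l" and \<sigma>: "\<sigma> = 1 \<or> \<sigma> = -1"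
    and x: "fr (fst l) (snd l) t 0 = fr (a i) (e i) \<tau> 0"
  shows "i \<in> IL l \<sigma>" "\<tau> = \<sigma> * t - \<sigma> * ((a i - fst l) \<bullet> snd l)"
    "fr (a i) (e i) (\<tau> + u) s = fr (fst l) (snd l) (t + \<sigma> * u) (\<sigma> * s)"
proof -
  have ai: "a i = fst l + (t - \<sigma> * \<tau>) *\<^sub>R snd l"
    using x i(2) by (simp add: fr_def algebra_simps)
  then have "a i = fr (fst l) (snd l) (t - \<sigma> * \<tau>) 0" by (simp add: fr_def)
  then show "i \<in> IL l \<sigma>" using i by (auto simp: IL_def ln_of_def)
  have "(a i - fst l) \<bullet> snd l = t - \<sigma> * \<tau>" using norm1_inner[OF unit[OF l]] by (simp add: ai)
  then show "\<tau> = \<sigma> * t - \<sigma> * ((a i - fst l) \<bullet> snd l)" using \<sigma> by auto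
  show "fr (a i) (e i) (\<tau> + u) s = fr (fst l) (snd l) (t + \<sigma> * u) (\<sigma> * s)"
    using \<sigma> by (auto simp: fr_def ai i(2) algebra_simps)
qed

text \<open>Close to its foot the fibre shows the one-sided value of \<open>S1\<close>, which is
  therefore the constant of the tube. Higher up, off the lines, the fibre has a point where
  \<open>S2\<close> differs from this constant by at most m.\<close>

lemma side_value:
  assumes l: "l \<in> \<Lambda>" and t: "t \<in> AL l" and \<sigma>: "\<sigma> = 1 \<or> \<sigma> = -1"
  obtains i \<tau> s v where "i \<in> IL l \<sigma>" "0 < \<tau>" "\<tau> < len i" "0 < s" "s < h i \<tau>"
    "\<And>u s'. fr (a i) (e i) (\<tau> + u) s' = fr (fst l) (snd l) (t + \<sigma> * u) (\<sigma> * s')"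
    "side S1 (fr (fst l) (snd l) t 0) (\<sigma> *\<^sub>R rot (snd l)) = c i"
    "fr (a i) (e i) \<tau> s \<notin> N" "\<bar>c i - S2 (fr (a i) (e i) \<tau> s)\<bar> \<le> mp l \<sigma> t"
proof -
  have tt: "fr (fst l) (snd l) t 0 \<in> interior \<Omega>" "fr (fst l) (snd l) t 0 \<notin> Z" "jmp S1 l t \<noteq> 0"
    using t by (auto simp: AL_def)
  have "\<sigma> *\<^sub>R snd l = snd l \<or> \<sigma> *\<^sub>R snd l = - snd l" using \<sigma> by auto
  from T_ex[OF l tt(2,1,3) this] obtain i \<tau> where i: "i \<in> I" "e i = \<sigma> *\<^sub>R snd l" "0 < \<tau>" "\<tau> < len i"
    and x: "fr (fst l) (snd l) t 0 = fr (a i) (e i) \<tau> 0" by blast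
  note tc = tube_coords[OF l i(1,2) \<sigma> x]
  from T_m[OF i(1,3,4)] x tt(2) obtain s where s: "0 < s" "s < h i \<tau>" "fr (a i) (e i) \<tau> s \<notin> N"
    "\<bar>S1 (fr (a i) (e i) \<tau> s) - S2 (fr (a i) (e i) \<tau> s)\<bar> \<le> m i \<tau>" by metis
  have Si: "S1 (fr (a i) (e i) \<tau> s) = c i" using T_S1[OF i(1,3,4) s(1-3)] .
  have "m i \<tau> = mt i \<tau>" using i by (simp add: mt_def)
  also have "\<dots> \<le> mp l \<sigma> t"
    unfolding mp_def tc(2)
    using IL_sub by (intro member_le_sum[OF tc(1)] mt_nonneg finIL) blast
  finally have m: "\<bar>c i - S2 (fr (a i) (e i) \<tau> s)\<bar> \<le> mp l \<sigma> t" using s(4) Si by simp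
  define x0 where "x0 = fr (fst l) (snd l) t 0"
  have l': "(fst l, snd l) \<in> \<Lambda>" using l by simp
  have x0: "x0 \<in> ln_of (fst l, snd l)" "x0 \<notin> X" using tt(2) Z(2) by (auto simp: x0_def ln_of_def)
  obtain r where r: "r > 0" "\<And>z. z \<in> ball x0 r \<Longrightarrow> (z - x0) \<bullet> rot (snd l) \<noteq> 0 \<Longrightarrow> z \<notin> N"
    using local_sides[OF S1(1) l' x0] by metis
  have n1: "norm (snd l) = 1" using unit[OF l] .
  have "\<forall>\<^sub>F s' in at_right (0::real). s' < min r s \<and> s' > 0"
    using r s by (auto simp: eventually_at intro!: exI[of _ "min r s"])
  then have "\<forall>\<^sub>F s' in at_right (0::real). S1 (x0 + s' *\<^sub>R (\<sigma> *\<^sub>R rot (snd l))) = c i"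
  proof eventually_elim
    case (elim s')
    have eq: "x0 + s' *\<^sub>R (\<sigma> *\<^sub>R rot (snd l)) = fr (a i) (e i) \<tau> s'"
      using tc(3)[of 0 s'] by (simp add: x0_def fr_def mult.commute)
    have "x0 + s' *\<^sub>R (\<sigma> *\<^sub>R rot (snd l)) \<notin> N"
    proof (rule r(2))
      show "x0 + s' *\<^sub>R (\<sigma> *\<^sub>R rot (snd l)) \<in> ball x0 r" using elim \<sigma> n1 by (auto simp: dist_norm)
      show "(x0 + s' *\<^sub>R (\<sigma> *\<^sub>R rot (snd l)) - x0) \<bullet> rot (snd l) \<noteq> 0" using elim \<sigma> norm1_inner[OF n1] by auto
    qed
    then show ?case unfolding eq using T_S1[OF i(1,3,4), of s'] elim s(2) by simp
  qed
  then have sd: "side S1 x0 (\<sigma> *\<^sub>R rot (snd l)) = c i" by (rule side_eq)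
  show ?thesis by (rule that[OF tc(1) i(3,4) s(1,2) tc(3) sd[unfolded x0_def] s(3) m])
qed

text \<open>The single fibre is thickened to a box: \<open>S2\<close> is constant near the point
  found at height s because that point is off the lines, and h is continuous, so neighbouring fibres
  reach beyond s as well.\<close>

lemma side_box:
  assumes l: "l \<in> \<Lambda>" and t: "t \<in> AL l" and \<sigma>: "\<sigma> = 1 \<or> \<sigma> = -1"
  obtains \<delta> \<eta> s v where "0 < \<delta>" "0 < \<eta>" "\<eta> < s"
    "\<And>u s'. \<bar>u - t\<bar> < \<delta> \<Longrightarrow> s - \<eta> \<le> s' \<Longrightarrow> s' \<le> s \<Longrightarrow> S2 (fr (fst l) (snd l) u (\<sigma> * s')) = v"
    "\<And>u s'. \<bar>u - t\<bar> < \<delta> \<Longrightarrow> 0 < s' \<Longrightarrow> s' \<le> s \<Longrightarrow> \<exists>i\<in>IL l \<sigma>. inT i (fr (fst l) (snd l) u (\<sigma> * s'))"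
    "\<bar>side S1 (fr (fst l) (snd l) t 0) (\<sigma> *\<^sub>R rot (snd l)) - v\<bar> \<le> mp l \<sigma> t"
proof -
  obtain i \<tau> s where i: "i \<in> IL l \<sigma>" "0 < \<tau>" "\<tau> < len i" "0 < s" "s < h i \<tau>"
    "\<And>u s'. fr (a i) (e i) (\<tau> + u) s' = fr (fst l) (snd l) (t + \<sigma> * u) (\<sigma> * s')"
    "side S1 (fr (fst l) (snd l) t 0) (\<sigma> *\<^sub>R rot (snd l)) = c i"
    "fr (a i) (e i) \<tau> s \<notin> N" "\<bar>c i - S2 (fr (a i) (e i) \<tau> s)\<bar> \<le> mp l \<sigma> t"
    using side_value[OF l t \<sigma>] by metis
  have iI: "i \<in> I" using i(1) IL_sub by blast
  have n1: "norm (snd l) = 1" using unit[OF l] .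
  have ss: "\<sigma> * \<sigma> = 1" "\<bar>\<sigma>\<bar> = 1" using \<sigma> by auto
  have eq: "fr (fst l) (snd l) u (\<sigma> * s') = fr (a i) (e i) (\<tau> + \<sigma> * (u - t)) s'" for u s'
    using i(6)[of "\<sigma> * (u - t)" s'] ss by (simp add: mult.assoc[symmetric])
  obtain r where r: "r > 0" "\<And>y. y \<in> ball (fr (a i) (e i) \<tau> s) r \<Longrightarrow> S2 y = S2 (fr (a i) (e i) \<tau> s)"
    using steplike_ball[OF S2(1) i(8)] by metis
  have "continuous (at \<tau>) (h i)" using hc[OF iI] i(2,3) by (simp add: continuous_on_eq_continuous_at)
  then have "\<forall>\<^sub>F x in at \<tau>. h i x > s" using i(5) by (intro order_tendstoD(1)[of "h i" "h i \<tau>"]) (simp_all add: isCont_def)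
  then obtain d where d: "d > 0" "\<And>x. x \<noteq> \<tau> \<Longrightarrow> dist x \<tau> < d \<Longrightarrow> h i x > s" unfolding eventually_at by auto
  define Q where "Q = {d, \<tau>, len i - \<tau>, r / 2}"
  define \<delta> where "\<delta> = Min Q"
  define \<eta> where "\<eta> = min (s / 2) (r / 3)"
  have Q: "finite Q" "Q \<noteq> {}" "\<forall>x\<in>Q. 0 < x" using d(1) r(1) i(2,3) by (simp_all add: Q_def)
  have d0: "0 < \<delta>" unfolding \<delta>_def using Q Min_in by blast
  have q1: "x \<in> Q \<Longrightarrow> \<delta> \<le> x" for x unfolding \<delta>_def using Q(1) by (rule Min_le)
  have d1: "\<delta> \<le> d" "\<delta> \<le> \<tau>" "\<delta> \<le> len i - \<tau>" "\<delta> \<le> r / 2"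
    by (rule q1, simp add: Q_def)+
  note \<delta> = d0 d1
  have \<eta>: "0 < \<eta>" "\<eta> < s" "\<eta> < r / 2" using r(1) i(4) by (auto simp: \<eta>_def min_def)
  show ?thesis
  proof (rule that[OF \<delta>(1) \<eta>(1,2)])
    fix u s' assume u: "\<bar>u - t\<bar> < \<delta>"
    have du: "\<bar>\<sigma> * (u - t)\<bar> < \<delta>" using u ss by (simp add: abs_mult)
    {
      assume s': "s - \<eta> \<le> s'" "s' \<le> s"
      have "dist (fr (a i) (e i) \<tau> s) (fr (fst l) (snd l) u (\<sigma> * s')) = sqrt ((\<sigma> * (u - t))\<^sup>2 + (s - s')\<^sup>2)"
        unfolding eq dist_fr[OF ne[OF iI]] by simp
      also have "\<dots> \<le> \<bar>\<sigma> * (u - t)\<bar> + \<bar>s - s'\<bar>" by (rule sqrt_sum_squares_le_sum_abs)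
      also have "\<dots> < r" using du s' \<delta> \<eta> by linarith
      finally show "S2 (fr (fst l) (snd l) u (\<sigma> * s')) = S2 (fr (a i) (e i) \<tau> s)" by (intro r(2)) simp
    next
      assume s': "0 < s'" "s' \<le> s"
      have "h i (\<tau> + \<sigma> * (u - t)) > s" 
      proof (cases "\<sigma> * (u - t) = 0")
        case True then show ?thesis unfolding True using i(5) by simp
      next
        case False then show ?thesis using du \<delta> by (intro d(2)) (simp_all add: dist_real_def)
      qed
      then have "inT i (fr (fst l) (snd l) u (\<sigma> * s'))" unfolding inT_def eq using s' du \<delta>
        by (intro exI[of _ "\<tau> + \<sigma> * (u - t)"] exI[of _ s']) auto
      then show "\<exists>i\<in>IL l \<sigma>. inT i (fr (fst l) (snd l) u (\<sigma> * s'))" using i(1) by blast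
    }
  next
    show "\<bar>side S1 (fr (fst l) (snd l) t 0) (\<sigma> *\<^sub>R rot (snd l)) - S2 (fr (a i) (e i) \<tau> s)\<bar> \<le> mp l \<sigma> t"
      using i(7,9) by simp
  qed
qed

lemma AL_open:
  assumes l: "l \<in> \<Lambda>" and t: "t \<in> AL l"
  obtains \<delta> where "\<delta> > 0" "\<And>u. \<bar>u - t\<bar> < \<delta> \<Longrightarrow> u \<in> AL l"
proof -
  have tt: "fr (fst l) (snd l) t 0 \<in> interior \<Omega>" "fr (fst l) (snd l) t 0 \<notin> Z" "jmp S1 l t \<noteq> 0"
    using t by (auto simp: AL_def)
  have l': "(fst l, snd l) \<in> \<Lambda>" using l by simp
  obtain r where r: "r > 0" "\<And>t'. \<bar>t' - t\<bar> < r \<Longrightarrow> jmp S1 l t' = jmp S1 l t"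
    using jmp_locally_const[OF S1(1) l', of t] tt(2) Z(2) by (metis prod.collapse subset_iff)
  have "open (interior \<Omega> - Z)" using Z(1) by (simp add: finite_imp_closed open_Diff)
  then obtain d where d: "d > 0" "ball (fr (fst l) (snd l) t 0) d \<subseteq> interior \<Omega> - Z"
    using tt by (meson DiffI open_contains_ball)
  show ?thesis
  proof (rule that[of "min r d"])
    show "min r d > 0" using r d by simp
    fix u assume u: "\<bar>u - t\<bar> < min r d"
    have "fr (fst l) (snd l) u 0 \<in> ball (fr (fst l) (snd l) t 0) d"
      using u by (simp add: dist_fr[OF unit[OF l]] abs_minus_commute)
    then show "u \<in> AL l" using d(2) r(2)[of u] u tt(3) by (auto simp: AL_def)
  qed
qed

lemma AL_meas: "l \<in> \<Lambda> \<Longrightarrow> AL l \<in> sets borel"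
proof -
  assume l: "l \<in> \<Lambda>"
  have "open (AL l)"
    unfolding open_dist
  proof
    fix t assume "t \<in> AL l"
    from AL_open[OF l this] obtain \<delta> where "\<delta> > 0" "\<And>u. \<bar>u - t\<bar> < \<delta> \<Longrightarrow> u \<in> AL l" by blast
    then show "\<exists>d>0. \<forall>y. dist y t < d \<longrightarrow> y \<in> AL l" by (auto simp: dist_real_def)
  qed
  then show ?thesis by simp
qed

section \<open>Rectangles across the jump set of \<open>S1\<close>\<close>

text \<open>End value \<open>v1\<close> below the line and \<open>v2\<close> above it, with both
  halves covered by tubes. The conditions hold for all abscissas within \<open>\<delta>\<close> of
  t, so every interval in this range can serve as the base of a rectangle.\<close>

definition cellp :: "pt \<times> pt \<Rightarrow> real \<Rightarrow> real \<Rightarrow> real \<Rightarrow> real \<Rightarrow> real \<Rightarrow> real \<Rightarrow> real \<Rightarrow> bool" where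
  "cellp l t \<delta> \<eta> s1 s2 v1 v2 \<longleftrightarrow> 0 < \<delta> \<and> 0 < \<eta> \<and> s1 + \<eta> < 0 \<and> 0 < s2 - \<eta> \<and> \<bar>v1 - v2\<bar> \<ge> wl l t \<and>
     (\<forall>u. \<bar>u - t\<bar> < \<delta> \<longrightarrow> u \<in> AL l \<and> (\<forall>s\<in>{s1..s1+\<eta>}. S2 (fr (fst l) (snd l) u s) = v1)
       \<and> (\<forall>s\<in>{s2-\<eta>..s2}. S2 (fr (fst l) (snd l) u s) = v2)
       \<and> (\<forall>s\<in>{0<..s2}. \<exists>i\<in>IL l 1. inT i (fr (fst l) (snd l) u s))
       \<and> (\<forall>s\<in>{s1..<0}. \<exists>i\<in>IL l (-1). inT i (fr (fst l) (snd l) u s)))"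

lemma cell_ex:
  assumes l: "l \<in> \<Lambda>" and t: "t \<in> AL l"
  shows "\<exists>\<delta> \<eta> s1 s2 v1 v2. cellp l t \<delta> \<eta> s1 s2 v1 v2"
proof -
  obtain \<delta>0 where d0: "\<delta>0 > 0" "\<And>u. \<bar>u - t\<bar> < \<delta>0 \<Longrightarrow> u \<in> AL l" using AL_open[OF l t] by blast
  obtain \<delta>1 \<eta>1 s1 v1 where p1: "0 < \<delta>1" "0 < \<eta>1" "\<eta>1 < s1"
    "\<And>u s'. \<bar>u - t\<bar> < \<delta>1 \<Longrightarrow> s1 - \<eta>1 \<le> s' \<Longrightarrow> s' \<le> s1 \<Longrightarrow> S2 (fr (fst l) (snd l) u (1 * s')) = v1"
    "\<And>u s'. \<bar>u - t\<bar> < \<delta>1 \<Longrightarrow> 0 < s' \<Longrightarrow> s' \<le> s1 \<Longrightarrow> \<exists>i\<in>IL l 1. inT i (fr (fst l) (snd l) u (1 * s'))"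
    "\<bar>side S1 (fr (fst l) (snd l) t 0) (1 *\<^sub>R rot (snd l)) - v1\<bar> \<le> mp l 1 t"
    by (rule side_box[OF l t, of 1]) (simp, rule that, assumption+)
  obtain \<delta>2 \<eta>2 s2 v2 where p2: "0 < \<delta>2" "0 < \<eta>2" "\<eta>2 < s2"
    "\<And>u s'. \<bar>u - t\<bar> < \<delta>2 \<Longrightarrow> s2 - \<eta>2 \<le> s' \<Longrightarrow> s' \<le> s2 \<Longrightarrow> S2 (fr (fst l) (snd l) u (-1 * s')) = v2"
    "\<And>u s'. \<bar>u - t\<bar> < \<delta>2 \<Longrightarrow> 0 < s' \<Longrightarrow> s' \<le> s2 \<Longrightarrow> \<exists>i\<in>IL l (-1). inT i (fr (fst l) (snd l) u (-1 * s'))"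
    "\<bar>side S1 (fr (fst l) (snd l) t 0) ((-1) *\<^sub>R rot (snd l)) - v2\<bar> \<le> mp l (-1) t"
    by (rule side_box[OF l t, of "-1"]) (simp, rule that, assumption+)
  have "fr (fst l) (snd l) t 0 \<notin> X" using t Z(2) by (auto simp: AL_def)
  then have J: "jmp S1 l t = side S1 (fr (fst l) (snd l) t 0) (rot (snd l)) - side S1 (fr (fst l) (snd l) t 0) (- rot (snd l))"
    by (simp add: jmp_def Let_def)
  \<comment> \<open>The tube to the right of l supplies the lower end, so its value comes first. The
    end values differ from the one-sided values of \<open>S1\<close> by at most the two terms
    \<open>mp\<close>, and the triangle inequality leaves \<open>wl\<close>.\<close>
  have "cellp l t (Min {\<delta>0, \<delta>1, \<delta>2}) (min \<eta>1 \<eta>2) (- s2) s1 v2 v1"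
    unfolding cellp_def
  proof (intro conjI allI impI ballI)
    show "0 < Min {\<delta>0, \<delta>1, \<delta>2}" "0 < min \<eta>1 \<eta>2" "- s2 + min \<eta>1 \<eta>2 < 0" "0 < s1 - min \<eta>1 \<eta>2"
      using d0 p1 p2 by auto
    show "wl l t \<le> \<bar>v2 - v1\<bar>" using p1(6) p2(6) J t by (simp add: wl_def)
    fix u assume "\<bar>u - t\<bar> < Min {\<delta>0, \<delta>1, \<delta>2}"
    then have u: "\<bar>u - t\<bar> < \<delta>0" "\<bar>u - t\<bar> < \<delta>1" "\<bar>u - t\<bar> < \<delta>2" by auto
    show "u \<in> AL l" using d0 u by blast
    show "S2 (fr (fst l) (snd l) u s) = v2" if "s \<in> {- s2..- s2 + min \<eta>1 \<eta>2}" for s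
      using p2(4)[OF u(3), of "-s"] that by (simp add: min_def split: if_splits)
    show "S2 (fr (fst l) (snd l) u s) = v1" if "s \<in> {s1 - min \<eta>1 \<eta>2..s1}" for s
      using p1(4)[OF u(2), of s] that by (simp add: min_def split: if_splits)
    show "\<exists>i\<in>IL l 1. inT i (fr (fst l) (snd l) u s)" if "s \<in> {0<..s1}" for s
      using p1(5)[OF u(2), of s] that by simp
    show "\<exists>i\<in>IL l (-1). inT i (fr (fst l) (snd l) u s)" if "s \<in> {- s2..<0}" for s
      using p2(5)[OF u(3), of "-s"] that by simp
  qed
  then show ?thesis by blast
qed

lemma inT_disj: "i \<in> I \<Longrightarrow> j \<in> I \<Longrightarrow> inT i z \<Longrightarrow> inT j z \<Longrightarrow> i = j"
  unfolding inT_def using T_disj by metis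

text \<open>A tube containing a jump point would force the value \<open>c i\<close> of
  \<open>S1\<close> on both sides of the line near that point, and there would be no jump.\<close>

lemma inT_not_base:
  assumes i: "i \<in> I" "inT i (fr (fst l) (snd l) t 0)" and l: "l \<in> \<Lambda>"
  shows "t \<notin> AL l"
proof
  assume t: "t \<in> AL l"
  define x where "x = fr (fst l) (snd l) t 0"
  obtain \<tau> s where ts: "0 < \<tau>" "\<tau> < len i" "0 < s" "s < h i \<tau>" "x = fr (a i) (e i) \<tau> s"
    using i(2) unfolding inT_def x_def by blast
  have l': "(fst l, snd l) \<in> \<Lambda>" using l by simp
  have "x \<notin> X" using t Z(2) by (auto simp: AL_def x_def)
  then have x: "x \<in> ln_of (fst l, snd l)" "x \<notin> X" by (auto simp: x_def ln_of_def)
  obtain r where r: "r > 0" 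
    "\<And>z. z \<in> ball x r \<Longrightarrow> (z - x) \<bullet> rot (snd l) > 0 \<Longrightarrow> S1 z = side S1 x (rot (snd l))"
    "\<And>z. z \<in> ball x r \<Longrightarrow> (z - x) \<bullet> rot (snd l) < 0 \<Longrightarrow> S1 z = side S1 x (- rot (snd l))"
    "\<And>z. z \<in> ball x r \<Longrightarrow> (z - x) \<bullet> rot (snd l) \<noteq> 0 \<Longrightarrow> z \<notin> N"
    using local_sides[OF S1(1) l' x] by metis
  have n1: "norm (snd l) = 1" using unit[OF l] .
  have ni: "norm (e i) = 1" using ne[OF i(1)] .
  have "continuous (at \<tau>) (h i)" using hc[OF i(1)] ts(1,2) by (simp add: continuous_on_eq_continuous_at)
  then have "\<forall>\<^sub>F x in at \<tau>. h i x > (h i \<tau> + s) / 2" using ts(4) by (intro order_tendstoD(1)[of "h i" "h i \<tau>"]) (simp_all add: isCont_def)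
  then obtain d where d: "d > 0" "\<And>x. x \<noteq> \<tau> \<Longrightarrow> dist x \<tau> < d \<Longrightarrow> h i x > (h i \<tau> + s) / 2" unfolding eventually_at by auto
  define Q where "Q = {d, \<tau>, len i - \<tau>, s, (h i \<tau> - s) / 2, r}"
  define q where "q = Min Q / 2"
  have Q: "finite Q" "Q \<noteq> {}" "\<forall>x\<in>Q. 0 < x" using d(1) ts(1-4) r(1) by (simp_all add: Q_def)
  have "0 < Min Q" using Q Min_in by blast
  moreover have "\<And>x. x \<in> Q \<Longrightarrow> Min Q \<le> x" using Q(1) by (rule Min_le)
  ultimately have q1: "0 < q" "\<And>x. x \<in> Q \<Longrightarrow> q < x" unfolding q_def by fastforce+
  have q: "0 < q" "q < d" "q < \<tau>" "q < len i - \<tau>" "q < s" "q < (h i \<tau> - s) / 2" "q < r"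
    by (rule q1(1)) (rule q1(2), simp add: Q_def)+
  have near: "S1 z = c i" if z: "norm (z - x) \<le> q" "z \<notin> N" for z
  proof -
    define t' s' where "t' = (z - a i) \<bullet> e i" and "s' = (z - a i) \<bullet> rot (e i)"
    have z': "z = fr (a i) (e i) t' s'" unfolding t'_def s'_def using fr_coords[OF ni] by simp
    have "norm (z - x) = sqrt ((t' - \<tau>)\<^sup>2 + (s' - s)\<^sup>2)" unfolding z' ts(5) fr_diff norm_frame[OF ni] ..
    then have b: "\<bar>t' - \<tau>\<bar> \<le> q" "\<bar>s' - s\<bar> \<le> q" using z(1) real_sqrt_sum_squares_ge1[of "t' - \<tau>" "s' - s"] real_sqrt_sum_squares_ge2[of "s' - s" "t' - \<tau>"] 
      by (smt (verit) real_sqrt_abs real_sqrt_le_iff zero_le_power2)+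
    have "h i t' > (h i \<tau> + s) / 2"
    proof (cases "t' = \<tau>")
      case True then show ?thesis using ts(4) by simp
    next
      case False then show ?thesis using d(2)[OF False] b q by (simp add: dist_real_def)
    qed
    then have "s' < h i t'" using b q by (simp add: field_simps)
    then show ?thesis using T_S1[OF i(1), of t' s'] b q z' z(2) by auto
  qed
  have "S1 (x + q *\<^sub>R rot (snd l)) = c i" "S1 (x + (-q) *\<^sub>R rot (snd l)) = c i"
    using q n1 norm1_inner[OF n1] by (intro near r(4); auto simp: dist_norm)+
  moreover have "S1 (x + q *\<^sub>R rot (snd l)) = side S1 x (rot (snd l))" "S1 (x + (-q) *\<^sub>R rot (snd l)) = side S1 x (- rot (snd l))"
    using q n1 norm1_inner[OF n1] by (auto simp: dist_norm intro!: r(2,3))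
  ultimately have "jmp S1 l t = 0" by (simp add: jmp_def Let_def x_def[symmetric])
  then show False using t by (simp add: AL_def)
qed

text \<open>A cell point off its line lies in a tube, and the tube determines the line. A cell point
  on its line lies in no tube, and a point on two lines is a crossing point, which \<open>AL\<close>
  excludes. So a common point fixes the line, and then the abscissa.\<close>

lemma cell_unique:
  assumes l: "l \<in> \<Lambda>" "cellp l t \<delta> \<eta> s1 s2 v1 v2" "\<bar>u - t\<bar> < \<delta>" "s \<in> {s1..s2}"
    and l': "l' \<in> \<Lambda>" "cellp l' t' \<delta>' \<eta>' s1' s2' v1' v2'" "\<bar>u' - t'\<bar> < \<delta>'" "s' \<in> {s1'..s2'}"
    and eq: "fr (fst l) (snd l) u s = fr (fst l') (snd l') u' s'"
  shows "l = l' \<and> u = u'"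
proof -
  have A: "u \<in> AL l" "u' \<in> AL l'" using l(2,3) l'(2,3) by (auto simp: cellp_def)
  have T: "s = 0 \<or> (\<exists>\<sigma>. (\<sigma> = 1 \<or> \<sigma> = -1) \<and> (\<exists>i\<in>IL l \<sigma>. inT i (fr (fst l) (snd l) u s)))"
    using l(2,3,4) unfolding cellp_def by (metis atLeastAtMost_iff atLeastLessThan_iff greaterThanAtMost_iff linorder_neqE_linordered_idom)
  have T': "s' = 0 \<or> (\<exists>\<sigma>. (\<sigma> = 1 \<or> \<sigma> = -1) \<and> (\<exists>i\<in>IL l' \<sigma>. inT i (fr (fst l') (snd l') u' s')))"
    using l'(2,3,4) unfolding cellp_def by (metis atLeastAtMost_iff atLeastLessThan_iff greaterThanAtMost_iff linorder_neqE_linordered_idom)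
  have ll: "l = l'"
  proof (cases "s = 0")
    case True
    have "s' = 0"
    proof (rule ccontr)
      assume "s' \<noteq> 0"
      then obtain \<sigma> i where "i \<in> IL l' \<sigma>" "inT i (fr (fst l') (snd l') u' s')" using T' by blast
      then have "i \<in> I" "inT i (fr (fst l) (snd l) u 0)" using eq True IL_sub[of l' \<sigma>] by auto
      then show False using inT_not_base l(1) A by blast
    qed
    then have eq0: "fr (fst l) (snd l) u 0 = fr (fst l') (snd l') u' 0" using eq True by simp
    show ?thesis
    proof (rule ccontr)
      assume "l \<noteq> l'"
      moreover have "fr (fst l) (snd l) u 0 \<in> ln_of l" "fr (fst l') (snd l') u' 0 \<in> ln_of l'" 
        by (auto simp: ln_of_def)
      ultimately have "fr (fst l) (snd l) u 0 \<in> X" using l(1) l'(1) eq0 unfolding X_def by auto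
      then show False using A(1) Z(2) by (auto simp: AL_def)
    qed
  next
    case False
    then obtain \<sigma> i where i: "\<sigma> = 1 \<or> \<sigma> = -1" "i \<in> IL l \<sigma>" "inT i (fr (fst l) (snd l) u s)" using T by blast
    have "s' \<noteq> 0"
    proof
      assume "s' = 0"
      then have "inT i (fr (fst l') (snd l') u' 0)" using i(3) eq by simp
      moreover have "i \<in> I" using i(2) IL_sub by blast
      ultimately show False using inT_not_base l'(1) A(2) by blast
    qed
    then obtain \<sigma>' j where j: "\<sigma>' = 1 \<or> \<sigma>' = -1" "j \<in> IL l' \<sigma>'" "inT j (fr (fst l) (snd l) u s)" using T' eq by auto
    have "i = j" using inT_disj i j IL_sub by blast
    then have "\<sigma> *\<^sub>R snd l = \<sigma>' *\<^sub>R snd l'" "a i \<in> ln_of l" "a i \<in> ln_of l'" using i j by (auto simp: IL_def)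
    then show ?thesis using line_eq[OF l(1) l'(1), of "a i"] i(1) j(1) by (auto simp: minus_equation_iff)
  qed
  then show ?thesis using eq fr_eq_iff[OF unit[OF l(1)]] by simp
qed

end

section \<open>From rectangles to the comparison of total variations\<close>

context tube_system begin

lemma mp_nonneg: "0 \<le> mp l \<sigma> t"
  unfolding mp_def using IL_sub by (intro sum_nonneg mt_nonneg) blast

lemma mt_affine:
  assumes "i \<in> I" "\<sigma> = 1 \<or> \<sigma> = -1"
  shows "integrable lborel (\<lambda>t. mt i (\<sigma> * t - k))" "(\<integral>t. mt i (\<sigma> * t - k) \<partial>lborel) = (\<integral>t. mt i t \<partial>lborel)"
proof -
  have nz: "\<sigma> \<noteq> 0" and ab: "\<bar>\<sigma>\<bar> = 1" using assms(2) by auto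
  show "integrable lborel (\<lambda>t. mt i (\<sigma> * t - k))"
    using lborel_integrable_real_affine_iff[OF nz, of "mt i" "-k"] mt_int[OF assms(1)] by simp
  show "(\<integral>t. mt i (\<sigma> * t - k) \<partial>lborel) = (\<integral>t. mt i t \<partial>lborel)"
    using lborel_integral_real_affine[OF nz, of "mt i" "-k"] ab by simp
qed

lemma mp_int:
  assumes "\<sigma> = 1 \<or> \<sigma> = -1"
  shows "integrable lborel (mp l \<sigma>)" "(\<integral>t. mp l \<sigma> t \<partial>lborel) = (\<Sum>i\<in>IL l \<sigma>. \<integral>t. mt i t \<partial>lborel)"
proof -
  have i: "i \<in> IL l \<sigma> \<Longrightarrow> i \<in> I" for i using IL_sub by blast
  show "integrable lborel (mp l \<sigma>)"
    unfolding mp_def[abs_def] using mt_affine(1)[OF i assms] by (intro Bochner_Integration.integrable_sum)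
  have "(\<integral>t. mp l \<sigma> t \<partial>lborel) = (\<Sum>i\<in>IL l \<sigma>. \<integral>t. mt i (\<sigma> * t - \<sigma> * ((a i - fst l) \<bullet> snd l)) \<partial>lborel)"
    unfolding mp_def[abs_def] using mt_affine(1)[OF i assms] by (intro Bochner_Integration.integral_sum)
  then show "(\<integral>t. mp l \<sigma> t \<partial>lborel) = (\<Sum>i\<in>IL l \<sigma>. \<integral>t. mt i t \<partial>lborel)"
    using mt_affine(2)[OF i assms] by simp
qed

text \<open>A tube stands on at most one line of the arrangement and on one side of it, so the sum
  over lines and sides counts each tube at most once.\<close>

lemma sum_IL_le:
  assumes "\<And>i. i \<in> I \<Longrightarrow> 0 \<le> k i"
  shows "(\<Sum>l\<in>\<Lambda>. (\<Sum>i\<in>IL l 1. k i) + (\<Sum>i\<in>IL l (-1). k i)) \<le> (\<Sum>i\<in>I. k i :: real)"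
proof -
  define J where "J = (\<lambda>l. IL l 1 \<union> IL l (-1))"
  have "(\<Sum>i\<in>IL l 1. k i) + (\<Sum>i\<in>IL l (-1). k i) = (\<Sum>i\<in>J l. k i)" if "l \<in> \<Lambda>" for l
  proof -
    have "snd l \<noteq> - snd l" using unit[OF that] by (auto simp: eq_neg_iff_add_eq_0 simp flip: scaleR_2)
    then have "IL l 1 \<inter> IL l (-1) = {}" by (auto simp: IL_def)
    then show ?thesis unfolding J_def using finIL by (simp add: sum.union_disjoint)
  qed
  then have "(\<Sum>l\<in>\<Lambda>. (\<Sum>i\<in>IL l 1. k i) + (\<Sum>i\<in>IL l (-1). k i)) = (\<Sum>l\<in>\<Lambda>. \<Sum>i\<in>J l. k i)" by simp
  also have "\<dots> = (\<Sum>i\<in>(\<Union>l\<in>\<Lambda>. J l). k i)"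
  proof (rule sum.UNION_disjoint[symmetric, OF fin])
    show "\<forall>l\<in>\<Lambda>. finite (J l)" using finIL by (simp add: J_def)
    show "\<forall>l\<in>\<Lambda>. \<forall>l'\<in>\<Lambda>. l \<noteq> l' \<longrightarrow> J l \<inter> J l' = {}"
    proof (intro ballI impI, rule ccontr)
      fix l l' assume l: "l \<in> \<Lambda>" "l' \<in> \<Lambda>" "l \<noteq> l'" "J l \<inter> J l' \<noteq> {}"
      then obtain i where "i \<in> J l" "i \<in> J l'" by blast
      then have "a i \<in> ln_of l" "a i \<in> ln_of l'" "e i = snd l \<or> e i = - snd l" "e i = snd l' \<or> e i = - snd l'"
        by (auto simp: J_def IL_def)
      moreover from this have "snd l' = snd l \<or> snd l' = - snd l" by (metis minus_minus)
      ultimately have "a i \<in> ln_of l" "a i \<in> ln_of l'" "snd l' = snd l \<or> snd l' = - snd l" by blast+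
      then show False using line_eq[OF l(1,2)] l(3) by blast
    qed
  qed
  also have "\<dots> \<le> (\<Sum>i\<in>I. k i)"
    using I IL_sub assms by (intro sum_mono2) (auto simp: J_def)
  finally show ?thesis .
qed

text \<open>Passing from all line points in the interior of \<open>\<Omega>\<close> to
  \<open>AL\<close> loses only zeros of the jump and points of the finite set Z.\<close>

lemma wl_int:
  assumes l: "l \<in> \<Lambda>"
  shows "integrable lborel (wl l)"
    "(\<integral>t. wl l t \<partial>lborel) \<ge> (\<integral>t. \<bar>jmp S1 l t\<bar> * indicator (interior \<Omega>) (fr (fst l) (snd l) t 0) \<partial>lborel)
       - (\<Sum>i\<in>IL l 1. \<integral>t. mt i t \<partial>lborel) - (\<Sum>i\<in>IL l (-1). \<integral>t. mt i t \<partial>lborel)"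
proof -
  have Am: "AL l \<in> sets lborel" using AL_meas[OF l] by simp
  have J0: "integrable lborel (\<lambda>t. \<bar>jmp S1 l t\<bar> * indicator (interior \<Omega>) (fr (fst l) (snd l) t 0))"
    by (rule jmp_abs_integrable[OF S1(1,3,4) l]) auto
  have "finite {t. fr (fst l) (snd l) t 0 \<in> Z}" using finite_fr_X[OF unit[OF l] Z(1)] .
  then have "AE t in lborel. t \<notin> {t. fr (fst l) (snd l) t 0 \<in> Z}" by (intro AE_not_in finite_imp_null_set_lborel)
  then have ae: "AE t in lborel. \<bar>jmp S1 l t\<bar> * indicator (interior \<Omega>) (fr (fst l) (snd l) t 0) = indicator (AL l) t * \<bar>jmp S1 l t\<bar>"
    by eventually_elim (auto simp: AL_def indicator_def)
  have Jm: "(\<lambda>t. indicator (AL l) t * \<bar>jmp S1 l t\<bar>) \<in> borel_measurable lborel"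
    using jmp_measurable[OF S1(1) l] Am by measurable
  have J1: "integrable lborel (\<lambda>t. indicator (AL l) t * \<bar>jmp S1 l t\<bar>)"
    using integrable_cong_AE_imp[OF J0 Jm ae] by simp
  have Jeq: "(\<integral>t. \<bar>jmp S1 l t\<bar> * indicator (interior \<Omega>) (fr (fst l) (snd l) t 0) \<partial>lborel) = (\<integral>t. indicator (AL l) t * \<bar>jmp S1 l t\<bar> \<partial>lborel)"
    using J0 by (intro integral_cong_AE ae Jm) auto
  have M: "integrable lborel (\<lambda>t. indicator (AL l) t * mp l \<sigma> t)"
    "(\<integral>t. indicator (AL l) t * mp l \<sigma> t \<partial>lborel) \<le> (\<Sum>i\<in>IL l \<sigma>. \<integral>t. mt i t \<partial>lborel)" if s: "\<sigma> = 1 \<or> \<sigma> = -1" for \<sigma>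
  proof -
    show 1: "integrable lborel (\<lambda>t. indicator (AL l) t * mp l \<sigma> t)"
      using integrable_mult_indicator[OF Am mp_int(1)[OF s, of l]] by simp
    show "(\<integral>t. indicator (AL l) t * mp l \<sigma> t \<partial>lborel) \<le> (\<Sum>i\<in>IL l \<sigma>. \<integral>t. mt i t \<partial>lborel)"
      unfolding mp_int(2)[OF s, symmetric]
      by (rule integral_mono[OF 1 mp_int(1)[OF s]]) (auto simp: indicator_def mp_nonneg)
  qed
  have w: "wl l = (\<lambda>t. indicator (AL l) t * \<bar>jmp S1 l t\<bar> - indicator (AL l) t * mp l 1 t - indicator (AL l) t * mp l (-1) t)"
    by (auto simp: wl_def fun_eq_iff algebra_simps)
  show "integrable lborel (wl l)" unfolding w
    using J1 M(1)[of 1] M(1)[of "-1"] by (intro Bochner_Integration.integrable_diff) auto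
  have "(\<integral>t. wl l t \<partial>lborel) = (\<integral>t. indicator (AL l) t * \<bar>jmp S1 l t\<bar> \<partial>lborel)
     - (\<integral>t. indicator (AL l) t * mp l 1 t \<partial>lborel) - (\<integral>t. indicator (AL l) t * mp l (-1) t \<partial>lborel)"
    unfolding w using J1 M(1)[of 1] M(1)[of "-1"] by simp
  then show "(\<integral>t. wl l t \<partial>lborel) \<ge> (\<integral>t. \<bar>jmp S1 l t\<bar> * indicator (interior \<Omega>) (fr (fst l) (snd l) t 0) \<partial>lborel)
       - (\<Sum>i\<in>IL l 1. \<integral>t. mt i t \<partial>lborel) - (\<Sum>i\<in>IL l (-1). \<integral>t. mt i t \<partial>lborel)"
    using M(2)[of 1] M(2)[of "-1"] Jeq by simp
qed

text \<open>The admissible cell size depends on the tag; a gauge for the Henstock--Kurzweil integral of \<open>wl\<close> allows exactly this.\<close>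
lemma tagged_cells:
  assumes l: "l \<in> \<Lambda>" and \<epsilon>: "\<epsilon> > 0" and \<delta>: "\<And>t. t \<in> AL l \<Longrightarrow> \<delta> t > 0"
  obtains P :: "(real \<times> real \<times> real) set" where "finite P"
    "\<And>t \<alpha> \<beta>. (t, \<alpha>, \<beta>) \<in> P \<Longrightarrow> t \<in> AL l \<and> \<alpha> < \<beta> \<and> 0 < wl l t \<and> (\<forall>u\<in>{\<alpha>..\<beta>}. \<bar>u - t\<bar> < \<delta> t)"
    "\<And>t \<alpha> \<beta> t' \<alpha>' \<beta>' u. (t, \<alpha>, \<beta>) \<in> P \<Longrightarrow> (t', \<alpha>', \<beta>') \<in> P \<Longrightarrow> u \<in> {\<alpha><..<\<beta>} \<Longrightarrow> u \<in> {\<alpha>'<..<\<beta>'} \<Longrightarrow> (t, \<alpha>, \<beta>) = (t', \<alpha>', \<beta>')"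
    "(\<Sum>(t,\<alpha>,\<beta>)\<in>P. (\<beta> - \<alpha>) * wl l t) \<ge> (\<integral>t. wl l t \<partial>lborel) - \<epsilon>"
proof -
  define R where "R = \<bar>M + norm (fst l)\<bar> + 1"
  have z: "wl l t = 0" if "t \<notin> {-R..R}" for t
  proof -
    have "t \<notin> AL l" using AL_bound[OF l, of t] that by (auto simp: R_def)
    then show ?thesis by (simp add: wl_def)
  qed
  have "(wl l has_integral (\<integral>t. wl l t \<partial>lborel)) UNIV"
    using has_integral_integral_lborel[OF wl_int(1)[OF l]] .
  moreover have "(\<lambda>t. if t \<in> {-R..R} then wl l t else 0) = wl l" using z by auto
  ultimately have "(wl l has_integral (\<integral>t. wl l t \<partial>lborel)) (cbox (-R) R)"
    using has_integral_restrict_UNIV[of "{-R..R}" "wl l" "\<integral>t. wl l t \<partial>lborel"] by simp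
  then obtain g where g: "gauge g" "\<And>p. p tagged_division_of cbox (-R) R \<Longrightarrow> g fine p \<Longrightarrow> 
      norm ((\<Sum>(x,k)\<in>p. measure lborel k *\<^sub>R wl l x) - (\<integral>t. wl l t \<partial>lborel)) < \<epsilon>"
    using has_integral[THEN iffD1, rule_format, OF _ \<epsilon>] by metis
  \<comment> \<open>Intersecting with balls keeps each interval within the admissible distance
    \<open>\<delta> t\<close> of its tag. Tags outside \<open>AL\<close>, where \<open>wl\<close> is
    0, get an arbitrary radius.\<close>
  define g' where "g' = (\<lambda>t. g t \<inter> ball t (if t \<in> AL l then \<delta> t else 1))"
  have "gauge g'" unfolding g'_def using g(1) by (intro gauge_Int gauge_ball_dependent) (auto simp: \<delta>)
  then obtain p where p: "p tagged_division_of cbox (-R) R" "g' fine p" using fine_division_exists by blast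
  have "g fine p" using p(2) by (auto simp: fine_def g'_def)
  with g(2)[OF p(1)] have S: "(\<Sum>(x,k)\<in>p. measure lborel k *\<^sub>R wl l x) \<ge> (\<integral>t. wl l t \<partial>lborel) - \<epsilon>"
    by (simp add: abs_less_iff)
  have fp: "finite p" using p(1) by blast
  \<comment> \<open>Intervals with nonpositive contribution are dropped. This cannot decrease the
    sum, and it removes degenerate intervals and tags outside \<open>AL\<close>.\<close>
  define p1 where "p1 = {(x,k)\<in>p. measure lborel k * wl l x > 0}"
  have fp1: "finite p1" using fp finite_subset[of p1 p] by (auto simp: p1_def)
  define F where "F = (\<lambda>(x::real, k::real set). (x, Inf k, Sup k))"
  have iv: "k = {Inf k..Sup k} \<and> Inf k < Sup k \<and> measure lborel k = Sup k - Inf k \<and> wl l x > 0" if "(x,k) \<in> p1" for x k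
  proof -
    have k: "(x,k) \<in> p" "measure lborel k * wl l x > 0" using that by (auto simp: p1_def)
    obtain \<alpha> \<beta> where ab: "k = cbox \<alpha> \<beta>" using tagged_division_ofD(4)[OF p(1) k(1)] by blast
    have c: "measure lborel k \<noteq> 0" using k(2) by auto
    then have "measure lborel k > 0" using content_pos_le[of k] by linarith
    then have "\<alpha> < \<beta>" using ab by (metis box_real(2) content_real_eq_0 linorder_not_le c)
    then show ?thesis using ab k(2) by (simp add: zero_less_mult_iff)
  qed
  have inj: "inj_on F p1"
  proof (rule inj_onI, clarify)
    fix x k x' k' assume h: "(x,k) \<in> p1" "(x',k') \<in> p1" "F (x,k) = F (x',k')"
    then have "x = x'" "Inf k = Inf k'" "Sup k = Sup k'" by (auto simp: F_def)
    then show "x = x' \<and> k = k'" using iv[OF h(1)] iv[OF h(2)] by metis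
  qed
  show ?thesis
  proof (rule that[of "F ` p1"])
    show "finite (F ` p1)" using fp1 by simp
    have un: "\<exists>k. (t,k) \<in> p1 \<and> k = {\<alpha>..\<beta>} \<and> \<alpha> < \<beta>" if "(t,\<alpha>,\<beta>) \<in> F ` p1" for t \<alpha> \<beta>
    proof -
      obtain k where k: "(t,k) \<in> p1" "\<alpha> = Inf k" "\<beta> = Sup k" using \<open>(t,\<alpha>,\<beta>) \<in> F ` p1\<close> by (auto simp: F_def)
      then show ?thesis using iv[OF k(1)] by blast
    qed
    {
      fix t \<alpha> \<beta> assume "(t,\<alpha>,\<beta>) \<in> F ` p1"
      then obtain k where k: "(t,k) \<in> p1" "k = {\<alpha>..\<beta>}" "\<alpha> < \<beta>" using un by blast
      have w: "wl l t > 0" using iv[OF k(1)] by blast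
      then have A: "t \<in> AL l" by (cases "t \<in> AL l") (auto simp: wl_def)
      have "k \<subseteq> g' t" using p(2) k(1) by (auto simp: fine_def p1_def)
      then show "t \<in> AL l \<and> \<alpha> < \<beta> \<and> 0 < wl l t \<and> (\<forall>u\<in>{\<alpha>..\<beta>}. \<bar>u - t\<bar> < \<delta> t)"
        using A w k by (auto simp: g'_def dist_real_def abs_minus_commute)
    }
    {
      fix t \<alpha> \<beta> t' \<alpha>' \<beta>' u
      assume h: "(t, \<alpha>, \<beta>) \<in> F ` p1" "(t', \<alpha>', \<beta>') \<in> F ` p1" "u \<in> {\<alpha><..<\<beta>}" "u \<in> {\<alpha>'<..<\<beta>'}"
      from un[OF h(1)] obtain k where k: "(t,k) \<in> p1" "k = {\<alpha>..\<beta>}" by blast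
      from un[OF h(2)] obtain k' where k': "(t',k') \<in> p1" "k' = {\<alpha>'..\<beta>'}" by blast
      have "u \<in> interior k \<inter> interior k'" using h(3,4) k k' by (simp add: interior_atLeastAtMost_real)
      then have "(t,k) = (t',k')" using tagged_division_ofD(5)[OF p(1), of t k t' k'] k k' unfolding p1_def by blast
      then show "(t, \<alpha>, \<beta>) = (t', \<alpha>', \<beta>')" using k(2) k'(2) un[OF h(1)] un[OF h(2)] by (auto simp: Icc_eq_Icc)
    }
    have "(\<Sum>(t,\<alpha>,\<beta>)\<in>F ` p1. (\<beta> - \<alpha>) * wl l t) = (\<Sum>(x,k)\<in>p1. measure lborel k * wl l x)"
      unfolding sum.reindex[OF inj] by (rule sum.cong) (use iv in \<open>auto simp: F_def\<close>)
    also have "\<dots> \<ge> (\<Sum>(x,k)\<in>p. measure lborel k * wl l x)"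
    proof -
      have "(\<Sum>(x,k)\<in>p. measure lborel k * wl l x) = (\<Sum>(x,k)\<in>p1. measure lborel k * wl l x) + (\<Sum>(x,k)\<in>p - p1. measure lborel k * wl l x)"
        using fp by (subst sum.subset_diff[of p1 p]) (auto simp: p1_def)
      moreover have "(\<Sum>(x,k)\<in>p - p1. measure lborel k * wl l x) \<le> 0"
        by (rule sum_nonpos) (auto simp: p1_def not_less)
      ultimately show ?thesis by simp
    qed
    finally show "(\<Sum>(t,\<alpha>,\<beta>)\<in>F ` p1. (\<beta> - \<alpha>) * wl l t) \<ge> (\<integral>t. wl l t \<partial>lborel) - \<epsilon>" using S by simp
  qed
qed

text \<open>The tagged intervals on all lines become the bases of disjoint rectangles, to which
  \<open>tv_lower\<close> applies. One half of \<open>\<epsilon>\<close> pays for the Riemann sums,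
  the other for the transitions of relative width \<open>\<theta>\<close>.\<close>

lemma tv_lower_wl:
  assumes \<epsilon>: "\<epsilon> > 0"
  shows "ereal ((\<Sum>l\<in>\<Lambda>. (\<integral>t. wl l t \<partial>lborel)) - \<epsilon>) \<le> TV \<Omega> S2"
proof -
  define \<epsilon>1 where "\<epsilon>1 = \<epsilon> / (2 * (real (card \<Lambda>) + 1))"
  have \<epsilon>1: "\<epsilon>1 > 0" "real (card \<Lambda>) * \<epsilon>1 \<le> \<epsilon> / 2" using \<epsilon> by (auto simp: \<epsilon>1_def field_simps)
  have "\<forall>l t. \<exists>d. l \<in> \<Lambda> \<longrightarrow> t \<in> AL l \<longrightarrow> (case d of (\<delta>, \<eta>, s1, s2, v1, v2) \<Rightarrow> cellp l t \<delta> \<eta> s1 s2 v1 v2)"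
    using cell_ex by (auto simp: split_paired_Ex)
  then obtain d where d: "\<And>l t. l \<in> \<Lambda> \<Longrightarrow> t \<in> AL l \<Longrightarrow> (case d l t of (\<delta>, \<eta>, s1, s2, v1, v2) \<Rightarrow> cellp l t \<delta> \<eta> s1 s2 v1 v2)"
    by metis
  define D where "D = (\<lambda>l t. fst (d l t))"
  define H where "H = (\<lambda>l t. fst (snd (d l t)))"
  define Sa where "Sa = (\<lambda>l t. fst (snd (snd (d l t))))"
  define Sb where "Sb = (\<lambda>l t. fst (snd (snd (snd (d l t)))))"
  define Va where "Va = (\<lambda>l t. fst (snd (snd (snd (snd (d l t))))))"
  define Vb where "Vb = (\<lambda>l t. snd (snd (snd (snd (snd (d l t))))))"
  have cp: "cellp l t (D l t) (H l t) (Sa l t) (Sb l t) (Va l t) (Vb l t)" if "l \<in> \<Lambda>" "t \<in> AL l" for l t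
    using d[OF that] by (simp add: D_def H_def Sa_def Sb_def Va_def Vb_def case_prod_beta)
  define G where "G = (\<lambda>l P. finite P \<and>
    (\<forall>t \<alpha> \<beta>. (t, \<alpha>, \<beta>) \<in> P \<longrightarrow> t \<in> AL l \<and> \<alpha> < \<beta> \<and> 0 < wl l t \<and> (\<forall>u\<in>{\<alpha>..\<beta>}. \<bar>u - t\<bar> < D l t)) \<and>
    (\<forall>t \<alpha> \<beta> t' \<alpha>' \<beta>' u. (t, \<alpha>, \<beta>) \<in> P \<longrightarrow> (t', \<alpha>', \<beta>') \<in> P \<longrightarrow> u \<in> {\<alpha><..<\<beta>} \<longrightarrow> u \<in> {\<alpha>'<..<\<beta>'} \<longrightarrow> (t, \<alpha>, \<beta>) = (t', \<alpha>', \<beta>')) \<and>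
    (\<Sum>(t,\<alpha>,\<beta>)\<in>P. (\<beta> - \<alpha>) * wl l t) \<ge> (\<integral>t. wl l t \<partial>lborel) - \<epsilon>1)"
  have "\<forall>l. \<exists>P. l \<in> \<Lambda> \<longrightarrow> G l P"
  proof
    fix l show "\<exists>P. l \<in> \<Lambda> \<longrightarrow> G l P"
    proof (cases "l \<in> \<Lambda>")
      case True
      have "\<And>t. t \<in> AL l \<Longrightarrow> D l t > 0" using cp[OF True] by (auto simp: cellp_def)
      note tc = tagged_cells[OF True \<epsilon>1(1) this]
      obtain P where P: "finite P"
        "\<And>t \<alpha> \<beta>. (t, \<alpha>, \<beta>) \<in> P \<Longrightarrow> t \<in> AL l \<and> \<alpha> < \<beta> \<and> 0 < wl l t \<and> (\<forall>u\<in>{\<alpha>..\<beta>}. \<bar>u - t\<bar> < D l t)"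
        "\<And>t \<alpha> \<beta> t' \<alpha>' \<beta>' u. (t, \<alpha>, \<beta>) \<in> P \<Longrightarrow> (t', \<alpha>', \<beta>') \<in> P \<Longrightarrow> u \<in> {\<alpha><..<\<beta>} \<Longrightarrow> u \<in> {\<alpha>'<..<\<beta>'} \<Longrightarrow> (t, \<alpha>, \<beta>) = (t', \<alpha>', \<beta>')"
        "(\<Sum>(t,\<alpha>,\<beta>)\<in>P. (\<beta> - \<alpha>) * wl l t) \<ge> (\<integral>t. wl l t \<partial>lborel) - \<epsilon>1"
        by (rule tc, assumption) (rule that, assumption+)
      have B: "\<forall>t \<alpha> \<beta>. (t, \<alpha>, \<beta>) \<in> P \<longrightarrow> t \<in> AL l \<and> \<alpha> < \<beta> \<and> 0 < wl l t \<and> (\<forall>u\<in>{\<alpha>..\<beta>}. \<bar>u - t\<bar> < D l t)"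
        by (intro allI impI) (rule P(2))
      have C: "\<forall>t \<alpha> \<beta> t' \<alpha>' \<beta>' u. (t, \<alpha>, \<beta>) \<in> P \<longrightarrow> (t', \<alpha>', \<beta>') \<in> P \<longrightarrow> u \<in> {\<alpha><..<\<beta>} \<longrightarrow> u \<in> {\<alpha>'<..<\<beta>'} \<longrightarrow> (t, \<alpha>, \<beta>) = (t', \<alpha>', \<beta>')"
        by (intro allI impI) (rule P(3))
      show ?thesis unfolding G_def by (intro exI[of _ P] impI) (rule conjI[OF P(1) conjI[OF B conjI[OF C P(4)]]])
    qed auto
  qed
  from choice[OF this] obtain P where "\<forall>l. l \<in> \<Lambda> \<longrightarrow> G l (P l)" ..
  then have PG: "G l (P l)" if "l \<in> \<Lambda>" for l using that by blast
  have P1: "finite (P l)" if "l \<in> \<Lambda>" for l using PG[OF that] unfolding G_def by (rule conjunct1)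
  have P2: "t \<in> AL l \<and> \<alpha> < \<beta> \<and> 0 < wl l t \<and> (\<forall>u\<in>{\<alpha>..\<beta>}. \<bar>u - t\<bar> < D l t)" if "l \<in> \<Lambda>" "(t, \<alpha>, \<beta>) \<in> P l" for l t \<alpha> \<beta>
    using PG[OF that(1), unfolded G_def, THEN conjunct2, THEN conjunct1] that(2) by blast
  have P3: "(t, \<alpha>, \<beta>) = (t', \<alpha>', \<beta>')" if "l \<in> \<Lambda>" "(t, \<alpha>, \<beta>) \<in> P l" "(t', \<alpha>', \<beta>') \<in> P l" "u \<in> {\<alpha><..<\<beta>}" "u \<in> {\<alpha>'<..<\<beta>'}" for l t \<alpha> \<beta> t' \<alpha>' \<beta>' u
    using PG[OF that(1), unfolded G_def, THEN conjunct2, THEN conjunct2, THEN conjunct1, rule_format, OF that(2-5)] .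
  have P4: "(\<Sum>(t,\<alpha>,\<beta>)\<in>P l. (\<beta> - \<alpha>) * wl l t) \<ge> (\<integral>t. wl l t \<partial>lborel) - \<epsilon>1" if "l \<in> \<Lambda>" for l
    using PG[OF that, unfolded G_def, THEN conjunct2, THEN conjunct2, THEN conjunct2] .
  define C where "C = (SIGMA l:\<Lambda>. P l)"
  define R where "R = (\<Sum>l\<in>\<Lambda>. \<Sum>(t,\<alpha>,\<beta>)\<in>P l. (\<beta> - \<alpha>) * wl l t)"
  have R0: "0 \<le> R" unfolding R_def using P2 by (intro sum_nonneg) force
  have R1: "R \<ge> (\<Sum>l\<in>\<Lambda>. (\<integral>t. wl l t \<partial>lborel)) - \<epsilon> / 2"
  proof -
    have "R \<ge> (\<Sum>l\<in>\<Lambda>. (\<integral>t. wl l t \<partial>lborel) - \<epsilon>1)" unfolding R_def by (rule sum_mono) (rule P4)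
    then show ?thesis using \<epsilon>1(2) by (simp add: sum_subtractf)
  qed
  \<comment> \<open>The transitions lose \<open>2 * \<theta> * R\<close>, and the + 1 covers R = 0.
    The bound 1/4 keeps the two transitions of a base apart.\<close>
  define \<theta> where "\<theta> = min (1/4) (\<epsilon> / (4 * (R + 1)))"
  have \<theta>: "0 < \<theta>" "\<theta> \<le> 1/4" 
    subgoal using \<epsilon> R0 by (simp add: \<theta>_def)
    subgoal unfolding \<theta>_def by (rule min.cobounded1)
    done
  have \<theta>R: "2 * \<theta> * R \<le> \<epsilon> / 2"
  proof -
    have "\<theta> * R \<le> \<epsilon> / (4 * (R + 1)) * R" using R0 unfolding \<theta>_def by (intro mult_right_mono min.cobounded2)
    also have "\<dots> \<le> \<epsilon> / 4" using R0 \<epsilon> by (simp add: field_simps)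
    finally show ?thesis by simp
  qed
  define tg where "tg = (\<lambda>k::((pt \<times> pt) \<times> real \<times> real \<times> real). fst (snd k))"
  define al where "al = (\<lambda>k::((pt \<times> pt) \<times> real \<times> real \<times> real). fst (snd (snd k)))"
  define be where "be = (\<lambda>k::((pt \<times> pt) \<times> real \<times> real \<times> real). snd (snd (snd k)))"
  have Ck: "fst k \<in> \<Lambda>" "tg k \<in> AL (fst k)" "al k < be k" "0 < wl (fst k) (tg k)"
    "\<And>u. u \<in> {al k..be k} \<Longrightarrow> \<bar>u - tg k\<bar> < D (fst k) (tg k)" if "k \<in> C" for k
    using that P2[of "fst k" "tg k" "al k" "be k"] by (auto simp: C_def tg_def al_def be_def)
  have Cc: "cellp (fst k) (tg k) (D (fst k) (tg k)) (H (fst k) (tg k)) (Sa (fst k) (tg k)) (Sb (fst k) (tg k)) (Va (fst k) (tg k)) (Vb (fst k) (tg k))" 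
    if "k \<in> C" for k by (rule cp[OF Ck(1,2)[OF that]])
  have inT_int: "z \<in> interior \<Omega>" if "i \<in> I" "inT i z" for i z using that T_int unfolding inT_def by blast
  have main: "ereal (\<Sum>k\<in>C. \<bar>Va (fst k) (tg k) - Vb (fst k) (tg k)\<bar> * (be k - al k - 2 * (\<theta> * (be k - al k)))) \<le> TV \<Omega> S2"
  proof (rule tv_lower[where e = "\<lambda>k. snd (fst k)" and p = "\<lambda>k. fst (fst k)" and \<eta> = "\<lambda>k. H (fst k) (tg k)" and ?s1.0 = "\<lambda>k. Sa (fst k) (tg k)" and ?s2.0 = "\<lambda>k. Sb (fst k) (tg k)", OF _ _ _ _ S2(2,3,5)])
    show "finite C" unfolding C_def using fin P1 by blast
    fix k assume k: "k \<in> C"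
    note c = Cc[OF k, unfolded cellp_def] and k' = Ck[OF k]
    show "norm (snd (fst k)) = 1" using unit[OF k'(1)] .
    show "0 < \<theta> * (be k - al k) \<and> 2 * (\<theta> * (be k - al k)) < be k - al k"
    proof -
      have "\<theta> * (be k - al k) \<le> 1/4 * (be k - al k)" using \<theta> k'(3) by (intro mult_right_mono) auto
      then show ?thesis using \<theta> k'(3) by simp
    qed
    show "0 < H (fst k) (tg k) \<and> 2 * H (fst k) (tg k) < Sb (fst k) (tg k) - Sa (fst k) (tg k)" using c by linarith
    show "S2 (fr (fst (fst k)) (snd (fst k)) t s) = Va (fst k) (tg k)" 
      if "t \<in> {al k..be k}" "s \<in> {Sa (fst k) (tg k)..Sa (fst k) (tg k) + H (fst k) (tg k)}" for t s
      using c k'(5)[OF that(1)] that(2) by blast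
    show "S2 (fr (fst (fst k)) (snd (fst k)) t s) = Vb (fst k) (tg k)" 
      if "t \<in> {al k..be k}" "s \<in> {Sb (fst k) (tg k) - H (fst k) (tg k)..Sb (fst k) (tg k)}" for t s
      using c k'(5)[OF that(1)] that(2) by blast
    show "fr (fst (fst k)) (snd (fst k)) t s \<in> interior \<Omega>" 
      if t: "t \<in> {al k..be k}" and s: "s \<in> {Sa (fst k) (tg k)..Sb (fst k) (tg k)}" for t s
    proof -
      have tt: "\<bar>t - tg k\<bar> < D (fst k) (tg k)" using k'(5)[OF t] .
      consider "s = 0" | "s > 0" | "s < 0" by linarith
      then show ?thesis
      proof cases
        case 1 then show ?thesis using c tt by (auto simp: AL_def)
      next
        case 2
        then obtain i where "i \<in> IL (fst k) 1" "inT i (fr (fst (fst k)) (snd (fst k)) t s)" using c tt s by fastforce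
        then show ?thesis using inT_int IL_sub by blast
      next
        case 3
        then obtain i where "i \<in> IL (fst k) (-1)" "inT i (fr (fst (fst k)) (snd (fst k)) t s)" using c tt s by fastforce
        then show ?thesis using inT_int IL_sub by blast
      qed
    qed
    fix k2 t s t' s' assume k2: "k2 \<in> C" and t: "t \<in> {al k<..<be k}" "s \<in> {Sa (fst k) (tg k)<..<Sb (fst k) (tg k)}"
      and t': "t' \<in> {al k2<..<be k2}" "s' \<in> {Sa (fst k2) (tg k2)<..<Sb (fst k2) (tg k2)}"
      and eq: "fr (fst (fst k)) (snd (fst k)) t s = fr (fst (fst k2)) (snd (fst k2)) t' s'"
    \<comment> \<open>A common point forces the same line and the same abscissa; the intervals
      chosen on one line do not overlap, so the two cells agree.\<close>
    have "fst k = fst k2 \<and> t = t'"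
      by (rule cell_unique[OF k'(1) Cc[OF k] k'(5) _ Ck(1)[OF k2] Cc[OF k2] Ck(5)[OF k2] _ eq]) (use t t' in auto)
    then have f: "fst k = fst k2" "t = t'" by auto
    have kk: "k = (fst k, tg k, al k, be k)" for k by (simp add: tg_def al_def be_def)
    have "(tg k, al k, be k) \<in> P (fst k)" "(tg k2, al k2, be k2) \<in> P (fst k)"
      using k k2 f by (auto simp: C_def tg_def al_def be_def)
    then have "(tg k, al k, be k) = (tg k2, al k2, be k2)" using P3[OF k'(1)] t(1) t'(1) f(2) by blast
    then show "k = k2" using kk f(1) by metis
  qed
  have "(1 - 2 * \<theta>) * R = (\<Sum>k\<in>C. (1 - 2 * \<theta>) * ((be k - al k) * wl (fst k) (tg k)))"
  proof -
    have "R = (\<Sum>k\<in>C. (be k - al k) * wl (fst k) (tg k))"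
      unfolding R_def C_def using fin P1
      by (subst sum.Sigma) (auto simp: be_def al_def tg_def case_prod_beta)
    then show ?thesis by (simp add: sum_distrib_left)
  qed
  also have "\<dots> \<le> (\<Sum>k\<in>C. \<bar>Va (fst k) (tg k) - Vb (fst k) (tg k)\<bar> * (be k - al k - 2 * (\<theta> * (be k - al k))))"
  proof (rule sum_mono)
    fix k assume k: "k \<in> C"
    have "wl (fst k) (tg k) \<le> \<bar>Va (fst k) (tg k) - Vb (fst k) (tg k)\<bar>" using Cc[OF k] by (simp add: cellp_def)
    then have "wl (fst k) (tg k) * ((1 - 2 * \<theta>) * (be k - al k)) \<le> \<bar>Va (fst k) (tg k) - Vb (fst k) (tg k)\<bar> * ((1 - 2 * \<theta>) * (be k - al k))"
      using \<theta> Ck(3)[OF k] by (intro mult_right_mono) auto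
    then show "(1 - 2 * \<theta>) * ((be k - al k) * wl (fst k) (tg k)) \<le> \<bar>Va (fst k) (tg k) - Vb (fst k) (tg k)\<bar> * (be k - al k - 2 * (\<theta> * (be k - al k)))"
      by (simp add: algebra_simps)
  qed
  finally have "(1 - 2 * \<theta>) * R \<le> (\<Sum>k\<in>C. \<bar>Va (fst k) (tg k) - Vb (fst k) (tg k)\<bar> * (be k - al k - 2 * (\<theta> * (be k - al k))))" .
  moreover have "(\<Sum>l\<in>\<Lambda>. (\<integral>t. wl l t \<partial>lborel)) - \<epsilon> \<le> (1 - 2 * \<theta>) * R" using R1 \<theta>R by (simp add: algebra_simps)
  ultimately show ?thesis using main by (meson ereal_less_eq(3) order_trans)
qed

theorem tv_compare: "TV \<Omega> S1 \<le> TV \<Omega> S2 + ereal (\<Sum>i\<in>I. \<integral>t. mt i t \<partial>lborel)"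
proof -
  define E where "E = (\<Sum>i\<in>I. \<integral>t. mt i t \<partial>lborel)"
  define W where "W = (\<Sum>l\<in>\<Lambda>. (\<integral>t. wl l t \<partial>lborel))"
  have WE: "(\<Sum>l\<in>\<Lambda>. \<integral>t. \<bar>jmp S1 l t\<bar> * indicator (interior \<Omega>) (fr (fst l) (snd l) t 0) \<partial>lborel) \<le> W + E"
  proof -
    have "(\<Sum>l\<in>\<Lambda>. (\<integral>t. \<bar>jmp S1 l t\<bar> * indicator (interior \<Omega>) (fr (fst l) (snd l) t 0) \<partial>lborel)
       - ((\<Sum>i\<in>IL l 1. \<integral>t. mt i t \<partial>lborel) + (\<Sum>i\<in>IL l (-1). \<integral>t. mt i t \<partial>lborel))) \<le> W"
      unfolding W_def using wl_int(2) by (intro sum_mono) (simp add: algebra_simps)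
    moreover have "(\<Sum>l\<in>\<Lambda>. (\<Sum>i\<in>IL l 1. \<integral>t. mt i t \<partial>lborel) + (\<Sum>i\<in>IL l (-1). \<integral>t. mt i t \<partial>lborel)) \<le> E"
      unfolding E_def using mt_nonneg by (intro sum_IL_le integral_nonneg_AE) auto
    ultimately show ?thesis unfolding sum_subtractf by linarith
  qed
  have Wle: "ereal W \<le> TV \<Omega> S2"
  proof (rule ereal_le_epsilon2)
    fix \<epsilon> :: real assume "0 < \<epsilon>"
    from tv_lower_wl[OF this] have "ereal (W - \<epsilon>) \<le> TV \<Omega> S2" by (simp add: W_def)
    then have "ereal (W - \<epsilon>) + ereal \<epsilon> \<le> TV \<Omega> S2 + ereal \<epsilon>" by (rule add_right_mono)
    then show "ereal W \<le> TV \<Omega> S2 + ereal \<epsilon>" by simp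
  qed
  show ?thesis
    unfolding TV_def[of \<Omega> S1] E_def[symmetric]
  proof (rule SUP_least)
    fix p assume "p \<in> test_fields \<Omega>"
    then have tf: "(fst p, snd p) \<in> test_fields \<Omega>" by simp
    have "integral \<Omega> (\<lambda>x. S1 x * (\<Sum>b\<in>Basis. snd p x b \<bullet> b)) \<le>
      (\<Sum>l\<in>\<Lambda>. \<integral>t. \<bar>jmp S1 l t\<bar> * indicator (interior \<Omega>) (fr (fst l) (snd l) t 0) \<partial>lborel)"
      by (rule tv_upper[OF tf S1(1-3), of M]) (use S1(4,5) in blast)+
    with WE have "integral \<Omega> (\<lambda>x. S1 x * (\<Sum>b\<in>Basis. snd p x b \<bullet> b)) \<le> W + E" by linarith
    then have "ereal (integral \<Omega> (\<lambda>x. S1 x * (\<Sum>b\<in>Basis. snd p x b \<bullet> b))) \<le> ereal W + ereal E" by simp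
    also have "\<dots> \<le> TV \<Omega> S2 + ereal E" using Wle by (rule add_right_mono)
    finally show "ereal (integral \<Omega> (\<lambda>x. S1 x * (\<Sum>b\<in>Basis. snd p x b \<bullet> b))) \<le> TV \<Omega> S2 + ereal E" .
  qed
qed

end

section \<open>Step functions on triangles\<close>

text \<open>Let b be the length of B. Removing the end pieces of length b / 4 from the interval
  leaves at least b / 2 of B, and there the distance to both ends is at least b / 4.\<close>

lemma min_integral_ge:
  fixes L :: real
  assumes B: "B \<in> sets borel" "B \<subseteq> {0<..<L}"
  shows "(\<integral>t. indicator B t * min t (L - t) \<partial>lborel) \<ge> (measure lborel B)\<^sup>2 / 8"
proof -
  define b where "b = measure lborel B"
  define B' where "B' = B - ({0<..<b/4} \<union> {L - b/4<..<L})"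
  have fB: "emeasure lborel B < \<infinity>"
    using le_less_trans[OF emeasure_mono[of B "{0<..<L}" lborel] emeasure_bounded_finite[of "{0<..<L}"]] B by simp
  have Bm: "B \<in> fmeasurable lborel" using B fB by (simp add: fmeasurable_def)
  have B'm: "B' \<in> fmeasurable lborel" unfolding B'_def using Bm by (rule fmeasurable_Diff) auto
  have b0: "0 \<le> b" by (simp add: b_def)
  have "b \<le> measure lborel (B' \<union> {0<..<b/4} \<union> {L - b/4<..<L})"
    unfolding b_def[symmetric]
  proof -
    have "{x<..<y} \<in> fmeasurable lborel" for x y :: real
      using emeasure_bounded_finite[of "{x<..<y}"] by (simp add: fmeasurable_def)
    then have "B' \<union> {0<..<b/4} \<union> {L - b/4<..<L} \<in> fmeasurable lborel" using B'm by (intro fmeasurable.Un)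
    then have "measure lborel B \<le> measure lborel (B' \<union> {0<..<b/4} \<union> {L - b/4<..<L})"
      using B(1) by (intro measure_mono_fmeasurable) (auto simp: B'_def)
    then show "b \<le> measure lborel (B' \<union> {0<..<b/4} \<union> {L - b/4<..<L})" by (simp add: b_def)
  qed
  also have "\<dots> \<le> measure lborel (B' \<union> {0<..<b/4}) + measure lborel {L - b/4<..<L}"
    using B'm by (intro measure_Un_le) auto
  also have "\<dots> \<le> measure lborel B' + measure lborel {0<..<b/4} + measure lborel {L - b/4<..<L}"
    using B'm by (intro add_right_mono measure_Un_le) auto
  also have "\<dots> = measure lborel B' + b / 2" using b0 by simp
  finally have B'2: "measure lborel B' \<ge> b / 2" by simp
  have i1: "integrable lborel (\<lambda>t. indicator B t * min t (L - t))"
  proof (rule integrable_bounded_support)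
    show "(\<lambda>t. indicator B t * min t (L - t)) \<in> borel_measurable borel" using B(1) by measurable
    show "\<bar>indicator B t * min t (L - t)\<bar> \<le> \<bar>L\<bar>" for t
      using B(2) by (cases "t \<in> B") (force simp: min_def)+
    show "indicator B t * min t (L - t) = 0" if "norm t > \<bar>L\<bar>" for t using B(2) that by (auto simp: indicator_def)
  qed
  have i2: "integrable lborel (\<lambda>t. indicator B' t * (b / 4))"
    using B'm by (intro integrable_mult_left integrable_real_indicator) (auto simp: fmeasurable_def)
  have "b\<^sup>2 / 8 = b / 2 * (b / 4)" by (simp add: power2_eq_square)
  also have "\<dots> \<le> measure lborel B' * (b / 4)" using B'2 b0 by (intro mult_right_mono) auto
  also have "\<dots> = (\<integral>t. indicator B' t * (b / 4) \<partial>lborel)" using B'm by (simp add: fmeasurable_def)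
  also have "\<dots> \<le> (\<integral>t. indicator B t * min t (L - t) \<partial>lborel)"
  proof (rule integral_mono[OF i2 i1])
    fix t
    have "b / 4 \<le> min t (L - t)" if "t \<in> B'" using that B(2) by (force simp: B'_def min_def)
    moreover have "0 \<le> min t (L - t)" if "t \<in> B" using that B(2) by (force simp: min_def)
    ultimately show "indicator B' t * (b / 4) \<le> indicator B t * min t (L - t)"
      by (cases "t \<in> B'"; cases "t \<in> B") (auto simp: B'_def)
  qed
  finally show ?thesis by (simp add: b_def)
qed

text \<open>A level set of length b lies under an area of at least
  \<open>\<kappa> * b^2 / 8\<close>. The integral of m is the sum of value times length over at most
  K nonzero values, and Cauchy-Schwarz turns it into a sum of squares at the price of the factor
  K.\<close>

lemma finite_values_estimate:
  fixes m :: "real \<Rightarrow> real"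
  assumes m: "m \<in> borel_measurable borel" "\<And>t. 0 \<le> m t" and V: "finite V" "card V \<le> K" "\<And>t. t \<in> {0<..<L} \<Longrightarrow> m t \<in> insert 0 V"
    and k: "\<kappa> > 0"
  shows "(\<integral>t. indicator {0<..<L} t * m t \<partial>lborel)\<^sup>2 \<le> 8 / \<kappa> * real K * (\<integral>t. indicator {0<..<L} t * ((m t)\<^sup>2 * (\<kappa> * min t (L - t))) \<partial>lborel)"
proof -
  \<comment> \<open>The value 0 contributes nothing to either integral; without it the count stays K
    although m may also take the default value 0.\<close>
  define W where "W = V - {0}"
  have W: "finite W" "card W \<le> K" "\<And>t. t \<in> {0<..<L} \<Longrightarrow> m t = 0 \<or> m t \<in> W"
    using V card_Diff1_le[of V 0] by (auto simp: W_def)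
  define B where "B = (\<lambda>v. {t\<in>{0<..<L}. m t = v})"
  define b where "b = (\<lambda>v. measure lborel (B v))"
  have Bs: "B v \<in> sets borel" "B v \<subseteq> {0<..<L}" for v
  proof -
    have "B v = {0<..<L} \<inter> (m -` {v} \<inter> space borel)" by (auto simp: B_def)
    then show "B v \<in> sets borel" using measurable_sets[OF m(1), of "{v}"] by simp
  qed (auto simp: B_def)
  have fB: "emeasure lborel (B v) < \<infinity>" for v
    using le_less_trans[OF emeasure_mono[OF Bs(2), of lborel v] emeasure_bounded_finite[of "{0<..<L}"]] by simp
  have one: "indicator {0<..<L} t * g (m t) = (\<Sum>v\<in>W. g v * indicator (B v) t)" if "g 0 = 0" for g :: "real \<Rightarrow> real" and t
  proof (cases "t \<in> {0<..<L} \<and> m t \<in> W")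
    case True
    have "(\<Sum>v\<in>W. g v * indicator (B v) t) = (\<Sum>v\<in>W. if v = m t then g (m t) else 0)"
      using True by (intro sum.cong) (auto simp: B_def)
    then show ?thesis using True W(1) by simp
  next
    case False
    then have "(\<Sum>v\<in>W. g v * indicator (B v) t) = 0" by (intro sum.neutral) (auto simp: B_def indicator_def)
    then show ?thesis using False W(3)[of t] that by (auto simp: indicator_def)
  qed
  have "(\<integral>t. indicator {0<..<L} t * m t \<partial>lborel) = (\<integral>t. (\<Sum>v\<in>W. v * indicator (B v) t) \<partial>lborel)"
    using one[of "\<lambda>v. v"] by simp
  also have "\<dots> = (\<Sum>v\<in>W. v * b v)"
    using Bs fB by (subst Bochner_Integration.integral_sum) (auto simp: b_def)
  finally have I1: "(\<integral>t. indicator {0<..<L} t * m t \<partial>lborel) = (\<Sum>v\<in>W. v * b v)" .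
  have ih: "integrable lborel (\<lambda>t. indicator (B v) t * min t (L - t))" for v
  proof (rule integrable_bounded_support)
    show "(\<lambda>t. indicator (B v) t * min t (L - t)) \<in> borel_measurable borel" using Bs(1) by measurable
    show "\<bar>indicator (B v) t * min t (L - t)\<bar> \<le> \<bar>L\<bar>" for t using Bs(2) by (auto simp: indicator_def B_def)
    show "indicator (B v) t * min t (L - t) = 0" if "norm t > \<bar>L\<bar>" for t using Bs(2)[of v] that by (auto simp: indicator_def B_def)
  qed
  have "(\<integral>t. indicator {0<..<L} t * ((m t)\<^sup>2 * (\<kappa> * min t (L - t))) \<partial>lborel) = (\<integral>t. (\<Sum>v\<in>W. v\<^sup>2 * \<kappa> * (indicator (B v) t * min t (L - t))) \<partial>lborel)"
  proof (rule Bochner_Integration.integral_cong[OF refl])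
    fix t
    have "indicator {0<..<L} t * ((m t)\<^sup>2 * (\<kappa> * min t (L - t))) = (indicator {0<..<L} t * (m t)\<^sup>2) * (\<kappa> * min t (L - t))" by simp
    also have "\<dots> = (\<Sum>v\<in>W. v\<^sup>2 * indicator (B v) t) * (\<kappa> * min t (L - t))" using one[of "\<lambda>v. v\<^sup>2" t] by simp
    also have "\<dots> = (\<Sum>v\<in>W. v\<^sup>2 * \<kappa> * (indicator (B v) t * min t (L - t)))" unfolding sum_distrib_right by (rule sum.cong) auto
    finally show "indicator {0<..<L} t * ((m t)\<^sup>2 * (\<kappa> * min t (L - t))) = (\<Sum>v\<in>W. v\<^sup>2 * \<kappa> * (indicator (B v) t * min t (L - t)))" .
  qed
  also have "\<dots> = (\<Sum>v\<in>W. v\<^sup>2 * \<kappa> * (\<integral>t. indicator (B v) t * min t (L - t) \<partial>lborel))"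
    using ih by (subst Bochner_Integration.integral_sum) auto
  also have "\<dots> \<ge> (\<Sum>v\<in>W. v\<^sup>2 * \<kappa> * ((b v)\<^sup>2 / 8))"
    unfolding b_def using k by (intro sum_mono mult_left_mono min_integral_ge Bs) auto
  also have "(\<Sum>v\<in>W. v\<^sup>2 * \<kappa> * ((b v)\<^sup>2 / 8)) = \<kappa> / 8 * (\<Sum>v\<in>W. (v * b v)\<^sup>2)"
    by (simp add: sum_distrib_left power_mult_distrib algebra_simps)
  finally have I2: "\<kappa> / 8 * (\<Sum>v\<in>W. (v * b v)\<^sup>2) \<le> (\<integral>t. indicator {0<..<L} t * ((m t)\<^sup>2 * (\<kappa> * min t (L - t))) \<partial>lborel)" .
  have "(\<Sum>v\<in>W. v * b v)\<^sup>2 \<le> (\<Sum>v\<in>W. (v * b v)\<^sup>2) * real (card W)"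
    by (rule sum_squared_le_sum_of_squares)
  also have "\<dots> \<le> (\<Sum>v\<in>W. (v * b v)\<^sup>2) * real K"
    using W(2) by (intro mult_left_mono sum_nonneg) auto
  also have "\<dots> = 8 / \<kappa> * real K * (\<kappa> / 8 * (\<Sum>v\<in>W. (v * b v)\<^sup>2))" using k by simp
  also have "\<dots> \<le> 8 / \<kappa> * real K * (\<integral>t. indicator {0<..<L} t * ((m t)\<^sup>2 * (\<kappa> * min t (L - t))) \<partial>lborel)"
    using I2 k by (intro mult_left_mono) auto
  finally show ?thesis unfolding I1 .
qed

section \<open>Triangles and the fibre minimum\<close>

definition tri :: "real \<Rightarrow> pt \<Rightarrow> pt \<Rightarrow> real \<Rightarrow> pt set" where
  "tri \<kappa> a e L = {fr a e t s | t s. 0 < t \<and> t < L \<and> 0 < s \<and> s < \<kappa> * min t (L - t)}"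

lemma fr_in_tri:
  assumes "norm e = 1"
  shows "fr a e t s \<in> tri \<kappa> a e L \<longleftrightarrow> 0 < t \<and> t < L \<and> 0 < s \<and> s < \<kappa> * min t (L - t)"
  unfolding tri_def using fr_eq_iff[OF assms] by auto

lemma tri_coords:
  assumes "norm e = 1"
  shows "tri \<kappa> a e L = {x. 0 < (x - a) \<bullet> e \<and> (x - a) \<bullet> e < L \<and> 0 < (x - a) \<bullet> rot e \<and> (x - a) \<bullet> rot e < \<kappa> * min ((x - a) \<bullet> e) (L - (x - a) \<bullet> e)}"
  using fr_in_tri[OF assms, of a "(x - a) \<bullet> e" "(x - a) \<bullet> rot e" \<kappa> L for x] fr_coords[OF assms, of a]
  by (auto simp: set_eq_iff)

lemma open_tri:
  assumes "norm e = 1" shows "open (tri \<kappa> a e L)"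
  unfolding tri_coords[OF assms]
  by (intro open_Collect_conj open_Collect_less continuous_intros)

context lines begin

definition Gt :: "pt \<Rightarrow> pt \<Rightarrow> real \<Rightarrow> real set" where
  "Gt a e L = {t. 0 < t \<and> t < L \<and> fr a e t 0 \<notin> X}"

text \<open>If the foot is a crossing point, the fibre may run inside a line and leave no value to
  minimise over; this is why the default 0 is used off \<open>Gt\<close>. Within the base only
  finitely many t are concerned.\<close>

definition mval :: "real \<Rightarrow> pt \<Rightarrow> pt \<Rightarrow> real \<Rightarrow> (pt \<Rightarrow> real) \<Rightarrow> real \<Rightarrow> real" where
  "mval \<kappa> a e L g t = (if t \<in> Gt a e L then
     Min {\<bar>g (fr a e t s)\<bar> | s. 0 < s \<and> s < \<kappa> * min t (L - t) \<and> fr a e t s \<notin> N} else 0)"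

text \<open>A fibre with two points on a line runs along it. Then its foot is on this line, which is
  perpendicular to the base line and thus a different one, so the foot would be a crossing
  point.\<close>

lemma fibre_finite:
  assumes e: "norm e = 1" and base: "l0 \<in> \<Lambda>" "\<And>t. fr a e t 0 \<in> ln_of l0" and t: "fr a e t 0 \<notin> X"
  shows "finite {s. fr a e t s \<in> N}"
proof -
  have "finite {s. fr a e t s \<in> ln_of l}" if l: "l \<in> \<Lambda>" for l
  proof (rule ccontr)
    assume inf: "infinite {s. fr a e t s \<in> ln_of l}"
    obtain s1 where s1: "fr a e t s1 \<in> ln_of l" using inf by (metis Collect_empty_eq finite.emptyI)
    have "infinite ({s. fr a e t s \<in> ln_of l} - {s1})" using inf by simp
    then obtain s2 where s2: "fr a e t s2 \<in> ln_of l" "s2 \<noteq> s1" by (metis (mono_tags, lifting) DiffE ex_in_conv finite.emptyI insertI1 mem_Collect_eq)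
    have n: "norm (snd l) = 1" using unit[OF l] .
    have lin: "(fr a e t s - fst l) \<bullet> rot (snd l) = (fr a e t 0 - fst l) \<bullet> rot (snd l) + s * (rot e \<bullet> rot (snd l))" for s
      by (simp add: fr_def inner_add_left inner_diff_left)
    have "s1 * (rot e \<bullet> rot (snd l)) = s2 * (rot e \<bullet> rot (snd l))"
      using s1 s2(1) lin[of s1] lin[of s2] ln_of_iff[OF n] by (metis add_left_cancel)
    then have perp: "rot e \<bullet> rot (snd l) = 0" using s2(2) by simp
    then have x: "fr a e t 0 \<in> ln_of l" using s1 lin[of s1] ln_of_iff[OF n] by simp
    have "l \<noteq> l0"
    proof
      assume "l = l0"
      then have "(fr a e (t+1) 0 - fst l) \<bullet> rot (snd l) = 0" "(fr a e t 0 - fst l) \<bullet> rot (snd l) = 0"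
        using base(2) ln_of_iff[OF n] by auto
      then have "e \<bullet> rot (snd l) = 0" by (simp add: fr_def inner_add_left inner_diff_left algebra_simps)
      then have "e = (e \<bullet> snd l) *\<^sub>R snd l" using frame_decomp[OF n, of e] by simp
      moreover have "e \<bullet> snd l = 0" using perp by simp
      ultimately show False using e by simp
    qed
    then have "fr a e t 0 \<in> X" using x base l unfolding X_def by blast
    then show False using t by simp
  qed
  then have "finite (\<Union>l\<in>\<Lambda>. {s. fr a e t s \<in> ln_of l})" using fin by blast
  moreover have "{s. fr a e t s \<in> N} = (\<Union>l\<in>\<Lambda>. {s. fr a e t s \<in> ln_of l})" by (auto simp: N_def)
  ultimately show ?thesis by simp
qed

context
  fixes \<kappa> L B :: real and a e :: pt and g :: "pt \<Rightarrow> real" and l0 :: "pt \<times> pt" and K :: nat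
  assumes e: "norm e = 1" and L: "L > 0" and k: "\<kappa> > 0" and base: "l0 \<in> \<Lambda>" "\<And>t. fr a e t 0 \<in> ln_of l0"
    and g: "steplike g" "g \<in> borel_measurable borel" "\<And>x. \<bar>g x\<bar> \<le> B"
    and V: "finite ((\<lambda>z. \<bar>g z\<bar>) ` (tri \<kappa> a e L - N))" "card ((\<lambda>z. \<bar>g z\<bar>) ` (tri \<kappa> a e L - N)) \<le> K"
begin

lemma mval_facts:
  assumes t: "t \<in> Gt a e L"
  shows "mval \<kappa> a e L g t \<in> (\<lambda>z. \<bar>g z\<bar>) ` (tri \<kappa> a e L - N)"
    "\<exists>s. 0 < s \<and> s < \<kappa> * min t (L - t) \<and> fr a e t s \<notin> N \<and> \<bar>g (fr a e t s)\<bar> = mval \<kappa> a e L g t"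
    "\<And>s. 0 < s \<Longrightarrow> s < \<kappa> * min t (L - t) \<Longrightarrow> fr a e t s \<notin> N \<Longrightarrow> mval \<kappa> a e L g t \<le> \<bar>g (fr a e t s)\<bar>"
proof -
  define A where "A = {\<bar>g (fr a e t s)\<bar> | s. 0 < s \<and> s < \<kappa> * min t (L - t) \<and> fr a e t s \<notin> N}"
  have t': "0 < t" "t < L" "fr a e t 0 \<notin> X" using t by (auto simp: Gt_def)
  have sub: "A \<subseteq> (\<lambda>z. \<bar>g z\<bar>) ` (tri \<kappa> a e L - N)"
    using t' fr_in_tri[OF e] unfolding A_def by blast
  have fA: "finite A" using sub V(1) finite_subset by blast
  have pos: "0 < \<kappa> * min t (L - t)" using t' k by simp
  have "infinite {0<..<\<kappa> * min t (L - t)}" using pos by (simp add: infinite_Ioo)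
  then have "infinite ({0<..<\<kappa> * min t (L - t)} - {s. fr a e t s \<in> N})"
    using fibre_finite[OF e base t'(3)] by (simp add: Diff_infinite_finite)
  then obtain s where "s \<in> {0<..<\<kappa> * min t (L - t)} - {s. fr a e t s \<in> N}"
    by (metis all_not_in_conv finite.emptyI)
  then have nA: "A \<noteq> {}" unfolding A_def by auto
  have eq: "mval \<kappa> a e L g t = Min A" using t by (simp add: mval_def A_def)
  have "Min A \<in> A" using Min_in[OF fA nA] .
  then show "mval \<kappa> a e L g t \<in> (\<lambda>z. \<bar>g z\<bar>) ` (tri \<kappa> a e L - N)"
    "\<exists>s. 0 < s \<and> s < \<kappa> * min t (L - t) \<and> fr a e t s \<notin> N \<and> \<bar>g (fr a e t s)\<bar> = mval \<kappa> a e L g t"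
    using sub unfolding eq by (auto simp: A_def)
  show "mval \<kappa> a e L g t \<le> \<bar>g (fr a e t s)\<bar>" if "0 < s" "s < \<kappa> * min t (L - t)" "fr a e t s \<notin> N" for s
    unfolding eq using that by (intro Min_le[OF fA]) (auto simp: A_def)
qed

lemma mval_range: "0 \<le> mval \<kappa> a e L g t" "mval \<kappa> a e L g t \<le> B"
proof -
  have B0: "0 \<le> B" using g(3)[of 0] by simp
  show "0 \<le> mval \<kappa> a e L g t" using mval_facts(1)[of t] by (cases "t \<in> Gt a e L") (auto simp: mval_def)
  show "mval \<kappa> a e L g t \<le> B" using mval_facts(1)[of t] g(3) B0 by (cases "t \<in> Gt a e L") (auto simp: mval_def)
qed

lemma open_Gt: "open (Gt a e L)"
proof -
  have "closed {t. fr a e t 0 \<in> X}" using finite_fr_X[OF e finX] by (rule finite_imp_closed)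
  then have "open ({0<..<L} - {t. fr a e t 0 \<in> X})" by (intro open_Diff) auto
  also have "{0<..<L} - {t. fr a e t 0 \<in> X} = Gt a e L" by (auto simp: Gt_def)
  finally show ?thesis .
qed

text \<open>Sublevel sets within \<open>Gt\<close> are open: a value attained at a point off the
  lines is attained at the same height on all nearby fibres, because g is constant near that
  point.\<close>

lemma mval_measurable: "mval \<kappa> a e L g \<in> borel_measurable borel"
proof (rule borel_measurableI_le)
  fix v
  define U where "U = {t \<in> Gt a e L. mval \<kappa> a e L g t \<le> v}"
  have "open U"
    unfolding open_dist
  proof
    fix t assume t: "t \<in> U"
    then have tG: "t \<in> Gt a e L" "mval \<kappa> a e L g t \<le> v" by (auto simp: U_def)
    obtain s where s: "0 < s" "s < \<kappa> * min t (L - t)" "fr a e t s \<notin> N" "\<bar>g (fr a e t s)\<bar> \<le> v"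
      using mval_facts(2)[OF tG(1)] tG(2) by auto
    obtain r where r: "r > 0" "ball (fr a e t s) r \<inter> N = {}" "\<And>y. y \<in> ball (fr a e t s) r \<Longrightarrow> g y = g (fr a e t s)"
      using steplike_ball[OF g(1) s(3)] by metis
    obtain d1 where d1: "d1 > 0" "\<And>u. dist u t < d1 \<Longrightarrow> u \<in> Gt a e L" using open_Gt tG(1) unfolding open_dist by blast
    have "open {u. s < \<kappa> * min u (L - u)}" by (intro open_Collect_less continuous_intros)
    then obtain d2 where d2: "d2 > 0" "\<And>u. dist u t < d2 \<Longrightarrow> s < \<kappa> * min u (L - u)" using s(2) unfolding open_dist by blast
    have "u \<in> U" if u: "dist u t < min r (min d1 d2)" for u
    proof -
      have uG: "u \<in> Gt a e L" using d1 u by simp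
      have "fr a e u s \<in> ball (fr a e t s) r" using u by (simp add: dist_fr[OF e] dist_real_def abs_minus_commute)
      then have "fr a e u s \<notin> N" "g (fr a e u s) = g (fr a e t s)" using r(2,3) by auto
      then have "mval \<kappa> a e L g u \<le> v" using mval_facts(3)[OF uG s(1) d2(2)] u s(4) by fastforce
      then show ?thesis using uG by (simp add: U_def)
    qed
    then show "\<exists>d>0. \<forall>u. dist u t < d \<longrightarrow> u \<in> U" using r(1) d1(1) d2(1) by (intro exI[of _ "min r (min d1 d2)"]) auto
  qed
  then have "U \<in> sets borel" by simp
  moreover have "- Gt a e L \<in> sets borel" using open_Gt by simp
  moreover have "{x \<in> space borel. mval \<kappa> a e L g x \<le> v} = (if v < 0 then U else U \<union> - Gt a e L)"
    using mval_range(1) by (auto simp: U_def mval_def[of \<kappa> a e L g] not_less split: if_splits) 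
  ultimately show "{x \<in> space borel. mval \<kappa> a e L g x \<le> v} \<in> sets borel" by auto
qed

text \<open>On each fibre the squared minimum times the height is at most the integral of the square
  of g. Integrating over t gives the integral over the triangle, and the count of values does the
  rest.\<close>

lemma mval_integral:
  assumes M: "\<And>x. norm x > M \<Longrightarrow> g x = 0"
  shows "(\<integral>t. indicator {0<..<L} t * mval \<kappa> a e L g t \<partial>lborel)\<^sup>2 \<le> 8 / \<kappa> * real K * (\<integral>x. indicator (tri \<kappa> a e L) x * (g x)\<^sup>2 \<partial>lborel)"
proof -
  define m where "m = mval \<kappa> a e L g"
  have mm: "m \<in> borel_measurable borel" unfolding m_def by (rule mval_measurable)
  have mr: "0 \<le> m t" "m t \<le> B" for t unfolding m_def using mval_range by auto
  have B0: "0 \<le> B" using g(3)[of 0] by simp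
  have Tb: "tri \<kappa> a e L \<in> sets borel" using open_tri[OF e] by simp
  have mV: "m t \<in> insert 0 ((\<lambda>z. \<bar>g z\<bar>) ` (tri \<kappa> a e L - N))" for t
    using mval_facts(1)[of t] by (cases "t \<in> Gt a e L") (auto simp: m_def mval_def)
  have I1: "integrable lborel (\<lambda>x. indicator (tri \<kappa> a e L) x * (g x)\<^sup>2)"
  proof (rule integrable_bounded_support)
    show "(\<lambda>x. indicator (tri \<kappa> a e L) x * (g x)\<^sup>2) \<in> borel_measurable borel" using Tb g(2) by measurable
    have "(g x)\<^sup>2 \<le> B\<^sup>2" for x using g(3)[of x] by (metis abs_le_square_iff abs_of_nonneg B0)
    then show "\<bar>indicator (tri \<kappa> a e L) x * (g x)\<^sup>2\<bar> \<le> B\<^sup>2" for x by (simp add: indicator_def)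
    show "indicator (tri \<kappa> a e L) x * (g x)\<^sup>2 = 0" if "norm x > M" for x using M[OF that] by simp
  qed
  have I2: "integrable lborel (\<lambda>t. indicator {0<..<L} t * ((m t)\<^sup>2 * (\<kappa> * min t (L - t))))"
  proof (rule integrable_bounded_support)
    show "(\<lambda>t. indicator {0<..<L} t * ((m t)\<^sup>2 * (\<kappa> * min t (L - t)))) \<in> borel_measurable borel" using mm by measurable
    show "\<bar>indicator {0<..<L} t * ((m t)\<^sup>2 * (\<kappa> * min t (L - t)))\<bar> \<le> B\<^sup>2 * (\<kappa> * L)" for t
    proof (cases "t \<in> {0<..<L}")
      case True
      have "(m t)\<^sup>2 \<le> B\<^sup>2" using mr by (intro power_mono) auto
      moreover have "min t (L - t) \<le> L" "0 \<le> min t (L - t)" using True by auto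
      ultimately have "(m t)\<^sup>2 * (\<kappa> * min t (L - t)) \<le> B\<^sup>2 * (\<kappa> * L)" using k by (intro mult_mono) auto
      then show ?thesis using True k \<open>0 \<le> min t (L - t)\<close> by (simp add: abs_mult)
    next
      case False then have "indicator {0<..<L} t = (0::real)" by (rule indicator_simps(2))
      then show ?thesis using k L by simp
    qed
    show "indicator {0<..<L} t * ((m t)\<^sup>2 * (\<kappa> * min t (L - t))) = 0" if "norm t > L" for t using that by (auto simp: indicator_def)
  qed
  have "ennreal (\<integral>t. indicator {0<..<L} t * ((m t)\<^sup>2 * (\<kappa> * min t (L - t))) \<partial>lborel)
    = (\<integral>\<^sup>+t. ennreal (indicator {0<..<L} t * ((m t)\<^sup>2 * (\<kappa> * min t (L - t)))) \<partial>lborel)"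
    using I2 k by (intro nn_integral_eq_integral[symmetric]) (auto simp: indicator_def)
  also have "\<dots> \<le> (\<integral>\<^sup>+t. \<integral>\<^sup>+s. ennreal (indicator (tri \<kappa> a e L) (fr a e t s) * (g (fr a e t s))\<^sup>2) \<partial>lborel \<partial>lborel)"
  proof (rule nn_integral_mono)
    fix t
    show "ennreal (indicator {0<..<L} t * ((m t)\<^sup>2 * (\<kappa> * min t (L - t)))) 
        \<le> (\<integral>\<^sup>+s. ennreal (indicator (tri \<kappa> a e L) (fr a e t s) * (g (fr a e t s))\<^sup>2) \<partial>lborel)"
    proof (cases "t \<in> Gt a e L")
      case False then show ?thesis by (auto simp: m_def mval_def)
    next
      case True
      then have t: "0 < t" "t < L" "fr a e t 0 \<notin> X" by (auto simp: Gt_def)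
      define h where "h = \<kappa> * min t (L - t)"
      have h: "0 < h" using t k by (simp add: h_def)
      have "ennreal (indicator {0<..<L} t * ((m t)\<^sup>2 * (\<kappa> * min t (L - t)))) = ennreal ((m t)\<^sup>2) * ennreal h"
        using t h by (simp add: h_def ennreal_mult)
      also have "\<dots> = (\<integral>\<^sup>+s. ennreal ((m t)\<^sup>2) * indicator {0<..<h} s \<partial>lborel)"
        using h by (simp add: nn_integral_cmult_indicator)
      also have "\<dots> \<le> (\<integral>\<^sup>+s. ennreal (indicator (tri \<kappa> a e L) (fr a e t s) * (g (fr a e t s))\<^sup>2) \<partial>lborel)"
      proof (rule nn_integral_mono_AE)
        have "AE s in lborel. s \<notin> {s. fr a e t s \<in> N}"
          using fibre_finite[OF e base t(3)] by (intro AE_not_in finite_imp_null_set_lborel)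
        then show "AE s in lborel. ennreal ((m t)\<^sup>2) * indicator {0<..<h} s \<le> ennreal (indicator (tri \<kappa> a e L) (fr a e t s) * (g (fr a e t s))\<^sup>2)"
        proof eventually_elim
          case (elim s)
          show ?case
          proof (cases "s \<in> {0<..<h}")
            case False then show ?thesis by simp
          next
            case s: True
            have "fr a e t s \<in> tri \<kappa> a e L" using fr_in_tri[OF e] s t by (simp add: h_def)
            moreover have "m t \<le> \<bar>g (fr a e t s)\<bar>" unfolding m_def using s elim by (intro mval_facts(3)[OF True]) (auto simp: h_def)
            then have "(m t)\<^sup>2 \<le> (g (fr a e t s))\<^sup>2" using mr(1)[of t] by (simp add: abs_le_square_iff[symmetric])
            ultimately show ?thesis using s by (simp add: ennreal_leI)
          qed
        qed
      qed
      finally show ?thesis .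
    qed
  qed
  also have "\<dots> = (\<integral>\<^sup>+x. ennreal (indicator (tri \<kappa> a e L) x * (g x)\<^sup>2) \<partial>lborel)"
    using borel_measurable_integrable[OF I1] by (intro nn_integral_fr[OF e, symmetric]) simp
  also have "\<dots> = ennreal (\<integral>x. indicator (tri \<kappa> a e L) x * (g x)\<^sup>2 \<partial>lborel)"
    using I1 by (intro nn_integral_eq_integral) auto
  finally have le: "(\<integral>t. indicator {0<..<L} t * ((m t)\<^sup>2 * (\<kappa> * min t (L - t))) \<partial>lborel) \<le> (\<integral>x. indicator (tri \<kappa> a e L) x * (g x)\<^sup>2 \<partial>lborel)"
    by (subst (asm) ennreal_le_iff) (auto intro: integral_nonneg_AE)
  have "(\<integral>t. indicator {0<..<L} t * m t \<partial>lborel)\<^sup>2 \<le> 8 / \<kappa> * real K * (\<integral>t. indicator {0<..<L} t * ((m t)\<^sup>2 * (\<kappa> * min t (L - t))) \<partial>lborel)"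
    by (rule finite_values_estimate[OF mm mr(1) V mV k])
  also have "\<dots> \<le> 8 / \<kappa> * real K * (\<integral>x. indicator (tri \<kappa> a e L) x * (g x)\<^sup>2 \<partial>lborel)"
    using le k by (intro mult_left_mono) auto
  finally show ?thesis by (simp add: m_def)
qed

end

end

section \<open>Rings and their edges\<close>

lemma seg_line: "closed_segment (p + \<alpha> *\<^sub>R d) (p + \<beta> *\<^sub>R d) = (\<lambda>\<tau>. p + \<tau> *\<^sub>R d) ` closed_segment \<alpha> \<beta>"
  for p d :: pt
proof -
  have "(\<lambda>\<tau>. p + \<tau> *\<^sub>R d) ` closed_segment \<alpha> \<beta> = (+) p ` ((\<lambda>\<tau>. \<tau> *\<^sub>R d) ` closed_segment \<alpha> \<beta>)"
    by (simp add: image_image)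
  also have "(\<lambda>\<tau>. \<tau> *\<^sub>R d) ` closed_segment \<alpha> \<beta> = closed_segment (\<alpha> *\<^sub>R d) (\<beta> *\<^sub>R d)"
    by (rule closed_segment_linear_image[symmetric]) (auto intro: linearI simp: algebra_simps)
  finally show ?thesis by (simp add: closed_segment_translation)
qed

lemma line_through:
  fixes p d :: pt
  assumes "u \<noteq> v" "u \<in> closed_segment A B" "v \<in> closed_segment A B" "u = p + \<tau> *\<^sub>R d" "v = p + \<tau>' *\<^sub>R d"
  obtains \<alpha> \<beta> where "A = p + \<alpha> *\<^sub>R d" "B = p + \<beta> *\<^sub>R d"
proof -
  obtain s where s: "u = (1 - s) *\<^sub>R A + s *\<^sub>R B" using assms(2) by (auto simp: closed_segment_def)
  obtain s' where s': "v = (1 - s') *\<^sub>R A + s' *\<^sub>R B" using assms(3) by (auto simp: closed_segment_def)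
  have ne: "s \<noteq> s'" using assms(1) s s' by auto
  have "v - u = (s' - s) *\<^sub>R (B - A)" unfolding s s' by (simp add: algebra_simps)
  moreover have "v - u = (\<tau>' - \<tau>) *\<^sub>R d" using assms(4,5) by (simp add: algebra_simps)
  ultimately have "(1 / (s' - s)) *\<^sub>R ((s' - s) *\<^sub>R (B - A)) = (1 / (s' - s)) *\<^sub>R ((\<tau>' - \<tau>) *\<^sub>R d)" by simp
  then have BA: "B - A = ((\<tau>' - \<tau>) / (s' - s)) *\<^sub>R d" using ne by simp
  have "A = u - s *\<^sub>R (B - A)" unfolding s by (simp add: algebra_simps)
  then have A: "A = p + (\<tau> - s * ((\<tau>' - \<tau>) / (s' - s))) *\<^sub>R d" unfolding BA assms(4) by (simp add: algebra_simps)
  have "B = A + ((\<tau>' - \<tau>) / (s' - s)) *\<^sub>R d" using BA by (simp add: algebra_simps)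
  then have "B = p + (\<tau> - s * ((\<tau>' - \<tau>) / (s' - s)) + (\<tau>' - \<tau>) / (s' - s)) *\<^sub>R d" using A by (simp add: algebra_simps)
  then show ?thesis using that A by blast
qed

lemma edge_line:
  assumes "is_edge \<B> E" "u \<in> E" "v \<in> E" "u \<noteq> v" "u = p + \<tau> *\<^sub>R d" "v = p + \<tau>' *\<^sub>R d"
  obtains \<alpha> \<beta> where "E = (\<lambda>\<tau>. p + \<tau> *\<^sub>R d) ` {\<alpha>..\<beta>}" "\<alpha> < \<beta>"
proof -
  obtain A B where E: "E = closed_segment A B" "A \<noteq> B" using assms(1) by (auto simp: is_edge_def)
  obtain \<alpha> \<beta> where ab: "A = p + \<alpha> *\<^sub>R d" "B = p + \<beta> *\<^sub>R d" using line_through[OF assms(4) _ _ assms(5,6)] assms(2,3) E by metis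
  have "\<alpha> \<noteq> \<beta>" using E ab by auto
  then show ?thesis using that[of "min \<alpha> \<beta>" "max \<alpha> \<beta>"] E ab seg_line[of p \<alpha> d \<beta>]
    by (auto simp: closed_segment_eq_real_ivl min_def max_def)
qed

text \<open>Edges are maximal segments. If two of them on one line are joined by a bridge inside
  \<open>\<B>\<close>, both together with the bridge form a segment containing them, and maximality
  makes each equal to it.\<close>

lemma edge_merge:
  fixes p d :: pt
  assumes E: "is_edge \<B> E" "E = (\<lambda>\<tau>. p + \<tau> *\<^sub>R d) ` {\<alpha>..\<beta>}" "y \<in> {\<alpha>..\<beta>}"
    and E': "is_edge \<B> E'" "E' = (\<lambda>\<tau>. p + \<tau> *\<^sub>R d) ` {\<alpha>'..\<beta>'}" "y' \<in> {\<alpha>'..\<beta>'}"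
    and yy: "\<And>\<tau>. min y y' \<le> \<tau> \<Longrightarrow> \<tau> \<le> max y y' \<Longrightarrow> p + \<tau> *\<^sub>R d \<in> \<B>"
  shows "E = E'"
proof -
  define m M where "m = min \<alpha> \<alpha>'" and "M = max \<beta> \<beta>'"
  have mM: "m \<le> M" using E(3) E'(3) by (auto simp: m_def M_def)
  define S where "S = closed_segment (p + m *\<^sub>R d) (p + M *\<^sub>R d)"
  have S: "S = (\<lambda>\<tau>. p + \<tau> *\<^sub>R d) ` {m..M}" unfolding S_def seg_line using mM by (simp add: closed_segment_eq_real_ivl)
  have "E \<subseteq> S" "E' \<subseteq> S" unfolding S E(2) E'(2) m_def M_def by (intro image_mono; auto)+
  moreover have "S \<subseteq> \<B>"
  proof
    fix z assume "z \<in> S"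
    then obtain \<tau> where t: "z = p + \<tau> *\<^sub>R d" "m \<le> \<tau>" "\<tau> \<le> M" unfolding S by force
    have "\<tau> \<in> {\<alpha>..\<beta>} \<or> \<tau> \<in> {\<alpha>'..\<beta>'} \<or> (min y y' \<le> \<tau> \<and> \<tau> \<le> max y y')"
      using t(2,3) E(3) E'(3) unfolding m_def M_def by auto
    moreover have "E \<subseteq> \<B>" "E' \<subseteq> \<B>" using E(1) E'(1) by (auto simp: is_edge_def)
    moreover have "\<tau> \<in> {\<alpha>..\<beta>} \<Longrightarrow> z \<in> E" "\<tau> \<in> {\<alpha>'..\<beta>'} \<Longrightarrow> z \<in> E'"
      unfolding E(2) E'(2) t(1) by (rule imageI, assumption)+
    ultimately show "z \<in> \<B>" using t(1) yy[of \<tau>] by auto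
  qed
  ultimately have "S = E" "S = E'" using E(1) E'(1) unfolding is_edge_def S_def by blast+
  then show ?thesis by simp
qed

text \<open>On the line through u and v, the edge is the connected component of the trace of
  \<open>\<B>\<close> that contains the segment; compactness makes it a closed interval.\<close>

lemma edge_exists:
  fixes \<B> :: "pt set"
  assumes B: "compact \<B>" and uv: "u \<noteq> v" "closed_segment u v \<subseteq> \<B>"
  obtains E where "is_edge \<B> E" "closed_segment u v \<subseteq> E"
proof -
  define d where "d = v - u"
  define ph where "ph = (\<lambda>\<tau>::real. u + \<tau> *\<^sub>R d)"
  have d: "d \<noteq> 0" using uv by (simp add: d_def)
  have phi: "inj ph" using d by (auto simp: inj_def ph_def)
  have uvs: "closed_segment u v = ph ` {0..1}"
    using seg_line[of u 0 d 1] by (simp add: d_def ph_def closed_segment_eq_real_ivl)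
  define J where "J = {\<tau>. ph \<tau> \<in> \<B>}"
  have pc: "continuous_on UNIV ph" unfolding ph_def by (intro continuous_intros)
  have "closed J" using continuous_closed_vimage[OF compact_imp_closed[OF B], of ph] pc
    by (simp add: J_def vimage_def continuous_on_eq_continuous_within)
  obtain C where C: "\<And>x. x \<in> \<B> \<Longrightarrow> norm x \<le> C" using compact_imp_bounded[OF B] by (auto simp: bounded_iff)
  have "\<bar>\<tau>\<bar> \<le> (C + norm u) / norm d" if "\<tau> \<in> J" for \<tau>
  proof -
    have "norm (\<tau> *\<^sub>R d) \<le> norm (ph \<tau>) + norm u" using norm_triangle_ineq4[of "ph \<tau>" u] by (simp add: ph_def)
    also have "\<dots> \<le> C + norm u" using C that by (simp add: J_def)
    finally show ?thesis using d by (simp add: field_simps)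
  qed
  then have "bounded J" unfolding bounded_iff by auto
  define Cc where "Cc = connected_component_set J 0"
  have 01: "{0..1} \<subseteq> J" using uv(2) unfolding uvs J_def by auto
  have sub: "{0..1} \<subseteq> Cc" unfolding Cc_def by (rule connected_component_maximal) (use 01 in auto)
  have CJ: "Cc \<subseteq> J" unfolding Cc_def by (rule connected_component_subset)
  have "compact Cc" unfolding compact_eq_bounded_closed Cc_def
    using bounded_subset[OF \<open>bounded J\<close> connected_component_subset] closed_connected_component[OF \<open>closed J\<close>] by simp
  moreover have "connected Cc" unfolding Cc_def by (rule connected_connected_component)
  ultimately obtain \<alpha> \<beta> where ab: "Cc = {\<alpha>..\<beta>}" using connected_compact_interval_1 by blast
  have ab': "\<alpha> \<le> 0" "1 \<le> \<beta>" using sub unfolding ab by auto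
  define E where "E = ph ` {\<alpha>..\<beta>}"
  have Es: "E = closed_segment (ph \<alpha>) (ph \<beta>)"
    unfolding E_def ph_def seg_line using ab' by (simp add: closed_segment_eq_real_ivl)
  have EB: "E \<subseteq> \<B>" using CJ unfolding E_def ab J_def by auto
  have "is_edge \<B> E"
    unfolding is_edge_def
  proof (intro conjI allI impI EB)
    have "ph \<alpha> \<noteq> ph \<beta>" using phi ab' by (auto simp: inj_eq)
    then show "\<exists>a b. a \<noteq> b \<and> E = closed_segment a b" using Es by blast
    fix a b assume S: "E \<subseteq> closed_segment a b \<and> closed_segment a b \<subseteq> \<B>"
    have "u = ph 0" "v = ph 1" by (auto simp: ph_def d_def)
    moreover have "ph 0 \<in> E" "ph 1 \<in> E" unfolding E_def using ab' by auto
    ultimately have "u \<in> closed_segment a b" "v \<in> closed_segment a b" "u = u + 0 *\<^sub>R d" "v = u + 1 *\<^sub>R d"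
      using S by (auto simp: d_def)
    from line_through[OF uv(1) this]
    obtain \<gamma> \<delta> where gd: "a = u + \<gamma> *\<^sub>R d" "b = u + \<delta> *\<^sub>R d" by metis
    have sg: "closed_segment a b = ph ` closed_segment \<gamma> \<delta>" unfolding gd seg_line ph_def ..
    have "closed_segment \<gamma> \<delta> \<subseteq> J" using S unfolding sg J_def by auto
    moreover have "0 \<in> closed_segment \<gamma> \<delta>"
    proof -
      have "ph 0 \<in> ph ` closed_segment \<gamma> \<delta>" using \<open>ph 0 \<in> E\<close> S sg by auto
      then show ?thesis using phi by (auto simp: inj_eq)
    qed
    ultimately have "closed_segment \<gamma> \<delta> \<subseteq> Cc" unfolding Cc_def by (intro connected_component_maximal) auto
    then show "closed_segment a b = E" using S unfolding sg E_def ab by auto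
  qed
  moreover have "closed_segment u v \<subseteq> E" unfolding uvs E_def using ab' by auto
  ultimately show ?thesis using that by blast
qed

section \<open>Flags: oriented pieces of edges with their triangles\<close>

type_synonym flag = "pt \<times> pt \<times> real"

definition fseg :: "flag \<Rightarrow> pt set" where "fseg f = (case f of (a, e, L) \<Rightarrow> (\<lambda>t. fr a e t 0) ` {0..L})"
definition foseg :: "flag \<Rightarrow> pt set" where "foseg f = (case f of (a, e, L) \<Rightarrow> (\<lambda>t. fr a e t 0) ` {0<..<L})"
definition ftri :: "real \<Rightarrow> flag \<Rightarrow> pt set" where "ftri \<kappa> f = (case f of (a, e, L) \<Rightarrow> tri \<kappa> a e L)"

text \<open>An oriented edge of R, with the isosceles triangle of slope \<kappa> over it lying to its left.\<close>
definition is_flag :: "real \<Rightarrow> pt set \<Rightarrow> flag \<Rightarrow> bool" where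
  "is_flag \<kappa> R f = (case f of (a, e, L) \<Rightarrow> norm e = 1 \<and> L > 0 \<and>
     (\<forall>t s. 0 \<le> t \<longrightarrow> t \<le> L \<longrightarrow> 0 \<le> s \<longrightarrow> s \<le> \<kappa> * min t (L - t) \<longrightarrow> fr a e t s \<in> closure R))"

text \<open>The ring condition in the form used from here on, with nonempty interior in place of
  regularity and flags in place of angles. A regular convex polygon fits it too, with
  \<open>Q2 = {}\<close> and a small slope; this serves for holes and for filled rings.\<close>

definition pring :: "real \<Rightarrow> nat \<Rightarrow> pt set \<Rightarrow> pt set \<Rightarrow> pt set \<Rightarrow> bool" where
  "pring \<kappa> N0 R Q1 Q2 \<longleftrightarrow> R = Q1 - Q2 \<and> Q2 \<subseteq> Q1 \<and> compact Q1 \<and> convex Q1 \<and> interior Q1 \<noteq> {} \<and>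
     compact Q2 \<and> convex Q2 \<and> (Q2 \<noteq> {} \<longrightarrow> interior Q2 \<noteq> {}) \<and> polygonal_boundary N0 Q1 \<and> polygonal_boundary N0 Q2 \<and>
     (\<forall>E. is_edge (frontier R) E \<longrightarrow> (\<exists>F. finite F \<and> card F \<le> 2 \<and> E = \<Union>(fseg ` F) \<and> (\<forall>f\<in>F. is_flag \<kappa> R f) \<and>
        (\<forall>f\<in>F. \<forall>g\<in>F. f \<noteq> g \<longrightarrow> foseg f \<inter> foseg g = {})))"

lemma fseg_closed_segment: "L \<ge> 0 \<Longrightarrow> fseg (a, e, L) = closed_segment a (a + L *\<^sub>R e)"
  using seg_line[of a 0 e L] by (simp add: fseg_def fr_def closed_segment_eq_real_ivl)

lemma foseg_sub: "foseg f \<subseteq> fseg f"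
  unfolding foseg_def fseg_def by (auto split: prod.split)

locale ring =
  fixes \<kappa> :: real and N0 :: nat and R Q1 Q2 :: "pt set"
  assumes k: "\<kappa> > 0" and pr: "pring \<kappa> N0 R Q1 Q2"
begin

lemma R: "R = Q1 - Q2" and Q12: "Q2 \<subseteq> Q1" and Q1: "compact Q1" "convex Q1" "interior Q1 \<noteq> {}"
  and Q2: "compact Q2" "convex Q2" "Q2 \<noteq> {} \<Longrightarrow> interior Q2 \<noteq> {}"
  using pr by (auto simp: pring_def)

lemma closedQ: "closed Q1" "closed Q2" using Q1 Q2 compact_imp_closed by auto

lemma clR: "closure R \<subseteq> Q1" using closedQ R by (simp add: closure_minimal)

lemma Q_closure_interior: "closure (interior Q1) = Q1" "closure (interior Q2) = Q2"
proof -
  show "closure (interior Q1) = Q1" using convex_closure_interior[OF Q1(2,3)] closedQ by simp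
  show "closure (interior Q2) = Q2"
    using convex_closure_interior[OF Q2(2,3)] closedQ by (cases "Q2 = {}") auto
qed

text \<open>The interior of \<open>Q2\<close> is dense in \<open>Q2\<close> and does not meet the
  closure of R, so an open set inside that closure cannot touch \<open>Q2\<close>.\<close>

lemma interior_closure: "interior (closure R) = interior R"
proof
  show "interior R \<subseteq> interior (closure R)" by (intro interior_mono closure_subset)
  show "interior (closure R) \<subseteq> interior R"
  proof (rule interior_maximal[OF _ open_interior])
    show "interior (closure R) \<subseteq> R"
    proof
      fix x assume x: "x \<in> interior (closure R)"
      have "x \<notin> Q2"
      proof
        assume "x \<in> Q2"
        then have "x \<in> closure (interior Q2)" using Q_closure_interior by simp
        then have "interior (closure R) \<inter> interior Q2 \<noteq> {}"
          using x open_Int_closure_eq_empty[OF open_interior, of "closure R" "interior Q2"] by blast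
        then obtain y where y: "y \<in> interior (closure R)" "y \<in> interior Q2" by blast
        have "interior Q2 \<inter> closure R = {}" using R interior_subset[of Q2] by (subst open_Int_closure_eq_empty) auto
        then show False using y interior_subset by blast
      qed
      then show "x \<in> R" using x clR interior_subset R by blast
    qed
  qed
qed

text \<open>\<open>Q1\<close> is the closure of its interior and \<open>Q2\<close> is closed, so R
  has no lower-dimensional parts.\<close>

lemma R_sub_closure: "R \<subseteq> closure (interior R)"
proof
  fix x assume x: "x \<in> R"
  show "x \<in> closure (interior R)"
    unfolding closure_iff_nhds_not_empty
  proof (intro allI impI)
    fix A V assume V: "V \<subseteq> A" "open V" "x \<in> V"
    have "x \<in> closure (interior Q1)" "x \<in> V - Q2" using x R Q_closure_interior V by auto
    moreover have oV: "open (V - Q2)" using V closedQ by auto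
    ultimately have "(V - Q2) \<inter> interior Q1 \<noteq> {}"
      using open_Int_closure_eq_empty[OF oV, of "interior Q1"] by blast
    moreover have "(V - Q2) \<inter> interior Q1 \<subseteq> interior R"
      using oV interior_subset R by (intro interior_maximal) auto
    ultimately show "interior R \<inter> A \<noteq> {}" using V(1) by blast
  qed
qed

lemma frontier_sub: "frontier R \<subseteq> frontier Q1 \<union> frontier Q2"
  unfolding R using frontier_Int_subset[of Q1 "- Q2"] by (auto simp: Diff_eq frontier_complement)

lemma closed_frontier_R: "compact (frontier R)"
proof -
  have "bounded R" using Q1(1) R compact_imp_bounded bounded_subset by blast
  then show ?thesis by (simp add: compact_frontier_bounded)
qed

lemma frontier1: "z \<in> frontier Q1 \<Longrightarrow> z \<notin> Q2 \<Longrightarrow> z \<in> frontier R"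
proof -
  assume z: "z \<in> frontier Q1" "z \<notin> Q2"
  then have "z \<in> R" using R closedQ frontier_subset_closed by blast
  moreover have "z \<notin> interior R" using z interior_mono[of R Q1] R by (auto simp: frontier_def)
  ultimately show ?thesis using closure_subset by (auto simp: frontier_def)
qed

lemma frontier2: "z \<in> frontier Q2 \<Longrightarrow> z \<in> interior Q1 \<Longrightarrow> z \<in> frontier R"
proof -
  assume z: "z \<in> frontier Q2" "z \<in> interior Q1"
  have "z \<in> Q2" using z closedQ frontier_subset_closed by blast
  then have "z \<notin> interior R" using R interior_subset by blast
  moreover have "z \<in> closure R"
    unfolding closure_iff_nhds_not_empty
  proof (intro allI impI)
    fix A V assume V: "V \<subseteq> A" "open V" "z \<in> V"
    have "z \<in> closure (- Q2)" using z by (simp add: frontier_closures)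
    moreover have oV: "open (V \<inter> interior Q1)" "z \<in> V \<inter> interior Q1" using V z by auto
    ultimately have "(V \<inter> interior Q1) \<inter> - Q2 \<noteq> {}"
      using open_Int_closure_eq_empty[OF oV(1), of "- Q2"] by blast
    then show "R \<inter> A \<noteq> {}" using V(1) interior_subset[of Q1] R by blast
  qed
  ultimately show ?thesis by (simp add: frontier_def)
qed

lemma flag_tri:
  assumes f: "is_flag \<kappa> R f"
  shows "ftri \<kappa> f \<subseteq> interior R"
proof -
  obtain a e L where fl: "f = (a, e, L)" by (cases f)
  have e: "norm e = 1" using f by (simp add: is_flag_def fl)
  have "tri \<kappa> a e L \<subseteq> closure R"
    using f fr_in_tri[OF e] unfolding tri_def is_flag_def fl by (auto simp: less_imp_le)
  then have "tri \<kappa> a e L \<subseteq> interior (closure R)" using open_tri[OF e] by (rule interior_maximal)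
  then show ?thesis by (simp add: interior_closure ftri_def fl)
qed

text \<open>If \<open>Q2\<close> touched the outer boundary at an inner point y of a flag, the
  supporting line of \<open>Q1\<close> at y would contain the flag, with \<open>Q1\<close> on the
  side of the triangle. The segment from y to an interior point w of \<open>Q2\<close> would then
  start inside the triangle, which belongs to R, although it runs through the interior of
  \<open>Q2\<close>.\<close>

lemma flag_not_double:
  assumes f: "is_flag \<kappa> R f" and y: "y \<in> foseg f" "y \<in> Q2" "y \<in> frontier Q1"
  shows False
proof -
  obtain a e L where fl: "f = (a, e, L)" by (cases f)
  have e: "norm e = 1" "L > 0" and cl: "\<And>t s. 0 \<le> t \<Longrightarrow> t \<le> L \<Longrightarrow> 0 \<le> s \<Longrightarrow> s \<le> \<kappa> * min t (L - t) \<Longrightarrow> fr a e t s \<in> Q1"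
    using f clR by (auto simp: is_flag_def fl)
  obtain t0 where t0: "0 < t0" "t0 < L" "y = fr a e t0 0" using y(1) by (auto simp: foseg_def fl)
  have ri: "rel_interior Q1 = interior Q1" using rel_interior_nonempty_interior[OF Q1(3)] .
  have "y \<in> Q1" "y \<notin> rel_interior Q1" using y Q12 ri by (auto simp: frontier_def)
  from supporting_hyperplane_rel_boundary[OF Q1(2) this] obtain n where n: "n \<noteq> 0"
    "\<And>z. z \<in> Q1 \<Longrightarrow> n \<bullet> y \<le> n \<bullet> z" "\<And>z. z \<in> rel_interior Q1 \<Longrightarrow> n \<bullet> y < n \<bullet> z" by metis
  note n' = n(2)
  have "n \<bullet> y \<le> n \<bullet> fr a e 0 0" "n \<bullet> y \<le> n \<bullet> fr a e L 0" using e k by (auto intro!: n' cl)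
  then have "t0 * (n \<bullet> e) \<le> 0" "0 \<le> (L - t0) * (n \<bullet> e)"
    unfolding t0(3) by (simp_all add: fr_def inner_add_right algebra_simps)
  then have ne: "n \<bullet> e = 0" using t0 by (simp add: mult_le_0_iff zero_le_mult_iff)
  define s where "s = \<kappa> * min t0 (L - t0)"
  have s: "0 < s" using t0 k by (simp add: s_def)
  have "n \<bullet> y \<le> n \<bullet> fr a e t0 s" using t0 s by (intro n' cl) (auto simp: s_def)
  then have "0 \<le> s * (n \<bullet> rot e)" unfolding t0(3) by (simp add: fr_def inner_add_right)
  then have "0 \<le> n \<bullet> rot e" using s by (simp add: zero_le_mult_iff)
  moreover have "n = (n \<bullet> rot e) *\<^sub>R rot e" using frame_decomp[OF e(1), of n] ne by simp
  ultimately have nr: "n \<bullet> rot e > 0" using n(1) by (metis less_eq_real_def scaleR_zero_left)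
  obtain w where w: "w \<in> interior Q2" using Q2(3) y(2) by blast
  have "w \<in> interior Q1" using w interior_mono[OF Q12] by blast
  then have "n \<bullet> y < n \<bullet> w" using n(3) ri by simp
  obtain t1 s1 where ts: "w = fr a e t1 s1" using fr_ex[OF e(1)] by blast
  have "0 < s1 * (n \<bullet> rot e)" using \<open>n \<bullet> y < n \<bullet> w\<close> unfolding ts t0(3) by (simp add: fr_def inner_add_right ne)
  then have s1: "0 < s1" using nr by (simp add: zero_less_mult_iff)
  \<comment> \<open>For small \<open>\<epsilon>\<close> the point that divides the way from y to w
    in ratio \<open>\<epsilon>\<close> is still below the legs of the triangle.\<close>
  have lim: "((\<lambda>\<epsilon>. \<kappa> * min (t0 + \<epsilon> * (t1 - t0)) (L - (t0 + \<epsilon> * (t1 - t0))) - \<epsilon> * s1) \<longlongrightarrow> \<kappa> * min (t0 + 0 * (t1 - t0)) (L - (t0 + 0 * (t1 - t0))) - 0 * s1) (at_right 0)"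
    by (intro tendsto_intros)
  have "\<forall>\<^sub>F \<epsilon> in at_right 0. 0 < \<kappa> * min (t0 + \<epsilon> * (t1 - t0)) (L - (t0 + \<epsilon> * (t1 - t0))) - \<epsilon> * s1"
    using s by (intro order_tendstoD(1)[OF lim]) (simp add: s_def)
  moreover have "\<forall>\<^sub>F \<epsilon>::real in at_right 0. \<epsilon> < 1 \<and> 0 < \<epsilon>" by (auto simp: eventually_at intro!: exI[of _ 1])
  ultimately have "\<forall>\<^sub>F \<epsilon> in at_right 0. 0 < \<kappa> * min (t0 + \<epsilon> * (t1 - t0)) (L - (t0 + \<epsilon> * (t1 - t0))) - \<epsilon> * s1 \<and> \<epsilon> < 1 \<and> 0 < \<epsilon>"
    by eventually_elim simp
  then obtain \<epsilon> where ep: "0 < \<kappa> * min (t0 + \<epsilon> * (t1 - t0)) (L - (t0 + \<epsilon> * (t1 - t0))) - \<epsilon> * s1" "\<epsilon> < 1" "0 < \<epsilon>"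
    using eventually_happens'[OF trivial_limit_at_right_real] by blast
  define z where "z = fr a e (t0 + \<epsilon> * (t1 - t0)) (\<epsilon> * s1)"
  have "0 < \<kappa> * min (t0 + \<epsilon> * (t1 - t0)) (L - (t0 + \<epsilon> * (t1 - t0)))" using ep s1 by (smt (verit) mult_pos_pos)
  then have mp: "0 < min (t0 + \<epsilon> * (t1 - t0)) (L - (t0 + \<epsilon> * (t1 - t0)))" using k by (simp add: zero_less_mult_iff del: min_less_iff_conj)
  have "z \<in> tri \<kappa> a e L" unfolding z_def fr_in_tri[OF e(1)] using ep s1 mp by auto
  then have zR: "z \<in> interior R" using flag_tri[OF f] by (auto simp: ftri_def fl)
  have "z = (1 - (1 - \<epsilon>)) *\<^sub>R w + (1 - \<epsilon>) *\<^sub>R y" unfolding z_def ts t0(3) by (simp add: fr_def algebra_simps)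
  moreover have "w \<noteq> y" using \<open>n \<bullet> y < n \<bullet> w\<close> by auto
  ultimately have "z \<in> open_segment w y" unfolding in_segment using ep by (intro conjI exI[of _ "1 - \<epsilon>"]) auto
  then have "z \<in> interior Q2" using in_interior_closure_convex_segment[OF Q2(2) w, of y] y(2) closure_subset by blast
  then show False using zR R interior_subset by blast
qed

definition EF :: "pt set \<Rightarrow> flag set" where
  "EF E = (SOME F. finite F \<and> card F \<le> 2 \<and> E = \<Union>(fseg ` F) \<and> (\<forall>f\<in>F. is_flag \<kappa> R f) \<and>
        (\<forall>f\<in>F. \<forall>g\<in>F. f \<noteq> g \<longrightarrow> foseg f \<inter> foseg g = {}))"

lemma EF:
  assumes "is_edge (frontier R) E"
  shows "finite (EF E)" "card (EF E) \<le> 2" "E = \<Union>(fseg ` EF E)" "\<And>f. f \<in> EF E \<Longrightarrow> is_flag \<kappa> R f"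
    "\<And>f g. f \<in> EF E \<Longrightarrow> g \<in> EF E \<Longrightarrow> f \<noteq> g \<Longrightarrow> foseg f \<inter> foseg g = {}"
proof -
  have "\<exists>F. finite F \<and> card F \<le> 2 \<and> E = \<Union>(fseg ` F) \<and> (\<forall>f\<in>F. is_flag \<kappa> R f) \<and>
        (\<forall>f\<in>F. \<forall>g\<in>F. f \<noteq> g \<longrightarrow> foseg f \<inter> foseg g = {})" using pr assms unfolding pring_def by blast
  from someI_ex[OF this] have "finite (EF E) \<and> card (EF E) \<le> 2 \<and> E = \<Union>(fseg ` EF E) \<and> (\<forall>f\<in>EF E. is_flag \<kappa> R f) \<and>
        (\<forall>f\<in>EF E. \<forall>g\<in>EF E. f \<noteq> g \<longrightarrow> foseg f \<inter> foseg g = {})" unfolding EF_def .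
  then show "finite (EF E)" "card (EF E) \<le> 2" "E = \<Union>(fseg ` EF E)" "\<And>f. f \<in> EF E \<Longrightarrow> is_flag \<kappa> R f"
    "\<And>f g. f \<in> EF E \<Longrightarrow> g \<in> EF E \<Longrightarrow> f \<noteq> g \<Longrightarrow> foseg f \<inter> foseg g = {}" by blast+
qed

end

lemma point_on_seg: "0 \<le> s \<Longrightarrow> s \<le> 1 \<Longrightarrow> p + s *\<^sub>R (q - p) \<in> closed_segment p q" for p q :: pt
  using seg_line[of p 0 "q - p" 1] by (auto simp: closed_segment_eq_real_ivl)

context ring begin

definition edges :: "pt set set" where "edges = {E. is_edge (frontier R) E}"

lemma edge_on_segment:
  assumes E: "is_edge (frontier R) E" and f: "f \<in> EF E" and inf: "infinite (foseg f \<inter> closed_segment p q)"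
  shows "\<exists>\<alpha> \<beta> \<upsilon>. E = (\<lambda>\<tau>. p + \<tau> *\<^sub>R (q - p)) ` {\<alpha>..\<beta>} \<and> \<upsilon> \<in> {\<alpha>..\<beta>} \<and> 0 \<le> \<upsilon> \<and> \<upsilon> \<le> 1 \<and> p + \<upsilon> *\<^sub>R (q - p) \<in> foseg f"
proof -
  have sub: "foseg f \<subseteq> E" using EF(3)[OF E] f foseg_sub by blast
  have ex: "\<exists>\<tau>. x = p + \<tau> *\<^sub>R (q - p) \<and> 0 \<le> \<tau> \<and> \<tau> \<le> 1" if "x \<in> closed_segment p q" for x
    using that by (auto simp: closed_segment_def algebra_simps)
  obtain u where u: "u \<in> foseg f \<inter> closed_segment p q" using inf by (metis all_not_in_conv finite.emptyI)
  have "infinite (foseg f \<inter> closed_segment p q - {u})" using inf by simp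
  then obtain v where v: "v \<in> foseg f \<inter> closed_segment p q" "v \<noteq> u" by (metis Diff_iff all_not_in_conv finite.emptyI insertI1)
  obtain \<tau> \<tau>' where t: "u = p + \<tau> *\<^sub>R (q - p)" "0 \<le> \<tau>" "\<tau> \<le> 1" "v = p + \<tau>' *\<^sub>R (q - p)" using ex u v by blast
  have uE: "u \<in> E" "v \<in> E" using u v sub by auto
  obtain \<alpha> \<beta> where ab: "E = (\<lambda>\<tau>. p + \<tau> *\<^sub>R (q - p)) ` {\<alpha>..\<beta>}" 
    using edge_line[OF E uE v(2)[symmetric] t(1,4)] by metis
  have "q - p \<noteq> 0" using t(1,4) v(2) by auto
  then have "\<tau> \<in> {\<alpha>..\<beta>}" using uE(1) t(1) unfolding ab by auto
  then show ?thesis using ab t u by blast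
qed

lemma between_Q2:
  fixes p d :: pt
  assumes "p + \<tau> *\<^sub>R d \<in> Q2" "p + \<gamma> *\<^sub>R d \<in> Q2" "\<mu> \<in> closed_segment \<tau> \<gamma>"
  shows "p + \<mu> *\<^sub>R d \<in> Q2"
proof -
  have "closed_segment (p + \<tau> *\<^sub>R d) (p + \<gamma> *\<^sub>R d) \<subseteq> Q2" using assms Q2(2) by (simp add: closed_segment_subset)
  then show ?thesis unfolding seg_line using assms(3) by blast
qed

text \<open>On a side of \<open>Q1\<close> no inner point of a flag lies in \<open>Q2\<close>. As
  \<open>Q2\<close> meets the side in an interval, at most two pieces remain, and they are told
  apart by their position relative to one parameter \<open>\<gamma>\<close> of that
  interval.\<close>

lemma same_edge_outer:
  assumes E: "is_edge (frontier R) E" "f \<in> EF E" "E = (\<lambda>\<tau>. p + \<tau> *\<^sub>R (q - p)) ` {\<alpha>..\<beta>}" "\<upsilon> \<in> {\<alpha>..\<beta>}" "0 \<le> \<upsilon>" "\<upsilon> \<le> 1" "p + \<upsilon> *\<^sub>R (q - p) \<in> foseg f"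
    and E': "is_edge (frontier R) E'" "f' \<in> EF E'" "E' = (\<lambda>\<tau>. p + \<tau> *\<^sub>R (q - p)) ` {\<alpha>'..\<beta>'}" "\<upsilon>' \<in> {\<alpha>'..\<beta>'}" "0 \<le> \<upsilon>'" "\<upsilon>' \<le> 1" "p + \<upsilon>' *\<^sub>R (q - p) \<in> foseg f'"
    and pq: "closed_segment p q \<subseteq> frontier Q1"
    and g: "\<And>\<tau>. 0 \<le> \<tau> \<Longrightarrow> \<tau> \<le> 1 \<Longrightarrow> p + \<tau> *\<^sub>R (q - p) \<in> Q2 \<Longrightarrow> p + \<gamma> *\<^sub>R (q - p) \<in> Q2"
    and b: "\<upsilon> \<le> \<gamma> \<longleftrightarrow> \<upsilon>' \<le> \<gamma>"
  shows "E = E'"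
proof (rule edge_merge[OF E(1,3,4) E'(1,3,4)])
  fix \<tau> assume t: "min \<upsilon> \<upsilon>' \<le> \<tau>" "\<tau> \<le> max \<upsilon> \<upsilon>'"
  have t01: "0 \<le> \<tau>" "\<tau> \<le> 1" using t E(5,6) E'(5,6) by auto
  have fr: "p + s *\<^sub>R (q - p) \<in> frontier Q1" if "0 \<le> s" "s \<le> 1" for s
    using pq point_on_seg[OF that] by blast
  have nQ: "p + \<upsilon> *\<^sub>R (q - p) \<notin> Q2" "p + \<upsilon>' *\<^sub>R (q - p) \<notin> Q2"
    using flag_not_double[OF EF(4)[OF E(1,2)] E(7)] flag_not_double[OF EF(4)[OF E'(1,2)] E'(7)] fr E(5,6) E'(5,6) by blast+
  have "p + \<tau> *\<^sub>R (q - p) \<notin> Q2"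
  proof
    assume tQ: "p + \<tau> *\<^sub>R (q - p) \<in> Q2"
    then have gQ: "p + \<gamma> *\<^sub>R (q - p) \<in> Q2" using g t01 by blast
    define \<mu> where "\<mu> = (if \<upsilon> \<le> \<gamma> then max \<upsilon> \<upsilon>' else min \<upsilon> \<upsilon>')"
    have "\<mu> \<in> closed_segment \<tau> \<gamma>" using t b by (auto simp: \<mu>_def closed_segment_eq_real_ivl)
    from between_Q2[OF tQ gQ this] show False using nQ by (auto simp: \<mu>_def max_def min_def split: if_splits)
  qed
  then show "p + \<tau> *\<^sub>R (q - p) \<in> frontier R" using frontier1 fr t01 by blast
qed

text \<open>On a side of \<open>Q2\<close> the inner points of flags lie in the interior of
  \<open>Q1\<close>, and by convexity so does everything between two of them. The bridge then
  belongs to the frontier of R and merges the edges.\<close>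

lemma same_edge_inner:
  assumes E: "is_edge (frontier R) E" "f \<in> EF E" "E = (\<lambda>\<tau>. p + \<tau> *\<^sub>R (q - p)) ` {\<alpha>..\<beta>}" "\<upsilon> \<in> {\<alpha>..\<beta>}" "0 \<le> \<upsilon>" "\<upsilon> \<le> 1" "p + \<upsilon> *\<^sub>R (q - p) \<in> foseg f"
    and E': "is_edge (frontier R) E'" "f' \<in> EF E'" "E' = (\<lambda>\<tau>. p + \<tau> *\<^sub>R (q - p)) ` {\<alpha>'..\<beta>'}" "\<upsilon>' \<in> {\<alpha>'..\<beta>'}" "0 \<le> \<upsilon>'" "\<upsilon>' \<le> 1" "p + \<upsilon>' *\<^sub>R (q - p) \<in> foseg f'"
    and pq: "closed_segment p q \<subseteq> frontier Q2"
  shows "E = E'"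
proof (rule edge_merge[OF E(1,3,4) E'(1,3,4)])
  fix \<tau> assume t: "min \<upsilon> \<upsilon>' \<le> \<tau>" "\<tau> \<le> max \<upsilon> \<upsilon>'"
  have t01: "0 \<le> \<tau>" "\<tau> \<le> 1" using t E(5,6) E'(5,6) by auto
  have fr: "p + s *\<^sub>R (q - p) \<in> frontier Q2" if "0 \<le> s" "s \<le> 1" for s
    using pq point_on_seg[OF that] by blast
  have fQ: "frontier Q2 \<subseteq> Q2" using closedQ frontier_subset_closed by blast
  have int: "z \<in> interior Q1" if "z \<in> Q2" "z \<notin> frontier Q1" for z
    using that Q12 closure_subset by (auto simp: frontier_def)
  have i1: "p + \<upsilon> *\<^sub>R (q - p) \<in> interior Q1"
    using flag_not_double[OF EF(4)[OF E(1,2)] E(7)] fr[OF E(5,6)] fQ int by blast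
  have i2: "p + \<upsilon>' *\<^sub>R (q - p) \<in> interior Q1"
    using flag_not_double[OF EF(4)[OF E'(1,2)] E'(7)] fr[OF E'(5,6)] fQ int by blast
  have "closed_segment (p + \<upsilon> *\<^sub>R (q - p)) (p + \<upsilon>' *\<^sub>R (q - p)) \<subseteq> interior Q1"
    using i1 i2 convex_interior[OF Q1(2)] by (simp add: closed_segment_subset)
  moreover have "\<tau> \<in> closed_segment \<upsilon> \<upsilon>'" using t by (auto simp: closed_segment_eq_real_ivl)
  ultimately have "p + \<tau> *\<^sub>R (q - p) \<in> interior Q1" unfolding seg_line by blast
  then show "p + \<tau> *\<^sub>R (q - p) \<in> frontier R" using frontier2 fr t01 by blast
qed

text \<open>Each edge shares infinitely many points with one of the at most \<open>2 * N0\<close>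
  sides of the two polygons. This side, with the position relative to a gap cut out by
  \<open>Q2\<close>, determines the edge; two positions for each side give
  \<open>4 * N0\<close>.\<close>

lemma edges_card: "finite edges \<and> card edges \<le> 4 * N0"
proof -
  have pb: "polygonal_boundary N0 Q1" "polygonal_boundary N0 Q2" using pr by (simp_all add: pring_def)
  obtain P1 where P1: "finite P1" "card P1 \<le> N0" "frontier Q1 = (\<Union>(a,b)\<in>P1. closed_segment a b)"
    using pb(1) unfolding polygonal_boundary_def by metis
  obtain P2 where P2: "finite P2" "card P2 \<le> N0" "frontier Q2 = (\<Union>(a,b)\<in>P2. closed_segment a b)"
    using pb(2) unfolding polygonal_boundary_def by metis
  define seg where "seg = (\<lambda>k::pt \<times> pt. closed_segment (fst k) (snd k))"
  define pnt where "pnt = (\<lambda>k::pt \<times> pt. \<lambda>\<tau>::real. fst k + \<tau> *\<^sub>R (snd k - fst k))"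
  \<comment> \<open>A parameter at which side k runs through \<open>Q2\<close>; it is arbitrary if
    there is none, and then no gap separates the edges.\<close>
  define \<gamma> where "\<gamma> = (\<lambda>k. SOME \<tau>. 0 \<le> \<tau> \<and> \<tau> \<le> 1 \<and> pnt k \<tau> \<in> Q2)"
  have \<gamma>: "pnt k (\<gamma> k) \<in> Q2" if "0 \<le> \<tau>" "\<tau> \<le> 1" "pnt k \<tau> \<in> Q2" for k \<tau>
  proof -
    have "\<exists>\<tau>. 0 \<le> \<tau> \<and> \<tau> \<le> 1 \<and> pnt k \<tau> \<in> Q2" using that by blast
    from someI_ex[OF this] show ?thesis unfolding \<gamma>_def by simp
  qed
  define good where "good = (\<lambda>E (f, k, \<alpha>, \<beta>, \<upsilon>). f \<in> EF E \<and> E = pnt k ` {\<alpha>..\<beta>} \<and> \<upsilon> \<in> {\<alpha>..\<beta>} \<and> 0 \<le> \<upsilon> \<and> \<upsilon> \<le> 1 \<and> pnt k \<upsilon> \<in> foseg f)"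
  have ex: "\<exists>d. good E d \<and> fst (snd d) \<in> P1 \<union> P2" if E: "E \<in> edges" for E
  proof -
    have E': "is_edge (frontier R) E" using E by (simp add: edges_def)
    then obtain A B where AB: "A \<noteq> B" "E = closed_segment A B" by (auto simp: is_edge_def)
    then have "E \<noteq> {}" by auto
    then have "EF E \<noteq> {}" using EF(3)[OF E'] by auto
    then obtain f where f: "f \<in> EF E" by blast
    obtain a e L where fl: "f = (a, e, L)" by (cases f)
    have eL: "norm e = 1" "L > 0" using EF(4)[OF E' f] by (auto simp: is_flag_def fl)
    have "infinite (foseg f)"
    proof
      assume "finite (foseg f)"
      moreover have "inj_on (\<lambda>t. fr a e t 0) {0<..<L}" using fr_eq_iff[OF eL(1)] by (auto simp: inj_on_def)
      ultimately have "finite {0<..<L}" unfolding foseg_def fl by (auto dest: finite_imageD)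
      then show False using eL(2) infinite_Ioo[of 0 L] by simp
    qed
    moreover have "foseg f \<subseteq> (\<Union>k\<in>P1 \<union> P2. foseg f \<inter> seg k)"
    proof -
      have "foseg f \<subseteq> frontier R" using EF(3)[OF E'] f foseg_sub[of f] E' by (auto simp: is_edge_def)
      also have "\<dots> \<subseteq> (\<Union>k\<in>P1 \<union> P2. seg k)" using frontier_sub unfolding P1(3) P2(3) seg_def case_prod_beta by blast
      finally show ?thesis by blast
    qed
    ultimately have "infinite (\<Union>k\<in>P1 \<union> P2. foseg f \<inter> seg k)" using finite_subset by blast
    then obtain k where k: "k \<in> P1 \<union> P2" "infinite (foseg f \<inter> seg k)" using P1(1) P2(1) by blast
    obtain \<alpha> \<beta> \<upsilon> where "E = pnt k ` {\<alpha>..\<beta>}" "\<upsilon> \<in> {\<alpha>..\<beta>}" "0 \<le> \<upsilon>" "\<upsilon> \<le> 1" "pnt k \<upsilon> \<in> foseg f"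
      using edge_on_segment[OF E' f k(2)[unfolded seg_def]] unfolding pnt_def by blast
    then have "good E (f, k, \<alpha>, \<beta>, \<upsilon>)" using f by (simp add: good_def)
    then show ?thesis using k(1) by (intro exI[of _ "(f, k, \<alpha>, \<beta>, \<upsilon>)"]) simp
  qed
  define D where "D = (\<lambda>E. SOME d. good E d \<and> fst (snd d) \<in> P1 \<union> P2)"
  have D: "good E (D E) \<and> fst (snd (D E)) \<in> P1 \<union> P2" if "E \<in> edges" for E
    unfolding D_def using someI_ex[OF ex[OF that]] .
  define kk where "kk = (\<lambda>E. fst (snd (D E)))"
  define uu where "uu = (\<lambda>E. snd (snd (snd (snd (D E)))))"
  define key where "key = (\<lambda>E. (kk E, uu E \<le> \<gamma> (kk E)))"
  have "inj_on key edges"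
  proof (rule inj_onI)
    fix E E' assume E: "E \<in> edges" "E' \<in> edges" "key E = key E'"
    obtain f k \<alpha> \<beta> \<upsilon> where d: "D E = (f, k, \<alpha>, \<beta>, \<upsilon>)" by (metis prod_cases5)
    obtain f' k' \<alpha>' \<beta>' \<upsilon>' where d': "D E' = (f', k', \<alpha>', \<beta>', \<upsilon>')" by (metis prod_cases5)
    have kk': "k' = k" and b: "\<upsilon> \<le> \<gamma> k \<longleftrightarrow> \<upsilon>' \<le> \<gamma> k" using E(3) by (auto simp: key_def kk_def uu_def d d')
    have g: "f \<in> EF E" "E = pnt k ` {\<alpha>..\<beta>}" "\<upsilon> \<in> {\<alpha>..\<beta>}" "0 \<le> \<upsilon>" "\<upsilon> \<le> 1" "pnt k \<upsilon> \<in> foseg f" "k \<in> P1 \<union> P2"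
      using D[OF E(1)] by (auto simp: d good_def)
    have g': "f' \<in> EF E'" "E' = pnt k ` {\<alpha>'..\<beta>'}" "\<upsilon>' \<in> {\<alpha>'..\<beta>'}" "0 \<le> \<upsilon>'" "\<upsilon>' \<le> 1" "pnt k \<upsilon>' \<in> foseg f'"
      using D[OF E(2)] by (auto simp: d' kk' good_def)
    have e: "is_edge (frontier R) E" "is_edge (frontier R) E'" using E by (auto simp: edges_def)
    show "E = E'"
    proof (cases "k \<in> P1")
      case True
      then have "closed_segment (fst k) (snd k) \<subseteq> frontier Q1" using P1(3) by auto
      then show ?thesis
        by (rule same_edge_outer[OF e(1) g(1-6)[unfolded pnt_def] e(2) g'[unfolded pnt_def] _ \<gamma>[of _ k, unfolded pnt_def] b])
    next
      case False
      then have "closed_segment (fst k) (snd k) \<subseteq> frontier Q2" using P2(3) g(7) by auto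
      then show ?thesis
        by (rule same_edge_inner[OF e(1) g(1-6)[unfolded pnt_def] e(2) g'[unfolded pnt_def]])
    qed
  qed
  moreover have "key ` edges \<subseteq> (P1 \<union> P2) \<times> UNIV"
  proof
    fix x assume "x \<in> key ` edges"
    then obtain E where "E \<in> edges" "x = key E" by blast
    then show "x \<in> (P1 \<union> P2) \<times> UNIV" using D[of E] unfolding key_def kk_def mem_Times_iff by simp
  qed
  moreover have fK: "finite ((P1 \<union> P2) \<times> (UNIV::bool set))" using P1 P2 by simp
  ultimately have "finite edges" "card edges \<le> card ((P1 \<union> P2) \<times> (UNIV::bool set))"
    using inj_on_finite card_inj_on_le by metis+
  moreover have "card ((P1 \<union> P2) \<times> (UNIV::bool set)) \<le> 4 * N0"
    using card_Un_le[of P1 P2] P1(2) P2(2) by (simp add: card_cartesian_product)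
  ultimately show ?thesis by simp
qed

definition flags :: "flag set" where "flags = (\<Union>E\<in>edges. EF E)"

lemma finite_flags: "finite flags"
  unfolding flags_def using edges_card EF(1) by (auto simp: edges_def)

lemma card_flags: "card flags \<le> 8 * N0"
proof -
  have "card flags \<le> (\<Sum>E\<in>edges. card (EF E))" unfolding flags_def using edges_card by (intro card_UN_le) simp
  also have "\<dots> \<le> (\<Sum>E\<in>edges. 2)" using EF(2) by (intro sum_mono) (simp add: edges_def)
  finally show ?thesis using edges_card by simp
qed

lemma flags_flag: "f \<in> flags \<Longrightarrow> is_flag \<kappa> R f"
  using EF(4) unfolding flags_def edges_def by blast

lemma flags_frontier: "f \<in> flags \<Longrightarrow> fseg f \<subseteq> frontier R"
  using EF(3) unfolding flags_def edges_def is_edge_def by blast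

lemma flag_line:
  assumes "is_flag \<kappa> R (a, e, L)"
  shows "a \<in> fseg (a, e, L)" "a + L *\<^sub>R e \<in> fseg (a, e, L)" "a \<noteq> a + L *\<^sub>R e"
  using assms by (auto simp: is_flag_def fseg_def fr_def image_iff intro: bexI[of _ 0] bexI[of _ L])

lemma flag_edge_line:
  assumes E: "is_edge \<B> E" and f: "is_flag \<kappa> R (a, e, L)" "fseg (a, e, L) \<subseteq> E"
  obtains \<alpha> \<beta> where "E = (\<lambda>\<tau>. a + \<tau> *\<^sub>R e) ` {\<alpha>..\<beta>}"
proof -
  have "a \<in> E" "a + L *\<^sub>R e \<in> E" using flag_line(1,2)[OF f(1)] f(2) by blast+
  moreover have "a = a + 0 *\<^sub>R e" by simp
  ultimately show ?thesis using edge_line[OF E _ _ flag_line(3)[OF f(1)] _ refl] that by metis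
qed

lemma flag_param:
  assumes fl: "is_flag \<kappa> R (a', e', L')" and y: "fr a e t 0 \<in> fseg (a', e', L')" and par: "e' = e \<or> e' = - e"
  shows "\<exists>\<tau> \<tau>'. a' = a + \<tau> *\<^sub>R e \<and> a' + L' *\<^sub>R e' = a + \<tau>' *\<^sub>R e"
proof -
  obtain t' where t': "fr a e t 0 = fr a' e' t' 0" using y unfolding fseg_def by force
  obtain \<sigma> where s: "e' = \<sigma> *\<^sub>R e" using par by (metis scaleR_minus_left scaleR_one)
  have "a' = a + (t - t' * \<sigma>) *\<^sub>R e" using t' unfolding s by (simp add: fr_def algebra_simps)
  moreover from this have "a' + L' *\<^sub>R e' = a + (t - t' * \<sigma> + L' * \<sigma>) *\<^sub>R e" unfolding s by (simp add: algebra_simps)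
  ultimately show ?thesis by blast
qed

text \<open>Parallel flags with a common inner point lie on one line, so their edges touch and
  coincide; and the flags of a single edge do not overlap.\<close>

lemma flags_disjoint:
  assumes f: "(a, e, L) \<in> flags" "(a', e', L') \<in> flags" and y: "y \<in> foseg (a, e, L)" "y \<in> foseg (a', e', L')" and par: "e' = e \<or> e' = - e"
  shows "(a, e, L) = (a', e', L')"
proof -
  obtain E where E: "is_edge (frontier R) E" "(a, e, L) \<in> EF E" using f(1) by (auto simp: flags_def edges_def)
  obtain E' where E': "is_edge (frontier R) E'" "(a', e', L') \<in> EF E'" using f(2) by (auto simp: flags_def edges_def)
  have fl: "is_flag \<kappa> R (a, e, L)" "is_flag \<kappa> R (a', e', L')" using f flags_flag by auto
  obtain t where t: "y = fr a e t 0" using y(1) by (auto simp: foseg_def)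
  have sub: "fseg (a, e, L) \<subseteq> E" "fseg (a', e', L') \<subseteq> E'" using EF(3)[OF E(1)] EF(3)[OF E'(1)] E(2) E'(2) by blast+
  have yy: "y \<in> E" "y \<in> E'" "y \<in> fseg (a', e', L')" using y sub foseg_sub by blast+
  obtain \<alpha> \<beta> where ab: "E = (\<lambda>\<tau>. a + \<tau> *\<^sub>R e) ` {\<alpha>..\<beta>}"
    using flag_edge_line[OF E(1) fl(1) sub(1)] by metis
  obtain \<tau> \<tau>' where tt: "a' = a + \<tau> *\<^sub>R e" "a' + L' *\<^sub>R e' = a + \<tau>' *\<^sub>R e" using flag_param[OF fl(2) yy(3)[unfolded t] par] by blast
  obtain \<alpha>' \<beta>' where ab': "E' = (\<lambda>\<tau>. a + \<tau> *\<^sub>R e) ` {\<alpha>'..\<beta>'}"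
    using edge_line[OF E'(1) subsetD[OF sub(2) flag_line(1)[OF fl(2)]] subsetD[OF sub(2) flag_line(2)[OF fl(2)]] flag_line(3)[OF fl(2)] tt] by metis
  have e0: "e \<noteq> 0" using fl(1) by (auto simp: is_flag_def)
  have "t \<in> {\<alpha>..\<beta>}" "t \<in> {\<alpha>'..\<beta>'}" using yy(1,2) e0 unfolding ab ab' t fr_def by auto
  then have "E = E'"
  proof (rule edge_merge[OF E(1) ab _ E'(1) ab'])
    fix \<tau> assume "min t t \<le> \<tau>" "\<tau> \<le> max t t"
    then have "a + \<tau> *\<^sub>R e = y" using t by (simp add: fr_def)
    then show "a + \<tau> *\<^sub>R e \<in> frontier R" using yy(1) E(1) by (auto simp: is_edge_def)
  qed
  then show ?thesis using EF(5)[OF E(1,2)] E'(2) y by blast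
qed

lemma flags_cover:
  assumes uv: "u \<noteq> v" "closed_segment u v \<subseteq> frontier R" "x \<in> closed_segment u v"
  obtains a e L c where "(a, e, L) \<in> flags" "x \<in> fseg (a, e, L)" "v - u = c *\<^sub>R e"
proof -
  obtain E where E: "is_edge (frontier R) E" "closed_segment u v \<subseteq> E" using edge_exists[OF closed_frontier_R uv(1,2)] by blast
  then obtain f where f: "f \<in> EF E" "x \<in> fseg f" using EF(3)[OF E(1)] uv(3) by blast
  obtain a e L where fl: "f = (a, e, L)" by (cases f)
  have fF: "(a, e, L) \<in> flags" using f(1) E(1) by (auto simp: flags_def edges_def fl)
  have "fseg f \<subseteq> E" using EF(3)[OF E(1)] f(1) by blast
  then obtain \<alpha> \<beta> where ab: "E = (\<lambda>\<tau>. a + \<tau> *\<^sub>R e) ` {\<alpha>..\<beta>}"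
    using flag_edge_line[OF E(1) flags_flag[OF fF]] unfolding fl by metis
  have "u \<in> E" "v \<in> E" using E(2) by auto
  then obtain \<tau> \<tau>' where "u = a + \<tau> *\<^sub>R e" "v = a + \<tau>' *\<^sub>R e" unfolding ab by blast
  then have "v - u = (\<tau>' - \<tau>) *\<^sub>R e" by (simp add: algebra_simps)
  then show ?thesis using that fF f(2) fl by blast
qed

text \<open>Origin of the slope \<open>\<kappa> / (2 + \<kappa>)\<close>: a point of the disc of
  radius s about \<open>fr a e t s\<close>, other than the foot, has height between 0 and 2 * s and
  abscissa within s of t. Because \<open>(2 + \<kappa>) * s < \<kappa> * min t (L - t)\<close>, it
  lies in the large triangle and hence in the interior of R.\<close>

lemma foot_unique:
  assumes f: "(a, e, L) \<in> flags" and z: "0 < t" "t < L" "0 < s" "s < \<kappa> / (2 + \<kappa>) * min t (L - t)"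
    and w: "w \<in> frontier R" "dist (fr a e t s) w \<le> s"
  shows "w = fr a e t 0"
proof -
  have fl: "is_flag \<kappa> R (a, e, L)" using flags_flag[OF f] .
  have e: "norm e = 1" using fl by (simp add: is_flag_def)
  obtain t1 s1 where ts: "w = fr a e t1 s1" using fr_ex[OF e] by blast
  have "(t - t1)\<^sup>2 + (s - s1)\<^sup>2 \<le> s\<^sup>2" using w(2) unfolding ts dist_fr[OF e] by (simp add: sqrt_le_D)
  then have q: "(t - t1)\<^sup>2 + s1\<^sup>2 \<le> 2 * s * s1" by (simp add: power2_eq_square algebra_simps)
  then have "0 \<le> 2 * s * s1" by (smt (verit) zero_le_power2)
  then have s1: "0 \<le> s1" using z(3) by (simp add: zero_le_mult_iff)
  show ?thesis
  proof (cases "s1 = 0")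
    case True then show ?thesis using q by (simp add: ts)
  next
    case False
    then have s1p: "0 < s1" using s1 by simp
    have "s1 * s1 \<le> 2 * s * s1" using q zero_le_power2[of "t - t1"] unfolding power2_eq_square by linarith
    then have s12: "s1 \<le> 2 * s" using s1p by simp
    have "(t - t1)\<^sup>2 \<le> s\<^sup>2" using \<open>(t - t1)\<^sup>2 + (s - s1)\<^sup>2 \<le> s\<^sup>2\<close> zero_le_power2[of "s - s1"] by linarith
    then have tt: "\<bar>t - t1\<bar> \<le> s" using z(3) by (simp add: abs_le_square_iff[symmetric])
    have kk: "s * (2 + \<kappa>) < \<kappa> * min t (L - t)" using z(4) k by (simp add: field_simps)
    have "min t1 (L - t1) \<ge> min t (L - t) - s" using tt by linarith
    then have "\<kappa> * (min t (L - t) - s) \<le> \<kappa> * min t1 (L - t1)" using k by (intro mult_left_mono) auto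
    then have lt: "s1 < \<kappa> * min t1 (L - t1)" using kk s12 by (simp add: algebra_simps)
    then have "0 < \<kappa> * min t1 (L - t1)" using s1p by linarith
    then have "0 < min t1 (L - t1)" using k by (simp add: zero_less_mult_iff del: min_less_iff_conj)
    then have "w \<in> tri \<kappa> a e L" unfolding ts fr_in_tri[OF e] using s1p lt by auto
    then have "w \<in> interior R" using flag_tri[OF fl] by (auto simp: ftri_def)
    then show ?thesis using w(1) by (simp add: frontier_def)
  qed
qed

text \<open>Shrinking the slope keeps each triangle closer to its own edge than to any other edge of the ring.\<close>
lemma tri_disjoint:
  assumes f: "f \<in> flags" "g \<in> flags" and z: "z \<in> ftri (\<kappa> / (2 + \<kappa>)) f" "z \<in> ftri (\<kappa> / (2 + \<kappa>)) g"
  shows "f = g"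
proof -
  obtain a e L where fl: "f = (a, e, L)" by (cases f)
  obtain a' e' L' where gl: "g = (a', e', L')" by (cases g)
  have e: "norm e = 1" "norm e' = 1" using flags_flag[OF f(1)] flags_flag[OF f(2)] by (auto simp: is_flag_def fl gl)
  obtain t s where ts: "z = fr a e t s" "0 < t" "t < L" "0 < s" "s < \<kappa> / (2 + \<kappa>) * min t (L - t)" using z(1) by (auto simp: fl ftri_def tri_def)
  obtain t' s' where ts': "z = fr a' e' t' s'" "0 < t'" "t' < L'" "0 < s'" "s' < \<kappa> / (2 + \<kappa>) * min t' (L' - t')" using z(2) by (auto simp: gl ftri_def tri_def)
  define y y' where "y = fr a e t 0" and "y' = fr a' e' t' 0"
  have yo: "y \<in> foseg f" "y' \<in> foseg g" using ts ts' by (auto simp: y_def y'_def foseg_def fl gl)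
  then have yf: "y \<in> frontier R" "y' \<in> frontier R" using flags_frontier f foseg_sub by blast+
  have d: "dist z y = s" unfolding ts(1) y_def dist_fr[OF e(1)] using ts(4) by simp
  have d': "dist z y' = s'" unfolding ts'(1) y'_def dist_fr[OF e(2)] using ts'(4) by simp
  \<comment> \<open>The disc with the larger of the two radii contains both feet, and it has only
    one frontier point.\<close>
  have yy: "y = y'"
  proof (cases "s \<le> s'")
    case True
    then have "dist (fr a' e' t' s') y \<le> s'" using d ts'(1) by simp
    then show ?thesis using foot_unique[OF f(2)[unfolded gl] ts'(2-5) yf(1)] by (simp add: y'_def)
  next
    case False
    then have "dist (fr a e t s) y' \<le> s" using d' ts(1) by simp
    then show ?thesis using foot_unique[OF f(1)[unfolded fl] ts(2-5) yf(2)] by (simp add: y_def)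
  qed
  then have "s = s'" using d d' by simp
  moreover have "z - y = s *\<^sub>R rot e" unfolding ts(1) y_def by (simp add: fr_def)
  moreover have "z - y' = s' *\<^sub>R rot e'" unfolding ts'(1) y'_def by (simp add: fr_def)
  ultimately have "rot e = rot e'" using yy ts(4) by simp
  then have "rot (rot e) = rot (rot e')" by simp
  then have "e = e'" by simp
  then show ?thesis using flags_disjoint[of a e L a' e' L' y] f yo yy fl gl by simp
qed

lemma small_tri_sub: "f \<in> flags \<Longrightarrow> ftri (\<kappa> / (2 + \<kappa>)) f \<subseteq> interior R"
proof -
  assume f: "f \<in> flags"
  have "tri (\<kappa> / (2 + \<kappa>)) a e L \<subseteq> tri \<kappa> a e L" for a e L
  proof
    fix z assume "z \<in> tri (\<kappa> / (2 + \<kappa>)) a e L"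
    then obtain t s where ts: "z = fr a e t s" "0 < t" "t < L" "0 < s" "s < \<kappa> / (2 + \<kappa>) * min t (L - t)" by (auto simp: tri_def)
    have "\<kappa> / (2 + \<kappa>) * min t (L - t) \<le> \<kappa> * min t (L - t)" using k ts by (intro mult_right_mono) (auto simp: field_simps)
    then show "z \<in> tri \<kappa> a e L" using ts unfolding tri_def by (intro CollectI exI[of _ t] exI[of _ s]) auto
  qed
  then show ?thesis using flag_tri[OF flags_flag[OF f]] unfolding ftri_def by (cases f) (simp, blast)
qed

end

section \<open>Triangles over the edges\<close>

lemma min_scale:
  fixes \<kappa> u v s :: real
  assumes "0 < \<kappa>"
  shows "s \<le> \<kappa> * min u v \<longleftrightarrow> s \<le> \<kappa> * u \<and> s \<le> \<kappa> * v" "s < \<kappa> * min u v \<longleftrightarrow> s < \<kappa> * u \<and> s < \<kappa> * v"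
  using assms by (cases "u \<le> v"; simp add: min_def; meson mult_left_mono less_imp_le less_le_trans order_trans not_le)+

lemma regular_interior:
  assumes "regular_set c0 Q" shows "compact Q" "convex Q" "interior Q \<noteq> {}"
proof -
  obtain x2 r2 where r: "r2 > 0" "cball x2 r2 \<subseteq> Q" and "compact Q" "convex Q" using assms unfolding regular_set_def by metis
  then show "compact Q" "convex Q" by auto
  have "x2 \<in> interior Q" unfolding mem_interior using r ball_subset_cball by blast
  then show "interior Q \<noteq> {}" by blast
qed

text \<open>The two inequalities place the point below both legs of the triangle; the weights are
  its barycentric coordinates, with w the weight of the apex.\<close>

lemma point_in_hull3:
  assumes L: "L > 0" and s2: "s2 > 0" and h: "0 \<le> s" "s * t2 \<le> t * s2" "s * (L - t2) \<le> (L - t) * s2"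
  shows "fr a e t s \<in> convex hull {a, fr a e L 0, fr a e t2 s2}"
proof -
  define w where "w = s / s2"
  define wb where "wb = (t - w * t2) / L"
  define wa where "wa = (L - t - w * (L - t2)) / L"
  have 1: "0 \<le> w" using h s2 by (simp add: w_def)
  have 2: "0 \<le> wb" using h s2 L by (simp add: wb_def w_def field_simps)
  have 3: "0 \<le> wa" using h s2 L by (simp add: wa_def w_def field_simps)
  have "wb * L = t - w * t2" "wa * L = L - t - w * (L - t2)" using L by (simp_all add: wa_def wb_def)
  then have 4: "(wa + wb + w) * L = 1 * L" by (simp add: algebra_simps)
  then have 4: "wa + wb + w = 1" using L by (simp only: mult_cancel_right) simp
  have "wb * L + w * t2 = t" "w * s2 = s" using L s2 by (simp_all add: wb_def w_def)
  then have "fr a e t s = wa *\<^sub>R a + wb *\<^sub>R fr a e L 0 + w *\<^sub>R fr a e t2 s2"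
  proof -
    have "wa *\<^sub>R a + wb *\<^sub>R fr a e L 0 + w *\<^sub>R fr a e t2 s2 = (wa + wb + w) *\<^sub>R a + (wb * L + w * t2) *\<^sub>R e + (w * s2) *\<^sub>R rot e"
      by (simp add: fr_def algebra_simps)
    also have "\<dots> = fr a e t s" using 4 \<open>wb * L + w * t2 = t\<close> \<open>w * s2 = s\<close> by (simp add: fr_def)
    finally show ?thesis by simp
  qed
  then show ?thesis unfolding convex_hull_3 using 1 2 3 4 by blast
qed

lemma flag_rev:
  assumes "norm e = 1"
  shows "fseg (a + L *\<^sub>R e, - e, L) = fseg (a, e, L)" "foseg (a + L *\<^sub>R e, - e, L) = foseg (a, e, L)"
proof -
  have eq: "fr (a + L *\<^sub>R e) (- e) t 0 = fr a e (L - t) 0" for t by (simp add: fr_def algebra_simps)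
  have "x \<in> (\<lambda>t. L - t) ` S" if "L - x \<in> S" for x S using that by (intro image_eqI[of _ _ "L - x"]) auto
  then have "(\<lambda>t. L - t) ` {0..L} = {0..L}" "(\<lambda>t. L - t) ` {0<..<L} = {0<..<L}" by auto
  then show "fseg (a + L *\<^sub>R e, - e, L) = fseg (a, e, L)" "foseg (a + L *\<^sub>R e, - e, L) = foseg (a, e, L)"
    unfolding fseg_def foseg_def split_conv eq
    using image_image[of "\<lambda>t. fr a e t 0" "\<lambda>t. L - t"] by metis+
qed

lemma segment_frame:
  fixes a b :: pt
  assumes "a \<noteq> b"
  obtains e L where "norm e = 1" "L > 0" "b = a + L *\<^sub>R e" "closed_segment a b = fseg (a, e, L)" "open_segment a b = foseg (a, e, L)"
proof -
  define L where "L = norm (b - a)"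
  define e where "e = (1 / L) *\<^sub>R (b - a)"
  have L: "L > 0" using assms by (simp add: L_def)
  have e: "norm e = 1" using L by (simp add: e_def L_def)
  have b: "b = a + L *\<^sub>R e" using L by (simp add: e_def)
  have c: "closed_segment a b = fseg (a, e, L)" using fseg_closed_segment[of L a e] L b by simp
  have inj: "inj (\<lambda>t. fr a e t 0)" using fr_eq_iff[OF e] by (auto simp: inj_def)
  have "fseg (a, e, L) - {a, b} = (\<lambda>t. fr a e t 0) ` ({0..L} - {0, L})"
    unfolding image_set_diff[OF inj] by (simp add: fseg_def b fr_def)
  moreover have "{0..L} - {0, L} = {0<..<L}" by auto
  ultimately have "open_segment a b = foseg (a, e, L)" unfolding open_segment_def c by (simp add: foseg_def)
  then show ?thesis using that e L b c by blast
qed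

text \<open>Equal base angles put the apex over the midpoint at height
  \<open>L / 2 * tan \<beta>\<close>, so every positive slope up to \<open>tan \<beta>\<close> is
  admissible. If the apex lies to the right of the segment from a to b, the flag runs from b to
  a.\<close>

lemma beta_flag:
  assumes bt: "beta_triangle \<beta> R a b" and \<beta>: "0 < \<beta>" "\<beta> \<le> pi / 3" and k: "0 < \<kappa>" "\<kappa> \<le> tan \<beta>"
  obtains f where "is_flag \<kappa> R f" "fseg f = closed_segment a b" "foseg f = open_segment a b"
proof -
  obtain p where ab: "a \<noteq> b" and p: "vec_angle (b - a) (p - a) = \<beta>" "vec_angle (a - b) (p - b) = \<beta>" "convex hull {a, b, p} \<subseteq> closure R"
    using bt unfolding beta_triangle_def by blast
  obtain e L where e: "norm e = 1" "L > 0" "b = a + L *\<^sub>R e" "closed_segment a b = fseg (a, e, L)" "open_segment a b = foseg (a, e, L)"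
    using segment_frame[OF ab] by metis
  obtain t s where ts: "p = fr a e t s" using fr_ex[OF e(1)] by blast
  have \<beta>2: "\<beta> < pi / 2" using \<beta>(2) pi_gt_zero by linarith
  have cb: "cos \<beta> > 0" using \<beta> \<beta>2 by (intro cos_gt_zero_pi) auto
  \<comment> \<open>For a zero vector \<open>vec_angle\<close> evaluates to \<open>arccos 0\<close>,
    that is \<open>pi / 2\<close>, which exceeds \<open>\<beta>\<close>; so the apex differs from a
    and b.\<close>
  have va: "u \<bullet> v = cos \<beta> * (norm u * norm v) \<and> v \<noteq> 0" if "vec_angle u v = \<beta>" "u \<noteq> 0" for u v :: pt
  proof -
    have v0: "v \<noteq> 0"
    proof
      assume "v = 0" then have "\<beta> = pi / 2" using that(1) by (simp add: vec_angle_def)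
      then show False using \<beta>2 by simp
    qed
    have "\<bar>u \<bullet> v\<bar> \<le> norm u * norm v" by (rule Cauchy_Schwarz_ineq2)
    then have "\<bar>(u \<bullet> v) / (norm u * norm v)\<bar> \<le> 1" using v0 that(2) by (simp add: abs_mult)
    then have "cos \<beta> = (u \<bullet> v) / (norm u * norm v)" using that(1) cos_arccos_abs unfolding vec_angle_def by metis
    then show ?thesis using v0 that(2) by simp
  qed
  have pa: "p - a = t *\<^sub>R e + s *\<^sub>R rot e" "b - a = L *\<^sub>R e" using ts e by (simp_all add: fr_def)
  have pb: "p - b = (t - L) *\<^sub>R e + s *\<^sub>R rot e" "a - b = (- L) *\<^sub>R e" using ts e by (simp_all add: fr_def algebra_simps)
  have n: "norm (p - a) = sqrt (t\<^sup>2 + s\<^sup>2)" "norm (p - b) = sqrt ((t - L)\<^sup>2 + s\<^sup>2)" unfolding pa pb norm_frame[OF e(1)] by simp_all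
  have "(b - a) \<bullet> (p - a) = L * t" "(a - b) \<bullet> (p - b) = L * (L - t)"
    unfolding pa pb using norm1_inner[OF e(1)] by (simp_all add: inner_add_right algebra_simps)
  moreover have "norm (b - a) = L" "norm (a - b) = L" unfolding pa pb using e by simp_all
  ultimately have "L * t = cos \<beta> * (L * sqrt (t\<^sup>2 + s\<^sup>2))" "L * (L - t) = cos \<beta> * (L * sqrt ((t - L)\<^sup>2 + s\<^sup>2))" "p \<noteq> a" "p \<noteq> b"
    using va[OF p(1)] va[OF p(2)] ab n by auto
  then have c: "t = cos \<beta> * sqrt (t\<^sup>2 + s\<^sup>2)" "L - t = cos \<beta> * sqrt ((t - L)\<^sup>2 + s\<^sup>2)" using e(2) by (simp_all add: mult.left_commute)
  have "sqrt (t\<^sup>2 + s\<^sup>2) > 0" "sqrt ((t - L)\<^sup>2 + s\<^sup>2) > 0" using n \<open>p \<noteq> a\<close> \<open>p \<noteq> b\<close> by (metis norm_eq_zero right_minus_eq zero_less_norm_iff)+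
  then have tp: "0 < t" "0 < L - t" using c cb by (metis mult_pos_pos)+
  have "t\<^sup>2 = (cos \<beta>)\<^sup>2 * (t\<^sup>2 + s\<^sup>2)" "(L - t)\<^sup>2 = (cos \<beta>)\<^sup>2 * ((t - L)\<^sup>2 + s\<^sup>2)"
    by (subst c, simp add: power_mult_distrib)+
  then have q: "t\<^sup>2 * (sin \<beta>)\<^sup>2 = (cos \<beta>)\<^sup>2 * s\<^sup>2" "(L - t)\<^sup>2 * (sin \<beta>)\<^sup>2 = (cos \<beta>)\<^sup>2 * s\<^sup>2"
    unfolding sin_squared_eq by (simp_all add: algebra_simps power2_commute)
  have sb: "sin \<beta> > 0" using \<beta> \<beta>2 by (intro sin_gt_zero) auto
  have "t\<^sup>2 * (sin \<beta>)\<^sup>2 = (L - t)\<^sup>2 * (sin \<beta>)\<^sup>2" unfolding q ..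
  moreover have "(sin \<beta>)\<^sup>2 \<noteq> 0" using sb by simp
  ultimately have "t\<^sup>2 = (L - t)\<^sup>2" using mult_right_cancel by blast
  then have t2: "t = L / 2" using tp by (simp add: power2_eq_iff)
  have "(t * sin \<beta>)\<^sup>2 = (cos \<beta> * \<bar>s\<bar>)\<^sup>2" using q(1) by (simp add: power_mult_distrib)
  then have "t * sin \<beta> = cos \<beta> * \<bar>s\<bar>" using tp sb cb by (subst (asm) power2_eq_iff_nonneg) auto
  then have s: "\<bar>s\<bar> = L / 2 * tan \<beta>" using cb t2 by (simp add: tan_def field_simps)
  have tb: "tan \<beta> > 0" using k by linarith
  have sp: "\<bar>s\<bar> > 0" unfolding s using tb e(2) by (intro mult_pos_pos) auto
  have key: "s' * (L / 2) \<le> t' * \<bar>s\<bar> \<and> s' * (L - L / 2) \<le> (L - t') * \<bar>s\<bar>" if "0 \<le> s'" "s' \<le> \<kappa> * min t' (L - t')" "0 \<le> t'" "t' \<le> L" for s' t'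
  proof -
    have "\<kappa> * min t' (L - t') \<le> tan \<beta> * min t' (L - t')" using k that by (intro mult_right_mono) auto
    then have "s' \<le> tan \<beta> * min t' (L - t')" using that by linarith
    moreover have "tan \<beta> * min t' (L - t') \<le> tan \<beta> * t'" "tan \<beta> * min t' (L - t') \<le> tan \<beta> * (L - t')" using tb by (intro mult_left_mono; auto)+
    ultimately have "s' * (L/2) \<le> tan \<beta> * t' * (L/2)" "s' * (L/2) \<le> tan \<beta> * (L - t') * (L/2)" using e(2) by (intro mult_right_mono; auto)+
    moreover have "L - L / 2 = L / 2" by simp
    ultimately show ?thesis unfolding s by (simp add: mult.commute mult.left_commute)
  qed
  show ?thesis
  proof (cases "s > 0")
    case True
    have "is_flag \<kappa> R (a, e, L)"
      unfolding is_flag_def split_conv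
    proof (intro conjI allI impI e(1,2))
      fix t' s' assume h: "0 \<le> t'" "t' \<le> L" "0 \<le> s'" "s' \<le> \<kappa> * min t' (L - t')"
      have "fr a e t' s' \<in> convex hull {a, fr a e L 0, fr a e (L/2) s}"
        using key[OF h(3,4,1,2)] True h by (intro point_in_hull3 e(2)) auto
      then show "fr a e t' s' \<in> closure R" using p(3) ts t2 e(3) by (auto simp: fr_def)
    qed
    then show ?thesis using that e by metis
  next
    case False
    have eqr: "fr b (- e) t' s' = fr a e (L - t') (- s')" for t' s' using e(3) by (simp add: fr_def algebra_simps)
    have "is_flag \<kappa> R (b, - e, L)"
      unfolding is_flag_def split_conv
    proof (intro conjI allI impI e(2))
      show "norm (- e) = 1" using e by simp
      fix t' s' assume h: "0 \<le> t'" "t' \<le> L" "0 \<le> s'" "s' \<le> \<kappa> * min t' (L - t')"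
      have "fr b (- e) t' s' \<in> convex hull {b, fr b (- e) L 0, fr b (- e) (L/2) (- s)}"
        using key[OF h(3,4,1,2)] False sp h by (intro point_in_hull3 e(2)) auto
      moreover have "fr b (- e) L 0 = a" "fr b (- e) (L/2) (- s) = p" unfolding eqr ts t2 by (simp_all add: fr_def)
      ultimately show "fr b (- e) t' s' \<in> closure R" using p(3) by (simp add: insert_commute subset_iff)
    qed
    moreover have "fseg (b, - e, L) = closed_segment a b" "foseg (b, - e, L) = open_segment a b"
      using flag_rev[OF e(1), of a L] e(3-5) by simp_all
    ultimately show ?thesis using that by metis
  qed
qed

lemma is_ring_pring:
  assumes r: "is_ring N0 c0 \<beta> R" and \<beta>: "0 < \<beta>" "\<beta> \<le> pi / 3" and k: "0 < \<kappa>" "\<kappa> \<le> tan \<beta>"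
  obtains Q1 Q2 where "pring \<kappa> N0 R Q1 Q2" "regular_set c0 Q1" "Q2 \<noteq> {} \<Longrightarrow> regular_set c0 Q2" "polygonal_boundary N0 Q1" "polygonal_boundary N0 Q2"
proof -
  obtain Q1 Q2 where Q: "R = Q1 - Q2" "Q2 \<subseteq> Q1 \<or> Q2 = {}" "regular_set c0 Q1" "polygonal_boundary N0 Q1"
    "Q2 \<noteq> {} \<Longrightarrow> regular_set c0 Q2 \<and> polygonal_boundary N0 Q2"
    using r unfolding is_ring_def by blast
  have pb2: "polygonal_boundary N0 Q2" using Q(5) by (cases "Q2 = {}") (auto simp: polygonal_boundary_def intro!: exI[of _ "{}"])
  have ed: "\<exists>F. finite F \<and> card F \<le> 2 \<and> E = \<Union>(fseg ` F) \<and> (\<forall>f\<in>F. is_flag \<kappa> R f) \<and>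
        (\<forall>f\<in>F. \<forall>g\<in>F. f \<noteq> g \<longrightarrow> foseg f \<inter> foseg g = {})" if E: "is_edge (frontier R) E" for E
  proof -
    have "(\<exists>a b. E = closed_segment a b \<and> beta_triangle \<beta> R a b) \<or>
        (\<exists>a1 b1 a2 b2. E = closed_segment a1 b1 \<union> closed_segment a2 b2 \<and>
           open_segment a1 b1 \<inter> open_segment a2 b2 = {} \<and> beta_triangle \<beta> R a1 b1 \<and> beta_triangle \<beta> R a2 b2)"
      using r E unfolding is_ring_def by blast
    then show ?thesis
    proof (elim disjE exE conjE)
      fix a b assume h: "E = closed_segment a b" "beta_triangle \<beta> R a b"
      obtain f where "is_flag \<kappa> R f" "fseg f = closed_segment a b" using beta_flag[OF h(2) \<beta> k] by metis
      then show ?thesis using h(1) by (intro exI[of _ "{f}"]) auto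
    next
      fix a b a' b' assume h: "E = closed_segment a b \<union> closed_segment a' b'" "open_segment a b \<inter> open_segment a' b' = {}"
        "beta_triangle \<beta> R a b" "beta_triangle \<beta> R a' b'"
      obtain f where f: "is_flag \<kappa> R f" "fseg f = closed_segment a b" "foseg f = open_segment a b" using beta_flag[OF h(3) \<beta> k] by metis
      obtain g where g: "is_flag \<kappa> R g" "fseg g = closed_segment a' b'" "foseg g = open_segment a' b'" using beta_flag[OF h(4) \<beta> k] by metis
      have "foseg f \<inter> foseg g = {}" "foseg g \<inter> foseg f = {}" using h(2) f(3) g(3) by blast+
      then show ?thesis using h(1) f(1,2) g(1,2) by (intro exI[of _ "{f, g}"]) (auto simp: card_insert_if)
    qed
  qed
  have "pring \<kappa> N0 R Q1 Q2"
    unfolding pring_def using regular_interior[OF Q(3)] regular_interior[of c0 Q2] Q pb2 ed by (cases "Q2 = {}") auto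
  then show ?thesis using that Q pb2 by blast
qed

text \<open>Here the flags come from regularity. The triangle spanned by an edge and the centre of
  the inner ball has height at least r2, while distances in H are at most
  \<open>2 * c0 * r2\<close>, so both its legs have slope at least \<open>1 / (2 * c0)\<close>. This
  serves for the hole of a ring and for the convex set obtained by filling it.\<close>

lemma hole_pring:
  assumes H: "regular_set c0 H" "polygonal_boundary N0 H" and c0: "c0 \<ge> 1" and k: "0 < \<kappa>" "\<kappa> \<le> 1 / (2 * c0)"
  shows "pring \<kappa> N0 H H {}"
proof -
  obtain x1 r1 x2 r2 where r: "r2 > 0" "cball x2 r2 \<subseteq> H" "H \<subseteq> cball x1 r1" "r1 \<le> c0 * r2" and cc: "compact H" "convex H"
    using H(1) unfolding regular_set_def by blast
  have int: "interior H \<noteq> {}" using regular_interior[OF H(1)] by blast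
  have clH: "closure H = H" using cc(1) by (simp add: compact_imp_closed)
  have dd: "dist x y \<le> 2 * c0 * r2" if "x \<in> H" "y \<in> H" for x y
  proof -
    have "dist x1 x \<le> r1" "dist x1 y \<le> r1" using that r(3) by auto
    then have "dist x y \<le> 2 * r1" using dist_triangle3[of x y x1] by linarith
    then show ?thesis using r(4) by linarith
  qed
  have fl: "is_flag \<kappa> H (a, e, L)" if e: "norm e = 1" "L > 0" and ab: "a \<in> H" "a + L *\<^sub>R e \<in> H" and half: "\<And>x. x \<in> H \<Longrightarrow> 0 \<le> (x - a) \<bullet> rot e" for a e L
    unfolding is_flag_def split_conv
  proof (intro conjI allI impI e)
    fix t s assume h: "0 \<le> t" "t \<le> L" "0 \<le> s" "s \<le> \<kappa> * min t (L - t)"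
    obtain t2 s2 where ts: "x2 = fr a e t2 s2" using fr_ex[OF e(1)] by blast
    \<comment> \<open>The lowest point of the inner ball is in H, hence not below the line of the
      edge; this puts the centre at height at least r2.\<close>
    have "x2 - r2 *\<^sub>R rot e \<in> H" using r(1,2) e by (auto simp: subset_iff dist_norm)
    from half[OF this] have s2: "r2 \<le> s2" using norm1_inner[OF e(1)] unfolding ts by (simp add: fr_def inner_diff_left inner_add_left)
    have x2H: "x2 \<in> H" using r(1,2) by auto
    have a0: "a = fr a e 0 0" and b0: "a + L *\<^sub>R e = fr a e L 0" by (simp_all add: fr_def)
    have da: "dist x2 a = sqrt (t2\<^sup>2 + s2\<^sup>2)"
      using dist_fr[OF e(1), of a t2 s2 0 0] unfolding a0[symmetric] ts[symmetric] by simp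
    have db: "dist (a + L *\<^sub>R e) x2 = sqrt ((L - t2)\<^sup>2 + s2\<^sup>2)"
      using dist_fr[OF e(1), of a L 0 t2 s2] unfolding b0[symmetric] ts[symmetric] by simp
    have "\<bar>t2\<bar> \<le> dist x2 a" "\<bar>L - t2\<bar> \<le> dist (a + L *\<^sub>R e) x2"
      unfolding da db using real_sqrt_sum_squares_ge1[of "\<bar>t2\<bar>" s2] real_sqrt_sum_squares_ge1[of "\<bar>L - t2\<bar>" s2] by simp_all
    then have t2: "t2 \<le> 2 * c0 * r2" "L - t2 \<le> 2 * c0 * r2" using dd[OF x2H ab(1)] dd[OF ab(2) x2H] by linarith+
    have kc: "\<kappa> * (2 * c0) \<le> 1" using k c0 by (simp add: field_simps)
    have st: "s * (2 * c0 * r2) \<le> u * s2" if "0 \<le> u" "s \<le> \<kappa> * u" for u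
    proof -
      have "s * (2 * c0 * r2) \<le> \<kappa> * u * (2 * c0 * r2)" using that(2) c0 r(1) by (intro mult_right_mono) auto
      also have "\<dots> = (\<kappa> * (2 * c0)) * (u * r2)" by simp
      also have "\<dots> \<le> 1 * (u * r2)" using kc that(1) r(1) by (intro mult_right_mono) auto
      also have "\<dots> \<le> u * s2" using s2 that(1) by (simp add: mult_left_mono)
      finally show ?thesis .
    qed
    have sk: "s \<le> \<kappa> * t" "s \<le> \<kappa> * (L - t)" using h(4) min_scale(1)[OF k(1)] by auto
    have "s * t2 \<le> t * s2" using mult_left_mono[OF t2(1) h(3)] st[OF h(1) sk(1)] by linarith
    moreover have "s * (L - t2) \<le> (L - t) * s2" using mult_left_mono[OF t2(2) h(3)] st[OF _ sk(2)] h(2) by linarith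
    ultimately have "fr a e t s \<in> convex hull {a, fr a e L 0, fr a e t2 s2}" using s2 r(1) h by (intro point_in_hull3 e(2)) auto
    moreover have "convex hull {a, fr a e L 0, fr a e t2 s2} \<subseteq> H" using ab x2H ts b0 cc(2) by (intro hull_minimal) auto
    ultimately show "fr a e t s \<in> closure H" using clH by blast
  qed
  have "\<exists>F. finite F \<and> card F \<le> 2 \<and> E = \<Union>(fseg ` F) \<and> (\<forall>f\<in>F. is_flag \<kappa> H f) \<and>
        (\<forall>f\<in>F. \<forall>g\<in>F. f \<noteq> g \<longrightarrow> foseg f \<inter> foseg g = {})" if E: "is_edge (frontier H) E" for E
  proof -
    obtain a b where ab: "a \<noteq> b" "E = closed_segment a b" using E by (auto simp: is_edge_def)
    obtain e L where e: "norm e = 1" "L > 0" "b = a + L *\<^sub>R e" "closed_segment a b = fseg (a, e, L)" using segment_frame[OF ab(1)] by metis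
    have EH: "E \<subseteq> frontier H" using E by (simp add: is_edge_def)
    have abH: "a \<in> H" "b \<in> H" using EH ab(2) frontier_subset_closed[of H] cc compact_imp_closed by auto
    define y where "y = fr a e (L/2) 0"
    have "y \<in> E" unfolding ab(2) e(4) y_def fseg_def using e(2) by auto
    then have "y \<in> H" "y \<notin> rel_interior H" using EH rel_interior_nonempty_interior[OF int] clH by (auto simp: frontier_def)
    \<comment> \<open>A supporting line at the midpoint of the edge contains the edge, so H lies on
      one side of it; this side decides the orientation of the flag.\<close>
    from supporting_hyperplane_rel_boundary[OF cc(2) this] obtain n where n: "n \<noteq> 0" "\<And>z. z \<in> H \<Longrightarrow> n \<bullet> y \<le> n \<bullet> z" by metis
    have "n \<bullet> y \<le> n \<bullet> a" "n \<bullet> y \<le> n \<bullet> b" using n(2) abH by auto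
    then have "L * (n \<bullet> e) = 0" unfolding e(3) y_def by (simp add: fr_def inner_add_right algebra_simps)
    then have ne: "n \<bullet> e = 0" using e(2) by simp
    then have nn: "n = (n \<bullet> rot e) *\<^sub>R rot e" using frame_decomp[OF e(1), of n] by simp
    have ge: "0 \<le> (n \<bullet> rot e) * ((x - a) \<bullet> rot e)" if "x \<in> H" for x
    proof -
      have "0 \<le> n \<bullet> (x - y)" using n(2)[OF that] by (simp add: inner_diff_right)
      also have "n \<bullet> (x - y) = n \<bullet> (x - a)" using ne by (simp add: y_def fr_def inner_diff_right inner_add_right)
      also have "\<dots> = (n \<bullet> rot e) * ((x - a) \<bullet> rot e)" by (subst nn) (simp add: inner_commute)
      finally show ?thesis .
    qed
    show ?thesis
    proof (cases "n \<bullet> rot e > 0")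
      case True
      then have "is_flag \<kappa> H (a, e, L)" using ge abH e(3) by (intro fl e(1,2)) (auto simp: zero_le_mult_iff)
      then show ?thesis using ab(2) e(4) by (intro exI[of _ "{(a, e, L)}"]) auto
    next
      case False
      then have neg: "n \<bullet> rot e < 0" using nn n(1) by (metis linorder_neqE_linordered_idom scaleR_zero_left)
      have "0 \<le> (x - b) \<bullet> rot (- e)" if "x \<in> H" for x
        using ge[OF that] neg e(3) by (auto simp: zero_le_mult_iff inner_diff_left inner_add_left)
      then have "is_flag \<kappa> H (b, - e, L)" using abH e by (intro fl) auto
      then show ?thesis using ab(2) e(4) flag_rev(1)[OF e(1), of a L] e(3) by (intro exI[of _ "{(b, - e, L)}"]) auto
    qed
  qed
  moreover have "polygonal_boundary N0 {}" by (auto simp: polygonal_boundary_def intro!: exI[of _ "{}"])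
  ultimately show ?thesis unfolding pring_def using cc int H(2) by simp
qed

section \<open>Packing of triangles and counting of incidences\<close>

text \<open>The triangle contains a rectangle with sides l / 2 and
  \<open>\<kappa> * l / 4\<close>.\<close>

lemma tri_area:
  assumes e: "norm e = 1" and l: "l > 0" and k: "\<kappa> > 0"
  shows "emeasure lborel (tri \<kappa> a e l) \<ge> ennreal (\<kappa> * l\<^sup>2 / 8)"
proof -
  have "ennreal (\<kappa> * l\<^sup>2 / 8) = ennreal (\<kappa> * l / 4) * ennreal (l / 2)"
    using l k by (subst ennreal_mult[symmetric]) (auto simp: power2_eq_square)
  also have "\<dots> = (\<integral>\<^sup>+t. ennreal (\<kappa> * l / 4) * indicator {l/4<..<3*l/4} t \<partial>lborel)"
    using l k by (subst nn_integral_cmult_indicator) auto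
  also have "\<dots> = (\<integral>\<^sup>+t. (\<integral>\<^sup>+s. indicator {l/4<..<3*l/4} t * indicator {0<..<\<kappa> * l / 4} s \<partial>lborel) \<partial>lborel)"
    using l k by (intro nn_integral_cong) (subst nn_integral_cmult_indicator, auto simp: mult.commute)
  also have "\<dots> \<le> (\<integral>\<^sup>+t. \<integral>\<^sup>+s. indicator (tri \<kappa> a e l) (fr a e t s) \<partial>lborel \<partial>lborel)"
  proof (intro nn_integral_mono)
    fix t s :: real
    have "fr a e t s \<in> tri \<kappa> a e l" if "t \<in> {l/4<..<3*l/4}" "s \<in> {0<..<\<kappa> * l / 4}"
    proof -
      have "\<kappa> * (l / 4) \<le> \<kappa> * min t (l - t)" using that k by (intro mult_left_mono) auto
      then show ?thesis unfolding fr_in_tri[OF e] using that l by auto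
    qed
    then show "indicator {l/4<..<3*l/4} t * indicator {0<..<\<kappa> * l / 4} s \<le> (indicator (tri \<kappa> a e l) (fr a e t s) :: ennreal)"
      by (auto simp: indicator_def)
  qed
  also have "\<dots> = (\<integral>\<^sup>+x. indicator (tri \<kappa> a e l) x \<partial>lborel)"
    using open_tri[OF e] by (intro nn_integral_fr[OF e, symmetric]) (auto intro!: borel_measurable_indicator)
  also have "\<dots> = emeasure lborel (tri \<kappa> a e l)" using open_tri[OF e] by simp
  finally show ?thesis .
qed

text \<open>The homothety with centre y and ratio \<open>l / L\<close> maps the triangle into
  itself. Slope at most 1 keeps the image within distance 2 * l of y.\<close>

lemma subtriangle:
  assumes e: "norm e = 1" and k: "0 < \<kappa>" "\<kappa> \<le> 1" and l: "0 < l" "l \<le> L"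
    and y: "y = fr a e t0 s0" "0 \<le> t0" "t0 \<le> L" "0 \<le> s0" "s0 \<le> \<kappa> * min t0 (L - t0)"
  obtains a' where "tri \<kappa> a' e l \<subseteq> tri \<kappa> a e L" "\<And>z. z \<in> tri \<kappa> a' e l \<Longrightarrow> dist z y \<le> 2 * l"
proof -
  define q where "q = l / L"
  have q: "0 < q" "q \<le> 1" "q * L = l" using l by (auto simp: q_def)
  define a' where "a' = fr a e ((1 - q) * t0) ((1 - q) * s0)"
  have eq: "fr a' e t s = fr a e ((1 - q) * t0 + t) ((1 - q) * s0 + s)" for t s by (simp add: a'_def fr_def algebra_simps)
  have ks: "s0 \<le> \<kappa> * t0" "s0 \<le> \<kappa> * (L - t0)" using y(5) min_scale(1)[OF k(1)] by auto
  show ?thesis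
  proof (rule that[of a'])
    show "tri \<kappa> a' e l \<subseteq> tri \<kappa> a e L"
    proof
      fix z assume "z \<in> tri \<kappa> a' e l"
      then obtain t s where ts: "z = fr a' e t s" "0 < t" "t < l" "0 < s" "s < \<kappa> * min t (l - t)" by (auto simp: tri_def)
      have s1: "s < \<kappa> * t" "s < \<kappa> * (l - t)" using ts(5) min_scale(2)[OF k(1)] by auto
      have m1: "(1 - q) * s0 \<le> (1 - q) * (\<kappa> * t0)" "(1 - q) * s0 \<le> (1 - q) * (\<kappa> * (L - t0))" using q ks by (intro mult_left_mono; simp)+
      have b1: "(1 - q) * s0 + s < \<kappa> * ((1 - q) * t0 + t)" using m1(1) s1(1) by (simp add: algebra_simps)
      have Le: "L - ((1 - q) * t0 + t) = (1 - q) * (L - t0) + (l - t)" using q(3) by (simp add: algebra_simps)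
      have b2: "(1 - q) * s0 + s < \<kappa> * (L - ((1 - q) * t0 + t))" unfolding Le using m1(2) s1(2) by (simp add: algebra_simps)
      have p1: "0 \<le> (1 - q) * t0" "0 \<le> (1 - q) * s0" "0 \<le> (1 - q) * (L - t0)" using q y by auto
      have "0 < (1 - q) * t0 + t" "(1 - q) * t0 + t < L" "0 < (1 - q) * s0 + s" using p1 ts Le by linarith+
      moreover have "(1 - q) * s0 + s < \<kappa> * min ((1 - q) * t0 + t) (L - ((1 - q) * t0 + t))" using b1 b2 by (simp add: min_def)
      ultimately show "z \<in> tri \<kappa> a e L" unfolding ts(1) eq fr_in_tri[OF e] by blast
    qed
    fix z assume "z \<in> tri \<kappa> a' e l"
    then obtain t s where ts: "z = fr a' e t s" "0 < t" "t < l" "0 < s" "s < \<kappa> * min t (l - t)" by (auto simp: tri_def)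
    have "\<kappa> * t \<le> t" using k ts by (simp add: mult_left_le_one_le)
    moreover have "s < \<kappa> * t" using ts(5) min_scale(2)[OF k(1)] by blast
    ultimately have sl: "s < l" using ts by linarith
    have "\<kappa> * t0 \<le> t0" using k y by (simp add: mult_left_le_one_le)
    then have "s0 \<le> L" using y ks by linarith
    then have qq: "0 \<le> q * s0" "q * s0 \<le> l" "0 \<le> q * t0" "q * t0 \<le> l" using q y mult_left_mono[of s0 L q] mult_left_mono[of t0 L q] by auto
    have "dist z y = sqrt (((1 - q) * t0 + t - t0)\<^sup>2 + ((1 - q) * s0 + s - s0)\<^sup>2)" unfolding ts(1) eq y(1) dist_fr[OF e] ..
    also have "\<dots> \<le> \<bar>(1 - q) * t0 + t - t0\<bar> + \<bar>(1 - q) * s0 + s - s0\<bar>" by (rule sqrt_sum_squares_le_sum_abs)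
    also have "\<dots> = \<bar>t - q * t0\<bar> + \<bar>s - q * s0\<bar>" by (simp add: algebra_simps)
    also have "\<dots> \<le> 2 * l" using qq ts sl by linarith
    finally show "dist z y \<le> 2 * l" .
  qed
qed

text \<open>Each flag has in its own triangle a smaller one of base length l within distance 4 * l
  of \<open>x0\<close>. The smaller triangles are disjoint, have area at least
  \<open>\<kappa> * l^2 / 8\<close> and lie in a square of side 8 * l; 64 * 8 gives the 512.\<close>

lemma packing:
  assumes F: "finite F" and k: "0 < \<kappa>" "\<kappa> \<le> 1" and l: "l > 0"
    and fl: "\<And>a e L. (a, e, L) \<in> F \<Longrightarrow> norm e = 1 \<and> l \<le> L \<and> (\<exists>t s. 0 \<le> t \<and> t \<le> L \<and> 0 \<le> s \<and> s \<le> \<kappa> * min t (L - t) \<and> dist (fr a e t s) x0 \<le> 2 * l)"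
    and disj: "\<And>f g. f \<in> F \<Longrightarrow> g \<in> F \<Longrightarrow> f \<noteq> g \<Longrightarrow> ftri \<kappa> f \<inter> ftri \<kappa> g = {}"
  shows "real (card F) \<le> 512 / \<kappa>"
proof -
  have "\<exists>a'. (case f of (a, e, L) \<Rightarrow> norm e = 1 \<and> tri \<kappa> a' e l \<subseteq> ftri \<kappa> f \<and> tri \<kappa> a' e l \<subseteq> cball x0 (4 * l))" if f: "f \<in> F" for f
  proof -
    obtain a e L where fe: "f = (a, e, L)" by (cases f)
    obtain t s where h: "norm e = 1" "l \<le> L" "0 \<le> t" "t \<le> L" "0 \<le> s" "s \<le> \<kappa> * min t (L - t)" "dist (fr a e t s) x0 \<le> 2 * l"
      using fl f fe by blast
    obtain a' where a': "tri \<kappa> a' e l \<subseteq> tri \<kappa> a e L" "\<And>z. z \<in> tri \<kappa> a' e l \<Longrightarrow> dist z (fr a e t s) \<le> 2 * l"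
      using subtriangle[OF h(1) k l h(2) refl h(3-6)] by metis
    have "tri \<kappa> a' e l \<subseteq> cball x0 (4 * l)"
    proof
      fix z assume "z \<in> tri \<kappa> a' e l"
      from a'(2)[OF this] h(7) show "z \<in> cball x0 (4 * l)" using dist_triangle[of z x0 "fr a e t s"] by (simp add: dist_commute)
    qed
    then show ?thesis using a'(1) h(1) by (auto simp: fe ftri_def)
  qed
  then have "\<forall>f\<in>F. \<exists>a'. (case f of (a, e, L) \<Rightarrow> norm e = 1 \<and> tri \<kappa> a' e l \<subseteq> ftri \<kappa> f \<and> tri \<kappa> a' e l \<subseteq> cball x0 (4 * l))" by blast
  from bchoice[OF this] obtain A where "\<forall>f\<in>F. (case f of (a, e, L) \<Rightarrow> norm e = 1 \<and> tri \<kappa> (A f) e l \<subseteq> ftri \<kappa> f \<and> tri \<kappa> (A f) e l \<subseteq> cball x0 (4 * l))" ..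
  then have A: "(case f of (a, e, L) \<Rightarrow> norm e = 1 \<and> tri \<kappa> (A f) e l \<subseteq> ftri \<kappa> f \<and> tri \<kappa> (A f) e l \<subseteq> cball x0 (4 * l))" if "f \<in> F" for f
    using that by (rule bspec)
  define T where "T = (\<lambda>f. tri \<kappa> (A f) (fst (snd f)) l)"
  have T: "norm (fst (snd f)) = 1" "T f \<subseteq> ftri \<kappa> f" "T f \<subseteq> cball x0 (4 * l)" if "f \<in> F" for f
    using A[OF that] by (auto simp: T_def case_prod_beta)
  have m: "T f \<in> sets lborel" if "f \<in> F" for f unfolding T_def using open_tri[OF T(1)[OF that]] by simp
  have "ennreal (real (card F) * (\<kappa> * l\<^sup>2 / 8)) = (\<Sum>f\<in>F. ennreal (\<kappa> * l\<^sup>2 / 8))"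
    using k by (subst ennreal_mult) (auto simp: ennreal_of_nat_eq_real_of_nat)
  also have "\<dots> \<le> (\<Sum>f\<in>F. emeasure lborel (T f))"
    unfolding T_def using T(1) l k by (intro sum_mono tri_area) auto
  also have "\<dots> = emeasure lborel (\<Union>f\<in>F. T f)"
  proof (rule sum_emeasure[OF _ _ F])
    show "T ` F \<subseteq> sets lborel" using m by blast
    show "disjoint_family_on T F" unfolding disjoint_family_on_def using disj T(2) by blast
  qed
  also have "\<dots> \<le> emeasure lborel (cbox (x0 - vec (4 * l)) (x0 + vec (4 * l)))"
  proof (rule emeasure_mono)
    show "(\<Union>f\<in>F. T f) \<subseteq> cbox (x0 - vec (4 * l)) (x0 + vec (4 * l))"
    proof
      fix z assume "z \<in> (\<Union>f\<in>F. T f)"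
      then have "z \<in> cball x0 (4 * l)" using T(3) by blast
      then have "norm (x0 - z) \<le> 4 * l" by (simp add: dist_norm)
      then have "\<bar>(x0 - z) $ i\<bar> \<le> 4 * l" for i using component_le_norm_cart[of "x0 - z" i] by linarith
      then have "\<bar>x0 $ i - z $ i\<bar> \<le> 4 * l" for i by simp
      then show "z \<in> cbox (x0 - vec (4 * l)) (x0 + vec (4 * l))" by (auto simp: mem_box_cart abs_le_iff) (smt (verit))+
    qed
  qed simp
  also have "\<dots> = ennreal ((8 * l)\<^sup>2)"
    using l by (subst emeasure_lborel_cbox_eq) (auto simp: Basis_pt inner_axis axis_eq_axis power2_eq_square)
  finally have "real (card F) * (\<kappa> * l\<^sup>2 / 8) \<le> (8 * l)\<^sup>2" by (subst (asm) ennreal_le_iff) auto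
  then have "real (card F) * \<kappa> * l\<^sup>2 \<le> 512 * l\<^sup>2" by (simp add: power_mult_distrib)
  then have "real (card F) * \<kappa> \<le> 512" using l by simp
  then show ?thesis using k by (simp add: field_simps)
qed

definition good_flags :: "real \<Rightarrow> flag set \<Rightarrow> bool" where
  "good_flags \<kappa> F \<longleftrightarrow> finite F \<and> (\<forall>(a, e, L)\<in>F. norm e = 1 \<and> L > 0) \<and> (\<forall>f\<in>F. \<forall>g\<in>F. f \<noteq> g \<longrightarrow> ftri \<kappa> f \<inter> ftri \<kappa> g = {})"

text \<open>Every incidence is charged to the shorter of the two edges, which by packing meets boundedly many longer ones.\<close>
lemma incidences:
  assumes F: "good_flags \<kappa> F" and G: "good_flags \<kappa> G" and k: "0 < \<kappa>" "\<kappa> \<le> 1"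
  shows "real (\<Sum>f\<in>F. card {g\<in>G. fseg g \<inter> ftri \<kappa> f \<noteq> {}}) \<le> 512 / \<kappa> * (real (card F) + real (card G))"
proof -
  define len where "len = (\<lambda>f::flag. snd (snd f))"
  have fin: "finite F" "finite G" using F G by (auto simp: good_flags_def)
  define P where "P = (\<lambda>f g. fseg g \<inter> ftri \<kappa> f \<noteq> {})"
  have b1: "real (card {f\<in>F. P f g \<and> len g \<le> len f}) \<le> 512 / \<kappa>" if g: "g \<in> G" for g
  proof -
    obtain a e L where ge: "g = (a, e, L)" by (cases g)
    have gg: "norm e = 1" "L > 0" using G g ge by (auto simp: good_flags_def)
    show ?thesis
    proof (rule packing[OF _ k gg(2), of _ a])
      show "finite {f\<in>F. P f g \<and> len g \<le> len f}" using fin by simp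
      show "ftri \<kappa> f \<inter> ftri \<kappa> f' = {}" if "f \<in> {f\<in>F. P f g \<and> len g \<le> len f}" "f' \<in> {f\<in>F. P f g \<and> len g \<le> len f}" "f \<noteq> f'" for f f'
        using F that unfolding good_flags_def by blast
      fix a' e' L' assume f: "(a', e', L') \<in> {f\<in>F. P f g \<and> len g \<le> len f}"
      have ff: "norm e' = 1" "L \<le> L'" using f F by (auto simp: good_flags_def len_def ge)
      obtain y where y: "y \<in> fseg g" "y \<in> ftri \<kappa> (a', e', L')" using f by (auto simp: P_def)
      obtain t where t: "y = fr a e t 0" "0 \<le> t" "t \<le> L" using y(1) by (auto simp: ge fseg_def)
      have "dist y a = dist (fr a e t 0) (fr a e 0 0)" by (simp add: t(1)) (simp add: fr_def)
      then have "dist y a = t" using t(2) by (simp add: dist_fr[OF gg(1)])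
      then have "dist y a \<le> 2 * L" using t gg by linarith
      moreover obtain t' s' where "y = fr a' e' t' s'" "0 < t'" "t' < L'" "0 < s'" "s' < \<kappa> * min t' (L' - t')" using y(2) by (auto simp: ftri_def tri_def)
      ultimately show "norm e' = 1 \<and> L \<le> L' \<and> (\<exists>t s. 0 \<le> t \<and> t \<le> L' \<and> 0 \<le> s \<and> s \<le> \<kappa> * min t (L' - t) \<and> dist (fr a' e' t s) a \<le> 2 * L)"
        using ff by (intro conjI exI[of _ t'] exI[of _ s']) auto
    qed
  qed
  \<comment> \<open>Now f is the shorter one: since the slope is at most 1, each point of its
    triangle is within 2 * L of its starting point.\<close>
  have b2: "real (card {g\<in>G. P f g \<and> len f \<le> len g}) \<le> 512 / \<kappa>" if f: "f \<in> F" for f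
  proof -
    obtain a e L where fe: "f = (a, e, L)" by (cases f)
    have ff: "norm e = 1" "L > 0" using F f fe by (auto simp: good_flags_def)
    show ?thesis
    proof (rule packing[OF _ k ff(2), of _ a])
      show "finite {g\<in>G. P f g \<and> len f \<le> len g}" using fin by simp
      show "ftri \<kappa> g \<inter> ftri \<kappa> g' = {}" if "g \<in> {g\<in>G. P f g \<and> len f \<le> len g}" "g' \<in> {g\<in>G. P f g \<and> len f \<le> len g}" "g \<noteq> g'" for g g'
        using G that unfolding good_flags_def by blast
      fix a' e' L' assume g: "(a', e', L') \<in> {g\<in>G. P f g \<and> len f \<le> len g}"
      have gg: "norm e' = 1" "L \<le> L'" using g G by (auto simp: good_flags_def len_def fe)
      obtain y where y: "y \<in> fseg (a', e', L')" "y \<in> ftri \<kappa> f" using g by (auto simp: P_def)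
      obtain t where t: "y = fr a' e' t 0" "0 \<le> t" "t \<le> L'" using y(1) by (auto simp: fseg_def)
      obtain t' s' where ts: "y = fr a e t' s'" "0 < t'" "t' < L" "0 < s'" "s' < \<kappa> * min t' (L - t')" using y(2) by (auto simp: fe ftri_def tri_def)
      have "\<kappa> * t' \<le> t'" using k ts by (simp add: mult_left_le_one_le)
      moreover have "s' < \<kappa> * t'" using ts(5) min_scale(2)[OF k(1)] by blast
      ultimately have "s' < L" using ts by linarith
      have "dist y a = dist (fr a e t' s') (fr a e 0 0)" by (simp add: ts(1)) (simp add: fr_def)
      also have "\<dots> \<le> \<bar>t'\<bar> + \<bar>s'\<bar>" unfolding dist_fr[OF ff(1)] using sqrt_sum_squares_le_sum_abs[of t' s'] by simp
      finally have "dist y a \<le> 2 * L" using ts \<open>s' < L\<close> by linarith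
      then show "norm e' = 1 \<and> L \<le> L' \<and> (\<exists>t s. 0 \<le> t \<and> t \<le> L' \<and> 0 \<le> s \<and> s \<le> \<kappa> * min t (L' - t) \<and> dist (fr a' e' t s) a \<le> 2 * L)"
        using gg t k by (intro conjI exI[of _ t] exI[of _ 0]) auto
    qed
  qed
  have "(\<Sum>f\<in>F. card {g\<in>G. P f g}) \<le> (\<Sum>f\<in>F. card {g\<in>G. P f g \<and> len g \<le> len f} + card {g\<in>G. P f g \<and> len f \<le> len g})"
  proof (rule sum_mono)
    fix f
    have eq: "{g\<in>G. P f g} = {g\<in>G. P f g \<and> len g \<le> len f} \<union> {g\<in>G. P f g \<and> len f \<le> len g}" by auto
    show "card {g\<in>G. P f g} \<le> card {g\<in>G. P f g \<and> len g \<le> len f} + card {g\<in>G. P f g \<and> len f \<le> len g}"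
      by (subst eq) (rule card_Un_le)
  qed
  also have "\<dots> = (\<Sum>g\<in>G. card {f\<in>F. P f g \<and> len g \<le> len f}) + (\<Sum>f\<in>F. card {g\<in>G. P f g \<and> len f \<le> len g})"
    unfolding sum.distrib using sum_multicount_gen[OF fin, of "\<lambda>f g. P f g \<and> len g \<le> len f" "\<lambda>g. card {f\<in>F. P f g \<and> len g \<le> len f}"] by simp
  finally have "real (\<Sum>f\<in>F. card {g\<in>G. P f g}) \<le> (\<Sum>g\<in>G. real (card {f\<in>F. P f g \<and> len g \<le> len f})) + (\<Sum>f\<in>F. real (card {g\<in>G. P f g \<and> len f \<le> len g}))"
    by (simp flip: of_nat_sum of_nat_add)
  also have "\<dots> \<le> (\<Sum>g\<in>G. 512 / \<kappa>) + (\<Sum>f\<in>F. 512 / \<kappa>)" using b1 b2 by (intro add_mono sum_mono) auto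
  also have "\<dots> = 512 / \<kappa> * (real (card F) + real (card G))" by (simp add: distrib_left mult.commute add.commute add_divide_distrib)
  finally show ?thesis by (simp add: P_def)
qed

section \<open>Half-discs at boundary points off the crossings\<close>

text \<open>The half of the disc to the left of v; taken for v and for - v, these are the two sides
  of the line through x.\<close>

definition hdisc :: "pt \<Rightarrow> real \<Rightarrow> pt \<Rightarrow> pt set" where
  "hdisc x r v = {z \<in> ball x r. (z - x) \<bullet> rot v > 0}"

lemma hdisc_eq: "hdisc x r v = ball x r \<inter> {z. rot v \<bullet> z > rot v \<bullet> x}"
  by (auto simp: hdisc_def inner_diff_left inner_diff_right inner_commute)

lemma hdisc_convex: "convex (hdisc x r v)" and hdisc_open: "open (hdisc x r v)"
  unfolding hdisc_eq by (intro convex_Int convex_ball convex_halfspace_gt open_Int open_ball open_halfspace_gt)+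

lemma hdisc_mono: "r \<le> r' \<Longrightarrow> hdisc x r v \<subseteq> hdisc x r' v"
  by (auto simp: hdisc_def)

lemma lines_meet_finite:
  assumes n: "norm (snd l) = 1" "norm (snd l') = 1" and ne: "ln_of l \<noteq> ln_of l'"
  shows "finite (ln_of l \<inter> ln_of l')"
proof -
  have eq: "u = v" if uv: "u \<in> ln_of l \<inter> ln_of l'" "v \<in> ln_of l \<inter> ln_of l'" for u v
  proof (rule ccontr)
    assume "u \<noteq> v"
    have sub: "ln_of k \<subseteq> ln_of k'" if k: "norm (snd k) = 1" "norm (snd k') = 1" "u \<in> ln_of k" "v \<in> ln_of k" "u \<in> ln_of k'" "v \<in> ln_of k'" for k k'
    proof
      fix x assume "x \<in> ln_of k"
      then obtain t where t: "x = fr (fst k) (snd k) t 0" by (auto simp: ln_of_def)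
      obtain a b where ab: "u = fr (fst k) (snd k) a 0" "v = fr (fst k) (snd k) b 0" using k(3,4) unfolding ln_of_def by blast
      have "a \<noteq> b" using \<open>u \<noteq> v\<close> ab by auto
      have "(u - fst k') \<bullet> rot (snd k') = 0" "(v - fst k') \<bullet> rot (snd k') = 0" using k(5,6) ln_of_iff[OF k(2)] by auto
      then have "(u - v) \<bullet> rot (snd k') = 0" by (simp add: inner_diff_left)
      moreover have "u - v = (a - b) *\<^sub>R snd k" unfolding ab by (simp add: fr_def algebra_simps)
      ultimately have o: "snd k \<bullet> rot (snd k') = 0" using \<open>a \<noteq> b\<close> by simp
      have "x - fst k' = (u - fst k') + (t - a) *\<^sub>R snd k" unfolding t ab by (simp add: fr_def algebra_simps)
      then have "(x - fst k') \<bullet> rot (snd k') = 0" using o \<open>(u - fst k') \<bullet> rot (snd k') = 0\<close> by (simp only: inner_add_left inner_scaleR_left)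
      then show "x \<in> ln_of k'" using ln_of_iff[OF k(2)] by blast
    qed
    show False using sub[OF n] sub[OF n(2,1)] uv ne by blast
  qed
  show ?thesis
  proof (cases "ln_of l \<inter> ln_of l' = {}")
    case False
    then obtain u where "u \<in> ln_of l \<inter> ln_of l'" by blast
    then have "ln_of l \<inter> ln_of l' \<subseteq> {u}" using eq by blast
    then show ?thesis using finite_subset by blast
  qed simp
qed

text \<open>Choice is made twice, of a line as a point set for each segment and then of one name for
  each such set, so that segments on a common line do not produce two names.\<close>

lemma lines_exist:
  assumes "finite (P :: (pt \<times> pt) set)"
  obtains \<Lambda> where "lines \<Lambda>" "(\<Union>(a,b)\<in>P. closed_segment a b) \<subseteq> (\<Union>l\<in>\<Lambda>. ln_of l)"
proof -
  define S where "S = (\<lambda>(a,b). SOME s. (\<exists>l. norm (snd l) = 1 \<and> s = ln_of l) \<and> closed_segment a b \<subseteq> s) ` P"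
  have ex: "\<exists>s. (\<exists>l. norm (snd l) = 1 \<and> s = ln_of l) \<and> closed_segment a b \<subseteq> s" for a b :: pt
  proof (cases "a = b")
    case True
    have "a = fr a (axis 1 1) 0 0" by (simp add: fr_def)
    then have "closed_segment a b \<subseteq> ln_of (a, axis 1 1)" unfolding ln_of_def using True by auto
    moreover have "norm (snd (a, axis 1 1 :: pt)) = 1" by simp
    ultimately show ?thesis by blast
  next
    case False
    obtain e L where e: "norm e = 1" "closed_segment a b = fseg (a, e, L)" using segment_frame[OF False] by metis
    have "fseg (a, e, L) \<subseteq> ln_of (a, e)" by (auto simp: fseg_def ln_of_def)
    moreover have "norm (snd (a, e)) = 1" using e by simp
    ultimately show ?thesis using e(2) by blast
  qed
  have S: "\<exists>l. norm (snd l) = 1 \<and> s = ln_of l" if "s \<in> S" for s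
    using that someI_ex[OF ex] unfolding S_def by fastforce
  have cov: "closed_segment a b \<subseteq> \<Union>S" if "(a,b) \<in> P" for a b
  proof -
    have "(SOME s. (\<exists>l. norm (snd l) = 1 \<and> s = ln_of l) \<and> closed_segment a b \<subseteq> s) \<in> S" unfolding S_def using that by force
    then show ?thesis using someI_ex[OF ex[of a b]] by blast
  qed
  define r where "r = (\<lambda>s. SOME l. norm (snd l) = 1 \<and> s = ln_of l)"
  have r: "norm (snd (r s)) = 1" "ln_of (r s) = s" if "s \<in> S" for s
    using someI_ex[OF S[OF that]] unfolding r_def by auto
  have "lines (r ` S)"
  proof
    show "finite (r ` S)" unfolding S_def using assms by simp
    show "norm (snd l) = 1" if "l \<in> r ` S" for l using that r by auto
    fix l l' assume l: "l \<in> r ` S" "l' \<in> r ` S" "l \<noteq> l'"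
    then have "ln_of l \<noteq> ln_of l'" using r(2) by auto
    then show "finite (ln_of l \<inter> ln_of l')" using l r(1) by (intro lines_meet_finite) auto
  qed
  moreover have "(\<Union>(a,b)\<in>P. closed_segment a b) \<subseteq> (\<Union>l\<in>r ` S. ln_of l)"
    using cov r(2) by fastforce
  ultimately show ?thesis using that by blast
qed

context lines begin

lemma convex_in_or_out:
  assumes "convex C" "C \<inter> N = {}" "frontier R \<subseteq> N" "z \<in> C" "z \<in> R"
  shows "C \<subseteq> R"
proof (rule ccontr)
  assume "\<not> C \<subseteq> R"
  then have "C \<inter> R \<noteq> {}" "C - R \<noteq> {}" using assms by auto
  from connected_Int_frontier[OF convex_connected[OF assms(1)] this] show False using assms by blast
qed

text \<open>A segment covered by finitely many lines has infinitely many points on one of them, and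
  so lies on it.\<close>

lemma flag_base:
  assumes e: "norm e = 1" "L > 0" and sub: "fseg (a, e, L) \<subseteq> N"
  obtains l where "l \<in> \<Lambda>" "\<And>t. fr a e t 0 \<in> ln_of l"
proof -
  have inj: "inj_on (\<lambda>t. fr a e t 0) {0..L}" using fr_eq_iff[OF e(1)] by (auto simp: inj_on_def)
  have "infinite (fseg (a, e, L))"
    unfolding fseg_def split_conv using finite_image_iff[OF inj] e(2) by (simp add: infinite_Icc)
  moreover have "fseg (a, e, L) = (\<Union>l\<in>\<Lambda>. fseg (a, e, L) \<inter> ln_of l)" using sub unfolding N_def by blast
  ultimately obtain l where l: "l \<in> \<Lambda>" "infinite (fseg (a, e, L) \<inter> ln_of l)" using fin by (metis finite_UN_I)
  have "norm (snd (a, e)) = 1" "norm (snd l) = 1" using e unit[OF l(1)] by auto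
  moreover have "fseg (a, e, L) \<inter> ln_of l \<subseteq> ln_of (a, e) \<inter> ln_of l" by (auto simp: fseg_def ln_of_def)
  then have "infinite (ln_of (a, e) \<inter> ln_of l)" using l(2) finite_subset by blast
  ultimately have "ln_of (a, e) = ln_of l" using lines_meet_finite by blast
  then show ?thesis using that[OF l(1)] by (auto simp: ln_of_def)
qed

lemma half_discs:
  assumes l: "l \<in> \<Lambda>" and x: "x \<in> ln_of l" "x \<notin> X"
  obtains r where "r > 0"
    "\<And>v. v = snd l \<or> v = - snd l \<Longrightarrow> convex (hdisc x r v) \<and> open (hdisc x r v) \<and> hdisc x r v \<inter> N = {}"
proof -
  \<comment> \<open>The zero function only serves to read off from \<open>local_sides\<close> a
    radius with the geometric property.\<close>
  have st: "steplike (\<lambda>_. 0)" by (simp add: steplike_def)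
  have l': "(fst l, snd l) \<in> \<Lambda>" "x \<in> ln_of (fst l, snd l)" using l x by simp_all
  obtain r where r: "r > 0" "\<And>z. z \<in> ball x r \<Longrightarrow> (z - x) \<bullet> rot (snd l) \<noteq> 0 \<Longrightarrow> z \<notin> N"
    using local_sides[OF st l' x(2)] by metis
  show ?thesis
  proof (rule that[OF r(1)], intro conjI hdisc_convex hdisc_open)
    fix v assume v: "v = snd l \<or> v = - snd l"
    show "hdisc x r v \<inter> N = {}" using r(2) v unfolding hdisc_def by fastforce
  qed
qed

lemma disc_split:
  assumes l: "l \<in> \<Lambda>" and v: "v = snd l \<or> v = - snd l" and x: "x \<in> ln_of l" and y: "y \<in> ln_of l" "y \<in> ball x r" and U: "open U" "y \<in> U"
  obtains z where "z \<in> U" "z \<in> ball x r" "(z - x) \<bullet> rot v > 0"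
proof -
  have n: "norm v = 1" using v unit[OF l] by auto
  obtain d where d: "d > 0" "ball y d \<subseteq> U \<inter> ball x r" using U y(2) open_contains_ball[of "U \<inter> ball x r"] by (metis IntI open_Int open_ball)
  have "(y - x) \<bullet> rot (snd l) = 0" using ln_of_iff[OF unit[OF l]] x y(1) by (simp add: inner_diff_left)
  then have 0: "(y - x) \<bullet> rot v = 0" using v by auto
  have "y + (d/2) *\<^sub>R rot v \<in> ball y d" using d(1) n by (simp add: dist_norm)
  moreover have "(y + (d/2) *\<^sub>R rot v - x) \<bullet> rot v > 0"
  proof -
    have "(y + (d/2) *\<^sub>R rot v - x) \<bullet> rot v = (y - x) \<bullet> rot v + (d/2) * (rot v \<bullet> rot v)" by (simp add: inner_diff_left inner_add_left)
    also have "\<dots> = d / 2" using 0 norm1_inner[OF n] by simp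
    finally show ?thesis using d(1) by simp
  qed
  ultimately show ?thesis using that d(2) by blast
qed

text \<open>If R fills one half-disc and misses the other, the diameter consists of frontier points,
  so a flag parallel to v passes through x. A flag of direction - v with x as an inner point is
  impossible, as its triangle would reach into the missed half. Whether x is an end point is settled
  only later, so this exclusion is a conclusion of its own.\<close>

lemma side_flag:
  assumes rg: "ring \<kappa> N0 R Q1 Q2" and l: "l \<in> \<Lambda>" and v: "v = snd l \<or> v = - snd l" and x: "x \<in> ln_of l" and r: "r > 0"
    and H1: "hdisc x r v \<subseteq> R" and H2: "hdisc x r (- v) \<inter> R = {}"
  obtains a e L where "(a, e, L) \<in> ring.flags \<kappa> R" "x \<in> fseg (a, e, L)" "e = v \<or> e = - v"
    "\<And>a' L' \<tau>. (a', - v, L') \<in> ring.flags \<kappa> R \<Longrightarrow> 0 < \<tau> \<Longrightarrow> \<tau> < L' \<Longrightarrow> x \<noteq> fr a' (- v) \<tau> 0"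
proof -
  interpret ring \<kappa> N0 R Q1 Q2 by (rule rg)
  have n: "norm v = 1" using v unit[OF l] by auto
  have v': "- v = snd l \<or> - v = - snd l" using v by auto
  have fr: "y \<in> frontier R" if y: "y \<in> ln_of l" "y \<in> ball x r" for y
  proof -
    have "y \<in> closure R"
      unfolding closure_iff_nhds_not_empty
    proof (intro allI impI)
      fix A V assume V: "V \<subseteq> A" "open V" "y \<in> V"
      obtain z where "z \<in> V" "z \<in> ball x r" "(z - x) \<bullet> rot v > 0" by (rule disc_split[OF l v x y V(2,3)])
      then show "R \<inter> A \<noteq> {}" using H1 V(1) unfolding hdisc_def by blast
    qed
    moreover have "y \<notin> interior R"
    proof
      assume "y \<in> interior R"
      obtain z where "z \<in> interior R" "z \<in> ball x r" "(z - x) \<bullet> rot (- v) > 0" by (rule disc_split[OF l v' x y open_interior \<open>y \<in> interior R\<close>])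
      then show False using H2 interior_subset unfolding hdisc_def by blast
    qed
    ultimately show ?thesis by (simp add: frontier_def)
  qed
  define u w where "u = x + (- (r/2)) *\<^sub>R v" and "w = x + (r/2) *\<^sub>R v"
  have on: "x + s *\<^sub>R v \<in> ln_of l" for s
    using ln_of_iff[OF unit[OF l]] x v by (auto simp: inner_add_left inner_diff_left)
  have seg: "closed_segment u w \<subseteq> frontier R"
  proof
    fix y assume "y \<in> closed_segment u w"
    then obtain s where s: "y = x + s *\<^sub>R v" "\<bar>s\<bar> \<le> r/2" unfolding u_def w_def seg_line using r by (force simp: closed_segment_eq_real_ivl)
    show "y \<in> frontier R" using on[of s] s r n by (intro fr) (auto simp: dist_norm)
  qed
  have "v \<noteq> 0" using n by auto
  moreover have wu: "w - u = r *\<^sub>R v" by (simp add: u_def w_def flip: scaleR_add_left)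
  ultimately have "u \<noteq> w" using r by auto
  moreover have "x \<in> closed_segment u w"
    unfolding u_def w_def seg_line using r by (intro image_eqI[of _ _ 0]) (auto simp: closed_segment_eq_real_ivl)
  ultimately obtain a e L c where f: "(a, e, L) \<in> flags" "x \<in> fseg (a, e, L)" "w - u = c *\<^sub>R e" using flags_cover[OF _ seg] by metis
  have e: "norm e = 1" using flags_flag[OF f(1)] by (simp add: is_flag_def)
  have rc: "r *\<^sub>R v = c *\<^sub>R e" using f(3) wu by simp
  have "norm (r *\<^sub>R v) = norm (c *\<^sub>R e)" unfolding rc ..
  then have "\<bar>c\<bar> = r" using e n r by simp
  then have "c = r \<or> c = - r" by auto
  then have ev: "e = v \<or> e = - v"
  proof
    assume "c = r" then have "r *\<^sub>R v = r *\<^sub>R e" using rc by simp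
    then show ?thesis using r by simp
  next
    assume "c = - r" then have "r *\<^sub>R v = r *\<^sub>R (- e)" using rc by simp
    then have "v = - e" using r by (metis less_irrefl scaleR_left_imp_eq)
    then show ?thesis by simp
  qed
  have no: "x \<noteq> fr a' (- v) \<tau> 0" if h: "(a', - v, L') \<in> flags" "0 < \<tau>" "\<tau> < L'" for a' L' \<tau>
  proof
    assume xe: "x = fr a' (- v) \<tau> 0"
    define s where "s = min (r/2) (\<kappa> * min \<tau> (L' - \<tau>) / 2)"
    have "0 < \<kappa> * min \<tau> (L' - \<tau>)" using k h by simp
    then have s: "0 < s" "s < r" "s < \<kappa> * min \<tau> (L' - \<tau>)" unfolding s_def using r by linarith+
    have "fr a' (- v) \<tau> s \<in> tri \<kappa> a' (- v) L'" using fr_in_tri[of "- v" a' \<tau> s \<kappa> L'] n s h by simp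
    then have "fr a' (- v) \<tau> s \<in> R" using flag_tri[OF flags_flag[OF h(1)]] interior_subset by (auto simp: ftri_def)
    moreover have eq: "fr a' (- v) \<tau> s = x + s *\<^sub>R rot (- v)" unfolding xe by (simp add: fr_def)
    moreover have "x + s *\<^sub>R rot (- v) \<in> hdisc x r (- v)" using s n norm1_inner[OF n] by (simp add: hdisc_def dist_norm)
    ultimately show False using H2 by auto
  qed
  show ?thesis by (rule that[OF f(1,2) ev no])
qed

text \<open>Each half-disc at z is inside R or disjoint from it. Both inside would put z in the
  interior of the closure, both outside would separate z from the interior of R; so exactly one is
  inside, and \<open>side_flag\<close> applies.\<close>

lemma generic_cover:
  assumes rg: "ring \<kappa> N0 R Q1 Q2" and sub: "frontier R \<subseteq> N" and z: "z \<in> frontier R" "z \<notin> X"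
  shows "\<exists>f\<in>ring.flags \<kappa> R. z \<in> fseg f"
proof -
  interpret ring \<kappa> N0 R Q1 Q2 by (rule rg)
  obtain l where l: "l \<in> \<Lambda>" "z \<in> ln_of l" using z(1) sub unfolding N_def by blast
  obtain r where r: "r > 0" 
    "\<And>v. v = snd l \<or> v = - snd l \<Longrightarrow> convex (hdisc z r v) \<and> open (hdisc z r v) \<and> hdisc z r v \<inter> N = {}"
    by (rule half_discs[OF l z(2)]) (rule that, assumption+)
  define H where "H = hdisc z r"
  have io: "H v \<subseteq> R \<or> H v \<inter> R = {}" if "v = snd l \<or> v = - snd l" for v
    using convex_in_or_out[of "H v" R] r(2)[OF that] sub unfolding H_def by blast
  have zb: "z \<in> ball z r" using r by simp
  have not_both_in: "\<not> (H (snd l) \<subseteq> R \<and> H (- snd l) \<subseteq> R)"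
  proof
    assume h: "H (snd l) \<subseteq> R \<and> H (- snd l) \<subseteq> R"
    have "ball z r \<subseteq> closure R"
    proof
      fix y assume y: "y \<in> ball z r"
      show "y \<in> closure R"
      proof (cases "(y - z) \<bullet> rot (snd l) = 0")
        case False
        then have "y \<in> H (snd l) \<or> y \<in> H (- snd l)" using y unfolding H_def hdisc_def by auto
        then show ?thesis using h closure_subset by blast
      next
        case True
        then have yl: "y \<in> ln_of l" using ln_of_iff[OF unit[OF l(1)]] l(2) by (simp add: inner_diff_left)
        show ?thesis unfolding closure_iff_nhds_not_empty
        proof (intro allI impI)
          fix A V assume V: "V \<subseteq> A" "open V" "y \<in> V"
          obtain w where "w \<in> V" "w \<in> ball z r" "(w - z) \<bullet> rot (snd l) > 0" by (rule disc_split[OF l(1) disjI1[OF refl] l(2) yl y V(2,3)])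
          then show "R \<inter> A \<noteq> {}" using h V(1) unfolding H_def hdisc_def by blast
        qed
      qed
    qed
    then have "z \<in> interior (closure R)" using interior_maximal[OF _ open_ball] zb by blast
    then show False using z(1) interior_closure by (simp add: frontier_def)
  qed
  have not_both_out: "\<not> (H (snd l) \<inter> R = {} \<and> H (- snd l) \<inter> R = {})"
  proof
    assume h: "H (snd l) \<inter> R = {} \<and> H (- snd l) \<inter> R = {}"
    have "z \<in> closure (interior R)" using z(1) closure_mono[OF R_sub_closure] by (auto simp: frontier_def)
    then have "ball z r \<inter> interior R \<noteq> {}" using open_Int_closure_eq_empty[OF open_ball, of z r "interior R"] zb by blast
    then obtain y where y: "y \<in> ball z r" "y \<in> interior R" by blast
    show False
    proof (cases "(y - z) \<bullet> rot (snd l) = 0")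
      case False
      then have "y \<in> H (snd l) \<or> y \<in> H (- snd l)" using y unfolding H_def hdisc_def by auto
      then show False using h y(2) interior_subset by blast
    next
      case True
      then have yl: "y \<in> ln_of l" using ln_of_iff[OF unit[OF l(1)]] l(2) by (simp add: inner_diff_left)
      obtain w where "w \<in> interior R" "w \<in> ball z r" "(w - z) \<bullet> rot (snd l) > 0"
        by (rule disc_split[OF l(1) disjI1[OF refl] l(2) yl y(1) open_interior y(2)])
      then show False using h interior_subset unfolding H_def hdisc_def by blast
    qed
  qed
  obtain v where v: "v = snd l \<or> v = - snd l" "H v \<subseteq> R" "H (- v) \<inter> R = {}"
    using not_both_in not_both_out io[of "snd l"] io[of "- snd l"] by (metis minus_minus)
  show ?thesis
    by (rule side_flag[OF rg l(1) v(1) l(2) r(1) v(2,3)[unfolded H_def]]) blast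
qed

end

section \<open>Comparing two ring partitions\<close>

text \<open>If w were below the edge, the line from w through the midpoint y of the edge would enter
  the triangle beyond y. Then y would lie strictly between w and an interior point of Q and be
  interior itself.\<close>

lemma convex_flag_halfplane:
  assumes rg: "ring \<kappa> N0 Q Q {}" and f: "(a, e, L) \<in> ring.flags \<kappa> Q" and w: "w \<in> Q"
  shows "0 \<le> (w - a) \<bullet> rot e"
proof (rule ccontr)
  interpret ring \<kappa> N0 Q Q "{}" by (rule rg)
  assume neg: "\<not> 0 \<le> (w - a) \<bullet> rot e"
  have fl: "norm e = 1" "L > 0" using flags_flag[OF f] by (auto simp: is_flag_def)
  obtain t1 s1 where ts: "w = fr a e t1 s1" using fr_ex[OF fl(1)] by blast
  have s1: "s1 < 0" using neg fl(1) by (simp add: ts)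
  define y where "y = fr a e (L/2) 0"
  have yf: "y \<in> frontier Q" using flags_frontier[OF f] foseg_sub[of "(a, e, L)"] fl(2) unfolding y_def foseg_def fseg_def by force
  define h where "h = (\<lambda>\<delta>::real. \<kappa> * min (L/2 - \<delta> * (t1 - L/2)) (L - (L/2 - \<delta> * (t1 - L/2))) + \<delta> * s1)"
  have "(h \<longlongrightarrow> \<kappa> * min (L/2 - 0 * (t1 - L/2)) (L - (L/2 - 0 * (t1 - L/2))) + 0 * s1) (at_right 0)"
    unfolding h_def by (intro tendsto_intros)
  moreover have "0 < \<kappa> * min (L/2 - 0 * (t1 - L/2)) (L - (L/2 - 0 * (t1 - L/2))) + 0 * s1" using k fl(2) by simp
  ultimately have "\<forall>\<^sub>F \<delta> in at_right 0. 0 < h \<delta>" by (rule order_tendstoD(1))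
  moreover have "\<forall>\<^sub>F \<delta>::real in at_right 0. 0 < \<delta>" by (auto simp: eventually_at intro!: exI[of _ 1])
  ultimately have "\<forall>\<^sub>F \<delta> in at_right 0. 0 < h \<delta> \<and> 0 < \<delta>" by eventually_elim simp
  then obtain \<delta> where d: "0 < h \<delta>" "0 < \<delta>" using eventually_happens'[OF trivial_limit_at_right_real] by blast
  define q where "q = fr a e (L/2 - \<delta> * (t1 - L/2)) (- (\<delta> * s1))"
  have ds: "0 < - (\<delta> * s1)" using d(2) s1 by (simp add: mult_pos_neg)
  then have "0 < \<kappa> * min (L/2 - \<delta> * (t1 - L/2)) (L - (L/2 - \<delta> * (t1 - L/2)))" using d(1) unfolding h_def by linarith
  then have "0 < min (L/2 - \<delta> * (t1 - L/2)) (L - (L/2 - \<delta> * (t1 - L/2)))" using k by (simp only: zero_less_mult_iff) auto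
  then have "q \<in> tri \<kappa> a e L" unfolding q_def fr_in_tri[OF fl(1)] using ds d(1) unfolding h_def by auto
  then have qi: "q \<in> interior Q" using flag_tri[OF flags_flag[OF f]] by (auto simp: ftri_def)
  have "y = (1 - \<delta> / (1 + \<delta>)) *\<^sub>R q + (\<delta> / (1 + \<delta>)) *\<^sub>R w"
  proof -
    have "(1 + \<delta>) *\<^sub>R y = q + \<delta> *\<^sub>R w" unfolding y_def q_def ts fr_def by (rule vector_eq_ldot[THEN iffD1], rule allI) (simp add: inner_add_right algebra_simps add_divide_distrib)
    then have "(1 / (1 + \<delta>)) *\<^sub>R ((1 + \<delta>) *\<^sub>R y) = (1 / (1 + \<delta>)) *\<^sub>R (q + \<delta> *\<^sub>R w)" by simp
    moreover have "1 - \<delta> / (1 + \<delta>) = 1 / (1 + \<delta>)" using d(2) by (simp add: field_simps)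
    ultimately show ?thesis using d(2) by (simp add: scaleR_add_right)
  qed
  moreover have "q \<noteq> w" unfolding q_def ts using fr_eq_iff[OF fl(1)] ds s1 by auto
  moreover have "0 < \<delta> / (1 + \<delta>)" "\<delta> / (1 + \<delta>) < 1" using d(2) by (simp_all add: field_simps)
  ultimately have "y \<in> open_segment q w" unfolding in_segment by blast
  then have "y \<in> interior Q" using in_interior_closure_convex_segment[OF Q1(2) qi, of w] w closure_subset by blast
  then show False using yf by (simp add: frontier_def)
qed

text \<open>The foot of an outer normal is the nearest point of the convex set Q, and nearest points
  are unique. The inequality \<open>key\<close> is the quantitative form: the angle at the foot is
  not acute.\<close>

lemma outer_tubes_disjoint:
  assumes rg: "ring \<kappa> N0 Q Q {}" and f: "(a, e, L) \<in> ring.flags \<kappa> Q" "(a', e', L') \<in> ring.flags \<kappa> Q"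
    and t: "0 < t" "t < L" "0 < s" "0 < t'" "t' < L'" "0 < s'" and eq: "fr a e t (- s) = fr a' e' t' (- s')"
  shows "(a, e, L) = (a', e', L')"
proof -
  interpret ring \<kappa> N0 Q Q "{}" by (rule rg)
  define z y y' where "z = fr a e t (- s)" and "y = fr a e t 0" and "y' = fr a' e' t' 0"
  have n: "norm e = 1" "norm e' = 1" using flags_flag[OF f(1)] flags_flag[OF f(2)] by (auto simp: is_flag_def)
  have yo: "y \<in> foseg (a, e, L)" "y' \<in> foseg (a', e', L')" using t by (auto simp: y_def y'_def foseg_def)
  then have "y \<in> frontier Q" "y' \<in> frontier Q" using flags_frontier f foseg_sub by blast+
  then have yQ: "y \<in> Q" "y' \<in> Q" using frontier_subset_closed closedQ(1) by blast+
  have key: "(norm (z - w))\<^sup>2 \<ge> s\<^sup>2 + (norm (w - y))\<^sup>2" if "(a, e, L) \<in> flags" "norm e = 1" "z = fr a e t (- s)" "y = fr a e t 0" "0 < s" "w \<in> Q" for a e L t s y w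
  proof -
    have "(w - a) \<bullet> rot e \<ge> 0" using convex_flag_halfplane[OF rg that(1,6)] .
    then have "(w - y) \<bullet> rot e \<ge> 0" using that(2,4) by (simp add: fr_def inner_diff_left inner_add_left)
    then have p: "0 \<le> s * ((w - y) \<bullet> rot e)" using that(5) by simp
    have "z - w = - (s *\<^sub>R rot e + (w - y))" using that(3,4) by (simp add: fr_def)
    then have "(norm (z - w))\<^sup>2 = (norm (s *\<^sub>R rot e + (w - y)))\<^sup>2" by (simp only: norm_minus_cancel)
    also have "\<dots> = s\<^sup>2 + 2 * (s * ((w - y) \<bullet> rot e)) + (norm (w - y))\<^sup>2"
      using norm1_inner[OF that(2)] unfolding power2_norm_eq_inner
      by (simp add: inner_add_left inner_add_right inner_commute power2_eq_square algebra_simps)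
    finally show ?thesis using p by linarith
  qed
  have k1: "(norm (z - y'))\<^sup>2 \<ge> s\<^sup>2 + (norm (y' - y))\<^sup>2" by (rule key[OF f(1) n(1) z_def y_def t(3) yQ(2)])
  have k2: "(norm (z - y))\<^sup>2 \<ge> s'\<^sup>2 + (norm (y - y'))\<^sup>2" by (rule key[OF f(2) n(2) z_def[unfolded eq] y'_def t(6) yQ(1)])
  have zy: "z - y = (- s) *\<^sub>R rot e" "z - y' = (- s') *\<^sub>R rot e'"
    subgoal by (simp add: z_def y_def fr_def)
    subgoal unfolding z_def eq by (simp add: y'_def fr_def)
    done
  then have "(norm (z - y))\<^sup>2 = s\<^sup>2" "(norm (z - y'))\<^sup>2 = s'\<^sup>2" using n by simp_all
  then have 0: "(norm (y' - y))\<^sup>2 + (norm (y - y'))\<^sup>2 \<le> 0" using k1 k2 by linarith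
  then have "(norm (y' - y))\<^sup>2 \<le> 0" using zero_le_power2[of "norm (y - y')"] by linarith
  then have yy: "y' = y" by simp
  then have "s\<^sup>2 = s'\<^sup>2" using k1 k2 \<open>(norm (z - y))\<^sup>2 = s\<^sup>2\<close> \<open>(norm (z - y'))\<^sup>2 = s'\<^sup>2\<close> by simp
  then have "s = s'" using t by (simp add: power2_eq_iff)
  then have "rot e = rot e'" using zy yy t(3) by simp
  then have "rot (rot e) = rot (rot e')" by simp
  then have "e = e'" by simp
  then show ?thesis using flags_disjoint[OF f yo(1)] yo(2) yy by blast
qed

lemma ring_facts:
  assumes "ring \<kappa> N0 R Q1 Q2"
  shows "R \<in> sets borel" "finite (ring.flags \<kappa> R)" "card (ring.flags \<kappa> R) \<le> 8 * N0"
proof -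
  interpret ring \<kappa> N0 R Q1 Q2 by (rule assms)
  show "R \<in> sets borel" unfolding R using closedQ by (intro sets.Diff borel_closed)
  show "finite (ring.flags \<kappa> R)" "card (ring.flags \<kappa> R) \<le> 8 * N0" using finite_flags card_flags by auto
qed

text \<open>
  The flag \<open>ext\<close> marks the case where the domain is the whole plane. Then the list of rings of \<open>S1\<close> also contains the
  hole of their union, if there is one, with value 0, so that they fill a convex set \<open>Q\<close>; the other side of the
  boundary of \<open>Q\<close> is served by the tubes in \<open>Io\<close>, which reach so far out that both functions vanish there.
\<close>
locale ring_partitions = lines +
  fixes \<Omega> Q :: "pt set" and \<kappa>0 M :: real and N0 n n' :: nat and R A B R' A' B' :: "nat \<Rightarrow> pt set" and c c' :: "nat \<Rightarrow> real"
    and S1 S2 :: "pt \<Rightarrow> real" and ext :: bool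
  assumes k0: "0 < \<kappa>0"
    and rR: "\<And>j. j < n' \<Longrightarrow> ring \<kappa>0 N0 (R j) (A j) (B j)"
    and rR': "\<And>j. j < n \<Longrightarrow> ring \<kappa>0 N0 (R' j) (A' j) (B' j)"
    and dR: "\<And>i j. i < n' \<Longrightarrow> j < n' \<Longrightarrow> i \<noteq> j \<Longrightarrow> interior (R i) \<inter> interior (R j) = {}"
    and dR': "\<And>i j. i < n \<Longrightarrow> j < n \<Longrightarrow> i \<noteq> j \<Longrightarrow> interior (R' i) \<inter> interior (R' j) = {}"
    and S1: "\<And>x. S1 x = (\<Sum>j<n'. c j * indicator (R j) x)"
    and S2: "\<And>x. S2 x = (\<Sum>j<n. c' j * indicator (R' j) x)"
    and NR: "\<And>j. j < n' \<Longrightarrow> frontier (R j) \<subseteq> N" "\<And>j. j < n \<Longrightarrow> frontier (R' j) \<subseteq> N"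
    and dom: "\<not> ext \<Longrightarrow> \<Omega> = (\<Union>j<n'. R j)" "(\<Union>j<n. R' j) \<subseteq> \<Omega>"
    and extd: "ext \<Longrightarrow> \<Omega> = UNIV" "ext \<Longrightarrow> (\<Union>j<n'. R j) = Q" "ext \<Longrightarrow> ring \<kappa>0 N0 Q Q {}" "ext \<Longrightarrow> frontier Q \<subseteq> N"
    and nn: "n' \<le> n + 1" "n \<ge> 1"
    and M: "\<And>j. j < n' \<Longrightarrow> R j \<subseteq> cball 0 M" "\<And>j. j < n \<Longrightarrow> R' j \<subseteq> cball 0 M"
begin

text \<open>The slope after shrinking, for which the triangles of one ring are disjoint.\<close>

definition \<kappa> :: real where "\<kappa> = \<kappa>0 / (2 + \<kappa>0)"

lemma k: "0 < \<kappa>" "\<kappa> \<le> 1" using k0 by (auto simp: \<kappa>_def)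

text \<open>A point off the lines is interior to every ring containing it, so it belongs to at most
  one ring.\<close>

lemma value_gen:
  fixes m :: nat
  assumes N: "\<And>j. j < m \<Longrightarrow> frontier (T j) \<subseteq> N" and d: "\<And>i j. i < m \<Longrightarrow> j < m \<Longrightarrow> i \<noteq> j \<Longrightarrow> interior (T i) \<inter> interior (T j) = {}"
    and j: "j < m" "z \<in> T j" "z \<notin> N"
  shows "(\<Sum>i<m. b i * indicator (T i) z) = (b j :: real)"
proof -
  have int: "z \<in> interior (T i)" if "i < m" "z \<in> T i" for i
    using N[OF that(1)] j(3) that(2) closure_subset by (auto simp: frontier_def)
  have "(\<Sum>i<m. b i * indicator (T i) z) = (\<Sum>i<m. if i = j then b j else 0)"
  proof (rule sum.cong[OF refl])
    fix i assume "i \<in> {..<m}"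
    then show "b i * indicator (T i) z = (if i = j then b j else 0)"
      using int[of i] int[OF j(1,2)] d[of i j] j by (auto simp: indicator_def)
  qed
  also have "\<dots> = (\<Sum>i<m. if j = i then b i else 0)" by (rule sum.cong) auto
  finally show ?thesis using j(1) by (simp add: sum.delta')
qed

lemma S1_val: "j < n' \<Longrightarrow> z \<in> R j \<Longrightarrow> z \<notin> N \<Longrightarrow> S1 z = c j"
  unfolding S1 by (rule value_gen[OF NR(1) dR])

lemma S2_val: "j < n \<Longrightarrow> z \<in> R' j \<Longrightarrow> z \<notin> N \<Longrightarrow> S2 z = c' j"
  unfolding S2 by (rule value_gen[OF NR(2) dR'])

lemma step_gen:
  fixes m :: nat
  assumes "\<And>j. j < m \<Longrightarrow> frontier (T j) \<subseteq> N"
  shows "steplike (\<lambda>x. \<Sum>j<m. b j * indicator (T j) x)"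
  unfolding steplike_def
proof (intro allI impI)
  fix x y :: pt assume d: "closed_segment x y \<inter> N = {}"
  have "x \<in> T j \<longleftrightarrow> y \<in> T j" if "j < m" for j
    using convex_in_or_out[OF convex_closed_segment d assms[OF that]] by auto
  then show "(\<Sum>j<m. b j * indicator (T j) x) = (\<Sum>j<m. b j * (indicator (T j) y :: real))"
    by (intro sum.cong) (auto simp: indicator_def)
qed

definition Bd :: real where "Bd = (\<Sum>j<n'. \<bar>c j\<bar>) + (\<Sum>j<n. \<bar>c' j\<bar>)"

lemma S1_facts: "steplike S1" "S1 \<in> borel_measurable borel" "\<bar>S1 x\<bar> \<le> Bd" "norm x > M \<Longrightarrow> S1 x = 0" "x \<notin> \<Omega> \<Longrightarrow> S1 x = 0"
proof -
  have "S1 = (\<lambda>x. \<Sum>j<n'. c j * indicator (R j) x)" using S1 by blast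
  moreover have "steplike (\<lambda>x. \<Sum>j<n'. c j * indicator (R j) x)" by (rule step_gen) (rule NR(1))
  ultimately show "steplike S1" by simp
  have "R j \<in> sets borel" if "j < n'" for j using ring_facts(1)[OF rR[OF that]] .
  then show "S1 \<in> borel_measurable borel" unfolding S1[abs_def] by (intro borel_measurable_sum borel_measurable_times) auto
  have "\<bar>S1 x\<bar> \<le> (\<Sum>j<n'. \<bar>c j\<bar>)" unfolding S1 by (intro order_trans[OF sum_abs] sum_mono) (auto simp: indicator_def)
  then show "\<bar>S1 x\<bar> \<le> Bd" unfolding Bd_def using sum_nonneg[of "{..<n}" "\<lambda>j. \<bar>c' j\<bar>"] by linarith
  show "norm x > M \<Longrightarrow> S1 x = 0" unfolding S1 using M(1) by (intro sum.neutral) (force simp: indicator_def)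
  show "S1 x = 0" if "x \<notin> \<Omega>"
  proof -
    have "x \<notin> (\<Union>j<n'. R j)" using that dom(1) extd(1) by auto
    then show ?thesis unfolding S1 by (intro sum.neutral) auto
  qed
qed

lemma S2_facts: "steplike S2" "S2 \<in> borel_measurable borel" "\<bar>S2 x\<bar> \<le> Bd" "norm x > M \<Longrightarrow> S2 x = 0" "x \<notin> \<Omega> \<Longrightarrow> S2 x = 0"
proof -
  have "S2 = (\<lambda>x. \<Sum>j<n. c' j * indicator (R' j) x)" using S2 by blast
  moreover have "steplike (\<lambda>x. \<Sum>j<n. c' j * indicator (R' j) x)" by (rule step_gen) (rule NR(2))
  ultimately show "steplike S2" by simp
  have "R' j \<in> sets borel" if "j < n" for j using ring_facts(1)[OF rR'[OF that]] .
  then show "S2 \<in> borel_measurable borel" unfolding S2[abs_def] by (intro borel_measurable_sum borel_measurable_times) auto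
  have "\<bar>S2 x\<bar> \<le> (\<Sum>j<n. \<bar>c' j\<bar>)" unfolding S2 by (intro order_trans[OF sum_abs] sum_mono) (auto simp: indicator_def)
  then show "\<bar>S2 x\<bar> \<le> Bd" unfolding Bd_def using sum_nonneg[of "{..<n'}" "\<lambda>j. \<bar>c j\<bar>"] by linarith
  show "norm x > M \<Longrightarrow> S2 x = 0" unfolding S2 using M(2) by (intro sum.neutral) (force simp: indicator_def)
  show "S2 x = 0" if "x \<notin> \<Omega>"
  proof -
    have "x \<notin> (\<Union>j<n. R' j)" using that dom(2) by blast
    then show ?thesis unfolding S2 by (intro sum.neutral) auto
  qed
qed

definition g :: "pt \<Rightarrow> real" where "g x = S1 x - S2 x"

lemma g_facts: "steplike g" "g \<in> borel_measurable borel" "\<bar>g x\<bar> \<le> 2 * Bd" "norm x > M \<Longrightarrow> g x = 0" "x \<notin> \<Omega> \<Longrightarrow> g x = 0"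
proof -
  show "steplike g" using steplike_diff[OF S1_facts(1) S2_facts(1)] by (simp add: g_def[abs_def])
  show "g \<in> borel_measurable borel" unfolding g_def[abs_def] using S1_facts(2) S2_facts(2) by measurable
  show "\<bar>g x\<bar> \<le> 2 * Bd" unfolding g_def using S1_facts(3)[of x] S2_facts(3)[of x] by linarith
  show "norm x > M \<Longrightarrow> g x = 0" "x \<notin> \<Omega> \<Longrightarrow> g x = 0" unfolding g_def using S1_facts(4,5) S2_facts(4,5) by simp_all
qed

section \<open>The tubes belonging to two ring partitions\<close>

definition I0 :: "(nat \<times> flag) set" where "I0 = (SIGMA j:{..<n'}. ring.flags \<kappa>0 (R j))"
text \<open>The edges of Q reversed, so that the left normal points out of Q. The first component n'
  is not a ring index; it marks these tubes in \<open>ih\<close>, \<open>im\<close> and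
  \<open>ic\<close>.\<close>

definition Io :: "(nat \<times> flag) set" where
  "Io = (if ext then (\<lambda>(a, e, L). (n', (a + L *\<^sub>R e, - e, L))) ` ring.flags \<kappa>0 Q else {})"
definition ia where "ia i = fst (snd i)" for i :: "nat \<times> flag"
definition ie where "ie i = fst (snd (snd i))" for i :: "nat \<times> flag"
definition il where "il i = snd (snd (snd i))" for i :: "nat \<times> flag"
text \<open>From a point of the ball of radius M a move by more than 2 * M leaves the ball; the
  extra 1 leaves room for choosing a height off the lines.\<close>

definition ih where "ih i t = (if fst i < n' then \<kappa> * min t (il i - t) else 2 * M + 1)" for i :: "nat \<times> flag"
definition im where "im i = (if fst i < n' then mval \<kappa> (ia i) (ie i) (il i) g else (\<lambda>_. 0))" for i :: "nat \<times> flag"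
definition ic where "ic i = (if fst i < n' then c (fst i) else 0)" for i :: "nat \<times> flag"
text \<open>The ends of the bases are included because a flag that merely ends at a point need not
  have the wanted orientation there.\<close>

definition Z where "Z = X \<union> (\<Union>i\<in>I0 \<union> Io. {ia i, ia i + il i *\<^sub>R ie i})"

lemmas idefs = ia_def ie_def il_def

lemma I0_D:
  assumes "i \<in> I0"
  shows "fst i < n'" "snd i \<in> ring.flags \<kappa>0 (R (fst i))" "(ia i, ie i, il i) = snd i" "norm (ie i) = 1" "il i > 0"
    "ftri \<kappa> (snd i) = tri \<kappa> (ia i) (ie i) (il i)" "tri \<kappa> (ia i) (ie i) (il i) \<subseteq> interior (R (fst i))"
    "fseg (ia i, ie i, il i) \<subseteq> frontier (R (fst i))"
proof -
  show 1: "fst i < n'" "snd i \<in> ring.flags \<kappa>0 (R (fst i))" using assms by (auto simp: I0_def)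
  show 2: "(ia i, ie i, il i) = snd i" by (simp add: idefs)
  interpret ring \<kappa>0 N0 "R (fst i)" "A (fst i)" "B (fst i)" by (rule rR[OF 1(1)])
  have "is_flag \<kappa>0 (R (fst i)) (ia i, ie i, il i)" unfolding 2 by (rule flags_flag[OF 1(2)])
  then show "norm (ie i) = 1" "il i > 0" by (auto simp: is_flag_def)
  show 3: "ftri \<kappa> (snd i) = tri \<kappa> (ia i) (ie i) (il i)" unfolding 2[symmetric] by (simp add: ftri_def)
  show "tri \<kappa> (ia i) (ie i) (il i) \<subseteq> interior (R (fst i))" using small_tri_sub[OF 1(2)] 3 unfolding \<kappa>_def[symmetric] by simp
  show "fseg (ia i, ie i, il i) \<subseteq> frontier (R (fst i))" unfolding 2 by (rule flags_frontier[OF 1(2)])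
qed

lemma Io_D:
  assumes "i \<in> Io"
  obtains a e L where "ext" "i = (n', (a + L *\<^sub>R e, - e, L))" "(a, e, L) \<in> ring.flags \<kappa>0 Q" "norm e = 1" "L > 0"
    "fseg (a + L *\<^sub>R e, - e, L) \<subseteq> frontier Q" "\<And>t s. fr (ia i) (ie i) t s = fr a e (L - t) (- s)"
proof -
  have "ext" using assms by (auto simp: Io_def split: if_splits)
  interpret ring \<kappa>0 N0 Q Q "{}" by (rule extd(3)[OF \<open>ext\<close>])
  obtain a e L where i: "i = (n', (a + L *\<^sub>R e, - e, L))" "(a, e, L) \<in> flags" using assms \<open>ext\<close> unfolding Io_def by auto
  have e: "norm e = 1" "L > 0" using flags_flag[OF i(2)] by (auto simp: is_flag_def)
  have "fseg (a + L *\<^sub>R e, - e, L) \<subseteq> frontier Q" using flags_frontier[OF i(2)] flag_rev(1)[OF e(1)] by simp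
  moreover have "fr (ia i) (ie i) t s = fr a e (L - t) (- s)" for t s by (simp add: i(1) idefs fr_def algebra_simps)
  ultimately show ?thesis using that \<open>ext\<close> i e by blast
qed

lemma finite_I: "finite I0" "finite Io"
proof -
  have "finite (ring.flags \<kappa>0 (R j))" if "j < n'" for j using ring_facts(2)[OF rR[OF that]] .
  then show "finite I0" unfolding I0_def by (intro finite_SigmaI) auto
  show "finite Io" unfolding Io_def using ring_facts(2)[OF extd(3)] by auto
qed

text \<open>On the triangle S1 is one constant, so the values of g are counted by those of S2: the
  coefficients of the rings met, and 0 for points outside all of them.\<close>

lemma V_sub:
  assumes i: "i \<in> I0"
  shows "(\<lambda>z. \<bar>g z\<bar>) ` (tri \<kappa> (ia i) (ie i) (il i) - N)
    \<subseteq> (\<lambda>w. \<bar>c (fst i) - w\<bar>) ` insert 0 (c' ` {k. k < n \<and> (tri \<kappa> (ia i) (ie i) (il i) - N) \<inter> R' k \<noteq> {}})"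
proof
  fix v assume "v \<in> (\<lambda>z. \<bar>g z\<bar>) ` (tri \<kappa> (ia i) (ie i) (il i) - N)"
  then obtain z where z: "z \<in> tri \<kappa> (ia i) (ie i) (il i)" "z \<notin> N" "v = \<bar>g z\<bar>" by blast
  have "z \<in> R (fst i)" using I0_D(7)[OF i] z(1) interior_subset by blast
  then have "S1 z = c (fst i)" using S1_val I0_D(1)[OF i] z(2) by blast
  moreover have "S2 z \<in> insert 0 (c' ` {k. k < n \<and> (tri \<kappa> (ia i) (ie i) (il i) - N) \<inter> R' k \<noteq> {}})"
  proof (cases "\<exists>k<n. z \<in> R' k")
    case True
    then obtain k where "k < n" "z \<in> R' k" by blast
    then show ?thesis using S2_val[of k z] z by blast
  next
    case False
    then have "S2 z = 0" unfolding S2 by (intro sum.neutral) auto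
    then show ?thesis by simp
  qed
  ultimately show "v \<in> (\<lambda>w. \<bar>c (fst i) - w\<bar>) ` insert 0 (c' ` {k. k < n \<and> (tri \<kappa> (ia i) (ie i) (il i) - N) \<inter> R' k \<noteq> {}})"
    unfolding z(3) g_def by (intro image_eqI[of _ _ "S2 z"]) simp_all
qed

lemma V_finite: "i \<in> I0 \<Longrightarrow> finite ((\<lambda>z. \<bar>g z\<bar>) ` (tri \<kappa> (ia i) (ie i) (il i) - N))"
  by (rule finite_subset[OF V_sub]) auto

definition G :: "flag set" where "G = (\<Union>k<n. ring.flags \<kappa>0 (R' k))"

text \<open>The triangle minus the finite set X is connected, so each ring meeting it either contains it or has an edge in it.\<close>
lemma card_J:
  assumes i: "i \<in> I0"
  shows "card {k. k < n \<and> (tri \<kappa> (ia i) (ie i) (il i) - N) \<inter> R' k \<noteq> {}} \<le> 1 + card {f\<in>G. fseg f \<inter> ftri \<kappa> (snd i) \<noteq> {}}"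
proof -
  define T where "T = tri \<kappa> (ia i) (ie i) (il i)"
  define J where "J = {k. k < n \<and> (T - N) \<inter> R' k \<noteq> {}}"
  define J1 where "J1 = {k\<in>J. \<exists>f\<in>ring.flags \<kappa>0 (R' k). fseg f \<inter> T \<noteq> {}}"
  have fJ: "finite J" by (simp add: J_def)
  have e: "norm (ie i) = 1" "il i > 0" using I0_D[OF i] by auto
  have oT: "open T" unfolding T_def by (rule open_tri[OF e(1)])
  have cT: "convex T" unfolding T_def tri_def
  proof (rule convexI)
    fix x y u v assume h: "x \<in> {fr (ia i) (ie i) t s |t s. 0 < t \<and> t < il i \<and> 0 < s \<and> s < \<kappa> * min t (il i - t)}"
      "y \<in> {fr (ia i) (ie i) t s |t s. 0 < t \<and> t < il i \<and> 0 < s \<and> s < \<kappa> * min t (il i - t)}" "0 \<le> u" "0 \<le> v" "u + v = (1::real)"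
    obtain t s where x: "x = fr (ia i) (ie i) t s" "0 < t" "t < il i" "0 < s" "s < \<kappa> * min t (il i - t)" using h(1) by blast
    obtain t' s' where y: "y = fr (ia i) (ie i) t' s'" "0 < t'" "t' < il i" "0 < s'" "s' < \<kappa> * min t' (il i - t')" using h(2) by blast
    have comb: "u * p + v * q < r" if "p < r" "q < r" for p q r :: real using convex_bound_lt[OF that h(3-5)] .
    have comb0: "0 < u * p + v * q" if "0 < p" "0 < q" for p q :: real using comb[of "-p" 0 "-q"] that by simp
    have "u *\<^sub>R x + v *\<^sub>R y = (u + v) *\<^sub>R ia i + (u * t + v * t') *\<^sub>R ie i + (u * s + v * s') *\<^sub>R rot (ie i)"
      unfolding x(1) y(1) by (simp add: fr_def algebra_simps)
    then have eq: "u *\<^sub>R x + v *\<^sub>R y = fr (ia i) (ie i) (u * t + v * t') (u * s + v * s')" using h(5) by (simp add: fr_def)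
    have m: "s < \<kappa> * t" "s < \<kappa> * (il i - t)" "s' < \<kappa> * t'" "s' < \<kappa> * (il i - t')" using x y min_scale(2)[OF k(1)] by auto
    have "0 < u * (\<kappa> * t - s) + v * (\<kappa> * t' - s')" "0 < u * (\<kappa> * (il i - t) - s) + v * (\<kappa> * (il i - t') - s')" using m by (intro comb0; simp)+
    moreover have "u * (\<kappa> * (il i - t) - s) + v * (\<kappa> * (il i - t') - s') = \<kappa> * ((u + v) * il i - (u * t + v * t')) - (u * s + v * s')" by (simp add: algebra_simps)
    ultimately have "u * s + v * s' < \<kappa> * (u * t + v * t')" "u * s + v * s' < \<kappa> * (il i - (u * t + v * t'))" using h(5) by (simp_all add: algebra_simps)
    then have "u * s + v * s' < \<kappa> * min (u * t + v * t') (il i - (u * t + v * t'))" using min_scale(2)[OF k(1)] by blast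
    then show "u *\<^sub>R x + v *\<^sub>R y \<in> {fr (ia i) (ie i) t s |t s. 0 < t \<and> t < il i \<and> 0 < s \<and> s < \<kappa> * min t (il i - t)}"
      unfolding eq using comb[OF x(3) y(3)] comb0[OF x(2) y(2)] comb0[OF x(4) y(4)] by blast
  qed
  have cTX: "connected (T - X)"
    using connected_open_delete_finite[OF oT convex_connected[OF cT] _ finX] by simp
  have XN: "X \<subseteq> N" unfolding X_def N_def by blast
  \<comment> \<open>A ring that meets the connected set \<open>T - X\<close> without containing it
    has a frontier point there; this point is no crossing, so it lies on a flag of the ring.\<close>
  have inside: "T - X \<subseteq> R' k" if "k \<in> J" "k \<notin> J1" for k
  proof (rule ccontr)
    assume "\<not> T - X \<subseteq> R' k"
    moreover have "(T - X) \<inter> R' k \<noteq> {}" using that(1) XN unfolding J_def by blast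
    ultimately have "(T - X) \<inter> frontier (R' k) \<noteq> {}" using connected_Int_frontier[OF cTX] by blast
    then obtain z where z: "z \<in> T" "z \<notin> X" "z \<in> frontier (R' k)" by blast
    have "k < n" using that(1) by (simp add: J_def)
    from generic_cover[OF rR'[OF this] NR(2)[OF this] z(3,2)] show False using that z(1) unfolding J1_def by blast
  qed
  have "tri \<kappa> (ia i) (ie i) (il i) \<noteq> {}"
  proof -
    have "fr (ia i) (ie i) (il i / 2) (\<kappa> * il i / 4) \<in> tri \<kappa> (ia i) (ie i) (il i)"
      unfolding fr_in_tri[OF e(1)] using e(2) k(1) by simp
    then show ?thesis by blast
  qed
  then have "infinite T" using finite_imp_not_open oT T_def by blast
  then have TX: "T - X \<noteq> {}" using finX by (metis finite_subset Diff_eq_empty_iff)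
  have "open (T - X)" using oT finX by (simp add: finite_imp_closed open_Diff)
  \<comment> \<open>Two rings that contain the nonempty open set \<open>T - X\<close> would have
    common interior points.\<close>
  then have one: "k = k'" if "k \<in> J - J1" "k' \<in> J - J1" for k k'
  proof -
    have "T - X \<subseteq> interior (R' k)" "T - X \<subseteq> interior (R' k')" using inside[of k] inside[of k'] that \<open>open (T - X)\<close> by (simp_all add: interior_maximal)
    then have "interior (R' k) \<inter> interior (R' k') \<noteq> {}" using TX by blast
    moreover have "k < n" "k' < n" using that by (simp_all add: J_def)
    ultimately show ?thesis using dR'[of k k'] by blast
  qed
  have c1: "card (J - J1) \<le> 1"
  proof (cases "J - J1 = {}")
    case False
    then obtain k where "k \<in> J - J1" by blast
    then have "J - J1 \<subseteq> {k}" using one by blast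
    then show ?thesis using card_mono[of "{k}" "J - J1"] by simp
  next
    case True then show ?thesis by (simp only: card.empty)
  qed
  have "\<forall>k\<in>J1. \<exists>f. f \<in> ring.flags \<kappa>0 (R' k) \<and> fseg f \<inter> T \<noteq> {}" by (auto simp: J1_def)
  from bchoice[OF this] obtain F where F: "\<forall>k\<in>J1. F k \<in> ring.flags \<kappa>0 (R' k) \<and> fseg (F k) \<inter> T \<noteq> {}" ..
  have finG: "finite G" unfolding G_def using ring_facts(2)[OF rR'] by auto
  \<comment> \<open>A flag determines its ring, because the small triangle over it lies in the
    interior of the ring.\<close>
  have "inj_on F J1"
  proof (rule inj_onI, rule ccontr)
    fix k k' assume h: "k \<in> J1" "k' \<in> J1" "F k = F k'" "k \<noteq> k'"
    have kn: "k < n" "k' < n" using h by (auto simp: J1_def J_def)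
    have s1: "ftri \<kappa> (F k) \<subseteq> interior (R' k)" using ring.small_tri_sub[OF rR'[OF kn(1)]] F h(1) unfolding \<kappa>_def by blast
    have s2: "ftri \<kappa> (F k) \<subseteq> interior (R' k')" using ring.small_tri_sub[OF rR'[OF kn(2)]] F h(2,3) unfolding \<kappa>_def by metis
    obtain a e' L where f: "F k = (a, e', L)" by (cases "F k")
    have "is_flag \<kappa>0 (R' k) (a, e', L)" using ring.flags_flag[OF rR'[OF kn(1)]] F h(1) f by metis
    then have "fr a e' (L/2) (\<kappa> * L / 4) \<in> ftri \<kappa> (F k)" unfolding f ftri_def split_conv using k(1) by (subst fr_in_tri) (auto simp: is_flag_def)
    then show False using s1 s2 dR'[OF kn h(4)] by blast
  qed
  moreover have "F ` J1 \<subseteq> {f\<in>G. fseg f \<inter> T \<noteq> {}}"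
  proof
    fix f assume "f \<in> F ` J1"
    then obtain k where "k \<in> J1" "f = F k" by blast
    then show "f \<in> {f\<in>G. fseg f \<inter> T \<noteq> {}}" using F unfolding G_def J1_def J_def by blast
  qed
  ultimately have c2: "card J1 \<le> card {f\<in>G. fseg f \<inter> T \<noteq> {}}" using finG by (intro card_inj_on_le) auto
  have "card J \<le> card (J - J1) + card J1"
    using card_Un_le[of "J - J1" J1] by (metis (no_types, lifting) J1_def Un_Diff_cancel2 mem_Collect_eq subsetI sup.absorb1)
  then show ?thesis using c1 c2 I0_D(6)[OF i] unfolding J_def T_def by simp
qed

text \<open>The 2 counts the value 0 and the one ring that may contain the triangle up to crossing
  points.\<close>

lemma card_V:
  assumes i: "i \<in> I0"
  shows "card ((\<lambda>z. \<bar>g z\<bar>) ` (tri \<kappa> (ia i) (ie i) (il i) - N)) \<le> 2 + card {f\<in>G. fseg f \<inter> ftri \<kappa> (snd i) \<noteq> {}}"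
proof -
  define J where "J = {k. k < n \<and> (tri \<kappa> (ia i) (ie i) (il i) - N) \<inter> R' k \<noteq> {}}"
  have fJ: "finite J" by (simp add: J_def)
  have "card ((\<lambda>z. \<bar>g z\<bar>) ` (tri \<kappa> (ia i) (ie i) (il i) - N)) \<le> card ((\<lambda>w. \<bar>c (fst i) - w\<bar>) ` insert 0 (c' ` J))"
    using V_sub[OF i] fJ unfolding J_def[symmetric] by (intro card_mono) auto
  also have "\<dots> \<le> card (insert 0 (c' ` J))" using fJ by (intro card_image_le) simp
  also have "\<dots> \<le> Suc (card (c' ` J))" using fJ by (simp add: card_insert_if)
  also have "\<dots> \<le> Suc (card J)" using card_image_le[OF fJ] by simp
  finally show ?thesis using card_J[OF i] unfolding J_def[symmetric] by simp
qed

end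

lemma flags_good:
  fixes m :: nat
  assumes k: "0 < \<kappa>" and rg: "\<And>j. j < m \<Longrightarrow> ring \<kappa> N0 (T j) (U j) (W j)"
    and d: "\<And>i j. i < m \<Longrightarrow> j < m \<Longrightarrow> i \<noteq> j \<Longrightarrow> interior (T i) \<inter> interior (T j) = {}"
  shows "good_flags (\<kappa> / (2 + \<kappa>)) (\<Union>j<m. ring.flags \<kappa> (T j))"
    and "card (\<Union>j<m. ring.flags \<kappa> (T j)) \<le> 8 * N0 * m"
    and "\<And>i j f f' z. i < m \<Longrightarrow> f \<in> ring.flags \<kappa> (T i) \<Longrightarrow> z \<in> ftri (\<kappa> / (2 + \<kappa>)) f \<Longrightarrow>
      j < m \<Longrightarrow> f' \<in> ring.flags \<kappa> (T j) \<Longrightarrow> z \<in> ftri (\<kappa> / (2 + \<kappa>)) f' \<Longrightarrow> i = j \<and> f = f'"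
proof -
  show uniq: "i = j \<and> f = f'" if "i < m" "f \<in> ring.flags \<kappa> (T i)" "z \<in> ftri (\<kappa> / (2 + \<kappa>)) f"
    "j < m" "f' \<in> ring.flags \<kappa> (T j)" "z \<in> ftri (\<kappa> / (2 + \<kappa>)) f'" for i j f f' z
  proof -
    have "z \<in> interior (T i)" "z \<in> interior (T j)"
      using ring.small_tri_sub[OF rg[OF that(1)] that(2)] ring.small_tri_sub[OF rg[OF that(4)] that(5)] that by blast+
    then have "i = j" using d[OF that(1,4)] by blast
    then show ?thesis using ring.tri_disjoint[OF rg[OF that(1)] that(2) _ that(3,6)] that(5) by simp
  qed
  have "norm e = 1 \<and> L > 0" if "j < m" "(a, e, L) \<in> ring.flags \<kappa> (T j)" for j a e L
    using ring.flags_flag[OF rg[OF that(1)] that(2)] by (auto simp: is_flag_def)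
  moreover have "ftri (\<kappa> / (2 + \<kappa>)) f \<inter> ftri (\<kappa> / (2 + \<kappa>)) f' = {}"
    if "i < m" "f \<in> ring.flags \<kappa> (T i)" "j < m" "f' \<in> ring.flags \<kappa> (T j)" "f \<noteq> f'" for i j f f'
    using uniq[OF that(1,2) _ that(3,4)] that(5) by blast
  moreover have fin: "finite (ring.flags \<kappa> (T j))" "card (ring.flags \<kappa> (T j)) \<le> 8 * N0" if "j < m" for j
    using ring_facts(2,3)[OF rg[OF that]] .
  ultimately show "good_flags (\<kappa> / (2 + \<kappa>)) (\<Union>j<m. ring.flags \<kappa> (T j))"
    unfolding good_flags_def by (intro conjI ballI impI finite_UN_I; blast)
  have "card (\<Union>j<m. ring.flags \<kappa> (T j)) \<le> (\<Sum>j<m. card (ring.flags \<kappa> (T j)))" by (rule card_UN_le) simp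
  also have "\<dots> \<le> (\<Sum>j<m. 8 * N0)" using fin(2) by (intro sum_mono) simp
  finally show "card (\<Union>j<m. ring.flags \<kappa> (T j)) \<le> 8 * N0 * m" by (simp add: mult.commute)
qed

lemma (in lines) jmp_eq_zero_if_const:
  assumes f: "steplike f" and l: "l \<in> \<Lambda>" and x: "x = fr (fst l) (snd l) t 0" and v: "v = snd l \<or> v = - snd l" and r: "r > 0"
    and H: "\<And>z. z \<in> hdisc x r v \<Longrightarrow> f z = K" "\<And>z. z \<in> hdisc x r (- v) \<Longrightarrow> f z = K"
  shows "jmp f l t = 0"
proof (cases "x \<in> X")
  case True then show ?thesis by (simp add: jmp_def Let_def x)
next
  case False
  have e: "norm (snd l) = 1" using unit[OF l] .
  have l': "(fst l, snd l) \<in> \<Lambda>" "x \<in> ln_of (fst l, snd l)" using l x by (auto simp: ln_of_def)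
  obtain r' where r': "r' > 0"
    "\<And>z. z \<in> ball x r' \<Longrightarrow> (z - x) \<bullet> rot (snd l) > 0 \<Longrightarrow> f z = side f x (rot (snd l))"
    "\<And>z. z \<in> ball x r' \<Longrightarrow> (z - x) \<bullet> rot (snd l) < 0 \<Longrightarrow> f z = side f x (- rot (snd l))"
    by (rule local_sides[OF f l' False]) (rule that, assumption+)
  define \<rho> where "\<rho> = min r r' / 2"
  have \<rho>: "0 < \<rho>" "\<rho> < r" "\<rho> < r'" using r r'(1) by (auto simp: \<rho>_def)
  define z where "z = (\<lambda>\<sigma>::real. x + (\<sigma> * \<rho>) *\<^sub>R rot (snd l))"
  have i: "(z \<sigma> - x) \<bullet> rot (snd l) = \<sigma> * \<rho>" for \<sigma> using norm1_inner[OF e] by (simp add: z_def)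
  have b: "z \<sigma> \<in> ball x r \<inter> ball x r'" if "\<bar>\<sigma>\<bar> = 1" for \<sigma> using that \<rho> e by (simp add: z_def dist_norm abs_mult)
  have "z 1 \<in> hdisc x r (snd l)" "z (-1) \<in> hdisc x r (- snd l)" using i[of 1] i[of "-1"] b[of 1] b[of "-1"] \<rho> by (simp_all add: hdisc_def)
  then have "f (z 1) = K" "f (z (-1)) = K" using v H by auto
  moreover have "f (z 1) = side f x (rot (snd l))" "f (z (-1)) = side f x (- rot (snd l))"
    using i[of 1] i[of "-1"] b[of 1] b[of "-1"] \<rho> r'(2)[of "z 1"] r'(3)[of "z (-1)"] by simp_all
  ultimately show ?thesis by (simp add: jmp_def Let_def x[symmetric])
qed

lemma hdisc_nonempty:
  assumes "norm v = 1" "r > 0"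
  shows "hdisc x r v \<noteq> {}"
proof -
  have "x + (r/2) *\<^sub>R rot v \<in> hdisc x r v" using assms norm1_inner[OF assms(1)] by (simp add: hdisc_def dist_norm)
  then show ?thesis by blast
qed

section \<open>Verification of the tube conditions\<close>

context ring_partitions begin

lemma Z: "finite Z" "X \<subseteq> Z"
  using finX finite_I by (auto simp: Z_def)

lemma I0_base:
  assumes "i \<in> I0"
  obtains l where "l \<in> \<Lambda>" "\<And>t. fr (ia i) (ie i) t 0 \<in> ln_of l"
  using flag_base[OF I0_D(4,5)[OF assms]] I0_D(1,8)[OF assms] NR(1) that by (metis subset_trans)

lemma Io_base:
  assumes "i \<in> Io"
  obtains l where "l \<in> \<Lambda>" "\<And>t. fr (ia i) (ie i) t 0 \<in> ln_of l"
proof -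
  obtain a e L where h: "ext" "i = (n', (a + L *\<^sub>R e, - e, L))" "norm e = 1" "L > 0" "fseg (a + L *\<^sub>R e, - e, L) \<subseteq> frontier Q"
    by (rule Io_D[OF assms]) (rule that, assumption+)
  have "norm (- e) = 1" using h by simp
  then show ?thesis using flag_base[of "- e" L "a + L *\<^sub>R e"] h extd(4) that by (simp add: idefs) (metis subset_trans)
qed

lemma I0_tri: "i \<in> I0 \<Longrightarrow> 0 < t \<Longrightarrow> t < il i \<Longrightarrow> 0 < s \<Longrightarrow> s < ih i t \<Longrightarrow> fr (ia i) (ie i) t s \<in> tri \<kappa> (ia i) (ie i) (il i)"
  using I0_D(1)[of i] by (simp add: fr_in_tri[OF I0_D(4)] ih_def)

lemma I0_disj:
  assumes "i \<in> I0" "i' \<in> I0" "z \<in> tri \<kappa> (ia i) (ie i) (il i)" "z \<in> tri \<kappa> (ia i') (ie i') (il i')"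
  shows "i = i'"
proof -
  have z: "z \<in> ftri (\<kappa>0 / (2 + \<kappa>0)) (snd i)" "z \<in> ftri (\<kappa>0 / (2 + \<kappa>0)) (snd i')"
    using assms(3,4) I0_D(6)[OF assms(1)] I0_D(6)[OF assms(2)] unfolding \<kappa>_def[symmetric] by simp_all
  from flags_good(3)[OF k0 rR dR I0_D(1,2)[OF assms(1)] z(1) I0_D(1,2)[OF assms(2)] z(2)] show ?thesis by (simp add: prod_eq_iff)
qed

lemma Io_outside:
  assumes "i \<in> Io" "0 < s"
  shows "fr (ia i) (ie i) t s \<notin> Q"
proof
  assume q: "fr (ia i) (ie i) t s \<in> Q"
  obtain a e L where h: "ext" "(a, e, L) \<in> ring.flags \<kappa>0 Q" "norm e = 1" "\<And>t s. fr (ia i) (ie i) t s = fr a e (L - t) (- s)"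
    by (rule Io_D[OF assms(1)]) (rule that, assumption+)
  have "0 \<le> (fr a e (L - t) (- s) - a) \<bullet> rot e" using convex_flag_halfplane[OF extd(3)[OF h(1)] h(2)] q h(4) by simp
  then show False using assms(2) h(3) by simp
qed

lemma fst_Io: "i \<in> Io \<Longrightarrow> fst i = n'" by (auto simp: Io_def split: if_splits)

text \<open>In the plane case the triangles over ring edges lie in Q and the outer tubes outside it,
  so only tubes of the same kind have to be compared.\<close>

lemma T_disj:
  assumes i: "i \<in> I0 \<union> Io" "0 < t" "t < il i" "0 < s" "s < ih i t"
    and i': "i' \<in> I0 \<union> Io" "0 < t'" "t' < il i'" "0 < s'" "s' < ih i' t'"
    and eq: "fr (ia i) (ie i) t s = fr (ia i') (ie i') t' s'"
  shows "i = i'"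
proof -
  have mixed: False if "p \<in> I0" "q \<in> Io" "0 < t" "t < il p" "0 < s" "s < ih p t" "0 < s'" "fr (ia p) (ie p) t s = fr (ia q) (ie q) t' s'" for p q t s t' s'
  proof -
    have "ext" using that(2) by (auto simp: Io_def split: if_splits)
    have "fr (ia p) (ie p) t s \<in> R (fst p)" using I0_tri[OF that(1,3-6)] I0_D(7)[OF that(1)] interior_subset by blast
    then have "fr (ia p) (ie p) t s \<in> Q" using extd(2)[OF \<open>ext\<close>] I0_D(1)[OF that(1)] by blast
    then show False using Io_outside[OF that(2,7)] that(8) by simp
  qed
  consider "i \<in> I0" "i' \<in> I0" | "i \<in> I0" "i' \<in> Io" | "i \<in> Io" "i' \<in> I0" | "i \<in> Io" "i' \<in> Io" using i i' by blast
  then show ?thesis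
  proof cases
    case 1
    show ?thesis using I0_disj[OF 1 I0_tri[OF 1(1) i(2-5)]] I0_tri[OF 1(2) i'(2-5)] eq by simp
  next
    case 2 then show ?thesis using mixed[OF 2 i(2-5) i'(4) eq] by blast
  next
    case 3 then show ?thesis using mixed[OF 3(2,1) i'(2-5) i(4) eq[symmetric]] by blast
  next
    case 4
    obtain a e L where h: "ext" "i = (n', (a + L *\<^sub>R e, - e, L))" "(a, e, L) \<in> ring.flags \<kappa>0 Q" "\<And>t s. fr (ia i) (ie i) t s = fr a e (L - t) (- s)"
      by (rule Io_D[OF 4(1)]) (rule that, assumption+)
    obtain a' e' L' where h': "i' = (n', (a' + L' *\<^sub>R e', - e', L'))" "(a', e', L') \<in> ring.flags \<kappa>0 Q" "\<And>t s. fr (ia i') (ie i') t s = fr a' e' (L' - t) (- s)"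
      by (rule Io_D[OF 4(2)]) (rule that, assumption+)
    have "il i = L" "il i' = L'" by (simp_all add: h(2) h'(1) il_def)
    then have "0 < L - t" "L - t < L" "0 < L' - t'" "L' - t' < L'" using i i' by simp_all
    moreover have "fr a e (L - t) (- s) = fr a' e' (L' - t') (- s')" using eq unfolding h(4) h'(3) .
    ultimately have "(a, e, L) = (a', e', L')" using outer_tubes_disjoint[OF extd(3)[OF h(1)] h(3) h'(2)] i(4) i'(4) by blast
    then show ?thesis using h(2) h'(1) by simp
  qed
qed

text \<open>On a triangle the fibre minimum is attained. On an outer tube any height between 2 * M
  and 2 * M + 1 off the lines will do: both functions vanish there and the error is 0.\<close>

lemma T_m:
  assumes i: "i \<in> I0 \<union> Io" and t: "0 < t" "t < il i" and z: "fr (ia i) (ie i) t 0 \<notin> Z"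
  shows "\<exists>s. 0 < s \<and> s < ih i t \<and> fr (ia i) (ie i) t s \<notin> N \<and> \<bar>S1 (fr (ia i) (ie i) t s) - S2 (fr (ia i) (ie i) t s)\<bar> \<le> im i t"
proof (cases "i \<in> I0")
  case True
  obtain l where l: "l \<in> \<Lambda>" "\<And>t. fr (ia i) (ie i) t 0 \<in> ln_of l" by (rule I0_base[OF True]) (rule that, assumption+)
  have "t \<in> Gt (ia i) (ie i) (il i)" using t z Z(2) by (auto simp: Gt_def)
  from mval_facts(2)[OF I0_D(4,5)[OF True] k(1) l g_facts(1-3) V_finite[OF True] order_refl this]
  obtain s where "0 < s" "s < \<kappa> * min t (il i - t)" "fr (ia i) (ie i) t s \<notin> N" "\<bar>g (fr (ia i) (ie i) t s)\<bar> = mval \<kappa> (ia i) (ie i) (il i) g t" by blast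
  then show ?thesis using I0_D(1)[OF True] unfolding ih_def im_def g_def by (intro exI[of _ s]) simp
next
  case False
  then have io: "i \<in> Io" using i by blast
  obtain l where l: "l \<in> \<Lambda>" "\<And>t. fr (ia i) (ie i) t 0 \<in> ln_of l" by (rule Io_base[OF io]) (rule that, assumption+)
  obtain a e L where h: "ext" "i = (n', (a + L *\<^sub>R e, - e, L))" "norm e = 1" "fseg (a + L *\<^sub>R e, - e, L) \<subseteq> frontier Q"
    by (rule Io_D[OF io]) (rule that, assumption+)
  have e: "norm (ie i) = 1" using h by (simp add: idefs)
  interpret q: ring \<kappa>0 N0 Q Q "{}" by (rule extd(3)[OF h(1)])
  have "fr (ia i) (ie i) t 0 \<in> fseg (a + L *\<^sub>R e, - e, L)" using t by (auto simp: fseg_def h(2) idefs)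
  then have "fr (ia i) (ie i) t 0 \<in> Q" using h(4) frontier_subset_closed[OF q.closedQ(1)] by blast
  then have nb: "norm (fr (ia i) (ie i) t 0) \<le> M" using M(1) extd(2)[OF h(1)] by force
  have "finite {s. fr (ia i) (ie i) t s \<in> N}" using fibre_finite[OF e l] z Z(2) by blast
  then have "infinite ({2 * M<..<2 * M + 1} - {s. fr (ia i) (ie i) t s \<in> N})" by (simp add: Diff_infinite_finite infinite_Ioo)
  then obtain s where s: "2 * M < s" "s < 2 * M + 1" "fr (ia i) (ie i) t s \<notin> N" by (metis (no_types, lifting) DiffE finite.emptyI ex_in_conv greaterThanLessThan_iff mem_Collect_eq)
  have "0 \<le> M" using nb norm_ge_zero order_trans by blast
  have "fr (ia i) (ie i) t s = s *\<^sub>R rot (ie i) + fr (ia i) (ie i) t 0" by (simp add: fr_def)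
  then have "norm (fr (ia i) (ie i) t s) \<ge> norm (s *\<^sub>R rot (ie i)) - norm (fr (ia i) (ie i) t 0)" using norm_diff_ineq by metis
  moreover have "norm (s *\<^sub>R rot (ie i)) = s" using e s(1) \<open>0 \<le> M\<close> by simp
  ultimately have "norm (fr (ia i) (ie i) t s) > M" using nb s(1) by linarith
  then have "S1 (fr (ia i) (ie i) t s) = 0" "S2 (fr (ia i) (ie i) t s) = 0" using S1_facts(4) S2_facts(4) by blast+
  then show ?thesis using s \<open>0 \<le> M\<close> fst_Io[OF io] by (intro exI[of _ s]) (simp add: ih_def im_def)
qed

lemma flag_interior:
  assumes "x \<in> fseg (a, e, L)" "x \<noteq> a" "x \<noteq> a + L *\<^sub>R e"
  obtains \<tau> where "0 < \<tau>" "\<tau> < L" "x = fr a e \<tau> 0"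
proof -
  obtain \<tau> where t: "0 \<le> \<tau>" "\<tau> \<le> L" "x = fr a e \<tau> 0" using assms(1) by (auto simp: fseg_def)
  have "\<tau> \<noteq> 0" "\<tau> \<noteq> L" using assms(2,3) t(3) by (auto simp: fr_def)
  then show ?thesis using that[of \<tau>] t by auto
qed

text \<open>A ring that meets the half-disc on the side of v fills it, and it cannot fill the other
  half too, since S1 jumps; this gives a flag of direction v. If no ring meets it, the domain is the
  plane and the half-disc is outside Q. The opposite half then lies in Q, as S1 would otherwise
  vanish on both; this gives a flag of Q, to be reversed.\<close>

lemma T_ex:
  assumes l: "l \<in> \<Lambda>" and xZ: "fr (fst l) (snd l) t 0 \<notin> Z" and xi: "fr (fst l) (snd l) t 0 \<in> interior \<Omega>" and j: "jmp S1 l t \<noteq> 0"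
    and v: "v = snd l \<or> v = - snd l"
  shows "\<exists>i\<in>I0 \<union> Io. ie i = v \<and> (\<exists>\<tau>. 0 < \<tau> \<and> \<tau> < il i \<and> fr (fst l) (snd l) t 0 = fr (ia i) (ie i) \<tau> 0)"
proof -
  define x where "x = fr (fst l) (snd l) t 0"
  have xl: "x \<in> ln_of l" by (auto simp: x_def ln_of_def)
  have xX: "x \<notin> X" using xZ Z(2) by (auto simp: x_def)
  obtain r0 where r0: "r0 > 0" "\<And>v. v = snd l \<or> v = - snd l \<Longrightarrow> convex (hdisc x r0 v) \<and> open (hdisc x r0 v) \<and> hdisc x r0 v \<inter> N = {}"
    by (rule half_discs[OF l xl xX]) (rule that, assumption+)
  obtain r1 where r1: "r1 > 0" "ball x r1 \<subseteq> \<Omega>" using xi by (auto simp: mem_interior x_def)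
  define r where "r = min r0 r1"
  have r: "r > 0" using r0 r1 by (simp add: r_def)
  have v': "- v = snd l \<or> - v = - snd l" using v by auto
  have nv: "norm v = 1" using v unit[OF l] by auto
  have HN: "hdisc x r w \<inter> N = {}" if "w = snd l \<or> w = - snd l" for w
    using r0(2)[OF that] hdisc_mono[of r r0 x w] by (auto simp: r_def)
  have H\<Omega>: "hdisc x r w \<subseteq> \<Omega>" for w using r1(2) by (auto simp: r_def hdisc_def)
  have io: "hdisc x r w \<subseteq> T \<or> hdisc x r w \<inter> T = {}" if "w = snd l \<or> w = - snd l" "frontier T \<subseteq> N" for w T
    using convex_in_or_out[OF hdisc_convex HN[OF that(1)] that(2)] by blast
  have nz: "hdisc x r w \<noteq> {}" if "w = v \<or> w = - v" for w using hdisc_nonempty[OF _ r, of w x] that nv by auto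
  show ?thesis
  proof (cases "\<exists>p<n'. R p \<inter> hdisc x r v \<noteq> {}")
    case True
    then obtain p where p: "p < n'" "R p \<inter> hdisc x r v \<noteq> {}" by blast
    have in1: "hdisc x r v \<subseteq> R p" using io[OF v NR(1)[OF p(1)]] p(2) by blast
    have "\<not> hdisc x r (- v) \<subseteq> R p"
    proof
      assume in2: "hdisc x r (- v) \<subseteq> R p"
      have "S1 z = c p" if "z \<in> hdisc x r v" for z using S1_val[OF p(1)] in1 HN[OF v] that by blast
      moreover have "S1 z = c p" if "z \<in> hdisc x r (- v)" for z using S1_val[OF p(1)] in2 HN[OF v'] that by blast
      ultimately show False using jmp_eq_zero_if_const[OF S1_facts(1) l x_def v r] j by blast
    qed
    then have out: "hdisc x r (- v) \<inter> R p = {}" using io[OF v' NR(1)[OF p(1)]] by blast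
    obtain a e L where f: "(a, e, L) \<in> ring.flags \<kappa>0 (R p)" "x \<in> fseg (a, e, L)" "e = v \<or> e = - v"
      "\<And>a' L' \<tau>. (a', - v, L') \<in> ring.flags \<kappa>0 (R p) \<Longrightarrow> 0 < \<tau> \<Longrightarrow> \<tau> < L' \<Longrightarrow> x \<noteq> fr a' (- v) \<tau> 0"
      by (rule side_flag[OF rR[OF p(1)] l v xl r in1 out]) (rule that, assumption+)
    have i: "(p, (a, e, L)) \<in> I0" using p(1) f(1) by (simp add: I0_def)
    then have "{ia (p, (a, e, L)), ia (p, (a, e, L)) + il (p, (a, e, L)) *\<^sub>R ie (p, (a, e, L))} \<subseteq> Z" unfolding Z_def by blast
    then have "x \<noteq> a" "x \<noteq> a + L *\<^sub>R e" using xZ by (auto simp: x_def idefs)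
    then obtain \<tau> where \<tau>: "0 < \<tau>" "\<tau> < L" "x = fr a e \<tau> 0" by (rule flag_interior[OF f(2)])
    have "e = v" using f(3)
    proof
      assume ev: "e = - v"
      then show ?thesis using f(4)[OF f(1)[unfolded ev] \<tau>(1,2)] \<tau>(3) by simp
    qed
    then show ?thesis using i \<tau> unfolding x_def[symmetric] by (intro bexI[of _ "(p, (a, e, L))"]) (auto simp: idefs)
  next
    case False
    then have none: "hdisc x r v \<inter> (\<Union>p<n'. R p) = {}" by blast
    then have ext using dom(1) H\<Omega>[of v] nz[of v] by blast
    then have outQ: "hdisc x r v \<inter> Q = {}" using none extd(2) by simp
    have zero: "S1 z = 0" if "z \<notin> Q" for z
    proof -
      have "z \<notin> (\<Union>p<n'. R p)" using that extd(2)[OF \<open>ext\<close>] by simp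
      then show ?thesis unfolding S1 by (intro sum.neutral) auto
    qed
    have "hdisc x r (- v) \<inter> Q \<noteq> {}"
    proof
      assume "hdisc x r (- v) \<inter> Q = {}"
      then have "S1 z = 0" if "z \<in> hdisc x r (- v)" for z using that zero by blast
      moreover have "S1 z = 0" if "z \<in> hdisc x r v" for z using that zero outQ by blast
      ultimately show False using jmp_eq_zero_if_const[OF S1_facts(1) l x_def v r] j by blast
    qed
    then have inQ: "hdisc x r (- v) \<subseteq> Q" using io[OF v' extd(4)[OF \<open>ext\<close>]] by blast
    have outQ': "hdisc x r (- (- v)) \<inter> Q = {}" using outQ by simp
    obtain a e L where f: "(a, e, L) \<in> ring.flags \<kappa>0 Q" "x \<in> fseg (a, e, L)" "e = - v \<or> e = - (- v)"
      "\<And>a' L' \<tau>. (a', - (- v), L') \<in> ring.flags \<kappa>0 Q \<Longrightarrow> 0 < \<tau> \<Longrightarrow> \<tau> < L' \<Longrightarrow> x \<noteq> fr a' (- (- v)) \<tau> 0"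
      by (rule side_flag[OF extd(3)[OF \<open>ext\<close>] l v' xl r inQ outQ']) (rule that, assumption+)
    define i where "i = (n', (a + L *\<^sub>R e, - e, L))"
    have i: "i \<in> Io" using f(1) \<open>ext\<close> unfolding Io_def i_def by force
    then have "{ia i, ia i + il i *\<^sub>R ie i} \<subseteq> Z" unfolding Z_def by blast
    then have "x \<noteq> a" "x \<noteq> a + L *\<^sub>R e" using xZ by (auto simp: x_def idefs i_def)
    then obtain \<tau> where \<tau>: "0 < \<tau>" "\<tau> < L" "x = fr a e \<tau> 0" by (rule flag_interior[OF f(2)])
    have "e = - v" using f(3)
    proof
      assume ev: "e = - (- v)"
      then show ?thesis using f(4)[OF f(1)[unfolded ev] \<tau>(1,2)] \<tau>(3) by simp
    qed
    moreover have "x = fr (ia i) (ie i) (L - \<tau>) 0" using \<tau>(3) by (simp add: i_def idefs fr_def algebra_simps)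
    ultimately show ?thesis using i \<tau>(1,2) unfolding x_def[symmetric] by (intro bexI[of _ i] conjI exI[of _ "L - \<tau>"]) (auto simp: i_def idefs)
  qed
qed

lemma tubes: "tube_system \<Lambda> \<Omega> Z S1 S2 Bd M (I0 \<union> Io) ia ie il ic ih im (2 * Bd)"
proof unfold_locales
  have B0: "0 \<le> Bd" unfolding Bd_def by (intro add_nonneg_nonneg sum_nonneg) simp_all
  show "norm (ie i) = 1" if "i \<in> I0 \<union> Io" for i
    using that I0_D(4)[of i] by (auto simp: idefs elim!: Io_D)
  show "continuous_on {0<..<il i} (ih i)" for i
    unfolding ih_def by (cases "fst i < n'") (auto intro!: continuous_intros)
  show "im i \<in> borel_measurable borel" "0 \<le> im i t" "im i t \<le> 2 * Bd" if i: "i \<in> I0 \<union> Io" for i t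
  proof -
    consider "i \<in> I0" | "i \<in> Io" using i by blast
    then have "im i \<in> borel_measurable borel \<and> 0 \<le> im i t \<and> im i t \<le> 2 * Bd"
    proof cases
      case 1
      obtain l where l: "l \<in> \<Lambda>" "\<And>t. fr (ia i) (ie i) t 0 \<in> ln_of l" by (rule I0_base[OF 1]) (rule that, assumption+)
      have im: "im i = mval \<kappa> (ia i) (ie i) (il i) g" using I0_D(1)[OF 1] by (simp add: im_def)
      note p = I0_D(4,5)[OF 1] k(1) l g_facts(1-3) V_finite[OF 1] order_refl
      show ?thesis unfolding im using mval_measurable[OF p] mval_range[OF p] by blast
    next
      case 2
      then show ?thesis using fst_Io[OF 2] B0 by (simp add: im_def)
    qed
    then show "im i \<in> borel_measurable borel" "0 \<le> im i t" "im i t \<le> 2 * Bd" by blast+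
  qed
  fix i t s assume i: "i \<in> I0 \<union> Io" and t: "0 < t" "t < il i" "0 < s" "s < ih i t"
  show "fr (ia i) (ie i) t s \<in> interior \<Omega>"
  proof (cases ext)
    case True then show ?thesis using extd(1) by simp
  next
    case False
    then have "i \<in> I0" using i unfolding Io_def by simp
    have "R (fst i) \<subseteq> \<Omega>" using dom(1)[OF False] I0_D(1)[OF \<open>i \<in> I0\<close>] by blast
    then have "interior (R (fst i)) \<subseteq> interior \<Omega>" by (rule interior_mono)
    then show ?thesis using I0_tri[OF \<open>i \<in> I0\<close> t] I0_D(7)[OF \<open>i \<in> I0\<close>] by blast
  qed
  assume z: "fr (ia i) (ie i) t s \<notin> N"
  show "S1 (fr (ia i) (ie i) t s) = ic i"
  proof (cases "i \<in> I0")
    case True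
    have "fr (ia i) (ie i) t s \<in> R (fst i)" using I0_tri[OF True t] I0_D(7)[OF True] interior_subset by blast
    then show ?thesis using S1_val[OF I0_D(1)[OF True] _ z] I0_D(1)[OF True] by (simp add: ic_def)
  next
    case False
    then have "i \<in> Io" using i by blast
    then have "ext" by (auto simp: Io_def split: if_splits)
    have "fr (ia i) (ie i) t s \<notin> (\<Union>p<n'. R p)" using Io_outside[OF \<open>i \<in> Io\<close> t(3)] extd(2)[OF \<open>ext\<close>] by simp
    then have "S1 (fr (ia i) (ie i) t s) = 0" unfolding S1 by (intro sum.neutral) auto
    then show ?thesis using fst_Io[OF \<open>i \<in> Io\<close>] by (simp add: ic_def)
  qed
qed (erule S1_facts(4,5) S2_facts(4,5) | rule S1_facts(1-3) S2_facts(1-3) Z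
    | (rule T_disj; assumption) | (rule T_m; assumption) | (rule T_ex; assumption) | simp add: finite_I)+

section \<open>Summing the errors\<close>

definition F :: "flag set" where "F = (\<Union>j<n'. ring.flags \<kappa>0 (R j))"

lemma good_FG: "good_flags \<kappa> F" "good_flags \<kappa> G"
  unfolding F_def G_def \<kappa>_def
  subgoal by (rule flags_good(1)[where U = A and W = B]) (use k0 rR dR in \<open>simp_all\<close>)
  subgoal by (rule flags_good(1)[where U = A' and W = B']) (use k0 rR' dR' in \<open>simp_all\<close>)
  done

text \<open>The ring index can be recovered from the flag, since the triangle over it lies in one
  ring only; so sums over \<open>I0\<close> become sums over \<open>F\<close>.\<close>

lemma snd_I0: "inj_on snd I0" "snd ` I0 = F"
proof -
  show "inj_on snd I0"
  proof (rule inj_onI)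
    fix i i' assume h: "i \<in> I0" "i' \<in> I0" "snd i = snd i'"
    have "fr (ia i) (ie i) (il i / 2) (\<kappa> * il i / 4) \<in> tri \<kappa> (ia i) (ie i) (il i)"
      unfolding fr_in_tri[OF I0_D(4)[OF h(1)]] using I0_D(5)[OF h(1)] k(1) by simp
    moreover have "tri \<kappa> (ia i) (ie i) (il i) = tri \<kappa> (ia i') (ie i') (il i')" using h(3) by (simp add: idefs)
    ultimately show "i = i'" using I0_disj[OF h(1,2)] by blast
  qed
  show "snd ` I0 = F" unfolding I0_def F_def by force
qed

lemma card_I0: "card I0 = card F"
  using card_image[OF snd_I0(1)] snd_I0(2) by simp

lemma total_values:
  "real (\<Sum>i\<in>I0. card ((\<lambda>z. \<bar>g z\<bar>) ` (tri \<kappa> (ia i) (ie i) (il i) - N))) \<le> 32 * real N0 * (1 + 512 / \<kappa>) * real n"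
proof -
  have "(\<Sum>i\<in>I0. card ((\<lambda>z. \<bar>g z\<bar>) ` (tri \<kappa> (ia i) (ie i) (il i) - N)))
      \<le> (\<Sum>i\<in>I0. 2 + card {f\<in>G. fseg f \<inter> ftri \<kappa> (snd i) \<noteq> {}})"
    using card_V by (intro sum_mono) simp
  also have "\<dots> = 2 * card F + (\<Sum>i\<in>I0. card {f\<in>G. fseg f \<inter> ftri \<kappa> (snd i) \<noteq> {}})"
    unfolding sum.distrib by (simp add: card_I0)
  also have "(\<Sum>i\<in>I0. card {f\<in>G. fseg f \<inter> ftri \<kappa> (snd i) \<noteq> {}}) = (\<Sum>f'\<in>F. card {f\<in>G. fseg f \<inter> ftri \<kappa> f' \<noteq> {}})"
    unfolding snd_I0(2)[symmetric] by (simp add: sum.reindex[OF snd_I0(1)])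
  finally have "real (\<Sum>i\<in>I0. card ((\<lambda>z. \<bar>g z\<bar>) ` (tri \<kappa> (ia i) (ie i) (il i) - N)))
      \<le> real (2 * card F + (\<Sum>f'\<in>F. card {f\<in>G. fseg f \<inter> ftri \<kappa> f' \<noteq> {}}))" by (simp only: of_nat_le_iff)
  also have "\<dots> = 2 * real (card F) + real (\<Sum>f'\<in>F. card {f\<in>G. fseg f \<inter> ftri \<kappa> f' \<noteq> {}})" by simp
  also have "\<dots> \<le> 2 * real (card F) + 512 / \<kappa> * (real (card F) + real (card G))"
    using incidences[OF good_FG k] by simp
  \<comment> \<open>A ring has at most \<open>8 * N0\<close> flags, and
    \<open>n' \<le> n + 1 \<le> 2 * n\<close> absorbs the hole that may have been added.\<close>
  also have "\<dots> \<le> 2 * (16 * real N0 * real n) + 512 / \<kappa> * (16 * real N0 * real n + 16 * real N0 * real n)"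
  proof -
    have "card F \<le> 8 * N0 * n'" "card G \<le> 8 * N0 * n"
      unfolding F_def G_def
      subgoal by (rule flags_good(2)[where U = A and W = B]) (use k0 rR dR in \<open>simp_all\<close>)
      subgoal by (rule flags_good(2)[where U = A' and W = B']) (use k0 rR' dR' in \<open>simp_all\<close>)
      done
    moreover have "8 * N0 * n' \<le> 8 * N0 * (2 * n)" using nn by (intro mult_le_mono2) simp
    moreover have "8 * N0 * (2 * n) = 16 * N0 * n" "8 * N0 * n \<le> 16 * N0 * n" by simp_all
    ultimately have "real (card F) \<le> real (16 * N0 * n)" "real (card G) \<le> real (16 * N0 * n)" unfolding of_nat_le_iff by (metis order_trans)+
    then have "real (card F) \<le> 16 * real N0 * real n" "real (card G) \<le> 16 * real N0 * real n" by simp_all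
    then show ?thesis using k(1) by (intro add_mono mult_left_mono) simp_all
  qed
  also have "\<dots> = 32 * real N0 * (1 + 512 / \<kappa>) * real n" by (simp add: algebra_simps)
  finally show ?thesis .
qed

lemma g2_integrable: "integrable lborel (\<lambda>x. (g x)\<^sup>2)"
proof (rule integrable_bounded_support)
  show "(\<lambda>x. (g x)\<^sup>2) \<in> borel_measurable borel" using g_facts(2) by measurable
  show "\<bar>(g x)\<^sup>2\<bar> \<le> (2 * Bd)\<^sup>2" for x using power_mono[OF g_facts(3)[of x], of 2] by simp
  show "norm x > M \<Longrightarrow> (g x)\<^sup>2 = 0" for x using g_facts(4) by simp
qed

lemma L2_eq: "L2_norm_on \<Omega> g = sqrt (\<integral>x. (g x)\<^sup>2 \<partial>lborel)"
proof -
  have "integral \<Omega> (\<lambda>x. (g x)\<^sup>2) = integral UNIV (\<lambda>x. if x \<in> \<Omega> then (g x)\<^sup>2 else 0)" by (rule integral_restrict_UNIV[symmetric])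
  also have "(\<lambda>x. if x \<in> \<Omega> then (g x)\<^sup>2 else 0) = (\<lambda>x. (g x)\<^sup>2)" using g_facts(5) by auto
  finally show ?thesis using has_integral_integral_lborel[OF g2_integrable] unfolding L2_norm_on_def by (simp add: integral_unique)
qed

text \<open>Cauchy-Schwarz separates the counts \<open>K i\<close>, whose sum is linear in n, from
  the integrals \<open>W i\<close> over the triangles. These are disjoint, so the \<open>W i\<close>
  add up to at most the square of the L2 norm. Outer tubes contribute 0.\<close>

lemma error_sum:
  "(\<Sum>i\<in>I0 \<union> Io. \<integral>t. indicator {0<..<il i} t * im i t \<partial>lborel)
    \<le> sqrt (8 / \<kappa> * (32 * real N0 * (1 + 512 / \<kappa>))) * sqrt (real n) * L2_norm_on \<Omega> g"
proof -
  define E where "E = (\<lambda>i. \<integral>t. indicator {0<..<il i} t * im i t \<partial>lborel)"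
  define K where "K = (\<lambda>i. real (card ((\<lambda>z. \<bar>g z\<bar>) ` (tri \<kappa> (ia i) (ie i) (il i) - N))))"
  define W where "W = (\<lambda>i. \<integral>x. indicator (tri \<kappa> (ia i) (ie i) (il i)) x * (g x)\<^sup>2 \<partial>lborel)"
  have W0: "0 \<le> W i" for i unfolding W_def by (intro integral_nonneg_AE) auto
  have K0: "0 \<le> 8 / \<kappa> * K i" for i unfolding K_def using k by simp
  have "I0 \<inter> Io = {}" using I0_D(1) fst_Io by fastforce
  moreover have "E i = 0" if "i \<in> Io" for i using fst_Io[OF that] by (simp add: E_def im_def)
  ultimately have "(\<Sum>i\<in>I0 \<union> Io. E i) = (\<Sum>i\<in>I0. E i)" using finite_I by (simp add: sum.union_disjoint)
  also have "\<dots> \<le> (\<Sum>i\<in>I0. \<bar>sqrt (8 / \<kappa> * K i)\<bar> * \<bar>sqrt (W i)\<bar>)"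
  proof (rule sum_mono)
    fix i assume i: "i \<in> I0"
    obtain l where l: "l \<in> \<Lambda>" "\<And>t. fr (ia i) (ie i) t 0 \<in> ln_of l" by (rule I0_base[OF i]) (rule that, assumption+)
    have im: "im i = mval \<kappa> (ia i) (ie i) (il i) g" using I0_D(1)[OF i] by (simp add: im_def)
    have "(E i)\<^sup>2 \<le> 8 / \<kappa> * K i * W i"
      using mval_integral[OF I0_D(4,5)[OF i] k(1) l g_facts(1-3) V_finite[OF i] order_refl g_facts(4)] unfolding E_def K_def W_def im .
    then have "\<bar>E i\<bar> \<le> sqrt (8 / \<kappa> * K i * W i)" using real_sqrt_le_mono by fastforce
    then have "E i \<le> sqrt (8 / \<kappa> * K i) * sqrt (W i)" unfolding real_sqrt_mult[of "8 / \<kappa> * K i"] by linarith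
    then show "E i \<le> \<bar>sqrt (8 / \<kappa> * K i)\<bar> * \<bar>sqrt (W i)\<bar>" using W0[of i] K0[of i] by simp
  qed
  also have "\<dots> \<le> L2_set (\<lambda>i. sqrt (8 / \<kappa> * K i)) I0 * L2_set (\<lambda>i. sqrt (W i)) I0" by (rule L2_set_mult_ineq)
  also have "\<dots> = sqrt (\<Sum>i\<in>I0. 8 / \<kappa> * K i) * sqrt (\<Sum>i\<in>I0. W i)" unfolding L2_set_def using W0 K0 by simp
  also have "\<dots> \<le> sqrt (8 / \<kappa> * (32 * real N0 * (1 + 512 / \<kappa>)) * real n) * sqrt (\<integral>x. (g x)\<^sup>2 \<partial>lborel)"
  proof (intro mult_mono real_sqrt_le_mono)
    have "(\<Sum>i\<in>I0. 8 / \<kappa> * K i) = 8 / \<kappa> * real (\<Sum>i\<in>I0. card ((\<lambda>z. \<bar>g z\<bar>) ` (tri \<kappa> (ia i) (ie i) (il i) - N)))"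
      unfolding K_def by (simp add: sum_distrib_left)
    also have "\<dots> \<le> 8 / \<kappa> * (32 * real N0 * (1 + 512 / \<kappa>) * real n)" using k(1) by (intro mult_left_mono total_values) simp
    finally show "(\<Sum>i\<in>I0. 8 / \<kappa> * K i) \<le> 8 / \<kappa> * (32 * real N0 * (1 + 512 / \<kappa>)) * real n" by (simp add: mult.assoc)
    have int: "integrable lborel (\<lambda>x. indicator (tri \<kappa> (ia i) (ie i) (il i)) x * (g x)\<^sup>2)" if "i \<in> I0" for i
    proof -
      have "tri \<kappa> (ia i) (ie i) (il i) \<in> sets lborel" using open_tri[OF I0_D(4)[OF that]] by simp
      from integrable_mult_indicator[OF this g2_integrable] show ?thesis by simp
    qed
    have "(\<Sum>i\<in>I0. W i) = (\<integral>x. (\<Sum>i\<in>I0. indicator (tri \<kappa> (ia i) (ie i) (il i)) x * (g x)\<^sup>2) \<partial>lborel)"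
      unfolding W_def using int by (intro Bochner_Integration.integral_sum[symmetric])
    also have "\<dots> \<le> (\<integral>x. (g x)\<^sup>2 \<partial>lborel)"
    proof (rule integral_mono)
      show "integrable lborel (\<lambda>x. \<Sum>i\<in>I0. indicator (tri \<kappa> (ia i) (ie i) (il i)) x * (g x)\<^sup>2)"
        using int by (intro Bochner_Integration.integrable_sum)
      show "integrable lborel (\<lambda>x. (g x)\<^sup>2)" by (rule g2_integrable)
      fix x
      have "(\<Sum>i\<in>I0. indicator (tri \<kappa> (ia i) (ie i) (il i)) x :: real) \<le> 1"
      proof (cases "\<exists>i\<in>I0. x \<in> tri \<kappa> (ia i) (ie i) (il i)")
        case True
        then obtain i where i: "i \<in> I0" "x \<in> tri \<kappa> (ia i) (ie i) (il i)" by blast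
        have "(\<Sum>i'\<in>I0. indicator (tri \<kappa> (ia i') (ie i') (il i')) x :: real) = (\<Sum>i'\<in>{i}. indicator (tri \<kappa> (ia i') (ie i') (il i')) x)"
          proof (rule sum.mono_neutral_right)
          show "\<forall>i'\<in>I0 - {i}. indicator (tri \<kappa> (ia i') (ie i') (il i')) x = (0 :: real)"
          proof
            fix i' assume "i' \<in> I0 - {i}"
            then have "x \<notin> tri \<kappa> (ia i') (ie i') (il i')" using I0_disj[of i' i x] i by blast
            then show "indicator (tri \<kappa> (ia i') (ie i') (il i')) x = (0 :: real)" by simp
          qed
        qed (use i finite_I in simp_all)
        also have "\<dots> = 1" using i(2) by simp
        finally show ?thesis by simp
      next
        case False
        then have "(\<Sum>i\<in>I0. indicator (tri \<kappa> (ia i) (ie i) (il i)) x :: real) = 0" by (intro sum.neutral) auto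
        then show ?thesis by simp
      qed
      then have "(\<Sum>i\<in>I0. indicator (tri \<kappa> (ia i) (ie i) (il i)) x) * (g x)\<^sup>2 \<le> 1 * (g x)\<^sup>2" by (rule mult_right_mono) simp
      then show "(\<Sum>i\<in>I0. indicator (tri \<kappa> (ia i) (ie i) (il i)) x * (g x)\<^sup>2) \<le> (g x)\<^sup>2" by (simp add: sum_distrib_right)
    qed
    finally show "(\<Sum>i\<in>I0. W i) \<le> (\<integral>x. (g x)\<^sup>2 \<partial>lborel)" .
    have "0 \<le> 8 / \<kappa> * (32 * real N0 * (1 + 512 / \<kappa>)) * real n" using k(1) by (intro mult_nonneg_nonneg add_nonneg_nonneg) simp_all
    then show "0 \<le> sqrt (8 / \<kappa> * (32 * real N0 * (1 + 512 / \<kappa>)) * real n)" by (rule real_sqrt_ge_zero)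
    show "0 \<le> sqrt (\<Sum>i\<in>I0. W i)" using W0 by (intro real_sqrt_ge_zero sum_nonneg) simp
  qed
  finally show ?thesis unfolding E_def L2_eq real_sqrt_mult[of _ "real n"] .
qed

theorem tv_compare_rings:
  "TV \<Omega> S1 \<le> TV \<Omega> S2 + ereal (sqrt (8 / \<kappa> * (32 * real N0 * (1 + 512 / \<kappa>))) * sqrt (real n) * L2_norm_on \<Omega> (\<lambda>x. S1 x - S2 x))"
proof -
  interpret tube_system \<Lambda> \<Omega> Z S1 S2 Bd M "I0 \<union> Io" ia ie il ic ih im "2 * Bd" by (rule tubes)
  have "TV \<Omega> S1 \<le> TV \<Omega> S2 + ereal (\<Sum>i\<in>I0 \<union> Io. \<integral>t. mt i t \<partial>lborel)" by (rule tv_compare)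
  also have "\<dots> \<le> TV \<Omega> S2 + ereal (sqrt (8 / \<kappa> * (32 * real N0 * (1 + 512 / \<kappa>))) * sqrt (real n) * L2_norm_on \<Omega> g)"
    using error_sum unfolding mt_def by (intro add_left_mono) simp
  finally show ?thesis unfolding g_def[abs_def] .
qed

end

section \<open>Assembly of the estimate\<close>

lemma lines_for_rings:
  assumes fin: "finite \<T>" and rg: "\<And>T. T \<in> \<T> \<Longrightarrow> \<exists>U W. ring \<kappa> N0 T U W"
  obtains \<Lambda> M where "lines \<Lambda>" "\<And>T. T \<in> \<T> \<Longrightarrow> frontier T \<subseteq> lines.N \<Lambda>" "\<And>T. T \<in> \<T> \<Longrightarrow> T \<subseteq> cball 0 M"
proof -
  have bnd: "bounded T" if "T \<in> \<T>" for T
  proof -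
    from rg[OF that] obtain U W where "ring \<kappa> N0 T U W" by blast
    then interpret ring \<kappa> N0 T U W .
    show ?thesis using compact_imp_bounded[OF Q1(1)] R bounded_diff by blast
  qed
  have "\<exists>P. finite P \<and> frontier T \<subseteq> (\<Union>(a,b)\<in>P. closed_segment a b)" if "T \<in> \<T>" for T
  proof -
    from rg[OF that] obtain U W where "ring \<kappa> N0 T U W" by blast
    then interpret ring \<kappa> N0 T U W .
    have "polygonal_boundary N0 U" "polygonal_boundary N0 W" using pr by (simp_all add: pring_def)
    then obtain P P' where P: "finite P" "frontier U = (\<Union>(a,b)\<in>P. closed_segment a b)" "finite P'" "frontier W = (\<Union>(a,b)\<in>P'. closed_segment a b)"
      unfolding polygonal_boundary_def by metis
    have "frontier T \<subseteq> (\<Union>(a,b)\<in>P \<union> P'. closed_segment a b)" using frontier_sub unfolding P(2,4) by (simp add: UN_Un)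
    then show ?thesis using P(1,3) by blast
  qed
  then have "\<forall>T\<in>\<T>. \<exists>P. finite P \<and> frontier T \<subseteq> (\<Union>(a,b)\<in>P. closed_segment a b)" by blast
  from bchoice[OF this] obtain P where P: "\<forall>T\<in>\<T>. finite (P T) \<and> frontier T \<subseteq> (\<Union>(a,b)\<in>P T. closed_segment a b)" ..
  have "finite (\<Union>T\<in>\<T>. P T)" using fin P by blast
  then obtain \<Lambda> where L: "lines \<Lambda>" "(\<Union>(a,b)\<in>(\<Union>T\<in>\<T>. P T). closed_segment a b) \<subseteq> (\<Union>l\<in>\<Lambda>. ln_of l)" by (rule lines_exist)
  have "bounded (\<Union>\<T>)" using fin bnd by blast
  then obtain M where M: "\<forall>x\<in>\<Union>\<T>. norm x \<le> M" unfolding bounded_iff by blast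
  show ?thesis
  proof (rule that[OF L(1)])
    show "frontier T \<subseteq> lines.N \<Lambda>" if "T \<in> \<T>" for T
    proof -
      have "frontier T \<subseteq> (\<Union>(a,b)\<in>P T. closed_segment a b)" using P that by simp
      also have "\<dots> \<subseteq> (\<Union>(a,b)\<in>(\<Union>T\<in>\<T>. P T). closed_segment a b)" using that by (intro UN_mono) auto
      finally show ?thesis using L(2) unfolding lines.N_def[OF L(1)] by simp
    qed
    show "T \<subseteq> cball 0 M" if "T \<in> \<T>" for T using M that by auto
  qed
qed

text \<open>All rings, and Q in the plane case, are put into one family, for which a common line
  arrangement and a common radius are chosen; neither of these enters the bound.\<close>

lemma compare_step_functions:
  fixes n n' :: nat and R R' :: "nat \<Rightarrow> pt set"
  assumes k0: "0 < \<kappa>0"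
    and rR: "\<And>j. j < n' \<Longrightarrow> \<exists>U W. ring \<kappa>0 N0 (R j) U W"
    and rR': "\<And>j. j < n \<Longrightarrow> \<exists>U W. ring \<kappa>0 N0 (R' j) U W"
    and dR: "\<And>i j. i < n' \<Longrightarrow> j < n' \<Longrightarrow> i \<noteq> j \<Longrightarrow> interior (R i) \<inter> interior (R j) = {}"
    and dR': "\<And>i j. i < n \<Longrightarrow> j < n \<Longrightarrow> i \<noteq> j \<Longrightarrow> interior (R' i) \<inter> interior (R' j) = {}"
    and S: "\<And>x. S1 x = (\<Sum>j<n'. c j * indicator (R j) x)" "\<And>x. S2 x = (\<Sum>j<n. c' j * indicator (R' j) x)"
    and dom: "\<not> ext \<Longrightarrow> \<Omega> = (\<Union>j<n'. R j)" "(\<Union>j<n. R' j) \<subseteq> \<Omega>"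
    and extd: "ext \<Longrightarrow> \<Omega> = UNIV" "ext \<Longrightarrow> (\<Union>j<n'. R j) = Q" "ext \<Longrightarrow> ring \<kappa>0 N0 Q Q {}"
    and nn: "n' \<le> n + 1" "n \<ge> 1"
  shows "TV \<Omega> S1 \<le> TV \<Omega> S2 + ereal (sqrt (8 / (\<kappa>0 / (2 + \<kappa>0)) * (32 * real N0 * (1 + 512 / (\<kappa>0 / (2 + \<kappa>0))))) * sqrt (real n) * L2_norm_on \<Omega> (\<lambda>x. S1 x - S2 x))"
proof -
  define \<T> where "\<T> = R ` {..<n'} \<union> R' ` {..<n} \<union> (if ext then {Q} else {})"
  have "finite \<T>" by (simp add: \<T>_def)
  moreover have "\<exists>U W. ring \<kappa>0 N0 T U W" if "T \<in> \<T>" for T using that rR rR' extd(3) unfolding \<T>_def by (auto split: if_splits)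
  ultimately obtain \<Lambda> M where L: "lines \<Lambda>" "\<And>T. T \<in> \<T> \<Longrightarrow> frontier T \<subseteq> lines.N \<Lambda>" "\<And>T. T \<in> \<T> \<Longrightarrow> T \<subseteq> cball 0 M"
    by (rule lines_for_rings) (assumption | rule that)+
  have in\<T>: "\<And>j. j < n' \<Longrightarrow> R j \<in> \<T>" "\<And>j. j < n \<Longrightarrow> R' j \<in> \<T>" "ext \<Longrightarrow> Q \<in> \<T>" by (auto simp: \<T>_def)
  have "\<forall>j. \<exists>U W. j < n' \<longrightarrow> ring \<kappa>0 N0 (R j) U W" "\<forall>j. \<exists>U W. j < n \<longrightarrow> ring \<kappa>0 N0 (R' j) U W" using rR rR' by blast+
  then obtain A B A' B' where AB: "\<And>j. j < n' \<Longrightarrow> ring \<kappa>0 N0 (R j) (A j) (B j)" "\<And>j. j < n \<Longrightarrow> ring \<kappa>0 N0 (R' j) (A' j) (B' j)" by metis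
  interpret ring_partitions \<Lambda> \<Omega> Q \<kappa>0 M N0 n n' R A B R' A' B' c c' S1 S2 ext
  proof (intro ring_partitions.intro ring_partitions_axioms.intro)
    show "lines \<Lambda>" by (rule L(1))
  qed (fact k0 AB dR dR' S dom extd nn | rule L(2,3), erule in\<T>)+
  show ?thesis using tv_compare_rings unfolding \<kappa>_def .
qed

theorem theorem3p3:
  fixes N0 :: nat and c0 \<beta> :: real
  assumes "c0 \<ge> 1" and "0 < \<beta>" and "\<beta> \<le> pi / 3"
  shows "\<exists>c>0. \<forall>\<Omega> n0 n S1 S2.
           admissible_domain N0 c0 \<beta> \<Omega> n0 \<and> n \<ge> n0 \<and>
           S1 \<in> S_n1 N0 c0 \<beta> \<Omega> n \<and> S2 \<in> S_n1 N0 c0 \<beta> \<Omega> n \<longrightarrow>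
           TV \<Omega> S1 \<le> TV \<Omega> S2 + ereal (c * sqrt (real n) * L2_norm_on \<Omega> (\<lambda>x. S1 x - S2 x))"
proof -
  \<comment> \<open>\<open>tan \<beta>\<close> serves the triangles of condition (c),
    \<open>1 / (2 * c0)\<close> the flags of a filled ring and of its hole.\<close>
  define k where "k = min (tan \<beta>) (1 / (2 * c0))"
  have "0 < tan \<beta>" using assms pi_gt_zero by (intro tan_gt_zero) linarith+
  then have k: "0 < k" "k \<le> tan \<beta>" "k \<le> 1 / (2 * c0)" using assms(1) by (auto simp: k_def)
  have ringI: "\<exists>U W. ring k N0 T U W" if "is_ring N0 c0 \<beta> T" for T
  proof -
    note r = that
    obtain Q1 Q2 where "pring k N0 T Q1 Q2" by (rule is_ring_pring[OF r assms(2,3) k(1,2)]) (rule that)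
    then show ?thesis using k(1) by (blast intro: ring.intro)
  qed
  have holeI: "ring k N0 H H {}" if "regular_set c0 H" "polygonal_boundary N0 H" for H
    using hole_pring[OF that assms(1) k(1,3)] k(1) by (blast intro: ring.intro)
  define C where "C = sqrt (8 / (k / (2 + k)) * (32 * real N0 * (1 + 512 / (k / (2 + k)))))"
  have "0 \<le> C" unfolding C_def using k(1) by simp
  have main: "TV \<Omega> S1 \<le> TV \<Omega> S2 + ereal (C * sqrt (real n) * L2_norm_on \<Omega> (\<lambda>x. S1 x - S2 x))"
    if ad: "admissible_domain N0 c0 \<beta> \<Omega> n0" and n: "n \<ge> n0" and s: "S1 \<in> S_n1 N0 c0 \<beta> \<Omega> n" "S2 \<in> S_n1 N0 c0 \<beta> \<Omega> n" for \<Omega> n0 n S1 S2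
  proof -
    have n1: "n \<ge> 1" using ad n by (auto simp: admissible_domain_def)
    obtain c R where R: "\<And>x. S1 x = (\<Sum>j<n. c j * indicator (R j) x)" "\<And>j. j < n \<Longrightarrow> is_ring N0 c0 \<beta> (R j)"
      "\<And>i j. i < n \<Longrightarrow> j < n \<Longrightarrow> i \<noteq> j \<Longrightarrow> interior (R i) \<inter> interior (R j) = {}"
      "if \<Omega> = UNIV then is_ring N0 c0 \<beta> (\<Union>j<n. R j) else \<Omega> = (\<Union>j<n. R j)"
      using s(1) unfolding S_n1_def by blast
    obtain c' R' where R': "\<And>x. S2 x = (\<Sum>j<n. c' j * indicator (R' j) x)" "\<And>j. j < n \<Longrightarrow> is_ring N0 c0 \<beta> (R' j)"
      "\<And>i j. i < n \<Longrightarrow> j < n \<Longrightarrow> i \<noteq> j \<Longrightarrow> interior (R' i) \<inter> interior (R' j) = {}"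
      "if \<Omega> = UNIV then is_ring N0 c0 \<beta> (\<Union>j<n. R' j) else \<Omega> = (\<Union>j<n. R' j)"
      using s(2) unfolding S_n1_def by blast
    have sub: "(\<Union>j<n. R' j) \<subseteq> \<Omega>" using R'(4) by (cases "\<Omega> = UNIV") simp_all
    show ?thesis
    proof (cases "\<Omega> = UNIV")
      case False
      then have dom: "\<Omega> = (\<Union>j<n. R j)" using R(4) by simp
      show ?thesis unfolding C_def
        by (rule compare_step_functions[where ext = False and n' = n and R = R and R' = R' and Q = "{}" and c = c and c' = c'])
          (use k(1) R(1-3) R'(1-3) ringI dom sub n1 in \<open>simp_all\<close>)
    next
      case True
      then have "is_ring N0 c0 \<beta> (\<Union>j<n. R j)" using R(4) by simp
      then obtain Q1 Q2 where Q: "pring k N0 (\<Union>j<n. R j) Q1 Q2" "regular_set c0 Q1" "Q2 \<noteq> {} \<Longrightarrow> regular_set c0 Q2"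
        "polygonal_boundary N0 Q1" "polygonal_boundary N0 Q2"
        by (rule is_ring_pring[OF _ assms(2,3) k(1,2)]) (rule that, assumption+)
      have UQ: "(\<Union>j<n. R j) = Q1 - Q2" "Q2 \<subseteq> Q1" using Q(1) by (auto simp: pring_def)
      show ?thesis
      proof (cases "Q2 = {}")
        case True
        \<comment> \<open>The union of the rings has no hole and is itself the convex set.\<close>
        show ?thesis unfolding C_def
          by (rule compare_step_functions[where ext = True and n' = n and R = R and R' = R' and Q = Q1 and c = c and c' = c'])
            (use k(1) R(1-3) R'(1-3) ringI \<open>\<Omega> = UNIV\<close> sub n1 UQ True holeI[OF Q(2,4)] in \<open>simp_all\<close>)
      next
        case False
        \<comment> \<open>The hole becomes ring number n with coefficient 0: S1 is unchanged, and
          the union is now the convex set \<open>Q1\<close>.\<close>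
        define P where "P = (\<lambda>j. if j < n then R j else Q2)"
        define b where "b = (\<lambda>j. if j < n then c j else 0)"
        have PU: "(\<Union>j<Suc n. P j) = Q1"
        proof -
          have "(\<Union>j<Suc n. P j) = (\<Union>j<n. R j) \<union> Q2" unfolding P_def lessThan_Suc by auto
          also have "\<dots> = Q1" using UQ(2) unfolding UQ(1) by (simp add: Un_absorb2)
          finally show ?thesis .
        qed
        have Pr: "\<exists>U W. ring k N0 (P j) U W" for j
        proof (cases "j < n")
          case True then show ?thesis using ringI R(2) by (simp add: P_def)
        next
          case F: False then show ?thesis using holeI[OF Q(3)[OF False] Q(5)] by (auto simp: P_def)
        qed
        have out: "interior (R j) \<inter> interior Q2 = {}" if "j < n" for j
        proof -
          have "R j \<subseteq> Q1 - Q2" unfolding UQ(1)[symmetric] using that by auto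
          then show ?thesis using interior_subset[of "R j"] interior_subset[of Q2] by blast
        qed
        have Pd: "interior (P i) \<inter> interior (P j) = {}" if "i < Suc n" "j < Suc n" "i \<noteq> j" for i j
          using that R(3)[of i j] out[of i] out[of j] by (auto simp: P_def)
        have PS: "S1 x = (\<Sum>j<Suc n. b j * indicator (P j) x)" for x
          unfolding R(1) by (simp add: b_def P_def)
        show ?thesis unfolding C_def
        proof (rule compare_step_functions[where ext = True and n' = "Suc n" and R = P and R' = R' and Q = Q1 and c = b and c' = c'])
          show "ring k N0 Q1 Q1 {}" by (rule holeI[OF Q(2,4)])
          show "\<exists>U W. ring k N0 (P j) U W" for j by (rule Pr)
          show "S1 x = (\<Sum>j<Suc n. b j * indicator (P j) x)" for x by (rule PS)
          show "S2 x = (\<Sum>j<n. c' j * indicator (R' j) x)" for x by (rule R'(1))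
          show "(\<Union>j<Suc n. P j) = Q1" by (rule PU)
          show "\<exists>U W. ring k N0 (R' j) U W" if "j < n" for j by (rule ringI[OF R'(2)[OF that]])
        qed (assumption | rule k(1) sub \<open>\<Omega> = UNIV\<close> n1 | erule Pd R'(3) | erule notE, rule TrueI | simp only: Suc_eq_plus1 order_refl)+
      qed
    qed
  qed
  \<comment> \<open>The constant has to be positive, but C is 0 when \<open>N0\<close> is 0; so 1 is
    added.\<close>
  have "TV \<Omega> S1 \<le> TV \<Omega> S2 + ereal ((C + 1) * sqrt (real n) * L2_norm_on \<Omega> (\<lambda>x. S1 x - S2 x))"
    if "TV \<Omega> S1 \<le> TV \<Omega> S2 + ereal (C * sqrt (real n) * L2_norm_on \<Omega> (\<lambda>x. S1 x - S2 x))" for \<Omega> n S1 S2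
  proof -
    \<comment> \<open>A function that is not integrable has integral 0 by default, so the sign is
      settled without a proof of integrability.\<close>
    have "0 \<le> integral \<Omega> (\<lambda>x. (S1 x - S2 x)\<^sup>2)"
      by (cases "(\<lambda>x. (S1 x - S2 x)\<^sup>2) integrable_on \<Omega>")
        (simp_all add: Henstock_Kurzweil_Integration.integral_nonneg not_integrable_integral)
    then have "0 \<le> L2_norm_on \<Omega> (\<lambda>x. S1 x - S2 x)" unfolding L2_norm_on_def by simp
    then have "ereal (C * sqrt (real n) * L2_norm_on \<Omega> (\<lambda>x. S1 x - S2 x)) \<le> ereal ((C + 1) * sqrt (real n) * L2_norm_on \<Omega> (\<lambda>x. S1 x - S2 x))"
      by (simp add: mult_right_mono)
    then show ?thesis by (intro order_trans[OF that] add_left_mono)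
  qed
  then show ?thesis using main \<open>0 \<le> C\<close> by (intro exI[of _ "C + 1"]) auto
qed

end
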